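(* There exists $\underline a(\cdot)\in\overline{\mathcal A[\alpha,\beta]}^{\,H}$ such that $$\lambda_{\underline a(\cdot)}=\inf_{a(\cdot)\in\overline{\mathcal A[\alpha,\beta]}^{\,H}}\lambda_{a(\cdot)}.$$
   Context: $\Omega\subset\mathbb R^n$ is a bounded Lipschitz domain, $0<\mu_0\le\mu_1<\infty$, $\mathbb S^n$ is the set of real symmetric $n\times n$ matrices with the usual order ($A\le B$ iff $B-A$ is positive semidefinite), $M[\mu_0,\mu_1]=\{A\in\mathbb S^n:\mu_0I\le A\le\mu_1I\}$, and $\mathcal M[\mu_0,\mu_1]$ is the set of measurable $a:\Omega\to M[\mu_0,\mu_1]$. $A_0\neq A_1$ are in $M[\mu_0,\mu_1]$ and $0\le\alpha\le\beta\le1$; either $0<\alpha\le\beta<1$ (no additional restriction on $A_0,A_1$), or $\alpha=0$, $\beta=1$ and neither $A_0\le A_1$ nor $A_1\le A_0$ holds. Define $$\mathcal A[\alpha,\beta]=\{A_0+\chi_{\Omega_1}(\cdot)(A_1-A_0):\ \Omega_1\subseteq\Omega\text{ measurable},\ \alpha|\Omega|\le|\Omega_1|\le\beta|\Omega|\}.$$ A sequence $a_k(\cdot)\in\mathcal M[\mu_0,\mu_1]$ $H$-converges to $a^*(\cdot)\in\mathcal M[\mu_0,\mu_1]$ on $\Omega$ if for every $f\in W^{-1,2}(\Omega)$ the weak solutions $y_k\in W^{1,2}_0(\Omega)$ of $-\nabla\cdot(a_k\nabla y_k)=f$ converge weakly in $W^{1,2}_0(\Omega)$ to the weak solution $y^*\in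 W^{1,2}_0(\Omega)$ of $-\nabla\cdot(a^*\nabla y^* )=f$. For $X\subseteq\mathcal M[\mu_0,\mu_1]$, $\overline X^{\,H}$ is the $H$-closure of $X$, i.e. the set of all $H$-limits in $\mathcal M[\mu_0,\mu_1]$ of sequences in $X$ (the topology of $H$-convergence on $\mathcal M[\mu_0,\mu_1]$ is metrizable). For $a(\cdot)\in\mathcal M[\mu_0,\mu_1]$, $\lambda_{a(\cdot)}=\inf_{y\in W^{1,2}_0(\Omega)\setminus\{0\}}\int_\Omega\langle a\nabla y,\nabla y\rangle dx/\|y\|_{L^2(\Omega)}^2$ is the principal Dirichlet eigenvalue of $-\nabla\cdot(a\nabla\,\cdot)$. *)

theory Defs
  imports "HOL-Analysis.Analysis"
begin

section \<open>Bounded Lipschitz domains\<close>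

text \<open>The graph condition is stated without coordinates: \<open>e\<close> is the local vertical direction,
  \<open>x - (x \<bullet> e) *\<^sub>R e\<close> the projection onto the hyperplane orthogonal to \<open>e\<close>, and near the
  boundary point \<open>p\<close> the set is the strict epigraph of a Lipschitz function on that hyperplane.\<close>

definition bounded_lipschitz_domain :: "(real^'n) set \<Rightarrow> bool" where
  "bounded_lipschitz_domain \<Omega> \<longleftrightarrow>
     open \<Omega> \<and> connected \<Omega> \<and> \<Omega> \<noteq> {} \<and> bounded \<Omega> \<and>
     (\<forall>p \<in> frontier \<Omega>. \<exists>r > 0. \<exists>e. norm e = 1 \<and>
        (\<exists>\<gamma> :: real^'n \<Rightarrow> real. \<exists>L. L-lipschitz_on {z. z \<bullet> e = 0} \<gamma> \<and>
           \<Omega> \<inter> ball p r = {x \<in> ball p r. \<gamma> (x - (x \<bullet> e) *\<^sub>R e) < x \<bullet> e}))"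

section \<open>Symmetric matrices and coefficient fields\<close>

definition symmetric_mat :: "real^'n^'n \<Rightarrow> bool" where
  "symmetric_mat A \<longleftrightarrow> transpose A = A"

definition psd_mat :: "real^'n^'n \<Rightarrow> bool" where
  "psd_mat A \<longleftrightarrow> (\<forall>x. 0 \<le> (A *v x) \<bullet> x)"

definition loewner_le :: "real^'n^'n \<Rightarrow> real^'n^'n \<Rightarrow> bool" (infix \<open>\<preceq>\<close> 50) where
  "A \<preceq> B \<longleftrightarrow> psd_mat (B - A)"

definition ellip_mats :: "real \<Rightarrow> real \<Rightarrow> (real^'n^'n) set" where
  "ellip_mats \<mu>0 \<mu>1 =
     {A. symmetric_mat A \<and> (\<mu>0 *\<^sub>R mat 1) \<preceq> A \<and> A \<preceq> (\<mu>1 *\<^sub>R mat 1)}"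

text \<open>Functions on \<open>\<Omega>\<close> are represented by total functions whose values outside \<open>\<Omega>\<close> are
  irrelevant; ``measurable'' means Lebesgue measurable.\<close>

definition coeff_fields :: "(real^'n) set \<Rightarrow> real \<Rightarrow> real \<Rightarrow> (real^'n \<Rightarrow> real^'n^'n) set" where
  "coeff_fields \<Omega> \<mu>0 \<mu>1 =
     {a. a \<in> borel_measurable (lebesgue_on \<Omega>) \<and> (\<forall>x \<in> \<Omega>. a x \<in> ellip_mats \<mu>0 \<mu>1)}"

definition two_phase ::
  "(real^'n) set \<Rightarrow> real^'n^'n \<Rightarrow> real^'n^'n \<Rightarrow> real \<Rightarrow> real \<Rightarrow> (real^'n \<Rightarrow> real^'n^'n) set" where
  "two_phase \<Omega> A0 A1 \<alpha> \<beta> =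
     {(\<lambda>x. A0 + indicat_real \<Omega>1 x *\<^sub>R (A1 - A0)) | \<Omega>1.
        \<Omega>1 \<subseteq> \<Omega> \<and> \<Omega>1 \<in> sets lebesgue \<and>
        \<alpha> * measure lebesgue \<Omega> \<le> measure lebesgue \<Omega>1 \<and>
        measure lebesgue \<Omega>1 \<le> \<beta> * measure lebesgue \<Omega>}"

section \<open>Sobolev spaces\<close>

definition partial_deriv :: "'n \<Rightarrow> (real^'n \<Rightarrow> real) \<Rightarrow> real^'n \<Rightarrow> real" where
  "partial_deriv i f x = frechet_derivative f (at x) (axis i 1)"

fun times_cont_diff :: "nat \<Rightarrow> (real^'n \<Rightarrow> real) \<Rightarrow> bool" where
  "times_cont_diff 0 f \<longleftrightarrow> continuous_on UNIV f"
| "times_cont_diff (Suc k) f \<longleftrightarrow>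
     (\<forall>x. f differentiable (at x)) \<and> (\<forall>i. times_cont_diff k (partial_deriv i f))"

definition test_function :: "(real^'n) set \<Rightarrow> (real^'n \<Rightarrow> real) \<Rightarrow> bool" where
  "test_function \<Omega> \<phi> \<longleftrightarrow> (\<forall>k. times_cont_diff k \<phi>) \<and>
     compact (closure {x. \<phi> x \<noteq> 0}) \<and> closure {x. \<phi> x \<noteq> 0} \<subseteq> \<Omega>"

definition L2 :: "(real^'n) set \<Rightarrow> (real^'n \<Rightarrow> 'b::euclidean_space) set" where
  "L2 \<Omega> = {u. u \<in> borel_measurable (lebesgue_on \<Omega>) \<and>
             integrable (lebesgue_on \<Omega>) (\<lambda>x. (norm (u x))\<^sup>2)}"

definition L2_norm_on :: "(real^'n) set \<Rightarrow> (real^'n \<Rightarrow> 'b::euclidean_space) \<Rightarrow> real" where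
  "L2_norm_on \<Omega> u = sqrt (LINT x|lebesgue_on \<Omega>. (norm (u x))\<^sup>2)"

definition has_weak_gradient ::
  "(real^'n) set \<Rightarrow> (real^'n \<Rightarrow> real) \<Rightarrow> (real^'n \<Rightarrow> real^'n) \<Rightarrow> bool" where
  "has_weak_gradient \<Omega> u g \<longleftrightarrow>
     (\<forall>\<phi> i. test_function \<Omega> \<phi> \<longrightarrow>
        (LINT x|lebesgue_on \<Omega>. u x * partial_deriv i \<phi> x) =
        - (LINT x|lebesgue_on \<Omega>. g x $ i * \<phi> x))"

definition W12 :: "(real^'n) set \<Rightarrow> (real^'n \<Rightarrow> real) set" where
  "W12 \<Omega> = {u \<in> L2 \<Omega>. \<exists>g \<in> L2 \<Omega>. has_weak_gradient \<Omega> u g}"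

text \<open>For \<open>u \<in> W12 \<Omega>\<close> the weak gradient is determined only up to null sets; an arbitrary
  representative is chosen. It is used only inside integrals.\<close>

definition weak_grad :: "(real^'n) set \<Rightarrow> (real^'n \<Rightarrow> real) \<Rightarrow> real^'n \<Rightarrow> real^'n" where
  "weak_grad \<Omega> u = (SOME g. g \<in> L2 \<Omega> \<and> has_weak_gradient \<Omega> u g)"

definition W12_norm :: "(real^'n) set \<Rightarrow> (real^'n \<Rightarrow> real) \<Rightarrow> real" where
  "W12_norm \<Omega> u = sqrt ((L2_norm_on \<Omega> u)\<^sup>2 + (L2_norm_on \<Omega> (weak_grad \<Omega> u))\<^sup>2)"

definition W12_0 :: "(real^'n) set \<Rightarrow> (real^'n \<Rightarrow> real) set" where
  "W12_0 \<Omega> = {u \<in> W12 \<Omega>. \<exists>\<phi> :: nat \<Rightarrow> real^'n \<Rightarrow> real.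
     (\<forall>k. test_function \<Omega> (\<phi> k)) \<and> (\<lambda>k. W12_norm \<Omega> (\<lambda>x. u x - \<phi> k x)) \<longlonglongrightarrow> 0}"

text \<open>The dual space of \<open>W12_0 \<Omega>\<close>. Boundedness together with linearity makes such a functional
  insensitive to changes on null sets; its values outside \<open>W12_0 \<Omega>\<close> are irrelevant.\<close>

definition W12_dual :: "(real^'n) set \<Rightarrow> ((real^'n \<Rightarrow> real) \<Rightarrow> real) set" where
  "W12_dual \<Omega> = {F.
     (\<forall>u \<in> W12_0 \<Omega>. \<forall>v \<in> W12_0 \<Omega>. F (\<lambda>x. u x + v x) = F u + F v) \<and>
     (\<forall>u \<in> W12_0 \<Omega>. \<forall>c. F (\<lambda>x. c * u x) = c * F u) \<and>
     (\<exists>C. \<forall>u \<in> W12_0 \<Omega>. \<bar>F u\<bar> \<le> C * W12_norm \<Omega> u)}"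

definition weakly_converges_W12_0 ::
  "(real^'n) set \<Rightarrow> (nat \<Rightarrow> real^'n \<Rightarrow> real) \<Rightarrow> (real^'n \<Rightarrow> real) \<Rightarrow> bool" where
  "weakly_converges_W12_0 \<Omega> ys y \<longleftrightarrow>
     (\<forall>k. ys k \<in> W12_0 \<Omega>) \<and> y \<in> W12_0 \<Omega> \<and>
     (\<forall>G \<in> W12_dual \<Omega>. (\<lambda>k. G (ys k)) \<longlonglongrightarrow> G y)"

section \<open>Weak solutions, H-convergence and the principal eigenvalue\<close>

definition weak_solution ::
  "(real^'n) set \<Rightarrow> (real^'n \<Rightarrow> real^'n^'n) \<Rightarrow> ((real^'n \<Rightarrow> real) \<Rightarrow> real) \<Rightarrow> (real^'n \<Rightarrow> real) \<Rightarrow> bool"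
  where
  "weak_solution \<Omega> a f y \<longleftrightarrow> y \<in> W12_0 \<Omega> \<and>
     (\<forall>v \<in> W12_0 \<Omega>.
        (LINT x|lebesgue_on \<Omega>. (a x *v weak_grad \<Omega> y x) \<bullet> weak_grad \<Omega> v x) = f v)"

text \<open>For coefficients in \<open>coeff_fields \<Omega> \<mu>0 \<mu>1\<close> with \<open>0 < \<mu>0\<close> and bounded \<open>\<Omega>\<close>, weak
  solutions exist and are unique up to null sets (Lax--Milgram), and weak convergence does not
  see null sets, so the choice of solutions below is immaterial.\<close>

definition H_converges ::
  "(real^'n) set \<Rightarrow> (nat \<Rightarrow> real^'n \<Rightarrow> real^'n^'n) \<Rightarrow> (real^'n \<Rightarrow> real^'n^'n) \<Rightarrow> bool" where
  "H_converges \<Omega> as a \<longleftrightarrow>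
     (\<forall>f \<in> W12_dual \<Omega>. \<exists>ys y.
        (\<forall>k. weak_solution \<Omega> (as k) f (ys k)) \<and> weak_solution \<Omega> a f y \<and>
        weakly_converges_W12_0 \<Omega> ys y)"

definition H_closure ::
  "(real^'n) set \<Rightarrow> real \<Rightarrow> real \<Rightarrow> (real^'n \<Rightarrow> real^'n^'n) set \<Rightarrow> (real^'n \<Rightarrow> real^'n^'n) set" where
  "H_closure \<Omega> \<mu>0 \<mu>1 X =
     {a \<in> coeff_fields \<Omega> \<mu>0 \<mu>1. \<exists>as. (\<forall>k. as k \<in> X) \<and> H_converges \<Omega> as a}"

definition principal_eigenvalue :: "(real^'n) set \<Rightarrow> (real^'n \<Rightarrow> real^'n^'n) \<Rightarrow> real" where
  "principal_eigenvalue \<Omega> a =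
     (INF y \<in> {y \<in> W12_0 \<Omega>. \<not> (AE x in lebesgue_on \<Omega>. y x = 0)}.
        (LINT x|lebesgue_on \<Omega>. (a x *v weak_grad \<Omega> y x) \<bullet> weak_grad \<Omega> y x) / (L2_norm_on \<Omega> y)\<^sup>2)"

end

theory Submission
  imports Defs "HOL-Library.Function_Algebras" "HOL-Complex_Analysis.Great_Picard"
begin

text \<open>The proof is the direct method. Take coefficients \<open>a\<^sub>k\<close> of the two-phase class whose
  principal eigenvalues tend to the infimum over that class. The eigenvalue is continuous
  along H-convergent sequences, and every sequence of uniformly elliptic symmetric
  coefficients has an H-convergent subsequence; so a limit \<open>a\<close> of the minimising sequence
  lies in the closure and has the infimum as its eigenvalue. By the same continuity no
  element of the closure has a smaller one.

  Continuity (\<open>eigenvalue_H_limit_ge\<close>, \<open>eigenvalue_H_limit_le\<close>) rests on recovery sequences: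
  for \<open>p\<close> in the energy space let \<open>q\<^sub>k\<close> solve \<open>div (a\<^sub>k \<nabla>q\<^sub>k) = div (a \<nabla>p)\<close>. By the
  definition of H-convergence \<open>q\<^sub>k\<close> tends to \<open>p\<close> weakly, and the energies of \<open>q\<^sub>k\<close> for \<open>a\<^sub>k\<close>
  tend to that of \<open>p\<close> for \<open>a\<close>. A lower bound for the eigenvalues of \<open>a\<^sub>k\<close> thus passes to
  \<open>a\<close>. Conversely, normalised near-minimisers for \<open>a\<^sub>k\<close> have a weak limit \<open>w\<close>, which is
  again normalised by Rellich's theorem, and comparison with the recovery sequence of \<open>w\<close>
  shows that the energy of \<open>w\<close> for \<open>a\<close> is at most the limit of the eigenvalues.

  Compactness (\<open>H_compactness\<close>) follows Murat and Tartar. A diagonal argument gives a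
  subsequence along which, for every \<open>g\<close> in \<open>L\<^sup>2\<close>, the solutions of \<open>div (a\<^sub>k \<nabla>u) = div g\<close>
  and their fluxes \<open>a\<^sub>k \<nabla>u\<close> converge weakly, say to \<open>U g\<close> and \<open>\<Sigma> g\<close>; the flux equation
  \<open>div (\<Sigma> g) = div g\<close> survives by linearity. It remains to find a matrix field \<open>a\<close> with
  \<open>\<Sigma> g = a \<nabla>(U g)\<close>. Since the divergences of the fluxes are fixed, scalar products of fluxes
  with gradients pass to the limit against test functions (\<open>product_limit\<close>). Hence the
  symmetry and ellipticity of \<open>a\<^sub>k\<close> become pointwise relations between \<open>\<Sigma> g\<close> and \<open>\<nabla>(U g)\<close>.
  The limit solution operator is coercive, so each gradient of a test function occurs as
  \<open>\<nabla>(U g)\<close> (\<open>U_surjective\<close>); with the functions \<open>\<psi>\<close> and \<open>x\<^sub>j \<psi>\<close> one reads off the rows of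
  \<open>a\<close> wherever \<open>\<psi>\<close> does not vanish, and patches over countably many \<open>\<psi>\<close> (\<open>limit_matrix\<close>).

  The space of weakly differentiable functions with zero trace is handled as a space of
  pairs of a function and its gradient, the closure of the pairs coming from test functions;
  \<open>W12_0_iff\<close> identifies the two.\<close>

section \<open>Smooth functions\<close>

lemma partial_derivI:
  assumes "(f has_derivative D) (at x)"
  shows "partial_deriv i f x = D (axis i 1)"
  using frechet_derivative_at[OF assms] by (simp add: partial_deriv_def)

lemma times_cont_diff_continuous: "times_cont_diff k f \<Longrightarrow> continuous_on UNIV f"
  by (cases k) (auto intro!: continuous_at_imp_continuous_on differentiable_imp_continuous_within)

lemma times_cont_diff_SucD: "times_cont_diff (Suc k) f \<Longrightarrow> times_cont_diff k f"
proof (induction k arbitrary: f)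
  case 0
  then show ?case using times_cont_diff_continuous[of "Suc 0" f] by simp
next
  case (Suc k)
  then show ?case by (metis times_cont_diff.simps(2))
qed

lemma partial_deriv_const [simp]: "partial_deriv i (\<lambda>x. c) = (\<lambda>x. 0)"
  by (rule ext) (simp add: partial_derivI[OF has_derivative_const])

lemma times_cont_diff_const [simp]: "times_cont_diff k (\<lambda>x. c)"
  by (induction k arbitrary: c) auto

lemma partial_deriv_add:
  assumes "f differentiable (at x)" "g differentiable (at x)"
  shows "partial_deriv i (\<lambda>x. f x + g x) x = partial_deriv i f x + partial_deriv i g x"
  using partial_derivI[OF has_derivative_add[OF assms[unfolded frechet_derivative_works]]]
  by (simp add: partial_deriv_def)

lemma partial_deriv_mult:
  assumes "f differentiable (at x)" "g differentiable (at x)"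
  shows "partial_deriv i (\<lambda>x. f x * g x) x = f x * partial_deriv i g x + partial_deriv i f x * g x"
  using partial_derivI[OF has_derivative_mult[OF assms[unfolded frechet_derivative_works]]]
  by (simp add: partial_deriv_def)

lemma times_cont_diff_add:
  "times_cont_diff k f \<Longrightarrow> times_cont_diff k g \<Longrightarrow> times_cont_diff k (\<lambda>x. f x + g x)"
proof (induction k arbitrary: f g)
  case 0
  then show ?case by (auto intro: continuous_on_add)
next
  case (Suc k)
  then have "partial_deriv i (\<lambda>x. f x + g x) = (\<lambda>x. partial_deriv i f x + partial_deriv i g x)" for i
    by (intro ext partial_deriv_add) auto
  with Suc show ?case by auto
qed

lemma times_cont_diff_mult:
  "times_cont_diff k f \<Longrightarrow> times_cont_diff k g \<Longrightarrow> times_cont_diff k (\<lambda>x. f x * g x)"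
proof (induction k arbitrary: f g)
  case 0
  then show ?case by (auto intro: continuous_on_mult)
next
  case (Suc k)
  then have "partial_deriv i (\<lambda>x. f x * g x) = (\<lambda>x. f x * partial_deriv i g x + partial_deriv i f x * g x)" for i
    by (intro ext partial_deriv_mult) auto
  moreover have "times_cont_diff k f" "times_cont_diff k g"
    using Suc.prems times_cont_diff_SucD by blast+
  ultimately show ?case
    using Suc by (auto intro!: times_cont_diff_add)
qed

definition smooth :: "(real^'n \<Rightarrow> real) \<Rightarrow> bool"
  where "smooth f \<longleftrightarrow> (\<forall>k. times_cont_diff k f)"

lemma smooth_const [simp]: "smooth (\<lambda>x. c)"
  by (simp add: smooth_def)

lemma smooth_add: "smooth f \<Longrightarrow> smooth g \<Longrightarrow> smooth (\<lambda>x. f x + g x)"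
  by (simp add: smooth_def times_cont_diff_add)

lemma smooth_mult: "smooth f \<Longrightarrow> smooth g \<Longrightarrow> smooth (\<lambda>x. f x * g x)"
  by (simp add: smooth_def times_cont_diff_mult)

lemma smooth_diff: "smooth f \<Longrightarrow> smooth g \<Longrightarrow> smooth (\<lambda>x. f x - g x)"
  using smooth_add[of f "\<lambda>x. (-1) * g x"] smooth_mult[of "\<lambda>x. -1" g] by simp

lemma smooth_sum: "finite I \<Longrightarrow> (\<And>i. i \<in> I \<Longrightarrow> smooth (f i)) \<Longrightarrow> smooth (\<lambda>x. \<Sum>i\<in>I. f i x)"
  by (induction I rule: finite_induct) (auto intro: smooth_add)

lemma smooth_differentiable: "smooth f \<Longrightarrow> f differentiable (at x)"
  using smooth_def times_cont_diff.simps(2) by metis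

lemma smooth_continuous: "smooth f \<Longrightarrow> continuous_on UNIV f"
  using smooth_def times_cont_diff.simps(1) by metis

lemma smooth_partial_deriv: "smooth f \<Longrightarrow> smooth (partial_deriv i f)"
  using smooth_def times_cont_diff.simps(2) by metis

lemma has_derivative_nth: "((\<lambda>x::real^'n. x $ j) has_derivative (\<lambda>x. x $ j)) (at x)"
  by (rule bounded_linear.has_derivative[OF bounded_linear_vec_nth has_derivative_ident])

lemma smooth_nth: "smooth (\<lambda>x::real^'n. x $ j)"
proof -
  have pd: "partial_deriv i (\<lambda>x::real^'n. x $ j) = (\<lambda>x. (axis i 1 :: real^'n) $ j)" for i
    by (intro ext partial_derivI has_derivative_nth)
  have "times_cont_diff k (\<lambda>x::real^'n. x $ j)" for k
  proof (cases k)
    case 0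
    then show ?thesis by (auto intro: continuous_intros)
  next
    case (Suc m)
    then show ?thesis using has_derivative_nth[of j] pd by (auto simp: differentiable_def)
  qed
  then show ?thesis by (simp add: smooth_def)
qed

text \<open>For \<open>e = 1\<close> and \<open>n = 0\<close> this is the classical flat function. The powers of \<open>t\<close> in the
  denominator make the family closed under differentiation up to linear combinations, so
  that all its members are smooth by one induction. Small \<open>e\<close> brings the values at \<open>t > 0\<close>
  close to \<open>1\<close>.\<close>

definition flat :: "nat \<Rightarrow> real \<Rightarrow> real \<Rightarrow> real"
  where "flat n e t = (if t > 0 then exp (- e / t) / t ^ n else 0)"

lemma flat_tendsto_0:
  assumes "e > 0"
  shows "((\<lambda>t. exp (- e / t) / t ^ n) \<longlongrightarrow> 0) (at_right (0::real))"
proof -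
  have "((\<lambda>s. ((e * s) ^ n / exp (e * s)) / e ^ n) \<longlongrightarrow> 0 / e ^ n) at_top"
    by (intro tendsto_divide tendsto_const filterlim_compose[OF tendsto_power_div_exp_0]
        filterlim_tendsto_pos_mult_at_top[OF tendsto_const] filterlim_ident) (use assms in auto)
  moreover have "((e * s) ^ n / exp (e * s)) / e ^ n = exp (- e * s) * s ^ n" for s :: real
    using assms by (simp add: power_mult_distrib exp_minus divide_inverse)
  ultimately have "((\<lambda>s. exp (- e * s) * s ^ n) \<longlongrightarrow> 0) at_top"
    by simp
  then have "((\<lambda>t. exp (- e * inverse t) * inverse t ^ n) \<longlongrightarrow> 0) (at_right (0::real))"
    by (rule filterlim_compose[OF _ filterlim_inverse_at_top_right])
  then show ?thesis
    by (simp add: divide_inverse power_inverse)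
qed

lemma flat_deriv:
  assumes "e > 0"
  shows "(flat n e has_real_derivative (e * flat (n + 2) e t - real n * flat (n + 1) e t)) (at t)"
proof -
  consider "t > 0" | "t < 0" | "t = 0" by linarith
  then show ?thesis
  proof cases
    case 1
    have "((\<lambda>t::real. exp (- e / t) / t ^ n) has_real_derivative
       ((exp (- e / t) * (e / t^2)) * t ^ n - exp (- e/t) * (real n * t ^ (n - 1))) / (t^n * t^n)) (at t)"
      using 1 by (auto intro!: derivative_eq_intros simp: power2_eq_square)
    also have "((exp (- e / t) * (e / t^2)) * t ^ n - exp (- e/t) * (real n * t ^ (n - 1))) / (t^n * t^n) = 
       e * (exp (- e / t) / t ^ (n+2)) - real n * (exp (- e / t) / t ^ (n+1))"
      using 1 by (cases n) (simp_all add: divide_simps power_add power2_eq_square, simp_all add: algebra_simps)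
    also have "\<dots> = e * flat (n + 2) e t - real n * flat (n + 1) e t"
      using 1 by (simp only: flat_def if_True)
    finally have "((\<lambda>t. exp (- e / t) / t ^ n) has_real_derivative (e * flat (n + 2) e t - real n * flat (n + 1) e t)) (at t)" .
    then show ?thesis
      by (rule has_field_derivative_transform_within_open[of _ _ _ "{0<..}"]) (use 1 in \<open>auto simp: flat_def\<close>)
  next
    case 2
    have "((\<lambda>t. 0) has_real_derivative (e * flat (n + 2) e t - real n * flat (n + 1) e t)) (at t)"
      using 2 by (simp add: flat_def)
    then show ?thesis
      by (rule has_field_derivative_transform_within_open[of _ _ _ "{..<0}"]) (use 2 in \<open>auto simp: flat_def\<close>)
  next
    case 3
    have R: "((\<lambda>h. flat n e h / h) \<longlongrightarrow> 0) (at_right 0)"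
    proof (rule Lim_transform_eventually[OF flat_tendsto_0[OF assms, of "Suc n"]])
      show "\<forall>\<^sub>F x in at_right 0. exp (- e / x) / x ^ Suc n = flat n e x / x"
        by (simp add: eventually_at_right_less flat_def eventually_at_filter field_simps)
    qed
    have L: "((\<lambda>h. flat n e h / h) \<longlongrightarrow> 0) (at_left 0)"
      by (rule Lim_transform_eventually[OF tendsto_const])
         (simp add: flat_def eventually_at_filter)
    have "((\<lambda>h. flat n e h / h) \<longlongrightarrow> 0) (at 0)"
      using L R by (simp add: filterlim_at_split)
    then show ?thesis
      using 3 by (simp add: DERIV_def flat_def)
  qed
qed

lemma partial_deriv_flat:
  assumes "e > 0" "s differentiable (at x)"
  shows "(\<lambda>x. flat n e (s x)) differentiable (at x)"
    and "partial_deriv i (\<lambda>x. flat n e (s x)) x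
      = (e * flat (n + 2) e (s x) - real n * flat (n + 1) e (s x)) * partial_deriv i s x"
proof -
  have "((\<lambda>x. flat n e (s x)) has_derivative
     (\<lambda>h. (e * flat (n + 2) e (s x) - real n * flat (n + 1) e (s x)) * frechet_derivative s (at x) h)) (at x)"
    using has_derivative_compose[OF assms(2)[unfolded frechet_derivative_works],
        OF flat_deriv[OF assms(1), unfolded has_field_derivative_def]] .
  then show "(\<lambda>x. flat n e (s x)) differentiable (at x)"
    and "partial_deriv i (\<lambda>x. flat n e (s x)) x
      = (e * flat (n + 2) e (s x) - real n * flat (n + 1) e (s x)) * partial_deriv i s x"
    using partial_derivI by (auto simp: differentiable_def partial_deriv_def)
qed

text \<open>The order of differentiability is the induction variable and \<open>n\<close> varies: a derivative of
  \<open>flat n\<close> is a combination of \<open>flat (n + 1)\<close> and \<open>flat (n + 2)\<close>.\<close>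

lemma smooth_flat:
  assumes e: "e > 0" and s: "smooth s"
  shows "smooth (\<lambda>x. flat n e (s x))"
proof -
  have "times_cont_diff k (\<lambda>x. flat n e (s x))" for k
  proof (induction k arbitrary: n)
    case 0
    show ?case
      by (auto intro!: continuous_at_imp_continuous_on differentiable_imp_continuous_within
          partial_deriv_flat(1)[OF e] smooth_differentiable[OF s])
  next
    case (Suc k)
    have "partial_deriv i (\<lambda>x. flat n e (s x)) =
        (\<lambda>x. (e * flat (n + 2) e (s x) + (- real n) * flat (n + 1) e (s x)) * partial_deriv i s x)" for i
      using partial_deriv_flat(2)[OF e smooth_differentiable[OF s]] by auto
    moreover have "times_cont_diff k (partial_deriv i s)" for i
      using smooth_partial_deriv[OF s] by (simp add: smooth_def)
    moreover have "times_cont_diff k (\<lambda>x. e * flat (n + 2) e (s x) + (- real n) * flat (n + 1) e (s x))"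
      by (intro times_cont_diff_add times_cont_diff_mult times_cont_diff_const Suc.IH)
    ultimately show ?case
      using partial_deriv_flat(1)[OF e smooth_differentiable[OF s]]
      by (simp only: times_cont_diff.simps times_cont_diff_mult simp_thms)
  qed
  then show ?thesis by (simp add: smooth_def)
qed

section \<open>Test functions\<close>

lemma test_function_iff:
  "test_function \<Omega> \<phi> \<longleftrightarrow> smooth \<phi> \<and> (\<exists>K. compact K \<and> K \<subseteq> \<Omega> \<and> (\<forall>x. x \<notin> K \<longrightarrow> \<phi> x = 0))"
proof
  assume "test_function \<Omega> \<phi>"
  then show "smooth \<phi> \<and> (\<exists>K. compact K \<and> K \<subseteq> \<Omega> \<and> (\<forall>x. x \<notin> K \<longrightarrow> \<phi> x = 0))"
    unfolding test_function_def smooth_def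
    using closure_subset[of "{x. \<phi> x \<noteq> 0}"] by blast
next
  assume "smooth \<phi> \<and> (\<exists>K. compact K \<and> K \<subseteq> \<Omega> \<and> (\<forall>x. x \<notin> K \<longrightarrow> \<phi> x = 0))"
  then obtain K where K: "smooth \<phi>" "compact K" "K \<subseteq> \<Omega>" "\<forall>x. x \<notin> K \<longrightarrow> \<phi> x = 0" by blast
  then have "closure {x. \<phi> x \<noteq> 0} \<subseteq> K"
    by (intro closure_minimal) (auto simp: compact_imp_closed)
  moreover have "bounded {x. \<phi> x \<noteq> 0}"
    using K by (auto intro: bounded_subset[OF compact_imp_bounded])
  ultimately show "test_function \<Omega> \<phi>"
    using K unfolding test_function_def smooth_def compact_closure by blast
qed

lemma test_function_smooth: "test_function \<Omega> \<phi> \<Longrightarrow> smooth \<phi>"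
  by (simp add: test_function_iff)

lemma test_function_mono: "test_function \<Omega> \<phi> \<Longrightarrow> \<Omega> \<subseteq> \<Omega>' \<Longrightarrow> test_function \<Omega>' \<phi>"
  by (auto simp: test_function_iff)

lemma test_function_add:
  assumes "test_function \<Omega> f" "test_function \<Omega> g"
  shows "test_function \<Omega> (\<lambda>x. f x + g x)"
proof -
  obtain K K' where "compact K" "K \<subseteq> \<Omega>" "\<forall>x. x \<notin> K \<longrightarrow> f x = 0"
    "compact K'" "K' \<subseteq> \<Omega>" "\<forall>x. x \<notin> K' \<longrightarrow> g x = 0"
    using assms by (auto simp: test_function_iff)
  then have "compact (K \<union> K') \<and> K \<union> K' \<subseteq> \<Omega> \<and> (\<forall>x. x \<notin> K \<union> K' \<longrightarrow> f x + g x = 0)"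
    by auto
  moreover have "smooth (\<lambda>x. f x + g x)"
    using assms by (intro smooth_add) (simp_all add: test_function_smooth)
  ultimately show ?thesis
    unfolding test_function_iff by blast
qed

lemma test_function_mult:
  assumes "smooth f" "test_function \<Omega> g"
  shows "test_function \<Omega> (\<lambda>x. f x * g x)"
proof -
  obtain K where "compact K" "K \<subseteq> \<Omega>" "\<forall>x. x \<notin> K \<longrightarrow> g x = 0"
    using assms by (auto simp: test_function_iff)
  moreover have "smooth (\<lambda>x. f x * g x)"
    using assms by (intro smooth_mult) (simp_all add: test_function_smooth)
  ultimately show ?thesis
    unfolding test_function_iff by (intro conjI exI[of _ K]) auto
qed

lemma test_function_zero: "test_function \<Omega> (\<lambda>x. 0)"
  unfolding test_function_iff using compact_empty by (auto intro!: exI[of _ "{}"])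

lemma test_function_sum:
  "finite I \<Longrightarrow> (\<And>i. i \<in> I \<Longrightarrow> test_function \<Omega> (f i)) \<Longrightarrow> test_function \<Omega> (\<lambda>x. \<Sum>i\<in>I. f i x)"
  by (induction I rule: finite_induct) (auto intro: test_function_add test_function_zero)

lemma test_function_flat:
  assumes "e > 0" "test_function \<Omega> s"
  shows "test_function \<Omega> (\<lambda>x. flat n e (s x))"
proof -
  obtain K where "compact K" "K \<subseteq> \<Omega>" "\<forall>x. x \<notin> K \<longrightarrow> s x = 0"
    using assms by (auto simp: test_function_iff)
  moreover from this have "\<forall>x. x \<notin> K \<longrightarrow> flat n e (s x) = 0" by (simp add: flat_def)
  moreover have "smooth (\<lambda>x. flat n e (s x))"
    using assms by (intro smooth_flat) (simp_all add: test_function_smooth)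
  ultimately show ?thesis
    unfolding test_function_iff by (intro conjI exI[of _ K]) auto
qed

lemma test_function_partial_deriv:
  assumes "test_function \<Omega> \<phi>"
  shows "test_function \<Omega> (partial_deriv i \<phi>)"
proof -
  obtain K where K: "compact K" "K \<subseteq> \<Omega>" "\<forall>x. x \<notin> K \<longrightarrow> \<phi> x = 0"
    using assms by (auto simp: test_function_iff)
  have "partial_deriv i \<phi> x = 0" if "x \<notin> K" for x
  proof -
    have "((\<lambda>x. 0) has_derivative (\<lambda>x. 0)) (at x)" by simp
    then have "(\<phi> has_derivative (\<lambda>x. 0)) (at x)"
      by (rule has_derivative_transform_within_open[of _ _ _ _ "- K"])
         (use K that compact_imp_closed in auto)
    then show ?thesis by (rule partial_derivI)
  qed
  moreover have "smooth (partial_deriv i \<phi>)"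
    using assms by (intro smooth_partial_deriv) (simp add: test_function_smooth)
  ultimately show ?thesis
    using K unfolding test_function_iff by (intro conjI exI[of _ K]) auto
qed

definition grad :: "(real^'n \<Rightarrow> real) \<Rightarrow> real^'n \<Rightarrow> real^'n"
  where "grad f x = (\<chi> i. partial_deriv i f x)"

lemma grad_nth [simp]: "grad f x $ i = partial_deriv i f x"
  by (simp add: grad_def)

lemma has_derivative_grad:
  assumes "f differentiable (at x)"
  shows "(f has_derivative (\<lambda>h. grad f x \<bullet> h)) (at x)"
proof -
  let ?D = "frechet_derivative f (at x)"
  have D: "(f has_derivative ?D) (at x)" using assms by (simp add: frechet_derivative_works)
  then have lin: "linear ?D" by (simp add: has_derivative_linear)
  have "?D h = grad f x \<bullet> h" for h
  proof -
    have "?D h = ?D (\<Sum>i\<in>UNIV. h $ i *\<^sub>R axis i 1)"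
      using basis_expansion[of h] by (simp only: scalar_mult_eq_scaleR)
    also have "\<dots> = (\<Sum>i\<in>UNIV. h $ i *\<^sub>R ?D (axis i 1))"
      by (simp add: linear_sum[OF lin] linear_cmul[OF lin])
    finally show ?thesis by (simp add: inner_vec_def partial_deriv_def mult.commute)
  qed
  then have "?D = (\<lambda>h. grad f x \<bullet> h)" by auto
  with D show ?thesis by simp
qed

lemma grad_add:
  assumes "smooth f" "smooth g" shows "grad (\<lambda>x. f x + g x) x = grad f x + grad g x"
  by (simp add: vec_eq_iff partial_deriv_add smooth_differentiable assms)

lemma grad_mult:
  assumes "smooth f" "smooth g" shows "grad (\<lambda>x. f x * g x) x = f x *\<^sub>R grad g x + g x *\<^sub>R grad f x"
  by (simp add: vec_eq_iff partial_deriv_mult smooth_differentiable assms)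

lemma grad_const [simp]: "grad (\<lambda>x. c) x = 0"
  by (simp add: vec_eq_iff)

lemma smooth_continuous_grad:
  assumes "smooth f"
  shows "continuous_on UNIV (grad f)"
proof -
  have c: "continuous_on UNIV (partial_deriv i f)" for i
    by (rule smooth_continuous[OF smooth_partial_deriv[OF assms]])
  have "continuous_on UNIV (\<lambda>x. \<chi> i. partial_deriv i f x)"
    by (rule continuous_on_vec_lambda) (rule c)
  then show ?thesis by (subst grad_def[abs_def])
qed

lemma bump_ball:
  fixes p :: "real^'n"
  assumes "r > 0" "cball p r \<subseteq> U"
  obtains b where "test_function U b" "\<And>x. 0 \<le> b x" "\<And>x. b x \<noteq> 0 \<longleftrightarrow> x \<in> ball p r"
proof
  define s where "s x = r\<^sup>2 - (\<Sum>i\<in>UNIV. (p $ i - x $ i) * (p $ i - x $ i))" for x :: "real^'n"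
  have s_eq: "s x = r\<^sup>2 - (dist p x)\<^sup>2" for x
  proof -
    have "(dist p x)\<^sup>2 = (p - x) \<bullet> (p - x)"
      by (simp add: dist_norm power2_norm_eq_inner)
    also have "\<dots> = (\<Sum>i\<in>UNIV. (p $ i - x $ i) * (p $ i - x $ i))"
      by (simp add: inner_vec_def)
    finally show ?thesis by (simp add: s_def)
  qed
  have s_pos: "s x > 0 \<longleftrightarrow> x \<in> ball p r" for x
    using assms(1) unfolding s_eq mem_ball by (simp add: power_mono_iff flip: not_le)
  have "smooth s" unfolding s_def
    by (intro smooth_diff smooth_sum smooth_mult smooth_nth smooth_const) auto
  let ?b = "\<lambda>x. flat 0 1 (s x)"
  show iff: "?b x \<noteq> 0 \<longleftrightarrow> x \<in> ball p r" for x
    unfolding s_pos[symmetric] by (simp add: flat_def)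
  show "0 \<le> ?b x" for x by (simp add: flat_def)
  show "test_function U ?b"
    unfolding test_function_iff
  proof (intro conjI exI[of _ "cball p r"] allI impI)
    show "smooth ?b" using \<open>smooth s\<close> by (intro smooth_flat) auto
    show "?b x = 0" if "x \<notin> cball p r" for x using iff[of x] that by auto
  qed (use assms in auto)
qed

text \<open>Countably many balls cover \<open>U\<close>, and the partial sums of their bumps are test functions
  that are eventually positive at each point of \<open>U\<close>. Composing the \<open>m\<close>-th partial sum with
  \<open>t \<mapsto> exp (- 1 / ((m + 1) t))\<close> flattens the positive values towards \<open>1\<close> and keeps the
  zeros.\<close>

lemma test_functions_tendsto_indicator:
  fixes U :: "(real^'n) set"
  assumes "open U"
  obtains \<psi> where "\<And>m. test_function U (\<psi> m)" "\<And>m x. 0 \<le> \<psi> m x" "\<And>m x. \<psi> m x \<le> 1"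
    "\<And>x. (\<lambda>m. \<psi> m x) \<longlonglongrightarrow> indicat_real U x"
proof (cases "U = {}")
  case True
  show ?thesis
    by (rule that[of "\<lambda>m x. 0"]) (simp_all add: True test_function_zero)
next
  case False
  have "\<exists>b. test_function U b \<and> (\<forall>x. 0 \<le> b x) \<and> b p \<noteq> 0" if p: "p \<in> U" for p
  proof -
    obtain r where r: "r > 0" "cball p r \<subseteq> U"
      using assms p open_contains_cball[of U] by blast
    obtain b where "test_function U b" "\<And>x. 0 \<le> b x" "\<And>x. b x \<noteq> 0 \<longleftrightarrow> x \<in> ball p r"
      by (rule bump_ball[OF r]) (rule that)
    with r show ?thesis by (intro exI[of _ b]) auto
  qed
  then have "\<forall>p\<in>U. \<exists>b. test_function U b \<and> (\<forall>x. 0 \<le> b x) \<and> b p \<noteq> 0"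
    by (rule ballI)
  then obtain b where b: "\<forall>p\<in>U. test_function U (b p) \<and> (\<forall>x. 0 \<le> b p x) \<and> b p p \<noteq> 0"
    by (rule bchoice[THEN exE])
  define B where "B p = {x. 0 < b p x}" for p
  have open_B: "open (B p)" if "p \<in> U" for p
  proof -
    have "test_function U (b p)" using b that by simp
    then have "continuous_on UNIV (b p)" by (intro smooth_continuous test_function_smooth)
    then show ?thesis unfolding B_def by (rule open_Collect_less[OF continuous_on_const])
  qed
  have self: "p \<in> B p" if "p \<in> U" for p
    using b that by (simp add: B_def order_less_le)
  obtain F where F: "F \<subseteq> B ` U" "countable F" "\<Union>F = \<Union>(B ` U)"
    using Lindelof[of "B ` U"] open_B by blast
  obtain P where P: "countable P" "P \<subseteq> U" "F = B ` P"
    using F(1,2) countable_subset_image[of F B U] by blast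
  have cover: "\<exists>p\<in>P. x \<in> B p" if "x \<in> U" for x
    using F(3) P(3) self[OF that] that by blast
  then have "P \<noteq> {}"
    using False by blast
  define c where "c j = b (from_nat_into P j)" for j
  have "from_nat_into P j \<in> U" for j
    using from_nat_into[OF \<open>P \<noteq> {}\<close>] P(2) by (rule subsetD[rotated])
  then have c: "test_function U (c j)" "0 \<le> c j x" for j x
    using b by (simp_all add: c_def)
  have c_pos: "\<exists>j. c j x > 0" if x: "x \<in> U" for x
  proof -
    obtain p where p: "p \<in> P" "x \<in> B p" using cover[OF x] by blast
    obtain j where "from_nat_into P j = p" using from_nat_into_surj[OF P(1) p(1)] by blast
    with p show ?thesis by (intro exI[of _ j]) (simp add: c_def B_def)
  qed
  define s where "s m x = (\<Sum>j<m. c j x)" for m x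
  define \<psi> where "\<psi> m x = flat 0 (1 / real (Suc m)) (s m x)" for m x
  have zero: "\<psi> m x = 0" if "x \<notin> U" for m x
  proof -
    have "c j x = 0" for j
      using c(1)[of j] that unfolding test_function_iff by blast
    then show ?thesis by (simp add: \<psi>_def s_def flat_def)
  qed
  show ?thesis
  proof
    show "test_function U (\<psi> m)" for m
      unfolding \<psi>_def s_def by (intro test_function_flat test_function_sum c) auto
    show "0 \<le> \<psi> m x" "\<psi> m x \<le> 1" for m x by (auto simp: \<psi>_def flat_def)
    show "(\<lambda>m. \<psi> m x) \<longlonglongrightarrow> indicat_real U x" for x
    proof (cases "x \<in> U")
      case True
      then obtain j where j: "c j x > 0" using c_pos by blast
      have ge: "s m x \<ge> c j x" if "m \<ge> Suc j" for m
        unfolding s_def using that c(2) by (intro member_le_sum) auto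
      have "(\<lambda>m. exp (- (1 / real (Suc m)) / c j x)) \<longlonglongrightarrow> exp (- 0 / c j x)"
        by (intro tendsto_intros LIMSEQ_Suc[OF lim_1_over_n]) (use j in auto)
      then have lo: "(\<lambda>m. exp (- (1 / real (Suc m)) / c j x)) \<longlonglongrightarrow> 1" by simp
      have "(\<lambda>m. \<psi> m x) \<longlonglongrightarrow> 1"
      proof (rule tendsto_sandwich[OF _ _ lo tendsto_const])
        show "\<forall>\<^sub>F m in sequentially. \<psi> m x \<le> 1" by (simp add: \<psi>_def flat_def)
        show "\<forall>\<^sub>F m in sequentially. exp (- (1 / real (Suc m)) / c j x) \<le> \<psi> m x"
          using eventually_ge_at_top[of "Suc j"]
        proof eventually_elim
          case (elim m)
          then show ?case using ge[OF elim] j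
            by (auto simp: \<psi>_def flat_def intro!: divide_left_mono)
        qed
      qed
      with True show ?thesis by simp
    next
      case False
      then show ?thesis by (simp add: zero)
    qed
  qed
qed

section \<open>Hilbert spaces with a semi-definite inner product\<close>

definition linear_functional_on :: "'v::real_vector set \<Rightarrow> ('v \<Rightarrow> real) \<Rightarrow> bool"
  where "linear_functional_on S f \<longleftrightarrow>
    (\<forall>u\<in>S. \<forall>v\<in>S. f (u + v) = f u + f v) \<and> (\<forall>u\<in>S. \<forall>c. f (c *\<^sub>R u) = c * f u)"

lemma linear_functional_onI:
  assumes "\<And>u v. u \<in> S \<Longrightarrow> v \<in> S \<Longrightarrow> f (u + v) = f u + f v"
    and "\<And>u c. u \<in> S \<Longrightarrow> f (c *\<^sub>R u) = c * f u"
  shows "linear_functional_on S f"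
  using assms by (simp add: linear_functional_on_def)

lemma linear_functional_onD:
  assumes "linear_functional_on S f" "subspace S" "u \<in> S" "v \<in> S"
  shows "f (u + v) = f u + f v" "f (c *\<^sub>R u) = c * f u" "f (u - v) = f u - f v"
proof -
  show "f (u + v) = f u + f v" "f (c *\<^sub>R u) = c * f u"
    using assms by (auto simp: linear_functional_on_def)
  have "f (u + (-1) *\<^sub>R v) = f u + (-1) * f v"
  proof -
    have "f (u + (-1) *\<^sub>R v) = f u + f ((-1) *\<^sub>R v)"
      using assms(1,3) subspace_scale[OF assms(2,4), of "-1"] unfolding linear_functional_on_def by blast
    also have "f ((-1) *\<^sub>R v) = (-1) * f v"
      using assms(1,4) unfolding linear_functional_on_def by blast
    finally show ?thesis .
  qed
  then show "f (u - v) = f u - f v" by simp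
qed

lemma linear_functional_on_subset:
  "linear_functional_on S f \<Longrightarrow> T \<subseteq> S \<Longrightarrow> linear_functional_on T f"
  by (simp add: linear_functional_on_def subset_iff)

lemma linear_functional_on_limit:
  assumes "\<And>k. linear_functional_on S (f k)" "\<And>u. u \<in> S \<Longrightarrow> (\<lambda>k. f k u) \<longlonglongrightarrow> g u" "subspace S"
  shows "linear_functional_on S g"
proof (rule linear_functional_onI)
  fix u v assume uv: "u \<in> S" "v \<in> S"
  have "(\<lambda>k. f k (u + v)) \<longlonglongrightarrow> g u + g v"
    using tendsto_add[OF assms(2)[OF uv(1)] assms(2)[OF uv(2)]] linear_functional_onD(1)[OF assms(1,3) uv] by simp
  then show "g (u + v) = g u + g v"
    by (rule LIMSEQ_unique[OF assms(2)[OF subspace_add[OF assms(3) uv]]])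
next
  fix u c assume u: "u \<in> S"
  have "(\<lambda>k. f k (c *\<^sub>R u)) \<longlonglongrightarrow> c * g u"
    using tendsto_mult_left[OF assms(2)[OF u], of c] linear_functional_onD(2)[OF assms(1,3) u u] by simp
  then show "g (c *\<^sub>R u) = c * g u"
    by (rule LIMSEQ_unique[OF assms(2)[OF subspace_scale[OF assms(3) u]]])
qed

text \<open>Functions are not identified when they agree almost everywhere, so the inner product is
  only semi-definite and limits are not unique. Uniqueness statements accordingly take the
  form that a seminorm vanishes.\<close>

locale semi_inner_space =
  fixes S :: "'v::real_vector set" and ip :: "'v \<Rightarrow> 'v \<Rightarrow> real"
  assumes subspace_S: "subspace S"
    and ip_linear: "v \<in> S \<Longrightarrow> linear_functional_on S (\<lambda>u. ip u v)"
    and ip_commute: "ip u v = ip v u"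
    and ip_nonneg: "u \<in> S \<Longrightarrow> 0 \<le> ip u u"
begin

definition nrm :: "'v \<Rightarrow> real" where "nrm u = sqrt (ip u u)"

lemmas S_add = subspace_add[OF subspace_S]
  and S_scale = subspace_scale[OF subspace_S]
  and S_diff = subspace_diff[OF subspace_S]
  and S_0 = subspace_0[OF subspace_S]

lemma ip_add_left: "u \<in> S \<Longrightarrow> v \<in> S \<Longrightarrow> w \<in> S \<Longrightarrow> ip (u + v) w = ip u w + ip v w"
  and ip_scale_left: "u \<in> S \<Longrightarrow> w \<in> S \<Longrightarrow> ip (c *\<^sub>R u) w = c * ip u w"
  and ip_diff_left: "u \<in> S \<Longrightarrow> v \<in> S \<Longrightarrow> w \<in> S \<Longrightarrow> ip (u - v) w = ip u w - ip v w"
  using linear_functional_onD[OF ip_linear subspace_S] by auto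

lemma ip_add_right: "u \<in> S \<Longrightarrow> v \<in> S \<Longrightarrow> w \<in> S \<Longrightarrow> ip w (u + v) = ip w u + ip w v"
  and ip_scale_right: "u \<in> S \<Longrightarrow> w \<in> S \<Longrightarrow> ip w (c *\<^sub>R u) = c * ip w u"
  and ip_diff_right: "u \<in> S \<Longrightarrow> v \<in> S \<Longrightarrow> w \<in> S \<Longrightarrow> ip w (u - v) = ip w u - ip w v"
  using ip_add_left ip_scale_left ip_diff_left by (simp_all add: ip_commute[of w])

lemma nrm_nonneg: "u \<in> S \<Longrightarrow> 0 \<le> nrm u"
  by (simp add: nrm_def ip_nonneg)

lemma nrm_sq: "u \<in> S \<Longrightarrow> (nrm u)\<^sup>2 = ip u u"
  by (simp add: nrm_def ip_nonneg)

lemma Cauchy_Schwarz: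
  assumes u: "u \<in> S" and v: "v \<in> S"
  shows "\<bar>ip u v\<bar> \<le> nrm u * nrm v"
proof -
  have q: "0 \<le> ip u u - 2 * t * ip u v + t\<^sup>2 * ip v v" for t
  proof -
    have "0 \<le> ip (u - t *\<^sub>R v) (u - t *\<^sub>R v)"
      by (intro ip_nonneg S_diff S_scale u v)
    also have "\<dots> = ip u u - 2 * t * ip u v + t\<^sup>2 * ip v v"
      using u v by (simp add: ip_diff_left ip_diff_right ip_scale_left ip_scale_right S_diff S_scale
          ip_commute[of v u] power2_eq_square algebra_simps)
    finally show ?thesis .
  qed
  have "(ip u v)\<^sup>2 \<le> ip u u * ip v v"
  proof (cases "ip v v = 0")
    case True
    have "ip u v = 0"
    proof (rule ccontr)
      assume ne: "ip u v \<noteq> 0"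
      \<comment> \<open>The quadratic polynomial is linear here, and at this argument it takes the value \<open>-1\<close>.\<close>
      have "0 \<le> ip u u - 2 * ((ip u u + 1) / (2 * ip u v)) * ip u v" using q[of "(ip u u + 1) / (2 * ip u v)"] True by simp
      then show False using ne by simp
    qed
    then show ?thesis using True by simp
  next
    case False
    then have pos: "ip v v > 0" using ip_nonneg[OF v] by simp
    have "0 \<le> ip u u - 2 * (ip u v / ip v v) * ip u v + (ip u v / ip v v)\<^sup>2 * ip v v" by (rule q)
    also have "\<dots> = ip u u - (ip u v)\<^sup>2 / ip v v"
      using pos by (simp add: power2_eq_square field_simps)
    finally show ?thesis using pos by (simp add: field_simps)
  qed
  then have "\<bar>ip u v\<bar> \<le> sqrt (ip u u * ip v v)"
    using real_le_rsqrt[of "\<bar>ip u v\<bar>"] by simp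
  then show ?thesis by (simp add: nrm_def real_sqrt_mult)
qed

lemma nrm_triangle:
  assumes u: "u \<in> S" and v: "v \<in> S"
  shows "nrm (u + v) \<le> nrm u + nrm v"
proof (rule power2_le_imp_le)
  have "(nrm (u + v))\<^sup>2 = ip u u + 2 * ip u v + ip v v"
    using u v by (simp add: nrm_sq S_add ip_add_left ip_add_right ip_commute[of v u])
  also have "\<dots> \<le> (nrm u)\<^sup>2 + 2 * (nrm u * nrm v) + (nrm v)\<^sup>2"
    using Cauchy_Schwarz[OF u v] u v by (simp add: nrm_sq)
  finally show "(nrm (u + v))\<^sup>2 \<le> (nrm u + nrm v)\<^sup>2"
    by (simp add: power2_sum)
qed (simp add: u v nrm_nonneg add_nonneg_nonneg)

lemma nrm_scale: "u \<in> S \<Longrightarrow> nrm (c *\<^sub>R u) = \<bar>c\<bar> * nrm u"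
  by (simp add: nrm_def ip_scale_left ip_scale_right S_scale real_sqrt_mult)

lemma nrm_minus: "u \<in> S \<Longrightarrow> nrm (- u) = nrm u"
  using nrm_scale[of u "-1"] by simp

lemma nrm_diff_commute: "u \<in> S \<Longrightarrow> v \<in> S \<Longrightarrow> nrm (u - v) = nrm (v - u)"
  using nrm_minus[of "u - v"] by (simp add: S_diff)

lemma nrm_triangle_diff:
  assumes "u \<in> S" "v \<in> S" "w \<in> S"
  shows "nrm (u - w) \<le> nrm (u - v) + nrm (v - w)"
  using nrm_triangle[of "u - v" "v - w"] assms by (simp add: S_diff)

lemma nrm_le_diff:
  assumes "u \<in> S" "v \<in> S"
  shows "nrm u \<le> nrm (u - v) + nrm v"
  using nrm_triangle[of "u - v" "v"] assms by (simp add: S_diff)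

lemma nrm_zero: "nrm 0 = 0"
  using nrm_scale[OF S_0, of 0] by simp

definition bounded_functional :: "('v \<Rightarrow> real) \<Rightarrow> bool"
  where "bounded_functional f \<longleftrightarrow> linear_functional_on S f \<and> (\<exists>K. \<forall>u\<in>S. \<bar>f u\<bar> \<le> K * nrm u)"

definition closed_in_S :: "'v set \<Rightarrow> bool"
  where "closed_in_S W \<longleftrightarrow> (\<forall>s w. (\<forall>k::nat. s k \<in> W) \<longrightarrow> w \<in> S \<longrightarrow> (\<lambda>k. nrm (s k - w)) \<longlonglongrightarrow> 0 \<longrightarrow> w \<in> W)"

lemma bounded_functional_tendsto:
  assumes "bounded_functional f" "\<And>k. s k \<in> S" "w \<in> S" "(\<lambda>k. nrm (s k - w)) \<longlonglongrightarrow> 0"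
  shows "(\<lambda>k. f (s k)) \<longlonglongrightarrow> f w"
proof -
  obtain K where K: "\<forall>u\<in>S. \<bar>f u\<bar> \<le> K * nrm u" and lin: "linear_functional_on S f"
    using assms(1) by (auto simp: bounded_functional_def)
  have "(\<lambda>k. f (s k) - f w) \<longlonglongrightarrow> 0"
  proof (rule tendsto_0_le[where K = K, OF assms(4)], rule always_eventually, rule allI)
    fix k
    have "\<bar>f (s k - w)\<bar> \<le> K * nrm (s k - w)"
      using K assms(2,3) S_diff by blast
    then show "norm (f (s k) - f w) \<le> norm (nrm (s k - w)) * K"
      using linear_functional_onD(3)[OF lin subspace_S assms(2,3)] nrm_nonneg[OF S_diff[OF assms(2,3)]]
      by (simp add: mult.commute)
  qed
  then show ?thesis by (rule LIM_zero_cancel)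
qed

lemma bounded_functional_ip:
  assumes "u \<in> S" shows "bounded_functional (ip u)"
  unfolding bounded_functional_def
proof
  show "linear_functional_on S (ip u)"
    using ip_linear[OF assms] by (simp add: ip_commute[of _ u])
  show "\<exists>K. \<forall>v\<in>S. \<bar>ip u v\<bar> \<le> K * nrm v"
    using Cauchy_Schwarz[OF assms] by blast
qed

end

locale semi_hilbert_space = semi_inner_space +
  assumes complete: "(\<And>k. s k \<in> S) \<Longrightarrow> (\<And>e. e > 0 \<Longrightarrow> \<exists>M. \<forall>m\<ge>M. \<forall>n\<ge>M. nrm (s m - s n) < e)
      \<Longrightarrow> \<exists>w\<in>S. (\<lambda>k. nrm (s k - w)) \<longlonglongrightarrow> 0"
begin

text \<open>For a symmetric form the solution is the minimiser of \<open>J v = b v v - 2 * f v\<close>. The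
  parallelogram law and coercivity make every minimising sequence Cauchy. Along it the
  first-order condition holds up to an error that tends to zero, since \<open>J\<close> decreases by at
  most \<open>1 / (k + 1)\<close> in any direction.\<close>

lemma lax_milgram:
  assumes b_lin: "\<And>v. v \<in> S \<Longrightarrow> linear_functional_on S (\<lambda>u. b u v)"
    and b_sym: "\<And>u v. u \<in> S \<Longrightarrow> v \<in> S \<Longrightarrow> b u v = b v u"
    and b_bound: "\<And>u v. u \<in> S \<Longrightarrow> v \<in> S \<Longrightarrow> \<bar>b u v\<bar> \<le> C * nrm u * nrm v"
    and coercive: "c > 0" "\<And>u. u \<in> S \<Longrightarrow> c * (nrm u)\<^sup>2 \<le> b u u"
    and f: "bounded_functional f"
  shows "\<exists>w\<in>S. \<forall>v\<in>S. b w v = f v"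
proof -
  note bl = linear_functional_onD[OF b_lin subspace_S]
  have b_add_l: "b (u + v) w = b u w + b v w" and b_diff_l: "b (u - v) w = b u w - b v w"
    and b_scale_l: "b (t *\<^sub>R u) w = t * b u w"
    if "u \<in> S" "v \<in> S" "w \<in> S" for u v w t
    using bl[OF that(3,1,2)] by auto
  have b_add_r: "b w (u + v) = b w u + b w v" and b_diff_r: "b w (u - v) = b w u - b w v"
    and b_scale_r: "b w (t *\<^sub>R u) = t * b w u"
    if "u \<in> S" "v \<in> S" "w \<in> S" for u v w t
    using that by (simp_all add: b_sym[of w] b_add_l b_diff_l b_scale_l S_add S_diff S_scale)
  obtain K where K: "\<forall>u\<in>S. \<bar>f u\<bar> \<le> K * nrm u" and fl: "linear_functional_on S f"
    using f by (auto simp: bounded_functional_def)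
  note fl = linear_functional_onD[OF fl subspace_S]
  define J where "J v = b v v - 2 * f v" for v
  have J_lower: "J v \<ge> - K\<^sup>2 / c" if v: "v \<in> S" for v
  proof -
    have "f v \<le> K * nrm v" using K v by force
    then have "J v \<ge> c * (nrm v)\<^sup>2 - 2 * (K * nrm v)"
      using coercive(2)[OF v] by (simp add: J_def)
    moreover have "0 \<le> (c * nrm v - K)\<^sup>2 / c" using coercive(1) by simp
    moreover have "(c * nrm v - K)\<^sup>2 / c = c * (nrm v)\<^sup>2 - 2 * (K * nrm v) + K\<^sup>2 / c"
      using coercive(1) by (simp add: power2_eq_square field_simps)
    ultimately show ?thesis by simp
  qed
  define m where "m = Inf (J ` S)"
  have bdd: "bdd_below (J ` S)" using J_lower by (intro bdd_belowI2)
  have m_le: "m \<le> J v" if "v \<in> S" for v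
    unfolding m_def by (intro cInf_lower bdd imageI that)
  have "\<exists>v\<in>S. J v < m + 1 / real (Suc k)" for k
  proof -
    have "Inf (J ` S) < m + 1 / real (Suc k)" by (simp add: m_def)
    then show ?thesis using cInf_lessD[of "J ` S"] S_0 by blast
  qed
  then obtain s where s: "\<And>k. s k \<in> S" "\<And>k. J (s k) < m + 1 / real (Suc k)" by metis
  have par: "b (u - v) (u - v) = 2 * J u + 2 * J v - 4 * J ((1/2) *\<^sub>R (u + v))" if "u \<in> S" "v \<in> S" for u v
    using that by (simp add: J_def b_diff_l b_diff_r b_scale_l b_scale_r b_add_l b_add_r S_add S_diff S_scale
        fl b_sym[of v u]) (simp add: field_simps)
  have close: "c * (nrm (s i - s j))\<^sup>2 \<le> 4 / real (Suc M)" if "i \<ge> M" "j \<ge> M" for i j M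
  proof -
    have "1 / real (Suc i) \<le> 1 / real (Suc M)" "1 / real (Suc j) \<le> 1 / real (Suc M)"
      using that by (auto intro!: divide_left_mono)
    moreover have "m \<le> J ((1/2) *\<^sub>R (s i + s j))" by (intro m_le S_scale S_add s)
    moreover have "4 / real (Suc M) = 4 * (1 / real (Suc M))" by simp
    ultimately have "b (s i - s j) (s i - s j) \<le> 4 / real (Suc M)"
      unfolding par[OF s(1) s(1)] using s(2)[of i] s(2)[of j] by linarith
    then show ?thesis using coercive(2)[OF S_diff[OF s(1) s(1)], of i j] by simp
  qed
  have "\<exists>M. \<forall>i\<ge>M. \<forall>j\<ge>M. nrm (s i - s j) < e" if e: "e > 0" for e
  proof -
    obtain M where M: "inverse (real (Suc M)) < c * e\<^sup>2 / 4"
      using reals_Archimedean[of "c * e\<^sup>2 / 4"] coercive(1) e by auto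
    then have M': "4 / real (Suc M) < c * e\<^sup>2" by (simp add: field_simps)
    have "nrm (s i - s j) < e" if "i \<ge> M" "j \<ge> M" for i j
    proof -
      have "c * (nrm (s i - s j))\<^sup>2 < c * e\<^sup>2"
        using close[OF that] M' by linarith
      then have "(nrm (s i - s j))\<^sup>2 < e\<^sup>2" using coercive(1) by simp
      then show ?thesis using e by (simp add: power_less_imp_less_base)
    qed
    then show ?thesis by blast
  qed
  then have "\<exists>w\<in>S. (\<lambda>k. nrm (s k - w)) \<longlonglongrightarrow> 0"
    by (rule complete[OF s(1)])
  then obtain w where w: "w \<in> S" "(\<lambda>k. nrm (s k - w)) \<longlonglongrightarrow> 0"
    by (rule bexE)
  have "b w v = f v" if v: "v \<in> S" for v
  proof -
    have bv: "bounded_functional (\<lambda>u. b u v)"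
      unfolding bounded_functional_def
    proof (intro conjI exI ballI)
      show "linear_functional_on S (\<lambda>u. b u v)" by (rule b_lin[OF v])
      show "\<bar>b u v\<bar> \<le> (C * nrm v) * nrm u" if "u \<in> S" for u
        using b_bound[OF that v] by (simp add: mult_ac)
    qed
    have "(\<lambda>k. b (s k) v - f v) \<longlonglongrightarrow> 0"
    proof -
      \<comment> \<open>Adding \<open>1\<close> keeps the divisor positive when \<open>v\<close> has seminorm zero.\<close>
      define B where "B = b v v + 1"
      have "0 \<le> c * (nrm v)\<^sup>2" using coercive(1) by simp
      then have B: "B > 0" using coercive(2)[OF v] unfolding B_def by linarith
      have "(b (s k) v - f v)\<^sup>2 \<le> B / real (Suc k)" for k
      proof -
        define d where "d = b (s k) v - f v"
        \<comment> \<open>This step size minimises the bound \<open>2 * t * d + t\<^sup>2 * B\<close> of the change of \<open>J\<close>.\<close>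
        define t where "t = - d / B"
        have "m \<le> J (s k + t *\<^sub>R v)" by (intro m_le S_add S_scale s v)
        also have "\<dots> = J (s k) + 2 * t * d + t\<^sup>2 * b v v"
          using s(1)[of k] v unfolding d_def J_def
          by (simp add: b_add_l b_add_r b_scale_l b_scale_r S_add S_scale fl b_sym[of v "s k"] power2_eq_square algebra_simps)
        also have "\<dots> \<le> m + 1 / real (Suc k) + 2 * t * d + t\<^sup>2 * B"
        proof -
          have "t\<^sup>2 * b v v \<le> t\<^sup>2 * B" by (intro mult_left_mono) (simp_all add: B_def)
          then show ?thesis using s(2)[of k] by linarith
        qed
        finally have "m \<le> m + 1 / real (Suc k) + 2 * t * d + t\<^sup>2 * B" .
        moreover have "2 * t * d = - (2 * (d\<^sup>2 / B))" by (simp add: t_def power2_eq_square)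
        moreover have "t\<^sup>2 * B = d\<^sup>2 / B" using B by (simp add: t_def power2_eq_square field_simps)
        ultimately have "d\<^sup>2 / B \<le> 1 / real (Suc k)" by linarith
        then have "B * (d\<^sup>2 / B) \<le> B * (1 / real (Suc k))" using B by (intro mult_left_mono) auto
        moreover have "B * (d\<^sup>2 / B) = d\<^sup>2" using B by simp
        ultimately show ?thesis unfolding d_def by simp
      qed
      then have le: "\<bar>b (s k) v - f v\<bar> \<le> sqrt (B / real (Suc k))" for k
        using real_le_rsqrt[of "\<bar>b (s k) v - f v\<bar>" "B / real (Suc k)"] by simp
      have "(\<lambda>k. B / real (Suc k)) \<longlonglongrightarrow> 0"
        using LIMSEQ_Suc[OF lim_const_over_n[of B]] by simp
      from tendsto_real_sqrt[OF this] have lim: "(\<lambda>k. sqrt (B / real (Suc k))) \<longlonglongrightarrow> 0"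
        by simp
      show ?thesis
      proof (rule tendsto_rabs_zero_cancel, rule tendsto_sandwich[OF _ _ tendsto_const lim])
        show "\<forall>\<^sub>F k in sequentially. \<bar>b (s k) v - f v\<bar> \<le> sqrt (B / real (Suc k))"
          using le by (intro always_eventually allI)
      qed simp
    qed
    then have "(\<lambda>k. b (s k) v) \<longlonglongrightarrow> f v" by (rule LIM_zero_cancel)
    then show ?thesis
      using bounded_functional_tendsto[where f = "\<lambda>u. b u v" and s = s, OF bv s(1) w]
      by (rule LIMSEQ_unique[rotated])
  qed
  then show ?thesis by (intro bexI[OF _ w(1)] ballI)
qed

lemma riesz:
  assumes "bounded_functional f"
  shows "\<exists>w\<in>S. \<forall>v\<in>S. ip w v = f v"
proof (rule lax_milgram[where b = ip and C = 1 and c = 1])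
  show "\<bar>ip u v\<bar> \<le> 1 * nrm u * nrm v" if "u \<in> S" "v \<in> S" for u v
    using Cauchy_Schwarz[OF that] by simp
  show "linear_functional_on S (\<lambda>u. ip u v)" if "v \<in> S" for v
    by (rule ip_linear[OF that])
  show "ip u v = ip v u" for u v by (rule ip_commute)
qed (simp_all add: nrm_sq assms)

lemma semi_hilbert_closed_subspace:
  assumes "subspace W" "W \<subseteq> S" "closed_in_S W"
  shows "semi_hilbert_space W ip"
proof -
  interpret W: semi_inner_space W ip
  proof
    show "subspace W" by (rule assms(1))
    show "linear_functional_on W (\<lambda>u. ip u v)" if "v \<in> W" for v
      using that assms(2) by (intro linear_functional_on_subset[OF ip_linear assms(2)]) auto
    show "ip u v = ip v u" for u v by (rule ip_commute)
    show "0 \<le> ip u u" if "u \<in> W" for u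
      using that assms(2) by (intro ip_nonneg) auto
  qed
  show ?thesis
  proof
    fix s :: "nat \<Rightarrow> 'a"
    assume s: "\<And>k. s k \<in> W" and "\<And>e. e > 0 \<Longrightarrow> \<exists>M. \<forall>m\<ge>M. \<forall>n\<ge>M. W.nrm (s m - s n) < e"
    then have "\<exists>w\<in>S. (\<lambda>k. nrm (s k - w)) \<longlonglongrightarrow> 0"
      using assms(2) by (intro complete) auto
    then obtain w where w: "w \<in> S" "(\<lambda>k. nrm (s k - w)) \<longlonglongrightarrow> 0"
      by (rule bexE)
    then have "w \<in> W" using assms(3)[unfolded closed_in_S_def, rule_format, of s w] s by simp
    with w show "\<exists>w\<in>W. (\<lambda>k. W.nrm (s k - w)) \<longlonglongrightarrow> 0" by auto
  qed
qed

lemma orthogonal_projection: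
  assumes W: "subspace W" "W \<subseteq> S" "closed_in_S W" and h: "h \<in> S"
  shows "\<exists>w\<in>W. \<forall>v\<in>W. ip (h - w) v = 0"
proof -
  interpret W: semi_hilbert_space W ip by (rule semi_hilbert_closed_subspace[OF W])
  have "W.bounded_functional (ip h)"
    unfolding W.bounded_functional_def
  proof
    show "linear_functional_on W (ip h)"
      using bounded_functional_ip[OF h] linear_functional_on_subset[OF _ W(2)]
      by (simp add: bounded_functional_def)
    show "\<exists>K. \<forall>u\<in>W. \<bar>ip h u\<bar> \<le> K * nrm u"
      using Cauchy_Schwarz[OF h subsetD[OF W(2)]] by (intro exI[of _ "nrm h"]) simp
  qed
  then have "\<exists>w\<in>W. \<forall>v\<in>W. ip w v = ip h v"
    by (rule W.riesz)
  then obtain w where w: "w \<in> W" "\<forall>v\<in>W. ip w v = ip h v"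
    by (rule bexE)
  show ?thesis
  proof (intro bexI[OF _ w(1)] ballI)
    fix v assume "v \<in> W"
    moreover have "w \<in> S" "v \<in> S" using w(1) W(2) \<open>v \<in> W\<close> by (simp_all add: subset_iff)
    ultimately show "ip (h - w) v = 0" using w(2) h by (simp add: ip_diff_left)
  qed
qed

text \<open>The difference of \<open>h\<close> and its projection is orthogonal to \<open>D\<close>, hence of seminorm zero; a
  closed set contains with a point everything at distance zero from it.\<close>

lemma closed_subspace_eq_whole:
  assumes W: "subspace W" "W \<subseteq> S" "closed_in_S W"
    and D: "D \<subseteq> W" "\<And>w. w \<in> S \<Longrightarrow> (\<And>d. d \<in> D \<Longrightarrow> ip w d = 0) \<Longrightarrow> nrm w = 0"
  shows "W = S"
proof (rule antisym[OF W(2)], rule subsetI)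
  fix h assume h: "h \<in> S"
  obtain w where w: "w \<in> W" "\<forall>v\<in>W. ip (h - w) v = 0"
    using orthogonal_projection[OF W h] by (rule bexE)
  have wS: "w \<in> S" using W(2) w(1) by (rule subsetD)
  have "ip (h - w) d = 0" if "d \<in> D" for d
    using w(2) subsetD[OF D(1) that] by (rule bspec)
  then have "nrm (h - w) = 0"
    by (rule D(2)[OF S_diff[OF h wS]])
  then have "nrm (w - h) = 0"
    by (simp only: nrm_diff_commute[OF wS h])
  then have lim: "(\<lambda>k::nat. nrm (w - h)) \<longlonglongrightarrow> 0"
    by simp
  have "(\<forall>k::nat. s k \<in> W) \<Longrightarrow> (\<lambda>k. nrm (s k - h)) \<longlonglongrightarrow> 0 \<Longrightarrow> h \<in> W" for s
    using W(3) h unfolding closed_in_S_def by simp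
  from this[of "\<lambda>k. w"] lim w(1) show "h \<in> W" by simp
qed

text \<open>Uniform boundedness makes the set of points of convergence a closed subspace. It contains
  the separating set \<open>D\<close> and is therefore everything. This reduces weak convergence to
  countably many tests once \<open>D\<close> is countable.\<close>

lemma functionals_converge_on_whole:
  assumes D: "D \<subseteq> S" "\<And>w. w \<in> S \<Longrightarrow> (\<And>d. d \<in> D \<Longrightarrow> ip w d = 0) \<Longrightarrow> nrm w = 0"
    and lin: "\<And>k. linear_functional_on S (f k)"
    and bound: "\<And>k u. u \<in> S \<Longrightarrow> \<bar>f k u\<bar> \<le> C * nrm u"
    and conv: "\<And>d. d \<in> D \<Longrightarrow> convergent (\<lambda>k::nat. f k d)"
    and h: "h \<in> S"
  shows "convergent (\<lambda>k. f k h)"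
proof -
  define W where "W = {h \<in> S. convergent (\<lambda>k. f k h)}"
  note fl = linear_functional_onD[OF lin subspace_S]
  have "W = S"
  proof (rule closed_subspace_eq_whole[where D = D])
    fix w assume "w \<in> S" "\<And>d. d \<in> D \<Longrightarrow> ip w d = 0"
    then show "nrm w = 0" by (rule D(2))
  next
    show "subspace W"
    proof (rule subspaceI)
      have "f k 0 = 0" for k using fl(2)[OF S_0 S_0, of k 0] by simp
      then show "0 \<in> W" by (simp add: W_def S_0 convergent_const)
      show "u + v \<in> W" if "u \<in> W" "v \<in> W" for u v
        using that by (simp add: W_def S_add fl(1) convergent_add)
      show "c *\<^sub>R u \<in> W" if "u \<in> W" for c u
        using that by (simp add: W_def S_scale fl(2)[OF _ S_0] convergent_mult convergent_const)
    qed
    show "W \<subseteq> S" "D \<subseteq> W" using D conv by (auto simp: W_def)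
    show "closed_in_S W"
      unfolding closed_in_S_def
    proof (intro allI impI)
      fix s w assume s: "\<forall>k::nat. s k \<in> W" and w: "w \<in> S" "(\<lambda>k. nrm (s k - w)) \<longlonglongrightarrow> 0"
      have "Cauchy (\<lambda>k. f k w)"
      proof (rule metric_CauchyI)
        fix e :: real assume e: "e > 0"
        define C' where "C' = \<bar>C\<bar> + 1"
        have C': "C' > 0" "C \<le> C'" by (auto simp: C'_def)
        have "\<forall>\<^sub>F j in sequentially. nrm (s j - w) < e / (3 * C')"
          using order_tendstoD(2)[OF w(2)] e C' by simp
        then obtain j where j: "nrm (s j - w) < e / (3 * C')"
          by (auto dest: eventually_happens)
        have sj: "s j \<in> S" "convergent (\<lambda>k. f k (s j))" using s by (auto simp: W_def)
        have near: "\<bar>f k (s j) - f k w\<bar> < e / 3" for k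
        proof -
          have "\<bar>f k (s j) - f k w\<bar> = \<bar>f k (s j - w)\<bar>" using fl(3)[OF sj(1) w(1)] by simp
          also have "\<dots> \<le> C * nrm (s j - w)" by (intro bound S_diff sj w)
          also have "\<dots> \<le> C' * nrm (s j - w)"
            by (intro mult_right_mono C' nrm_nonneg S_diff sj w)
          also have "\<dots> < C' * (e / (3 * C'))" using j C' by (intro mult_strict_left_mono) auto
          finally show ?thesis using C' by simp
        qed
        obtain M where M: "\<forall>m\<ge>M. \<forall>n\<ge>M. dist (f m (s j)) (f n (s j)) < e / 3"
          using convergent_Cauchy[OF sj(2)] e unfolding Cauchy_def by (meson divide_pos_pos zero_less_numeral)
        have "dist (f m w) (f n w) < e" if "m \<ge> M" "n \<ge> M" for m n
        proof -
          have "dist (f m (s j)) (f n (s j)) < e / 3" using M that by blast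
          then show ?thesis using near[of m] near[of n] unfolding dist_real_def by linarith
        qed
        then show "\<exists>M. \<forall>m\<ge>M. \<forall>n\<ge>M. dist (f m w) (f n w) < e" by blast
      qed
      then show "w \<in> W" using w(1) by (simp add: W_def Cauchy_convergent_iff)
    qed
  qed
  with h show ?thesis by (auto simp: W_def)
qed

lemma functional_limit:
  assumes lin: "\<And>k. linear_functional_on S (f k)"
    and bound: "\<And>k u. u \<in> S \<Longrightarrow> \<bar>f k u\<bar> \<le> C * nrm u"
    and conv: "\<And>h. h \<in> S \<Longrightarrow> convergent (\<lambda>k::nat. f k h)"
  obtains w where "w \<in> S" "\<And>h. h \<in> S \<Longrightarrow> (\<lambda>k. f k h) \<longlonglongrightarrow> ip w h"
proof -
  have L: "(\<lambda>k. f k h) \<longlonglongrightarrow> lim (\<lambda>k. f k h)" if "h \<in> S" for h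
    using conv[OF that] by (rule convergent_LIMSEQ_iff[THEN iffD1])
  have "bounded_functional (\<lambda>h. lim (\<lambda>k. f k h))"
    unfolding bounded_functional_def
  proof (intro conjI exI ballI)
    show "linear_functional_on S (\<lambda>h. lim (\<lambda>k. f k h))"
    proof (rule linear_functional_on_limit[where f = f])
      show "linear_functional_on S (f k)" for k by (rule lin)
      show "(\<lambda>k. f k u) \<longlonglongrightarrow> lim (\<lambda>k. f k u)" if "u \<in> S" for u by (rule L[OF that])
    qed (rule subspace_S)
    fix h assume h: "h \<in> S"
    show "\<bar>lim (\<lambda>k. f k h)\<bar> \<le> C * nrm h"
    proof (rule LIMSEQ_le_const2)
      show "(\<lambda>k. \<bar>f k h\<bar>) \<longlonglongrightarrow> \<bar>lim (\<lambda>k. f k h)\<bar>"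
        by (intro tendsto_rabs L h)
      show "\<exists>N. \<forall>n\<ge>N. \<bar>f n h\<bar> \<le> C * nrm h"
        using bound[OF h] by blast
    qed
  qed
  then have "\<exists>w\<in>S. \<forall>v\<in>S. ip w v = lim (\<lambda>k. f k v)"
    by (rule riesz)
  then obtain w where w: "w \<in> S" "\<forall>v\<in>S. ip w v = lim (\<lambda>k. f k v)"
    by (rule bexE)
  show ?thesis
  proof (rule that[OF w(1)])
    show "(\<lambda>k. f k h) \<longlonglongrightarrow> ip w h" if "h \<in> S" for h
      using L[OF that] w(2) that by simp
  qed
qed

end

section \<open>Square-integrable functions\<close>

text \<open>Pointwise scaling turns functions into a real vector space, which lets the abstract
  Hilbert space results apply to \<open>L2\<close> as a subspace of the space of all functions.\<close>

instantiation "fun" :: (type, real_vector) real_vector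
begin

definition scaleR_fun :: "real \<Rightarrow> ('a \<Rightarrow> 'b) \<Rightarrow> 'a \<Rightarrow> 'b"
  where "c *\<^sub>R f = (\<lambda>x. c *\<^sub>R f x)"

instance
  by standard (auto simp: scaleR_fun_def fun_eq_iff algebra_simps)

end

lemma scaleR_fun_apply [simp]: "(c *\<^sub>R f) x = c *\<^sub>R f x"
  by (simp add: scaleR_fun_def)

definition L2_inner :: "(real^'n) set \<Rightarrow> (real^'n \<Rightarrow> 'b::euclidean_space) \<Rightarrow> (real^'n \<Rightarrow> 'b) \<Rightarrow> real"
  where "L2_inner \<Omega> u v = (LINT x|lebesgue_on \<Omega>. u x \<bullet> v x)"

lemma L2_measurable: "u \<in> L2 \<Omega> \<Longrightarrow> u \<in> borel_measurable (lebesgue_on \<Omega>)"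
  by (simp add: L2_def)

lemma L2_integrable_sq: "u \<in> L2 \<Omega> \<Longrightarrow> integrable (lebesgue_on \<Omega>) (\<lambda>x. (norm (u x))\<^sup>2)"
  by (simp add: L2_def)

lemma L2I_bound:
  assumes "u \<in> borel_measurable (lebesgue_on \<Omega>)" "integrable (lebesgue_on \<Omega>) g"
    "\<And>x. x \<in> \<Omega> \<Longrightarrow> (norm (u x))\<^sup>2 \<le> g x"
  shows "u \<in> L2 \<Omega>"
proof -
  have m: "(\<lambda>x. (norm (u x))\<^sup>2) \<in> borel_measurable (lebesgue_on \<Omega>)"
    using assms(1) by measurable
  have "AE x in lebesgue_on \<Omega>. norm ((norm (u x))\<^sup>2) \<le> norm (g x)"
    using assms(3) by (intro AE_I2) (force simp: space_restrict_space)
  from Bochner_Integration.integrable_bound[OF assms(2) m this]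
  show ?thesis using assms(1) by (simp add: L2_def)
qed

lemma L2_inner_integrable:
  assumes "u \<in> L2 \<Omega>" "v \<in> L2 \<Omega>"
  shows "integrable (lebesgue_on \<Omega>) (\<lambda>x. u x \<bullet> v x)"
proof -
  have m: "(\<lambda>x. u x \<bullet> v x) \<in> borel_measurable (lebesgue_on \<Omega>)"
    using assms by (intro borel_measurable_inner L2_measurable)
  have i: "integrable (lebesgue_on \<Omega>) (\<lambda>x. (norm (u x))\<^sup>2 + (norm (v x))\<^sup>2)"
    using assms by (intro Bochner_Integration.integrable_add L2_integrable_sq)
  have "norm (u x \<bullet> v x) \<le> norm ((norm (u x))\<^sup>2 + (norm (v x))\<^sup>2)" for x
  proof -
    have "norm (u x \<bullet> v x) \<le> norm (u x) * norm (v x)"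
      using Cauchy_Schwarz_ineq2 by simp
    also have "\<dots> \<le> (norm (u x))\<^sup>2 + (norm (v x))\<^sup>2"
      using sum_squares_bound[of "norm (u x)" "norm (v x)"]
        mult_nonneg_nonneg[OF norm_ge_zero[of "u x"] norm_ge_zero[of "v x"]] by linarith
    finally show ?thesis by simp
  qed
  then show ?thesis
    by (intro Bochner_Integration.integrable_bound[OF i m] AE_I2)
qed

lemma L2_add: assumes "u \<in> L2 \<Omega>" "v \<in> L2 \<Omega>" shows "(\<lambda>x. u x + v x) \<in> L2 \<Omega>"
proof (rule L2I_bound)
  show "(\<lambda>x. u x + v x) \<in> borel_measurable (lebesgue_on \<Omega>)"
    using assms by (intro borel_measurable_add L2_measurable)
  show "integrable (lebesgue_on \<Omega>) (\<lambda>x. 2 * (norm (u x))\<^sup>2 + 2 * (norm (v x))\<^sup>2)"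
    using assms by (intro Bochner_Integration.integrable_add integrable_mult_right L2_integrable_sq)
  show "(norm (u x + v x))\<^sup>2 \<le> 2 * (norm (u x))\<^sup>2 + 2 * (norm (v x))\<^sup>2" for x
  proof -
    have "(norm (u x + v x))\<^sup>2 \<le> (norm (u x) + norm (v x))\<^sup>2"
      by (intro power_mono norm_triangle_ineq) simp
    also have "\<dots> \<le> 2 * (norm (u x))\<^sup>2 + 2 * (norm (v x))\<^sup>2"
      using sum_squares_bound[of "norm (u x)" "norm (v x)"] by (simp add: power2_sum)
    finally show ?thesis .
  qed
qed

lemma L2_scale: assumes "u \<in> L2 \<Omega>" shows "(\<lambda>x. c *\<^sub>R u x) \<in> L2 \<Omega>"
proof (rule L2I_bound)
  show "(\<lambda>x. c *\<^sub>R u x) \<in> borel_measurable (lebesgue_on \<Omega>)"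
    using L2_measurable[OF assms] by measurable
  show "integrable (lebesgue_on \<Omega>) (\<lambda>x. c\<^sup>2 * (norm (u x))\<^sup>2)"
    using assms by (intro integrable_mult_right L2_integrable_sq)
qed (simp add: power_mult_distrib)

lemma subspace_L2: "subspace (L2 \<Omega> :: (real^'n \<Rightarrow> 'b::euclidean_space) set)"
proof (rule subspaceI)
  show "(0 :: real^'n \<Rightarrow> 'b) \<in> L2 \<Omega>"
    by (simp add: L2_def zero_fun_def)
  show "u + v \<in> L2 \<Omega>" if "u \<in> L2 \<Omega>" "v \<in> L2 \<Omega>" for u v :: "real^'n \<Rightarrow> 'b"
    using L2_add[OF that] by (simp add: plus_fun_def)
  show "c *\<^sub>R u \<in> L2 \<Omega>" if "u \<in> L2 \<Omega>" for c and u :: "real^'n \<Rightarrow> 'b"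
    using L2_scale[OF that] by (simp add: scaleR_fun_def)
qed

lemma L2_norm_eq: "sqrt (L2_inner \<Omega> u u) = L2_norm_on \<Omega> u"
  by (simp add: L2_inner_def L2_norm_on_def power2_norm_eq_inner)

lemma semi_inner_space_L2:
  "semi_inner_space (L2 \<Omega> :: (real^'n \<Rightarrow> 'b::euclidean_space) set) (L2_inner \<Omega>)"
proof
  show "subspace (L2 \<Omega> :: (real^'n \<Rightarrow> 'b) set)" by (rule subspace_L2)
  show "linear_functional_on (L2 \<Omega>) (\<lambda>u. L2_inner \<Omega> u v)" if "v \<in> L2 \<Omega>" for v :: "real^'n \<Rightarrow> 'b"
    using L2_inner_integrable[OF _ that]
    by (intro linear_functional_onI) (simp_all add: L2_inner_def inner_add_left)
  show "L2_inner \<Omega> u v = L2_inner \<Omega> v u" for u v :: "real^'n \<Rightarrow> 'b"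
    by (simp add: L2_inner_def inner_commute)
  show "0 \<le> L2_inner \<Omega> u u" for u :: "real^'n \<Rightarrow> 'b"
    by (simp add: L2_inner_def)
qed

interpretation L2: semi_inner_space "L2 \<Omega>" "L2_inner \<Omega>"
  rewrites "semi_inner_space.nrm (L2_inner \<Omega>) = L2_norm_on \<Omega>"
  for \<Omega> :: "(real^'n) set"
proof -
  show "semi_inner_space (L2 \<Omega>) (L2_inner \<Omega>)" by (rule semi_inner_space_L2)
  then show "semi_inner_space.nrm (L2_inner \<Omega>) = L2_norm_on \<Omega>"
    by (intro ext) (simp add: semi_inner_space.nrm_def[OF semi_inner_space_L2] L2_norm_eq)
qed

lemma L2_norm_zero_iff:
  assumes "u \<in> L2 \<Omega>"
  shows "L2_norm_on \<Omega> u = 0 \<longleftrightarrow> (AE x in lebesgue_on \<Omega>. u x = 0)"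
  using integral_nonneg_eq_0_iff_AE[OF L2_integrable_sq[OF assms]] by (simp add: L2_norm_on_def)

lemma L2_inner_cong_AE:
  assumes "u \<in> L2 \<Omega>" "u' \<in> L2 \<Omega>" "v \<in> L2 \<Omega>" "L2_norm_on \<Omega> (u - u') = 0"
  shows "L2_inner \<Omega> u v = L2_inner \<Omega> u' v"
proof -
  have "\<bar>L2_inner \<Omega> (u - u') v\<bar> \<le> 0"
    using L2.Cauchy_Schwarz[OF L2.S_diff[OF assms(1,2)] assms(3)] assms(4) by simp
  then show ?thesis using assms by (simp add: L2.ip_diff_left)
qed

text \<open>Used with small \<open>e\<close> this turns \<open>L\<^sup>2\<close> bounds on a set of finite measure into \<open>L\<^sup>1\<close> bounds,
  in place of the inequality of Cauchy and Schwarz.\<close>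

lemma le_weighted_square:
  fixes x :: real assumes "e > 0" shows "x \<le> e + x\<^sup>2 / e"
proof (cases "x \<le> e")
  case True
  then show ?thesis using assms by (simp add: add_increasing2)
next
  case False
  then have "x * e \<le> x * x" using assms by (intro mult_left_mono) auto
  then have "x \<le> x\<^sup>2 / e" using assms by (simp add: power2_eq_square pos_le_divide_eq)
  then show ?thesis using assms by linarith
qed

text \<open>A subsequence with differences of order \<open>(1/2)^k\<close> in \<open>L\<^sup>2\<close> has summable differences in
  \<open>L\<^sup>1\<close>, because the measure is finite; hence it converges almost everywhere, and Fatou's
  lemma gives convergence in \<open>L\<^sup>2\<close> of the whole Cauchy sequence.\<close>

lemma L2_complete:
  fixes s :: "nat \<Rightarrow> real^'n \<Rightarrow> 'b::euclidean_space"
  assumes fin: "finite_measure (lebesgue_on \<Omega>)"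
    and s: "\<And>k. s k \<in> L2 \<Omega>"
    and Cauchy: "\<And>e. e > 0 \<Longrightarrow> \<exists>M. \<forall>m\<ge>M. \<forall>n\<ge>M. L2_norm_on \<Omega> (s m - s n) < e"
  shows "\<exists>w\<in>L2 \<Omega>. (\<lambda>k. L2_norm_on \<Omega> (s k - w)) \<longlonglongrightarrow> 0"
proof -
  interpret finite_measure "lebesgue_on \<Omega>" by (rule fin)
  let ?M = "lebesgue_on \<Omega>"
  note [measurable] = L2_measurable[OF s]
  have "\<forall>k. \<exists>M. \<forall>m\<ge>M. \<forall>n\<ge>M. L2_norm_on \<Omega> (s m - s n) < (1/2) ^ k"
    using Cauchy by simp
  then obtain g where g: "\<And>k m n. m \<ge> g k \<Longrightarrow> n \<ge> g k \<Longrightarrow> L2_norm_on \<Omega> (s m - s n) < (1/2) ^ k"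
    by metis
  \<comment> \<open>Partial sums make \<open>r k\<close> an upper bound of \<open>g j\<close> for all \<open>j \<le> k\<close>.\<close>
  define r where "r k = (\<Sum>i\<le>k. g i)" for k
  have r_ge: "g j \<le> r k" if "j \<le> k" for j k
    unfolding r_def using that by (intro member_le_sum) auto
  have sq: "(LINT x|?M. (norm (s m x - s n x))\<^sup>2) = (L2_norm_on \<Omega> (s m - s n))\<^sup>2" for m n
    by (simp add: L2_norm_on_def)
  have int_sq: "integrable ?M (\<lambda>x. (norm (s m x - s n x))\<^sup>2)" for m n
    using L2_integrable_sq[OF L2.S_diff[OF s s, of m n]] by simp
  have nn_sq: "(\<integral>\<^sup>+x. ennreal ((norm (s m x - s n x))\<^sup>2) \<partial>?M) \<le> ennreal (((1/2) ^ k)\<^sup>2)"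
    if "m \<ge> g k" "n \<ge> g k" for m n k
  proof -
    have "(\<integral>\<^sup>+x. ennreal ((norm (s m x - s n x))\<^sup>2) \<partial>?M) = ennreal ((L2_norm_on \<Omega> (s m - s n))\<^sup>2)"
      using nn_integral_eq_integral[OF int_sq] by (simp add: sq)
    also have "\<dots> \<le> ennreal (((1/2) ^ k)\<^sup>2)"
      using g[OF that] L2.nrm_nonneg[OF L2.S_diff[OF s s], of m n] by (intro ennreal_leI power_mono) auto
    finally show ?thesis .
  qed
  define d where "d k x = s (r (Suc k)) x - s (r k) x" for k x
  have [measurable]: "d k \<in> borel_measurable ?M" for k unfolding d_def by measurable
  have d1: "(\<integral>\<^sup>+x. ennreal (norm (d k x)) \<partial>?M) \<le> ennreal ((1/2) ^ k * (measure ?M (space ?M) + 1))" for k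
  proof -
    have "(\<integral>\<^sup>+x. ennreal (norm (d k x)) \<partial>?M)
        \<le> (\<integral>\<^sup>+x. ennreal ((1/2)^k) + ennreal (2^k) * ennreal ((norm (d k x))\<^sup>2) \<partial>?M)"
    proof (intro nn_integral_mono)
      fix x
      have "norm (d k x) \<le> (1/2)^k + (norm (d k x))\<^sup>2 / (1/2)^k"
        by (rule le_weighted_square) simp
      also have "\<dots> = (1/2)^k + 2^k * (norm (d k x))\<^sup>2"
        by (simp add: power_one_over)
      finally show "ennreal (norm (d k x)) \<le> ennreal ((1/2)^k) + ennreal (2^k) * ennreal ((norm (d k x))\<^sup>2)"
        by (simp add: ennreal_mult[symmetric] ennreal_plus[symmetric] ennreal_leI del: ennreal_plus)
    qed
    also have "\<dots> = ennreal ((1/2)^k) * emeasure ?M (space ?M) + ennreal (2^k) * (\<integral>\<^sup>+x. ennreal ((norm (d k x))\<^sup>2) \<partial>?M)"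
      by (simp add: nn_integral_add nn_integral_cmult)
    also have "\<dots> \<le> ennreal ((1/2)^k) * emeasure ?M (space ?M) + ennreal (2^k) * ennreal (((1/2) ^ k)\<^sup>2)"
      unfolding d_def by (intro add_left_mono mult_left_mono nn_sq r_ge) auto
    also have "\<dots> = ennreal ((1/2)^k) * ennreal (measure ?M (space ?M)) + ennreal (2^k * ((1/2) ^ k)\<^sup>2)"
      by (simp add: emeasure_eq_measure ennreal_mult)
    also have "(2::real)^k * ((1/2) ^ k)\<^sup>2 = (1/2)^k"
      by (simp add: power2_eq_square power_one_over)
    also have "ennreal ((1/2)^k) * ennreal (measure ?M (space ?M)) + ennreal ((1/2)^k)
        = ennreal ((1/2) ^ k * (measure ?M (space ?M) + 1))"
      by (simp add: ennreal_mult[symmetric] ennreal_plus[symmetric] distrib_left del: ennreal_plus)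
    finally show ?thesis .
  qed
  have "(\<integral>\<^sup>+x. (\<Sum>k. ennreal (norm (d k x))) \<partial>?M) = (\<Sum>k. \<integral>\<^sup>+x. ennreal (norm (d k x)) \<partial>?M)"
    by (intro nn_integral_suminf) measurable
  also have "\<dots> \<le> (\<Sum>k. ennreal ((1/2) ^ k * (measure ?M (space ?M) + 1)))"
    by (intro suminf_le d1) auto
  also have "\<dots> = ennreal (\<Sum>k. (1/2) ^ k * (measure ?M (space ?M) + 1))"
    by (intro suminf_ennreal2 summable_mult2 summable_geometric) auto
  also have "\<dots> < \<infinity>" by simp
  finally have "(\<integral>\<^sup>+x. (\<Sum>k. ennreal (norm (d k x))) \<partial>?M) \<noteq> \<infinity>" by simp
  then have "AE x in ?M. (\<Sum>k. ennreal (norm (d k x))) \<noteq> \<infinity>"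
    by (intro nn_integral_noteq_infinite) measurable
  then have conv: "AE x in ?M. convergent (\<lambda>k. s (r k) x)"
  proof (rule eventually_mono)
    fix x assume "(\<Sum>k. ennreal (norm (d k x))) \<noteq> \<infinity>"
    then have "summable (\<lambda>k. norm (d k x))" by (intro summable_suminf_not_top) auto
    then have "summable (\<lambda>k. d k x)" by (rule summable_norm_cancel)
    then have "convergent (\<lambda>n. \<Sum>k<n. d k x)" by (simp add: summable_iff_convergent)
    moreover have "(\<Sum>k<n. d k x) = s (r n) x - s (r 0) x" for n
      unfolding d_def by (rule sum_lessThan_telescope)
    ultimately have "convergent (\<lambda>n. s (r n) x - s (r 0) x)" by simp
    from convergent_add[OF this convergent_const[of "s (r 0) x"]] show "convergent (\<lambda>n. s (r n) x)" by simp
  qed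
  define w where "w x = lim (\<lambda>k. s (r k) x)" for x
  have [measurable]: "w \<in> borel_measurable ?M" unfolding w_def by measurable
  have lim: "AE x in ?M. (\<lambda>k. s (r k) x) \<longlonglongrightarrow> w x"
    using conv by (rule eventually_mono) (simp add: w_def convergent_LIMSEQ_iff)
  have fatou: "(\<integral>\<^sup>+x. ennreal ((norm (s m x - w x))\<^sup>2) \<partial>?M) \<le> ennreal (((1/2) ^ k)\<^sup>2)" if "m \<ge> g k" for m k
  proof -
    have "AE x in ?M. ennreal ((norm (s m x - w x))\<^sup>2) = liminf (\<lambda>j. ennreal ((norm (s m x - s (r j) x))\<^sup>2))"
      using lim
    proof (rule eventually_mono)
      fix x assume "(\<lambda>k. s (r k) x) \<longlonglongrightarrow> w x"
      then have "(\<lambda>j. ennreal ((norm (s m x - s (r j) x))\<^sup>2)) \<longlonglongrightarrow> ennreal ((norm (s m x - w x))\<^sup>2)"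
        by (intro tendsto_ennrealI tendsto_intros)
      then show "ennreal ((norm (s m x - w x))\<^sup>2) = liminf (\<lambda>j. ennreal ((norm (s m x - s (r j) x))\<^sup>2))"
        by (intro lim_imp_Liminf[symmetric]) auto
    qed
    then have "(\<integral>\<^sup>+x. ennreal ((norm (s m x - w x))\<^sup>2) \<partial>?M)
        = (\<integral>\<^sup>+x. liminf (\<lambda>j. ennreal ((norm (s m x - s (r j) x))\<^sup>2)) \<partial>?M)"
      by (rule nn_integral_cong_AE)
    also have "\<dots> \<le> liminf (\<lambda>j. \<integral>\<^sup>+x. ennreal ((norm (s m x - s (r j) x))\<^sup>2) \<partial>?M)"
      by (intro nn_integral_liminf) measurable
    also have "\<dots> \<le> liminf (\<lambda>j. ennreal (((1/2) ^ k)\<^sup>2))"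
    proof (rule Liminf_mono)
      show "\<forall>\<^sub>F j in sequentially. (\<integral>\<^sup>+x. ennreal ((norm (s m x - s (r j) x))\<^sup>2) \<partial>?M) \<le> ennreal (((1/2) ^ k)\<^sup>2)"
        using eventually_ge_at_top[of k] by eventually_elim (intro nn_sq that r_ge)
    qed
    also have "\<dots> = ennreal (((1/2) ^ k)\<^sup>2)" by (simp add: Liminf_const)
    finally show ?thesis .
  qed
  have diff: "s m - w \<in> L2 \<Omega>" "L2_norm_on \<Omega> (s m - w) \<le> (1/2) ^ k" if "m \<ge> g k" for m k
  proof -
    have i: "integrable ?M (\<lambda>x. (norm (s m x - w x))\<^sup>2)"
      using fatou[OF that] by (intro integrableI_bounded) (auto simp: le_less_trans[OF _ ennreal_less_top])
    then show "s m - w \<in> L2 \<Omega>" by (simp add: L2_def fun_diff_def)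
    have "ennreal (LINT x|?M. (norm (s m x - w x))\<^sup>2) \<le> ennreal (((1/2) ^ k)\<^sup>2)"
      using fatou[OF that] nn_integral_eq_integral[OF i] by simp
    then have "(LINT x|?M. (norm (s m x - w x))\<^sup>2) \<le> ((1/2) ^ k)\<^sup>2"
      by (subst (asm) ennreal_le_iff) auto
    then show "L2_norm_on \<Omega> (s m - w) \<le> (1/2) ^ k"
      unfolding L2_norm_on_def fun_diff_def by (intro real_le_lsqrt) auto
  qed
  have "s (g 0) - (s (g 0) - w) \<in> L2 \<Omega>"
    by (intro L2.S_diff s diff[of 0]) simp
  then have w: "w \<in> L2 \<Omega>" by simp
  have "(\<lambda>k. L2_norm_on \<Omega> (s k - w)) \<longlonglongrightarrow> 0"
  proof (rule LIMSEQ_I)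
    fix e :: real assume "e > 0"
    then obtain k where k: "(1/2) ^ k < e"
      using real_arch_pow_inv[of e "1/2"] by auto
    have "norm (L2_norm_on \<Omega> (s m - w) - 0) < e" if "m \<ge> g k" for m
      using diff(2)[OF that] k L2.nrm_nonneg[OF L2.S_diff[OF s w], of m] by simp
    then show "\<exists>no. \<forall>n\<ge>no. norm (L2_norm_on \<Omega> (s n - w) - 0) < e" by blast
  qed
  with w show ?thesis by blast
qed

lemma semi_hilbert_space_L2:
  assumes "finite_measure (lebesgue_on \<Omega>)"
  shows "semi_hilbert_space (L2 \<Omega> :: (real^'n \<Rightarrow> 'b::euclidean_space) set) (L2_inner \<Omega>)"
proof (intro semi_hilbert_space.intro semi_inner_space_L2 semi_hilbert_space_axioms.intro)
  fix s :: "nat \<Rightarrow> real^'n \<Rightarrow> 'b"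
  assume "\<And>k. s k \<in> L2 \<Omega>"
    "\<And>e. 0 < e \<Longrightarrow> \<exists>M. \<forall>m\<ge>M. \<forall>n\<ge>M. semi_inner_space.nrm (L2_inner \<Omega>) (s m - s n) < e"
  moreover have nrm: "semi_inner_space.nrm (L2_inner \<Omega>) = (L2_norm_on \<Omega> :: (real^'n \<Rightarrow> 'b) \<Rightarrow> real)"
    by (intro ext) (simp add: semi_inner_space.nrm_def[OF semi_inner_space_L2] L2_norm_eq)
  ultimately show "\<exists>w\<in>L2 \<Omega>. (\<lambda>k. semi_inner_space.nrm (L2_inner \<Omega>) (s k - w)) \<longlonglongrightarrow> 0"
    unfolding nrm by (intro L2_complete assms)
qed

section \<open>The fundamental lemma of the calculus of variations\<close>

text \<open>By outer regularity the set where \<open>F\<close> is negative differs by a null set from a decreasing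
  intersection of open sets, so \<open>F\<close> has nonnegative integral over it.\<close>

lemma AE_nonneg_if_integral_open_nonneg:
  fixes F :: "real^'n \<Rightarrow> real"
  assumes \<Omega>: "open \<Omega>" and F: "integrable (lebesgue_on \<Omega>) F"
    and nn: "\<And>U. open U \<Longrightarrow> U \<subseteq> \<Omega> \<Longrightarrow> 0 \<le> (LINT x|lebesgue_on \<Omega>. indicat_real U x * F x)"
  shows "AE x in lebesgue_on \<Omega>. 0 \<le> F x"
proof -
  let ?M = "lebesgue_on \<Omega>"
  have \<Omega>m: "\<Omega> \<in> sets lebesgue" using \<Omega> by auto
  have Fm: "F \<in> borel_measurable ?M" using F by (rule borel_measurable_integrable)
  define E where "E = {x \<in> \<Omega>. F x < 0}"
  have "E \<in> sets ?M"
    using Fm unfolding E_def by (auto simp: space_restrict_space intro!: borel_measurable_less[of F ?M "\<lambda>_. 0", simplified space_lebesgue_on])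
  then have E: "E \<in> sets lebesgue" "E \<in> sets ?M"
    using \<Omega>m by (auto simp: sets_restrict_space_iff)
  have "\<exists>T. open T \<and> E \<subseteq> T \<and> T - E \<in> lmeasurable \<and> emeasure lebesgue (T - E) < ennreal (1 / Suc k)" for k
    using sets_lebesgue_outer_open[OF E(1), of "1 / Suc k"] by (metis of_nat_0_less_iff zero_less_Suc zero_less_divide_1_iff)
  then obtain T where T: "\<And>k. open (T k)" "\<And>k. E \<subseteq> T k" "\<And>k. T k - E \<in> lmeasurable"
      "\<And>k. emeasure lebesgue (T k - E) < ennreal (1 / Suc k)"
    by metis
  define U where "U k = (\<Inter>i\<le>k. T i) \<inter> \<Omega>" for k
  define G where "G = (\<Inter>k. U k)"
  have U: "open (U k)" "U k \<subseteq> \<Omega>" for k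
    unfolding U_def using T(1) \<Omega> by (auto intro!: open_Int open_INT)
  have EG: "E \<subseteq> G" unfolding G_def U_def using T(2) by (auto simp: E_def)
  have Gm: "G \<in> sets lebesgue" unfolding G_def using U(1) by auto
  have null: "G - E \<in> null_sets lebesgue"
  proof -
    have le: "emeasure lebesgue (G - E) \<le> ennreal (1 / Suc k)" for k
    proof -
      have "emeasure lebesgue (G - E) \<le> emeasure lebesgue (T k - E)"
        using T(3) by (intro emeasure_mono) (auto simp: G_def U_def)
      then show ?thesis using T(4)[of k] by simp
    qed
    have "(\<lambda>k. ennreal (1 / Suc k)) \<longlonglongrightarrow> ennreal 0"
      by (intro tendsto_ennrealI) (rule LIMSEQ_Suc[OF lim_1_over_n])
    from LIMSEQ_le_const[OF this, of "emeasure lebesgue (G - E)"] le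
    have "emeasure lebesgue (G - E) \<le> 0" by auto
    then show ?thesis using Gm E(1) by auto
  qed
  have "AE x in lebesgue. x \<notin> G - E" using null by (rule AE_not_in)
  then have GE: "AE x in ?M. indicat_real G x * F x = indicat_real E x * F x"
    using \<Omega>m EG by (auto simp: AE_restrict_space_iff indicator_def elim!: eventually_mono)
  have lim: "(\<lambda>k. indicat_real (U k) x) \<longlonglongrightarrow> indicat_real G x" for x
  proof (cases "x \<in> G")
    case True
    then show ?thesis by (simp add: G_def)
  next
    case False
    then obtain k where "x \<notin> U k" by (auto simp: G_def)
    then have "x \<notin> U j" if "j \<ge> k" for j using that by (auto simp: U_def)
    then have "\<forall>\<^sub>F j in sequentially. indicat_real (U j) x = 0"
      by (auto simp: eventually_sequentially intro!: exI[of _ k])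
    then show ?thesis using False by (simp add: tendsto_eventually)
  qed
  have meas: "(\<lambda>x. indicat_real A x * F x) \<in> borel_measurable ?M" if "A \<in> sets lebesgue" for A
    using that Fm \<Omega>m by (intro borel_measurable_times borel_measurable_indicator')
       (auto simp: space_restrict_space sets_restrict_space)
  have "(\<lambda>k. LINT x|?M. indicat_real (U k) x * F x) \<longlonglongrightarrow> (LINT x|?M. indicat_real G x * F x)"
  proof (rule integral_dominated_convergence[where w = "\<lambda>x. norm (F x)"])
    show "AE x in ?M. (\<lambda>k. indicat_real (U k) x * F x) \<longlonglongrightarrow> indicat_real G x * F x"
      using lim by (intro AE_I2 tendsto_mult tendsto_const)
    show "AE x in ?M. norm (indicat_real (U k) x * F x) \<le> norm (F x)" for k
      by (intro AE_I2) (simp add: indicator_def)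
    show "(\<lambda>x. indicat_real (U k) x * F x) \<in> borel_measurable ?M" for k
      using U by (intro meas) auto
  qed (use Gm F meas in auto)
  then have "0 \<le> (LINT x|?M. indicat_real G x * F x)"
    using nn[OF U] by (intro LIMSEQ_le_const) auto
  also have "\<dots> = (LINT x|?M. indicat_real E x * F x)"
    by (intro integral_cong_AE meas Gm E(1) GE)
  finally have "(LINT x|?M. - (indicat_real E x * F x)) \<le> 0" by simp
  moreover have int: "integrable ?M (\<lambda>x. - (indicat_real E x * F x))"
  proof (rule Bochner_Integration.integrable_bound[OF F])
    show "(\<lambda>x. - (indicat_real E x * F x)) \<in> borel_measurable ?M"
      using meas[OF E(1)] by (intro borel_measurable_uminus)
    show "AE x in ?M. norm (- (indicat_real E x * F x)) \<le> norm (F x)"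
      by (intro AE_I2) (simp add: indicator_def)
  qed
  moreover have nneg: "AE x in ?M. 0 \<le> - (indicat_real E x * F x)"
    by (auto simp: indicator_def E_def)
  ultimately have "(LINT x|?M. - (indicat_real E x * F x)) = 0"
    using integral_nonneg_AE[OF nneg] by simp
  then have "AE x in ?M. - (indicat_real E x * F x) = 0"
    using integral_nonneg_eq_0_iff_AE[OF int nneg] by simp
  moreover have "AE x in ?M. x \<in> \<Omega>" by (intro AE_I2) (simp add: space_restrict_space)
  ultimately show ?thesis
    by eventually_elim (auto simp: indicator_def E_def split: if_splits)
qed

lemma L2_bounded:
  assumes "\<Omega> \<in> lmeasurable" "u \<in> borel_measurable (lebesgue_on \<Omega>)" "\<And>x. x \<in> \<Omega> \<Longrightarrow> norm (u x) \<le> B"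
  shows "u \<in> L2 \<Omega>"
proof (rule L2I_bound[OF assms(2)])
  interpret finite_measure "lebesgue_on \<Omega>" by (rule finite_measure_lebesgue_on[OF assms(1)])
  show "integrable (lebesgue_on \<Omega>) (\<lambda>x. B\<^sup>2)" by simp
  show "(norm (u x))\<^sup>2 \<le> B\<^sup>2" if "x \<in> \<Omega>" for x
    using assms(3)[OF that] by (intro power_mono) auto
qed

lemma continuous_measurable_lebesgue_on:
  fixes f :: "real^'n \<Rightarrow> 'b::euclidean_space"
  assumes "continuous_on UNIV f"
  shows "f \<in> borel_measurable (lebesgue_on \<Omega>)"
proof -
  have "f \<in> borel_measurable borel" using assms by (rule borel_measurable_continuous_onI)
  then have "f \<in> borel_measurable lebesgue"
    by (intro measurable_completion) simp
  then show ?thesis by (rule measurable_restrict_space1)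
qed

lemma integrable_times_bounded:
  fixes F :: "real^'n \<Rightarrow> real"
  assumes "integrable (lebesgue_on \<Omega>) F" "\<psi> \<in> borel_measurable (lebesgue_on \<Omega>)" "\<And>x. norm (\<psi> x) \<le> B"
  shows "integrable (lebesgue_on \<Omega>) (\<lambda>x. F x * \<psi> x)"
proof (rule Bochner_Integration.integrable_bound)
  show "integrable (lebesgue_on \<Omega>) (\<lambda>x. B * F x)" using assms(1) by simp
  show "(\<lambda>x. F x * \<psi> x) \<in> borel_measurable (lebesgue_on \<Omega>)"
    by (rule borel_measurable_times[OF borel_measurable_integrable[OF assms(1)] assms(2)])
  have "norm (F x * \<psi> x) \<le> norm (B * F x)" for x
    using mult_right_mono[OF assms(3)[of x], of "\<bar>F x\<bar>"] order_trans[OF norm_ge_zero assms(3)[of x]]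
    by (simp add: abs_mult mult.commute)
  then show "AE x in lebesgue_on \<Omega>. norm (F x * \<psi> x) \<le> norm (B * F x)" by simp
qed

lemma test_function_bounded:
  assumes "test_function \<Omega> \<phi>" obtains B where "B > 0" "\<And>x. norm (\<phi> x) \<le> B"
proof -
  obtain K where K: "compact K" "\<forall>x. x \<notin> K \<longrightarrow> \<phi> x = 0" using assms unfolding test_function_iff by blast
  have "continuous_on K \<phi>"
    using smooth_continuous[OF test_function_smooth[OF assms]] by (rule continuous_on_subset) simp
  then have "bounded (\<phi> ` K)" using K(1) by (intro compact_imp_bounded compact_continuous_image)
  then obtain B where B: "B > 0" "\<forall>y\<in>\<phi> ` K. norm y \<le> B" unfolding bounded_pos by blast
  show ?thesis
  proof (rule that[OF B(1)])
    show "norm (\<phi> x) \<le> B" for x using B K(2) by (cases "x \<in> K") auto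
  qed
qed

lemma test_function_continuous: "test_function \<Omega> \<phi> \<Longrightarrow> continuous_on UNIV \<phi>"
  by (intro smooth_continuous test_function_smooth)

lemma test_function_measurable: "test_function \<Omega>' \<phi> \<Longrightarrow> \<phi> \<in> borel_measurable (lebesgue_on \<Omega>)"
  by (intro continuous_measurable_lebesgue_on test_function_continuous)

text \<open>Test functions between \<open>0\<close> and \<open>1\<close> approach the indicator of any open set, so dominated
  convergence reduces the claim to integrals over open sets. The inequality version is what
  transfers pointwise bounds to weak limits; the equality version follows by applying it to
  \<open>F\<close> and \<open>- F\<close>.\<close>

lemma AE_nonneg_if_test_integral_nonneg:
  fixes F :: "real^'n \<Rightarrow> real"
  assumes \<Omega>: "open \<Omega>" and F: "integrable (lebesgue_on \<Omega>) F"
    and nn: "\<And>\<psi>. test_function \<Omega> \<psi> \<Longrightarrow> (\<And>x. 0 \<le> \<psi> x) \<Longrightarrow> 0 \<le> (LINT x|lebesgue_on \<Omega>. F x * \<psi> x)"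
  shows "AE x in lebesgue_on \<Omega>. 0 \<le> F x"
proof (rule AE_nonneg_if_integral_open_nonneg[OF \<Omega> F])
  fix U :: "(real^'n) set" assume U: "open U" "U \<subseteq> \<Omega>"
  obtain \<psi> where \<psi>: "\<And>m. test_function U (\<psi> m)" "\<And>m x. 0 \<le> \<psi> m x" "\<And>m x. \<psi> m x \<le> 1"
      "\<And>x. (\<lambda>m. \<psi> m x) \<longlonglongrightarrow> indicat_real U x"
    by (rule test_functions_tendsto_indicator[OF U(1)]) (rule that)
  have t: "test_function \<Omega> (\<psi> m)" for m using test_function_mono[OF \<psi>(1) U(2)] .
  have "(\<lambda>m. LINT x|lebesgue_on \<Omega>. F x * \<psi> m x) \<longlonglongrightarrow> (LINT x|lebesgue_on \<Omega>. F x * indicat_real U x)"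
  proof (rule integral_dominated_convergence[where w = "\<lambda>x. norm (F x)"])
    show "AE x in lebesgue_on \<Omega>. (\<lambda>m. F x * \<psi> m x) \<longlonglongrightarrow> F x * indicat_real U x"
      using \<psi>(4) by (intro AE_I2 tendsto_mult tendsto_const)
    show m: "(\<lambda>x. F x * \<psi> m x) \<in> borel_measurable (lebesgue_on \<Omega>)" for m
      by (rule borel_measurable_times[OF borel_measurable_integrable[OF F] test_function_measurable[OF t]])
    show "(\<lambda>x. F x * indicat_real U x) \<in> borel_measurable (lebesgue_on \<Omega>)"
    proof (rule borel_measurable_LIMSEQ_metric[OF m])
      show "(\<lambda>m. F x * \<psi> m x) \<longlonglongrightarrow> F x * indicat_real U x" for x
        using \<psi>(4) by (intro tendsto_mult tendsto_const)
    qed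
    show "AE x in lebesgue_on \<Omega>. norm (F x * \<psi> m x) \<le> norm (F x)" for m
      using \<psi>(2,3) by (intro AE_I2) (simp add: abs_mult mult_left_le)
  qed (use F in auto)
  then have "0 \<le> (LINT x|lebesgue_on \<Omega>. F x * indicat_real U x)"
    by (rule LIMSEQ_le_const) (use nn[OF t \<psi>(2)] in blast)
  then show "0 \<le> (LINT x|lebesgue_on \<Omega>. indicat_real U x * F x)" by (simp add: mult.commute)
qed

lemma AE_zero_if_test_integral_zero:
  fixes F :: "real^'n \<Rightarrow> real"
  assumes \<Omega>: "open \<Omega>" and F: "integrable (lebesgue_on \<Omega>) F"
    and z: "\<And>\<psi>. test_function \<Omega> \<psi> \<Longrightarrow> (LINT x|lebesgue_on \<Omega>. F x * \<psi> x) = 0"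
  shows "AE x in lebesgue_on \<Omega>. F x = 0"
proof -
  have "AE x in lebesgue_on \<Omega>. 0 \<le> F x"
    by (rule AE_nonneg_if_test_integral_nonneg[OF \<Omega> F]) (simp add: z)
  moreover have "AE x in lebesgue_on \<Omega>. 0 \<le> - F x"
    by (rule AE_nonneg_if_test_integral_nonneg[OF \<Omega>]) (simp_all add: z F)
  ultimately show ?thesis by eventually_elim simp
qed

section \<open>A countable separating family\<close>

text \<open>Finite unions of basic open sets form a countable family that exhausts every open set from
  inside; the basis vectors test the components.\<close>

definition L2_probes :: "(real^'n \<Rightarrow> 'b::euclidean_space) set"
  where "L2_probes = (\<lambda>(\<V>, b) x. indicat_real (\<Union>\<V>) x *\<^sub>R b) `
    ({\<V>. finite \<V> \<and> \<V> \<subseteq> (SOME \<B>. countable \<B> \<and> topological_basis \<B>)} \<times> Basis)"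

lemma countable_L2_probes: "countable (L2_probes :: (real^'n \<Rightarrow> 'b::euclidean_space) set)"
proof -
  have "countable (SOME \<B>::(real^'n) set set. countable \<B> \<and> topological_basis \<B>)"
    using someI_ex[OF ex_countable_basis] by blast
  then have "countable {\<V>. finite \<V> \<and> \<V> \<subseteq> (SOME \<B>::(real^'n) set set. countable \<B> \<and> topological_basis \<B>)}"
    by (rule countable_Collect_finite_subset)
  then show ?thesis unfolding L2_probes_def
    by (intro countable_image countable_SIGMA) (auto intro: countable_finite)
qed

lemma L2_probes_measurable:
  fixes d :: "real^'n \<Rightarrow> 'b::euclidean_space"
  assumes "d \<in> L2_probes" shows "d \<in> borel_measurable (lebesgue_on \<Omega>)" "\<And>x. norm (d x) \<le> 1"
proof -
  have B: "topological_basis (SOME \<B>::(real^'n) set set. countable \<B> \<and> topological_basis \<B>)"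
    using someI_ex[OF ex_countable_basis] by blast
  obtain \<V> b where d: "d = (\<lambda>x. indicat_real (\<Union>\<V>) x *\<^sub>R b)" "b \<in> Basis"
      "\<V> \<subseteq> (SOME \<B>::(real^'n) set set. countable \<B> \<and> topological_basis \<B>)"
    using assms unfolding L2_probes_def by auto
  have "open (\<Union>\<V>)" using topological_basis_open[OF B] d(3) by blast
  then have "indicat_real (\<Union>\<V>) \<in> borel_measurable (lebesgue_on \<Omega>)"
    by (intro measurable_restrict_space1 borel_measurable_indicator) auto
  then show "d \<in> borel_measurable (lebesgue_on \<Omega>)" unfolding d(1) by measurable
  show "norm (d x) \<le> 1" for x using d(2) by (simp add: d(1) indicator_def)
qed

lemma L2_probes_L2:
  assumes "\<Omega> \<in> lmeasurable" "d \<in> L2_probes" shows "d \<in> L2 \<Omega>" "L2_norm_on \<Omega> d \<le> sqrt (measure lebesgue \<Omega>)"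
proof -
  interpret finite_measure "lebesgue_on \<Omega>" by (rule finite_measure_lebesgue_on[OF assms(1)])
  show L2: "d \<in> L2 \<Omega>" by (rule L2_bounded[OF assms(1) L2_probes_measurable[OF assms(2)]])
  have "(LINT x|lebesgue_on \<Omega>. (norm (d x))\<^sup>2) \<le> (LINT x|lebesgue_on \<Omega>. 1)"
    using L2_probes_measurable(2)[OF assms(2)]
    by (intro integral_mono L2_integrable_sq L2) (simp_all add: power_le_one)
  also have "\<dots> = measure lebesgue \<Omega>"
    using assms(1) by (simp add: measure_restrict_space space_restrict_space fmeasurableD)
  finally show "L2_norm_on \<Omega> d \<le> sqrt (measure lebesgue \<Omega>)" by (simp add: L2_norm_on_def)
qed

text \<open>A function orthogonal to all probes has zero integral over every open set, in each
  component.\<close>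

lemma L2_probes_separating:
  fixes w :: "real^'n \<Rightarrow> 'b::euclidean_space"
  assumes \<Omega>: "open \<Omega>" "\<Omega> \<in> lmeasurable" and w: "w \<in> L2 \<Omega>" and orth: "\<And>d. d \<in> L2_probes \<Longrightarrow> L2_inner \<Omega> w d = 0"
  shows "L2_norm_on \<Omega> w = 0"
proof -
  interpret finite_measure "lebesgue_on \<Omega>" by (rule finite_measure_lebesgue_on[OF \<Omega>(2)])
  define \<B> where "\<B> = (SOME \<B>::(real^'n) set set. countable \<B> \<and> topological_basis \<B>)"
  have B: "countable \<B>" "topological_basis \<B>"
    unfolding \<B>_def using someI_ex[OF ex_countable_basis] by blast+
  have comp: "AE x in lebesgue_on \<Omega>. w x \<bullet> b = 0" if b: "b \<in> Basis" for b
  proof -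
    have cb: "(\<lambda>x. b) \<in> L2 \<Omega>" by (rule L2_bounded[OF \<Omega>(2), of _ "norm b"]) auto
    have int: "integrable (lebesgue_on \<Omega>) (\<lambda>x. w x \<bullet> b)" by (rule L2_inner_integrable[OF w cb])
    have U0: "(LINT x|lebesgue_on \<Omega>. indicat_real U x * (w x \<bullet> b)) = 0" if U: "open U" for U
    proof -
      obtain \<V> where V: "\<V> \<subseteq> \<B>" "U = \<Union>\<V>" using U B(2) unfolding topological_basis_def by metis
      have cV: "countable \<V>" using V(1) B(1) by (rule countable_subset)
      define \<W> where "\<W> k = {V \<in> \<V>. to_nat_on \<V> V \<le> k}" for k
      have fin: "finite (\<W> k)" for k
      proof (rule finite_imageD)
        show "finite (to_nat_on \<V> ` \<W> k)" by (rule finite_subset[of _ "{..k}"]) (auto simp: \<W>_def)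
        show "inj_on (to_nat_on \<V>) (\<W> k)"
          using inj_on_to_nat_on[OF cV] by (rule inj_on_subset) (auto simp: \<W>_def)
      qed
      have "(\<lambda>x. indicat_real (\<Union>(\<W> k)) x *\<^sub>R b) \<in> L2_probes" for k
        unfolding L2_probes_def \<B>_def[symmetric] using fin[of k] V(1) b
        by (intro image_eqI[of _ _ "(\<W> k, b)"]) (auto simp: \<W>_def)
      from orth[OF this] have zero: "(LINT x|lebesgue_on \<Omega>. indicat_real (\<Union>(\<W> k)) x * (w x \<bullet> b)) = 0" for k
        by (simp add: L2_inner_def)
      have mU: "(\<lambda>x. indicat_real A x * (w x \<bullet> b)) \<in> borel_measurable (lebesgue_on \<Omega>)" if "open A" for A
      proof (intro borel_measurable_times borel_measurable_integrable[OF int])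
        show "indicat_real A \<in> borel_measurable (lebesgue_on \<Omega>)"
          using that by (intro measurable_restrict_space1 borel_measurable_indicator) auto
      qed
      have oW: "open (\<Union>(\<W> k))" for k
        using topological_basis_open[OF B(2)] V(1) by (intro open_Union) (auto simp: \<W>_def)
      have "(\<lambda>k. LINT x|lebesgue_on \<Omega>. indicat_real (\<Union>(\<W> k)) x * (w x \<bullet> b))
          \<longlonglongrightarrow> (LINT x|lebesgue_on \<Omega>. indicat_real U x * (w x \<bullet> b))"
      proof (rule integral_dominated_convergence[where w = "\<lambda>x. norm (w x \<bullet> b)"])
        have "(\<lambda>k. indicat_real (\<Union>(\<W> k)) x) \<longlonglongrightarrow> indicat_real U x" for x
        proof (cases "x \<in> U")
          case True
          then obtain V' where V': "V' \<in> \<V>" "x \<in> V'" using V(2) by blast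
          then have "\<forall>\<^sub>F k in sequentially. indicat_real (\<Union>(\<W> k)) x = 1"
            unfolding eventually_sequentially
            by (intro exI[of _ "to_nat_on \<V> V'"]) (auto simp: \<W>_def indicator_def)
          then show ?thesis using True by (simp add: tendsto_eventually)
        next
          case False
          then have "indicat_real (\<Union>(\<W> k)) x = 0" for k using V(2) by (auto simp: \<W>_def indicator_def)
          then show ?thesis using False by simp
        qed
        then show "AE x in lebesgue_on \<Omega>. (\<lambda>k. indicat_real (\<Union>(\<W> k)) x * (w x \<bullet> b)) \<longlonglongrightarrow> indicat_real U x * (w x \<bullet> b)"
          by (intro AE_I2 tendsto_mult tendsto_const)
        show "AE x in lebesgue_on \<Omega>. norm (indicat_real (\<Union>(\<W> k)) x * (w x \<bullet> b)) \<le> norm (w x \<bullet> b)" for k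
          by (intro AE_I2) (simp add: indicator_def)
      qed (use int mU U oW in auto)
      then show ?thesis unfolding zero by (simp add: LIMSEQ_const_iff)
    qed
    have "AE x in lebesgue_on \<Omega>. 0 \<le> w x \<bullet> b"
      by (rule AE_nonneg_if_integral_open_nonneg[OF \<Omega>(1) int]) (simp add: U0)
    moreover have "AE x in lebesgue_on \<Omega>. 0 \<le> - (w x \<bullet> b)"
      by (rule AE_nonneg_if_integral_open_nonneg[OF \<Omega>(1)]) (use int U0 in auto)
    ultimately show ?thesis by eventually_elim simp
  qed
  have "AE x in lebesgue_on \<Omega>. \<forall>b\<in>Basis. w x \<bullet> b = 0"
    using comp by (intro AE_finite_allI) auto
  then have "AE x in lebesgue_on \<Omega>. w x = 0"
    by eventually_elim (auto intro: euclidean_eqI)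
  then show ?thesis by (simp add: L2_norm_zero_iff[OF w])
qed

section \<open>Translations and integration by parts\<close>

lemma lborel_integral_translate:
  fixes f :: "real^'n \<Rightarrow> real"
  assumes "f \<in> borel_measurable borel"
  shows "(LINT x|lborel. f (x + c)) = (LINT x|lborel. f x)"
proof -
  have "(LINT x|lborel. f x) = (LINT x|distr lborel borel ((+) c). f x)"
    by (simp add: lborel_distr_plus)
  also have "\<dots> = (LINT x|lborel. f (c + x))"
    using assms by (intro integral_distr) auto
  finally show ?thesis by (simp add: add.commute)
qed

lemma integrable_continuous_compact_support:
  fixes f :: "real^'n \<Rightarrow> real"
  assumes "continuous_on UNIV f" "\<And>x. x \<notin> cball 0 R \<Longrightarrow> f x = 0"
  shows "integrable lborel f"
proof -
  have "integrable lborel (\<lambda>x. indicator (cball 0 R) x *\<^sub>R f x)"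
    using continuous_on_subset[OF assms(1)] by (intro borel_integrable_compact) auto
  moreover have "(\<lambda>x. indicator (cball 0 R) x *\<^sub>R f x) = f"
    using assms(2) by (auto simp: fun_eq_iff indicator_def)
  ultimately show ?thesis by simp
qed

lemma L2_norm_UNIV:
  fixes f :: "real^'n \<Rightarrow> 'b::euclidean_space"
  assumes "f \<in> borel_measurable borel"
  shows "(L2_norm_on UNIV f)\<^sup>2 = (LINT x|lborel. (norm (f x))\<^sup>2)"
  using assms by (simp add: L2_norm_on_def lebesgue_on_UNIV_eq integral_completion)

lemma test_function_ball_support:
  assumes "test_function \<Omega> \<phi>"
  obtains R where "R > 0" "\<And>x. R < norm x \<Longrightarrow> \<phi> x = 0"
proof -
  obtain K where K: "compact K" "\<forall>x. x \<notin> K \<longrightarrow> \<phi> x = 0"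
    using assms unfolding test_function_iff by blast
  obtain R where "R > 0" "\<forall>x\<in>K. norm x \<le> R"
    using compact_imp_bounded[OF K(1)] unfolding bounded_pos by blast
  then show ?thesis using K(2) by (intro that[of R]) force+
qed

lemma test_function_grad_bounded:
  fixes \<phi> :: "real^'n \<Rightarrow> real"
  assumes "test_function \<Omega> \<phi>"
  obtains B where "B > 0" "\<And>x. norm (grad \<phi> x) \<le> B"
proof -
  have "\<exists>B. B > 0 \<and> (\<forall>x. norm (partial_deriv i \<phi> x) \<le> B)" for i
    using test_function_bounded[OF test_function_partial_deriv[OF assms, of i]] by metis
  then obtain b where b: "\<And>i. b i > 0" "\<And>i x. norm (partial_deriv i \<phi> x) \<le> b i" by metis
  show ?thesis
  proof (rule that)
    show "sum b UNIV > 0" using b(1) by (intro sum_pos) auto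
    fix x
    have "norm (grad \<phi> x) \<le> (\<Sum>i\<in>UNIV. \<bar>grad \<phi> x $ i\<bar>)" by (rule norm_le_l1_cart)
    also have "\<dots> \<le> sum b UNIV" using b(2) by (intro sum_mono) simp
    finally show "norm (grad \<phi> x) \<le> sum b UNIV" .
  qed
qed

lemma Lipschitz_if_grad_bounded:
  fixes \<phi> :: "real^'n \<Rightarrow> real"
  assumes "smooth \<phi>" "\<And>x. norm (grad \<phi> x) \<le> B"
  shows "\<bar>\<phi> (x + h) - \<phi> x\<bar> \<le> B * norm h"
proof -
  have "norm (\<phi> (x + h) - \<phi> x) \<le> B * norm (x + h - x)"
  proof (rule differentiable_bound[of UNIV])
    show "(\<phi> has_derivative (\<lambda>h. grad \<phi> x \<bullet> h)) (at x within UNIV)" for x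
      using has_derivative_grad[OF smooth_differentiable[OF assms(1)]] by simp
    show "onorm (\<lambda>h. grad \<phi> x \<bullet> h) \<le> B" for x
    proof (rule onorm_le)
      fix h
      have "norm (grad \<phi> x \<bullet> h) \<le> norm (grad \<phi> x) * norm h"
        using Cauchy_Schwarz_ineq2 by simp
      also have "\<dots> \<le> B * norm h" by (intro mult_right_mono assms) simp
      finally show "norm (grad \<phi> x \<bullet> h) \<le> B * norm h" .
    qed
  qed auto
  then show ?thesis by simp
qed

text \<open>The step is \<open>1 / (m + 1)\<close>, so the difference quotients form a sequence to which dominated
  convergence applies.\<close>

definition diffquot :: "(real^'n \<Rightarrow> real) \<Rightarrow> real^'n \<Rightarrow> nat \<Rightarrow> real^'n \<Rightarrow> real"
  where "diffquot \<phi> z m x = real (Suc m) * (\<phi> (x + (1 / real (Suc m)) *\<^sub>R z) - \<phi> x)"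

lemma diffquot_tendsto:
  assumes "smooth \<phi>"
  shows "(\<lambda>m. diffquot \<phi> z m x) \<longlonglongrightarrow> grad \<phi> x \<bullet> z"
proof -
  have "((\<lambda>t. x + t *\<^sub>R z) has_derivative (\<lambda>t. t *\<^sub>R z)) (at 0)"
    by (auto intro!: derivative_eq_intros)
  moreover have "(\<phi> has_derivative (\<lambda>h. grad \<phi> x \<bullet> h)) (at (x + 0 *\<^sub>R z))"
    using has_derivative_grad[OF smooth_differentiable[OF assms]] by simp
  ultimately have "((\<lambda>t. \<phi> (x + t *\<^sub>R z)) has_derivative (\<lambda>t. grad \<phi> x \<bullet> (t *\<^sub>R z))) (at 0)"
    by (rule has_derivative_compose)
  then have "((\<lambda>t. \<phi> (x + t *\<^sub>R z)) has_real_derivative (grad \<phi> x \<bullet> z)) (at 0)"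
    by (simp add: has_field_derivative_def mult.commute[of _ "grad \<phi> x \<bullet> z"] mult_commute_abs)
  then have "((\<lambda>h. (\<phi> (x + h *\<^sub>R z) - \<phi> x) / h) \<longlongrightarrow> grad \<phi> x \<bullet> z) (at 0)"
    by (simp add: DERIV_def)
  moreover have "filterlim (\<lambda>m. 1 / real (Suc m)) (at 0) sequentially"
    unfolding filterlim_at using LIMSEQ_Suc[OF lim_1_over_n] by (simp add: eventually_sequentially)
  ultimately have "(\<lambda>m. (\<phi> (x + (1 / real (Suc m)) *\<^sub>R z) - \<phi> x) / (1 / real (Suc m))) \<longlonglongrightarrow> grad \<phi> x \<bullet> z"
    by (rule filterlim_compose)
  then show ?thesis by (simp add: diffquot_def[abs_def] mult.commute)
qed

lemma diffquot_dominated: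
  fixes \<phi> :: "real^'n \<Rightarrow> real"
  assumes "test_function \<Omega> \<phi>"
  obtains R B where "B \<ge> 0" "\<And>m x. \<bar>diffquot \<phi> z m x\<bar> \<le> B * indicat_real (cball 0 R) x"
proof -
  obtain R where R: "R > 0" "\<And>x. R < norm x \<Longrightarrow> \<phi> x = 0"
    using test_function_ball_support[OF assms] by blast
  obtain B where B: "B > 0" "\<And>x. norm (grad \<phi> x) \<le> B"
    using test_function_grad_bounded[OF assms] by blast
  have "\<bar>diffquot \<phi> z m x\<bar> \<le> (B * norm z) * indicat_real (cball 0 (R + norm z)) x" for m x
  proof (cases "norm x \<le> R + norm z")
    case True
    have "\<bar>diffquot \<phi> z m x\<bar> = real (Suc m) * \<bar>\<phi> (x + (1 / real (Suc m)) *\<^sub>R z) - \<phi> x\<bar>"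
      unfolding diffquot_def abs_mult by simp
    also have "\<dots> \<le> real (Suc m) * (B * norm ((1 / real (Suc m)) *\<^sub>R z))"
      by (intro mult_left_mono Lipschitz_if_grad_bounded test_function_smooth[OF assms] B) simp
    also have "\<dots> = B * norm z" by simp
    finally show ?thesis using True by simp
  next
    case False
    let ?w = "(1 / real (Suc m)) *\<^sub>R z"
    have "norm ?w \<le> norm z"
      by (simp add: divide_le_eq mult_left_le_one_le mult_le_cancel_left1)
    moreover have "norm x \<le> norm (x + ?w) + norm ?w"
      using norm_triangle_ineq4[of "x + ?w" ?w] by simp
    ultimately have "R < norm x" "R < norm (x + ?w)" using False norm_ge_zero[of z] by linarith+
    then have "diffquot \<phi> z m x = 0" using R(2) by (simp add: diffquot_def)
    then show ?thesis using B by simp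
  qed
  then show ?thesis using B by (intro that[of "B * norm z"]) auto
qed

lemma continuous_on_diffquot:
  fixes \<phi> :: "real^'n \<Rightarrow> real"
  assumes "continuous_on UNIV \<phi>"
  shows "continuous_on UNIV (diffquot \<phi> z m)"
  unfolding diffquot_def[abs_def]
  by (intro continuous_intros continuous_on_compose2[OF assms]) auto

lemma integrable_indicator_cball: "integrable lborel (\<lambda>x::real^'n. B * indicat_real (cball 0 R) x)"
  using emeasure_lborel_cball_finite[of "0::real^'n" R]
  by (intro integrable_mult_right integrable_real_indicator) (simp_all add: less_top)

lemma integral_diffquot_tendsto:
  fixes \<phi> :: "real^'n \<Rightarrow> real"
  assumes \<phi>: "test_function \<Omega> \<phi>"
  shows "(\<lambda>m. LINT x|lborel. diffquot \<phi> z m x) \<longlonglongrightarrow> (LINT x|lborel. grad \<phi> x \<bullet> z)"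
    and "(\<lambda>m. LINT x|lborel. (diffquot \<phi> z m x)\<^sup>2) \<longlonglongrightarrow> (LINT x|lborel. (grad \<phi> x \<bullet> z)\<^sup>2)"
proof -
  note sm = test_function_smooth[OF \<phi>]
  obtain B R where B: "B \<ge> 0" "\<And>m x. \<bar>diffquot \<phi> z m x\<bar> \<le> B * indicat_real (cball 0 R) x"
    using diffquot_dominated[OF \<phi>, of z] by metis
  have m1: "diffquot \<phi> z m \<in> borel_measurable borel" for m
    by (intro borel_measurable_continuous_onI continuous_on_diffquot smooth_continuous sm)
  have m2: "(\<lambda>x. grad \<phi> x \<bullet> z) \<in> borel_measurable borel"
    by (intro borel_measurable_continuous_onI continuous_on_inner smooth_continuous_grad sm continuous_on_const)
  show "(\<lambda>m. LINT x|lborel. diffquot \<phi> z m x) \<longlonglongrightarrow> (LINT x|lborel. grad \<phi> x \<bullet> z)"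
  proof (rule integral_dominated_convergence[where w = "\<lambda>x. B * indicat_real (cball 0 R) x"])
    show "integrable lborel (\<lambda>x::real^'n. B * indicat_real (cball 0 R) x)"
      by (rule integrable_indicator_cball)
  qed (use m1 m2 B diffquot_tendsto[OF sm] in auto)
  show "(\<lambda>m. LINT x|lborel. (diffquot \<phi> z m x)\<^sup>2) \<longlonglongrightarrow> (LINT x|lborel. (grad \<phi> x \<bullet> z)\<^sup>2)"
  proof (rule integral_dominated_convergence[where w = "\<lambda>x. B\<^sup>2 * indicat_real (cball 0 R) x"])
    show "AE x in lborel. norm ((diffquot \<phi> z m x)\<^sup>2) \<le> B\<^sup>2 * indicat_real (cball 0 R) x" for m
    proof (rule AE_I2)
      fix x
      have "\<bar>diffquot \<phi> z m x\<bar>\<^sup>2 \<le> (B * indicat_real (cball 0 R) x)\<^sup>2"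
        by (intro power_mono B) simp
      also have "\<dots> = B\<^sup>2 * indicat_real (cball 0 R) x" by (simp add: power_mult_distrib indicator_def)
      finally show "norm ((diffquot \<phi> z m x)\<^sup>2) \<le> B\<^sup>2 * indicat_real (cball 0 R) x" by simp
    qed
    show "AE x in lborel. (\<lambda>m. (diffquot \<phi> z m x)\<^sup>2) \<longlonglongrightarrow> (grad \<phi> x \<bullet> z)\<^sup>2"
      by (intro AE_I2 tendsto_power diffquot_tendsto sm)
    show "integrable lborel (\<lambda>x::real^'n. B\<^sup>2 * indicat_real (cball 0 R) x)"
      by (rule integrable_indicator_cball)
  qed (use m1 m2 in auto)
qed

lemma test_function_integrable_lborel:
  fixes \<phi> :: "real^'n \<Rightarrow> real"
  assumes "test_function \<Omega> \<phi>"
  shows "integrable lborel \<phi>"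
proof -
  obtain R where "R > 0" "\<And>x. R < norm x \<Longrightarrow> \<phi> x = 0"
    using test_function_ball_support[OF assms] by blast
  then show ?thesis
    by (intro integrable_continuous_compact_support[of _ R] test_function_continuous[OF assms]) auto
qed

text \<open>The integrals of the difference quotients vanish by translation invariance of Lebesgue
  measure, and they converge to the integral of the directional derivative. Applied to a
  product of test functions this is integration by parts.\<close>

lemma integral_grad_zero:
  fixes \<phi> :: "real^'n \<Rightarrow> real"
  assumes \<phi>: "test_function \<Omega> \<phi>"
  shows "(LINT x|lborel. grad \<phi> x \<bullet> z) = 0"
proof -
  have m: "\<phi> \<in> borel_measurable borel"
    by (intro borel_measurable_continuous_onI test_function_continuous[OF \<phi>])
  have i: "integrable lborel (\<lambda>x. \<phi> (x + c))" for c :: "real^'n"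
  proof -
    obtain R where R: "R > 0" "\<And>x. R < norm x \<Longrightarrow> \<phi> x = 0"
      using test_function_ball_support[OF \<phi>] by blast
    show ?thesis
    proof (rule integrable_continuous_compact_support[of _ "R + norm c"])
      show "continuous_on UNIV (\<lambda>x. \<phi> (x + c))"
        by (intro continuous_on_compose2[OF test_function_continuous[OF \<phi>]] continuous_intros) auto
      fix x :: "real^'n" assume "x \<notin> cball 0 (R + norm c)"
      then have "R < norm (x + c)" using norm_triangle_ineq4[of "x + c" c] by simp
      then show "\<phi> (x + c) = 0" by (rule R(2))
    qed
  qed
  have "(LINT x|lborel. diffquot \<phi> z m x) = 0" for m
    using i[of "(1 / real (Suc m)) *\<^sub>R z"] test_function_integrable_lborel[OF \<phi>]
      lborel_integral_translate[OF m, of "(1 / real (Suc m)) *\<^sub>R z"]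
    by (simp add: diffquot_def)
  then show ?thesis
    using integral_diffquot_tendsto(1)[OF \<phi>, of z] by (simp add: LIMSEQ_const_iff)
qed

lemma lebesgue_on_integral_eq_lborel:
  fixes f :: "real^'n \<Rightarrow> real"
  assumes "\<Omega> \<in> sets lebesgue" "f \<in> borel_measurable borel" "\<And>x. x \<notin> \<Omega> \<Longrightarrow> f x = 0"
  shows "(LINT x|lebesgue_on \<Omega>. f x) = (LINT x|lborel. f x)"
proof -
  have "(LINT x|lebesgue_on \<Omega>. f x) = (LINT x|lebesgue. indicator \<Omega> x *\<^sub>R f x)"
    using assms(1) by (intro integral_restrict_space) auto
  also have "(\<lambda>x. indicator \<Omega> x *\<^sub>R f x) = f" using assms(3) by (auto simp: fun_eq_iff indicator_def)
  also have "(LINT x|lebesgue. f x) = (LINT x|lborel. f x)"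
    using assms(2) by (intro integral_completion) simp
  finally show ?thesis .
qed

lemma test_function_zero_outside: "test_function \<Omega> \<phi> \<Longrightarrow> x \<notin> \<Omega> \<Longrightarrow> \<phi> x = 0"
  unfolding test_function_iff by blast

lemma grad_zero_outside: "test_function \<Omega> \<phi> \<Longrightarrow> x \<notin> \<Omega> \<Longrightarrow> grad \<phi> x = 0"
  by (simp add: vec_eq_iff test_function_zero_outside[OF test_function_partial_deriv])

lemma has_weak_gradient_test_function:
  fixes \<phi> :: "real^'n \<Rightarrow> real"
  assumes \<Omega>: "open \<Omega>" and \<phi>: "test_function \<Omega> \<phi>"
  shows "has_weak_gradient \<Omega> \<phi> (grad \<phi>)"
  unfolding has_weak_gradient_def
proof (intro allI impI)
  fix \<psi> :: "real^'n \<Rightarrow> real" and i assume \<psi>: "test_function \<Omega> \<psi>"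
  have \<Omega>m: "\<Omega> \<in> sets lebesgue" using \<Omega> by auto
  have prod: "test_function \<Omega> (\<lambda>x. \<phi> x * \<psi> x)"
    by (rule test_function_mult[OF test_function_smooth[OF \<phi>] \<psi>])
  have t1: "test_function \<Omega> (\<lambda>x. \<phi> x * partial_deriv i \<psi> x)"
    by (intro test_function_mult test_function_smooth[OF \<phi>] test_function_partial_deriv \<psi>)
  have t2: "test_function \<Omega> (\<lambda>x. partial_deriv i \<phi> x * \<psi> x)"
    by (intro test_function_mult test_function_smooth[OF test_function_partial_deriv[OF \<phi>]] \<psi>)
  have conv: "(LINT x|lebesgue_on \<Omega>. f x) = (LINT x|lborel. f x)" if "test_function \<Omega> f" for f
    using that \<Omega>m by (intro lebesgue_on_integral_eq_lborel test_function_zero_outside[OF that]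
        borel_measurable_continuous_onI test_function_continuous[OF that])
  have "0 = (LINT x|lborel. grad (\<lambda>x. \<phi> x * \<psi> x) x \<bullet> axis i 1)"
    by (rule integral_grad_zero[OF prod, symmetric])
  also have "\<dots> = (LINT x|lborel. \<phi> x * partial_deriv i \<psi> x + partial_deriv i \<phi> x * \<psi> x)"
    using test_function_smooth[OF \<phi>] test_function_smooth[OF \<psi>]
    by (simp add: inner_axis grad_mult algebra_simps)
  also have "\<dots> = (LINT x|lborel. \<phi> x * partial_deriv i \<psi> x) + (LINT x|lborel. partial_deriv i \<phi> x * \<psi> x)"
    by (rule Bochner_Integration.integral_add[OF test_function_integrable_lborel[OF t1]
          test_function_integrable_lborel[OF t2]])
  finally show "(LINT x|lebesgue_on \<Omega>. \<phi> x * partial_deriv i \<psi> x) = - (LINT x|lebesgue_on \<Omega>. grad \<phi> x $ i * \<psi> x)"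
    using conv[OF t1] conv[OF t2] by simp
qed

lemma L2_UNIV_continuous_compact_support:
  fixes f :: "real^'n \<Rightarrow> real"
  assumes "continuous_on UNIV f" "\<And>x. R < norm x \<Longrightarrow> f x = 0"
  shows "f \<in> L2 UNIV"
proof -
  have "integrable lborel (\<lambda>x. (norm (f x))\<^sup>2)"
    using assms by (intro integrable_continuous_compact_support[of _ R] continuous_intros) auto
  then have "integrable (lebesgue_on UNIV) (\<lambda>x. (norm (f x))\<^sup>2)"
    by (simp add: lebesgue_on_UNIV_eq integrable_completion borel_measurable_integrable)
  then show ?thesis
    using continuous_measurable_lebesgue_on[OF assms(1)] by (simp add: L2_def)
qed

text \<open>Split the translation by \<open>z\<close> into \<open>m + 1\<close> equal steps. All steps change \<open>\<phi>\<close> by the same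
  amount in \<open>L\<^sup>2\<close>, so the total change is at most the norm of the difference quotient with
  step \<open>1 / (m + 1)\<close>; then let \<open>m\<close> tend to infinity. Both the Poincare inequality and
  Rellich's theorem come from this estimate.\<close>

lemma translation_estimate:
  fixes \<phi> :: "real^'n \<Rightarrow> real"
  assumes \<phi>: "test_function \<Omega> \<phi>"
  shows "(LINT x|lborel. (\<phi> (x + z) - \<phi> x)\<^sup>2) \<le> (LINT x|lborel. (grad \<phi> x \<bullet> z)\<^sup>2)"
proof -
  obtain R where R: "R > 0" "\<And>x. R < norm x \<Longrightarrow> \<phi> x = 0"
    using test_function_ball_support[OF \<phi>] by blast
  define D where "D w = (\<lambda>x. \<phi> (x + w) - \<phi> x)" for w
  have cont: "continuous_on UNIV (D w)" for w
    unfolding D_def by (intro continuous_intros continuous_on_compose2[OF test_function_continuous[OF \<phi>]]) auto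
  have supp: "D w x = 0" if "R + norm w < norm x" for w x
  proof -
    have "R < norm (x + w)" using norm_triangle_ineq4[of "x + w" w] that by simp
    moreover have "R < norm x" using that norm_ge_zero[of w] by linarith
    ultimately show ?thesis by (simp add: D_def R(2))
  qed
  have D_L2: "(\<lambda>x. D w (x + v)) \<in> L2 UNIV" for w v
  proof (rule L2_UNIV_continuous_compact_support[where R = "R + norm w + norm v"])
    show "continuous_on UNIV (\<lambda>x. D w (x + v))"
      by (intro continuous_on_compose2[OF cont] continuous_intros) auto
    show "D w (x + v) = 0" if "R + norm w + norm v < norm x" for x
      using norm_triangle_ineq4[of "x + v" v] that by (intro supp) simp
  qed
  have D_L2': "D w \<in> L2 UNIV" for w using D_L2[of w 0] by simp
  have bm: "D w \<in> borel_measurable borel" for w by (intro borel_measurable_continuous_onI cont)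
  have norm_sq: "(L2_norm_on UNIV (D w))\<^sup>2 = (LINT x|lborel. (D w x)\<^sup>2)" for w
    using L2_norm_UNIV[OF bm] by simp
  have transl: "L2_norm_on UNIV (\<lambda>x. D w (x + v)) = L2_norm_on UNIV (D w)" for w v
  proof -
    have bm': "(\<lambda>x. D w (x + v)) \<in> borel_measurable borel"
      using bm[of w] by measurable
    have "(L2_norm_on UNIV (\<lambda>x. D w (x + v)))\<^sup>2 = (L2_norm_on UNIV (D w))\<^sup>2"
      using L2_norm_UNIV[OF bm'] L2_norm_UNIV[OF bm, of w]
        lborel_integral_translate[of "\<lambda>x. (D w x)\<^sup>2" v] bm[of w] by simp
    then show ?thesis using L2.nrm_nonneg[OF D_L2] L2.nrm_nonneg[OF D_L2'] by simp
  qed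
  have mult: "L2_norm_on UNIV (D (real j *\<^sub>R w)) \<le> real j * L2_norm_on UNIV (D w)" for j w
  proof (induction j)
    case 0
    show ?case by (simp add: L2_norm_on_def D_def)
  next
    case (Suc j)
    have "D (real (Suc j) *\<^sub>R w) = (\<lambda>x. D (real j *\<^sub>R w) (x + w)) + D w"
      by (simp add: D_def fun_eq_iff algebra_simps)
    then have "L2_norm_on UNIV (D (real (Suc j) *\<^sub>R w)) \<le> L2_norm_on UNIV (\<lambda>x. D (real j *\<^sub>R w) (x + w)) + L2_norm_on UNIV (D w)"
      using L2.nrm_triangle[OF D_L2 D_L2'] by simp
    also have "\<dots> \<le> real j * L2_norm_on UNIV (D w) + L2_norm_on UNIV (D w)"
      using Suc.IH by (simp add: transl)
    finally show ?case by (simp add: algebra_simps)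
  qed
  have "(LINT x|lborel. (D z x)\<^sup>2) \<le> (LINT x|lborel. (diffquot \<phi> z m x)\<^sup>2)" for m
  proof -
    let ?w = "(1 / real (Suc m)) *\<^sub>R z"
    have "L2_norm_on UNIV (D z) \<le> real (Suc m) * L2_norm_on UNIV (D ?w)"
      using mult[of "Suc m" ?w] by simp
    then have "(L2_norm_on UNIV (D z))\<^sup>2 \<le> (real (Suc m) * L2_norm_on UNIV (D ?w))\<^sup>2"
      using L2.nrm_nonneg[OF D_L2'] by (intro power_mono) auto
    also have "\<dots> = (LINT x|lborel. (real (Suc m))\<^sup>2 * (D ?w x)\<^sup>2)"
      by (simp only: power_mult_distrib norm_sq integral_mult_right_zero)
    also have "\<dots> = (LINT x|lborel. (diffquot \<phi> z m x)\<^sup>2)"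
      by (simp only: diffquot_def D_def power_mult_distrib)
    finally show ?thesis by (simp add: norm_sq)
  qed
  then have "(LINT x|lborel. (D z x)\<^sup>2) \<le> (LINT x|lborel. (grad \<phi> x \<bullet> z)\<^sup>2)"
    by (intro LIMSEQ_le_const[OF integral_diffquot_tendsto(2)[OF \<phi>]]) blast
  then show ?thesis by (simp add: D_def)
qed

lemma L2_dominated:
  fixes u :: "real^'n \<Rightarrow> 'b::euclidean_space" and v :: "real^'n \<Rightarrow> 'c::euclidean_space"
  assumes "u \<in> borel_measurable (lebesgue_on \<Omega>)" "v \<in> L2 \<Omega>" "0 \<le> C"
    "\<And>x. x \<in> \<Omega> \<Longrightarrow> norm (u x) \<le> C * norm (v x)"
  shows "u \<in> L2 \<Omega>" "L2_norm_on \<Omega> u \<le> C * L2_norm_on \<Omega> v"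
proof -
  have i: "integrable (lebesgue_on \<Omega>) (\<lambda>x. C\<^sup>2 * (norm (v x))\<^sup>2)"
    by (intro integrable_mult_right L2_integrable_sq assms)
  have le: "(norm (u x))\<^sup>2 \<le> C\<^sup>2 * (norm (v x))\<^sup>2" if "x \<in> \<Omega>" for x
    using power_mono[OF assms(4)[OF that], of 2] by (simp add: power_mult_distrib)
  show u: "u \<in> L2 \<Omega>" by (rule L2I_bound[OF assms(1) i le])
  have "(LINT x|lebesgue_on \<Omega>. (norm (u x))\<^sup>2) \<le> (LINT x|lebesgue_on \<Omega>. C\<^sup>2 * (norm (v x))\<^sup>2)"
    using le by (intro integral_mono L2_integrable_sq u i) (simp add: space_restrict_space)
  then have "L2_norm_on \<Omega> u \<le> sqrt (C\<^sup>2 * (LINT x|lebesgue_on \<Omega>. (norm (v x))\<^sup>2))"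
    unfolding L2_norm_on_def by simp
  then show "L2_norm_on \<Omega> u \<le> C * L2_norm_on \<Omega> v"
    using assms(3) by (simp add: L2_norm_on_def real_sqrt_mult)
qed

section \<open>The energy space as a space of jets\<close>

text \<open>A jet is a function into \<open>real \<times> real^'n\<close> holding a function and its gradient. Its \<open>L\<^sup>2\<close>
  norm is the Sobolev norm, so the energy space becomes a closed subspace of an \<open>L\<^sup>2\<close> space,
  and no gradient has to be chosen.\<close>

definition val :: "(real^'n \<Rightarrow> real \<times> (real^'n)) \<Rightarrow> real^'n \<Rightarrow> real"
  where "val p x = fst (p x)"

definition gr :: "(real^'n \<Rightarrow> real \<times> (real^'n)) \<Rightarrow> real^'n \<Rightarrow> real^'n"
  where "gr p x = snd (p x)"

definition jet :: "(real^'n \<Rightarrow> real) \<Rightarrow> (real^'n \<Rightarrow> real^'n) \<Rightarrow> real^'n \<Rightarrow> real \<times> (real^'n)"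
  where "jet u g x = (u x, g x)"

lemma val_jet [simp]: "val (jet u g) = u" and gr_jet [simp]: "gr (jet u g) = g"
  and jet_val_gr [simp]: "jet (val p) (gr p) = p"
  by (auto simp: val_def gr_def jet_def fun_eq_iff)

lemma val_add: "val (p + q) = val p + val q" and val_diff: "val (p - q) = val p - val q"
  and val_scale: "val (c *\<^sub>R p) = c *\<^sub>R val p"
  and gr_add: "gr (p + q) = gr p + gr q" and gr_diff: "gr (p - q) = gr p - gr q"
  and gr_scale: "gr (c *\<^sub>R p) = c *\<^sub>R gr p"
  by (auto simp: val_def gr_def fun_eq_iff)

lemma L2_val: assumes "p \<in> L2 \<Omega>" shows "val p \<in> L2 \<Omega>" "L2_norm_on \<Omega> (val p) \<le> L2_norm_on \<Omega> p"
proof -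
  have m: "val p \<in> borel_measurable (lebesgue_on \<Omega>)"
    unfolding val_def[abs_def]
    by (rule measurable_compose[OF L2_measurable[OF assms] borel_measurable_continuous_onI])
       (rule continuous_on_fst[OF continuous_on_id])
  show "val p \<in> L2 \<Omega>" "L2_norm_on \<Omega> (val p) \<le> L2_norm_on \<Omega> p"
    using L2_dominated[OF m assms, of 1] norm_fst_le[of "fst (p x)" "snd (p x)" for x] by (simp_all add: val_def)
qed

lemma L2_gr: assumes "p \<in> L2 \<Omega>" shows "gr p \<in> L2 \<Omega>" "L2_norm_on \<Omega> (gr p) \<le> L2_norm_on \<Omega> p"
proof -
  have m: "gr p \<in> borel_measurable (lebesgue_on \<Omega>)"
    unfolding gr_def[abs_def]
    by (rule measurable_compose[OF L2_measurable[OF assms] borel_measurable_continuous_onI])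
       (rule continuous_on_snd[OF continuous_on_id])
  show "gr p \<in> L2 \<Omega>" "L2_norm_on \<Omega> (gr p) \<le> L2_norm_on \<Omega> p"
    using L2_dominated[OF m assms, of 1] norm_snd_le[of "snd (p x)" "fst (p x)" for x] by (simp_all add: gr_def)
qed

lemma jet_measurable:
  assumes "u \<in> borel_measurable (lebesgue_on \<Omega>)" "g \<in> borel_measurable (lebesgue_on \<Omega>)"
  shows "jet u g \<in> borel_measurable (lebesgue_on \<Omega>)"
  unfolding jet_def[abs_def] by (rule borel_measurable_Pair[OF assms])

lemma norm_jet_sq: "(norm (jet u g x))\<^sup>2 = (norm (u x))\<^sup>2 + (norm (g x))\<^sup>2"
  by (simp add: jet_def norm_prod_def)

lemma L2_jet:
  assumes "u \<in> L2 \<Omega>" "g \<in> L2 \<Omega>"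
  shows "jet u g \<in> L2 \<Omega>" "L2_norm_on \<Omega> (jet u g) = sqrt ((L2_norm_on \<Omega> u)\<^sup>2 + (L2_norm_on \<Omega> g)\<^sup>2)"
proof -
  show "jet u g \<in> L2 \<Omega>"
    using jet_measurable[OF L2_measurable[OF assms(1)] L2_measurable[OF assms(2)]] assms
    by (simp add: L2_def norm_jet_sq)
  show "L2_norm_on \<Omega> (jet u g) = sqrt ((L2_norm_on \<Omega> u)\<^sup>2 + (L2_norm_on \<Omega> g)\<^sup>2)"
    using L2_integrable_sq[OF assms(1)] L2_integrable_sq[OF assms(2)]
    unfolding L2_norm_on_def norm_jet_sq by simp
qed

lemma L2_norm_val_gr:
  assumes "p \<in> L2 \<Omega>"
  shows "(L2_norm_on \<Omega> p)\<^sup>2 = (L2_norm_on \<Omega> (val p))\<^sup>2 + (L2_norm_on \<Omega> (gr p))\<^sup>2"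
  using L2_jet(2)[OF L2_val(1)[OF assms] L2_gr(1)[OF assms]] by simp

abbreviation "test_jet \<phi> \<equiv> jet \<phi> (grad \<phi>)"

lemma test_jet_add: "smooth \<phi> \<Longrightarrow> smooth \<psi> \<Longrightarrow> test_jet (\<lambda>x. \<phi> x + \<psi> x) = test_jet \<phi> + test_jet \<psi>"
  by (auto simp: jet_def fun_eq_iff grad_add)

lemma test_jet_scale: "smooth \<phi> \<Longrightarrow> test_jet (\<lambda>x. c * \<phi> x) = c *\<^sub>R test_jet \<phi>"
  by (auto simp: jet_def fun_eq_iff grad_mult)

locale bounded_open_set =
  fixes \<Omega> :: "(real^'n) set"
  assumes open_\<Omega>: "open \<Omega>" and bounded_\<Omega>: "bounded \<Omega>"
begin

abbreviation "N \<equiv> L2_norm_on \<Omega>"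

lemma lmeasurable_\<Omega>: "\<Omega> \<in> lmeasurable"
  using open_\<Omega> bounded_\<Omega> by (simp add: lmeasurable_open)

lemma finite_measure_\<Omega>: "finite_measure (lebesgue_on \<Omega>)"
  by (rule finite_measure_lebesgue_on[OF lmeasurable_\<Omega>])

lemma N_0: "N (0 :: real^'n \<Rightarrow> 'b::euclidean_space) = 0"
  by (rule L2.nrm_zero)

lemma L2_hilbert: "semi_hilbert_space (L2 \<Omega> :: (real^'n \<Rightarrow> 'b::euclidean_space) set) (L2_inner \<Omega>)"
  by (rule semi_hilbert_space_L2[OF finite_measure_\<Omega>])

lemma nrm_L2: "semi_inner_space.nrm (L2_inner \<Omega>) = (L2_norm_on \<Omega> :: (real^'n \<Rightarrow> 'b::euclidean_space) \<Rightarrow> real)"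
  by (intro ext) (simp add: semi_inner_space.nrm_def[OF semi_inner_space_L2] L2_norm_eq)

lemma test_function_L2: "test_function \<Omega>' \<phi> \<Longrightarrow> \<phi> \<in> L2 \<Omega>"
  by (rule test_function_bounded) (auto intro!: L2_bounded[OF lmeasurable_\<Omega> test_function_measurable])

lemma grad_L2: "test_function \<Omega>' \<phi> \<Longrightarrow> grad \<phi> \<in> L2 \<Omega>"
  by (rule test_function_grad_bounded)
     (auto intro!: L2_bounded[OF lmeasurable_\<Omega> continuous_measurable_lebesgue_on] smooth_continuous_grad test_function_smooth)

lemma test_jet_L2: "test_function \<Omega>' \<phi> \<Longrightarrow> test_jet \<phi> \<in> L2 \<Omega>"
  by (intro L2_jet test_function_L2 grad_L2)

text \<open>The elements of this closure carry their weak gradient along as second component.\<close>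

definition V :: "(real^'n \<Rightarrow> real \<times> (real^'n)) set"
  where "V = {p \<in> L2 \<Omega>. \<forall>e>0. \<exists>\<phi>. test_function \<Omega> \<phi> \<and> N (p - test_jet \<phi>) < e}"

lemma V_L2: "p \<in> V \<Longrightarrow> p \<in> L2 \<Omega>"
  by (simp add: V_def)

lemma V_approx:
  assumes "p \<in> V" "e > 0"
  obtains \<phi> where "test_function \<Omega> \<phi>" "N (p - test_jet \<phi>) < e"
  using assms unfolding V_def by blast

lemma V_approx_seq:
  assumes "p \<in> V"
  obtains \<phi> where "\<And>k. test_function \<Omega> (\<phi> k)" "\<And>k. N (p - test_jet (\<phi> k)) < 1 / real (Suc k)"
proof -
  have "\<forall>k. \<exists>\<phi>. test_function \<Omega> \<phi> \<and> N (p - test_jet \<phi>) < 1 / real (Suc k)"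
    using assms unfolding V_def by simp
  then show ?thesis using that by metis
qed

lemma test_jet_V: assumes "test_function \<Omega> \<phi>" shows "test_jet \<phi> \<in> V"
  unfolding V_def using assms test_jet_L2[OF assms]
  by (auto simp: N_0 intro!: exI[of _ \<phi>])

lemma subspace_V: "subspace V"
proof (rule subspaceI)
  have "test_jet (\<lambda>x. 0) \<in> V" by (rule test_jet_V[OF test_function_zero])
  moreover have "test_jet (\<lambda>x. 0) = (0 :: real^'n \<Rightarrow> real \<times> (real^'n))" by (auto simp: jet_def fun_eq_iff zero_prod_def)
  ultimately show "0 \<in> V" by simp
next
  fix p q assume p: "p \<in> V" and q: "q \<in> V"
  show "p + q \<in> V"
    unfolding V_def
  proof (intro CollectI conjI allI impI)
    show "p + q \<in> L2 \<Omega>" using p q by (intro L2.S_add V_L2)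
    fix e :: real assume "e > 0"
    then have e2: "e / 2 > 0" by simp
    obtain \<phi> where \<phi>: "test_function \<Omega> \<phi>" "N (p - test_jet \<phi>) < e / 2" using V_approx[OF p e2] .
    obtain \<psi> where \<psi>: "test_function \<Omega> \<psi>" "N (q - test_jet \<psi>) < e / 2" using V_approx[OF q e2] .
    have "test_jet (\<lambda>x. \<phi> x + \<psi> x) = test_jet \<phi> + test_jet \<psi>"
      using \<phi>(1) \<psi>(1) by (intro test_jet_add test_function_smooth)
    then have eq: "p + q - test_jet (\<lambda>x. \<phi> x + \<psi> x) = (p - test_jet \<phi>) + (q - test_jet \<psi>)" by simp
    have "N ((p - test_jet \<phi>) + (q - test_jet \<psi>)) \<le> N (p - test_jet \<phi>) + N (q - test_jet \<psi>)"
      using \<phi>(1) \<psi>(1) p q by (intro L2.nrm_triangle L2.S_diff V_L2 test_jet_L2)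
    then have "N (p + q - test_jet (\<lambda>x. \<phi> x + \<psi> x)) < e"
      unfolding eq using \<phi>(2) \<psi>(2) by linarith
    then show "\<exists>\<phi>. test_function \<Omega> \<phi> \<and> N (p + q - test_jet \<phi>) < e"
      using test_function_add[OF \<phi>(1) \<psi>(1)] by blast
  qed
next
  fix c p assume p: "p \<in> V"
  show "c *\<^sub>R p \<in> V"
    unfolding V_def
  proof (intro CollectI conjI allI impI)
    show "c *\<^sub>R p \<in> L2 \<Omega>" using p by (intro L2.S_scale V_L2)
    fix e :: real assume "e > 0"
    then have e2: "e / (\<bar>c\<bar> + 1) > 0" by simp
    obtain \<phi> where \<phi>: "test_function \<Omega> \<phi>" "N (p - test_jet \<phi>) < e / (\<bar>c\<bar> + 1)" using V_approx[OF p e2] .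
    have "test_jet (\<lambda>x. c * \<phi> x) = c *\<^sub>R test_jet \<phi>"
      using \<phi>(1) by (intro test_jet_scale test_function_smooth)
    then have "c *\<^sub>R p - test_jet (\<lambda>x. c * \<phi> x) = c *\<^sub>R (p - test_jet \<phi>)" by (simp add: scaleR_diff_right)
    then have "N (c *\<^sub>R p - test_jet (\<lambda>x. c * \<phi> x)) = \<bar>c\<bar> * N (p - test_jet \<phi>)"
      using L2.nrm_scale[OF L2.S_diff[OF V_L2[OF p] test_jet_L2[OF \<phi>(1)]]] by simp
    also have "\<dots> \<le> \<bar>c\<bar> * (e / (\<bar>c\<bar> + 1))" using \<phi>(2) by (intro mult_left_mono) auto
    also have "\<dots> < e" using \<open>e > 0\<close> by (simp add: field_simps)
    finally show "\<exists>\<phi>. test_function \<Omega> \<phi> \<and> N (c *\<^sub>R p - test_jet \<phi>) < e"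
      using test_function_mult[OF smooth_const \<phi>(1)] by blast
  qed
qed

lemma V_closed:
  assumes s: "\<And>k::nat. s k \<in> V" and w: "w \<in> L2 \<Omega>" "(\<lambda>k. N (s k - w)) \<longlonglongrightarrow> 0"
  shows "w \<in> V"
  unfolding V_def
proof (intro CollectI conjI allI impI w(1))
  fix e :: real assume "e > 0"
  then have e2: "e / 2 > 0" by simp
  obtain k where k: "N (s k - w) < e / 2"
    using order_tendstoD(2)[OF w(2) e2] by (auto dest: eventually_happens)
  obtain \<phi> where \<phi>: "test_function \<Omega> \<phi>" "N (s k - test_jet \<phi>) < e / 2" using V_approx[OF s e2] .
  have "N (w - test_jet \<phi>) \<le> N (w - s k) + N (s k - test_jet \<phi>)"
    by (intro L2.nrm_triangle_diff w V_L2[OF s] test_jet_L2[OF \<phi>(1)])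
  moreover have "N (w - s k) = N (s k - w)" by (intro L2.nrm_diff_commute w V_L2[OF s])
  ultimately have "N (w - test_jet \<phi>) < e" using k \<phi>(2) by simp
  then show "\<exists>\<phi>. test_function \<Omega> \<phi> \<and> N (w - test_jet \<phi>) < e" using \<phi>(1) by blast
qed

lemma V_hilbert: "semi_hilbert_space V (L2_inner \<Omega>)"
proof (rule semi_hilbert_space.semi_hilbert_closed_subspace[OF L2_hilbert subspace_V])
  show "V \<subseteq> L2 \<Omega>" using V_L2 by blast
  show "semi_inner_space.closed_in_S (L2 \<Omega>) (L2_inner \<Omega>) V"
    unfolding semi_inner_space.closed_in_S_def[OF semi_inner_space_L2] nrm_L2
    using V_closed by blast
qed

lemmas V_add = subspace_add[OF subspace_V] and V_diff = subspace_diff[OF subspace_V]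
  and V_scale = subspace_scale[OF subspace_V]

lemma bounded_functional_zero_on_V:
  assumes lin: "linear_functional_on (L2 \<Omega>) f" and bd: "\<And>p. p \<in> L2 \<Omega> \<Longrightarrow> \<bar>f p\<bar> \<le> C * N p"
    and z: "\<And>\<phi>. test_function \<Omega> \<phi> \<Longrightarrow> f (test_jet \<phi>) = 0" and p: "p \<in> V"
  shows "f p = 0"
proof -
  obtain \<phi> where \<phi>: "\<And>k. test_function \<Omega> (\<phi> k)" "\<And>k. N (p - test_jet (\<phi> k)) < 1 / real (Suc k)"
    by (rule V_approx_seq[OF p]) (rule that)
  have "\<bar>f p\<bar> \<le> \<bar>C\<bar> * (1 / real (Suc k))" for k
  proof -
    have L: "p \<in> L2 \<Omega>" "test_jet (\<phi> k) \<in> L2 \<Omega>" using V_L2[OF p] test_jet_L2[OF \<phi>(1)] by auto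
    have "f p = f (p - test_jet (\<phi> k))"
      using linear_functional_onD(3)[OF lin subspace_L2 L] z[OF \<phi>(1)] by simp
    then have "\<bar>f p\<bar> \<le> C * N (p - test_jet (\<phi> k))" using bd[OF L2.S_diff[OF L]] by simp
    also have "\<dots> \<le> \<bar>C\<bar> * N (p - test_jet (\<phi> k))"
      using L2.nrm_nonneg[OF L2.S_diff[OF L]] by (intro mult_right_mono) auto
    also have "\<dots> \<le> \<bar>C\<bar> * (1 / real (Suc k))"
      using \<phi>(2)[of k] by (intro mult_left_mono) auto
    finally show ?thesis .
  qed
  moreover have "(\<lambda>k. \<bar>C\<bar> * (1 / real (Suc k))) \<longlonglongrightarrow> \<bar>C\<bar> * 0"
    by (intro tendsto_mult tendsto_const LIMSEQ_Suc[OF lim_1_over_n])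
  ultimately have "\<bar>f p\<bar> \<le> \<bar>C\<bar> * 0"
    by (intro LIMSEQ_le_const[of "\<lambda>k. \<bar>C\<bar> * (1 / real (Suc k))"]) auto
  then show ?thesis by simp
qed

text \<open>The inner product of a jet \<open>(u, g)\<close> with this probe is the integral of \<open>u \<partial>\<^sub>i\<psi> + g\<^sub>i \<psi>\<close>,
  so orthogonality to all probes says that \<open>g\<close> is a weak gradient of \<open>u\<close>.\<close>

definition ibp_probe :: "'n \<Rightarrow> (real^'n \<Rightarrow> real) \<Rightarrow> real^'n \<Rightarrow> real \<times> (real^'n)"
  where "ibp_probe i \<psi> = jet (partial_deriv i \<psi>) (\<lambda>x. \<psi> x *\<^sub>R axis i 1)"

lemma ibp_probe_L2: "test_function \<Omega> \<psi> \<Longrightarrow> ibp_probe i \<psi> \<in> L2 \<Omega>"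
proof -
  assume \<psi>: "test_function \<Omega> \<psi>"
  have "(\<lambda>x. \<psi> x *\<^sub>R (axis i 1 :: real^'n)) \<in> L2 \<Omega>"
  proof (rule L2_dominated(1)[OF _ test_function_L2[OF \<psi>], of _ 1])
    show "(\<lambda>x. \<psi> x *\<^sub>R (axis i 1 :: real^'n)) \<in> borel_measurable (lebesgue_on \<Omega>)"
      using test_function_measurable[OF \<psi>] by measurable
  qed (auto simp: norm_axis_1)
  then show ?thesis unfolding ibp_probe_def
    by (intro L2_jet test_function_L2[OF test_function_partial_deriv[OF \<psi>]])
qed

lemma has_weak_gradient_iff:
  assumes "u \<in> L2 \<Omega>" "g \<in> L2 \<Omega>"
  shows "has_weak_gradient \<Omega> u g \<longleftrightarrow> (\<forall>\<psi> i. test_function \<Omega> \<psi> \<longrightarrow> L2_inner \<Omega> (jet u g) (ibp_probe i \<psi>) = 0)"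
proof -
  have "L2_inner \<Omega> (jet u g) (ibp_probe i \<psi>)
      = (LINT x|lebesgue_on \<Omega>. u x * partial_deriv i \<psi> x) + (LINT x|lebesgue_on \<Omega>. g x $ i * \<psi> x)"
    if \<psi>: "test_function \<Omega> \<psi>" for \<psi> i
  proof -
    have i1: "integrable (lebesgue_on \<Omega>) (\<lambda>x. u x * partial_deriv i \<psi> x)"
      using L2_inner_integrable[OF assms(1) test_function_L2[OF test_function_partial_deriv[OF \<psi>, of i]]] by simp
    have i2: "integrable (lebesgue_on \<Omega>) (\<lambda>x. g x $ i * \<psi> x)"
      using L2_inner_integrable[OF assms(2) L2_gr(1)[OF ibp_probe_L2[OF \<psi>, of i]]]
      by (simp add: ibp_probe_def inner_axis mult.commute)
    show ?thesis
      using Bochner_Integration.integral_add[OF i1 i2]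
      by (simp add: L2_inner_def ibp_probe_def jet_def inner_prod_def inner_axis mult.commute)
  qed
  then show ?thesis unfolding has_weak_gradient_def by (auto simp: eq_neg_iff_add_eq_0)
qed

text \<open>Orthogonality to a fixed probe is a closed condition, and on test jets it is integration
  by parts.\<close>

lemma has_weak_gradient_V:
  assumes p: "p \<in> V" shows "has_weak_gradient \<Omega> (val p) (gr p)"
proof -
  have "L2_inner \<Omega> p (ibp_probe i \<psi>) = 0" if \<psi>: "test_function \<Omega> \<psi>" for i \<psi>
  proof (rule bounded_functional_zero_on_V[OF L2.ip_linear[OF ibp_probe_L2[OF \<psi>]] _ _ p])
    show "\<bar>L2_inner \<Omega> p (ibp_probe i \<psi>)\<bar> \<le> N (ibp_probe i \<psi>) * N p" if "p \<in> L2 \<Omega>" for p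
      using L2.Cauchy_Schwarz[OF that ibp_probe_L2[OF \<psi>, of i]] by (simp add: mult.commute)
    show "L2_inner \<Omega> (test_jet \<phi>) (ibp_probe i \<psi>) = 0" if \<phi>: "test_function \<Omega> \<phi>" for \<phi>
      using has_weak_gradient_test_function[OF open_\<Omega> \<phi>] has_weak_gradient_iff[OF test_function_L2[OF \<phi>] grad_L2[OF \<phi>]] \<psi>
      by blast
  qed
  then show ?thesis
    using has_weak_gradient_iff[OF L2_val(1)[OF V_L2[OF p]] L2_gr(1)[OF V_L2[OF p]]] by simp
qed

lemma weak_gradient_unique:
  assumes g: "g \<in> L2 \<Omega>" "has_weak_gradient \<Omega> u g" and g': "g' \<in> L2 \<Omega>" "has_weak_gradient \<Omega> u g'"
  shows "N (g - g') = 0"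
proof -
  have "AE x in lebesgue_on \<Omega>. (g x - g' x) $ i = 0" for i
  proof (rule AE_zero_if_test_integral_zero[OF open_\<Omega>])
    have c: "(\<lambda>x. axis i 1 :: real^'n) \<in> L2 \<Omega>"
      by (rule L2_bounded[OF lmeasurable_\<Omega>, of _ 1]) (auto simp: norm_axis_1)
    have ii: "integrable (lebesgue_on \<Omega>) (\<lambda>x. h x $ i)" if "h \<in> L2 \<Omega>" for h :: "real^'n \<Rightarrow> real^'n"
      using L2_inner_integrable[OF that c] by (simp add: inner_axis)
    show "integrable (lebesgue_on \<Omega>) (\<lambda>x. (g x - g' x) $ i)"
      using ii[OF L2.S_diff[OF g(1) g'(1)]] by simp
    fix \<psi> :: "real^'n \<Rightarrow> real" assume \<psi>: "test_function \<Omega> \<psi>"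
    obtain B where B: "\<And>x. norm (\<psi> x) \<le> B" using test_function_bounded[OF \<psi>] by metis
    have j: "integrable (lebesgue_on \<Omega>) (\<lambda>x. h x $ i * \<psi> x)" if "h \<in> L2 \<Omega>" for h :: "real^'n \<Rightarrow> real^'n"
      by (rule integrable_times_bounded[OF ii[OF that] test_function_measurable[OF \<psi>] B])
    have "(LINT x|lebesgue_on \<Omega>. (g x - g' x) $ i * \<psi> x)
        = (LINT x|lebesgue_on \<Omega>. g x $ i * \<psi> x) - (LINT x|lebesgue_on \<Omega>. g' x $ i * \<psi> x)"
      using Bochner_Integration.integral_diff[OF j[OF g(1)] j[OF g'(1)]] by (simp add: left_diff_distrib)
    also have "\<dots> = 0"
      using g(2)[unfolded has_weak_gradient_def, rule_format, OF \<psi>, of i]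
        g'(2)[unfolded has_weak_gradient_def, rule_format, OF \<psi>, of i] by simp
    finally show "(LINT x|lebesgue_on \<Omega>. (g x - g' x) $ i * \<psi> x) = 0" .
  qed
  then have "AE x in lebesgue_on \<Omega>. \<forall>i\<in>UNIV. (g x - g' x) $ i = 0"
    by (intro AE_finite_allI) auto
  then have "AE x in lebesgue_on \<Omega>. (g - g') x = 0"
    by eventually_elim (simp add: vec_eq_iff)
  then show ?thesis by (simp only: L2_norm_zero_iff[OF L2.S_diff[OF g(1) g'(1)]])
qed

lemma weak_grad:
  assumes "g \<in> L2 \<Omega>" "has_weak_gradient \<Omega> u g"
  shows "weak_grad \<Omega> u \<in> L2 \<Omega>" "has_weak_gradient \<Omega> u (weak_grad \<Omega> u)" "N (weak_grad \<Omega> u - g) = 0"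
proof -
  have "weak_grad \<Omega> u \<in> L2 \<Omega> \<and> has_weak_gradient \<Omega> u (weak_grad \<Omega> u)"
    unfolding weak_grad_def by (rule someI[of _ g]) (simp add: assms)
  then show "weak_grad \<Omega> u \<in> L2 \<Omega>" "has_weak_gradient \<Omega> u (weak_grad \<Omega> u)" by auto
  then show "N (weak_grad \<Omega> u - g) = 0" by (rule weak_gradient_unique[OF _ _ assms])
qed

lemma N_eq_if_diff_zero:
  assumes "u \<in> L2 \<Omega>" "v \<in> L2 \<Omega>" "N (u - v) = 0"
  shows "N u = N v"
  using L2.nrm_le_diff[OF assms(1,2)] L2.nrm_le_diff[OF assms(2,1)] L2.nrm_diff_commute[OF assms(1,2)] assms(3)
  by simp

lemma W12_norm_eq:
  assumes "u \<in> L2 \<Omega>" "g \<in> L2 \<Omega>" "has_weak_gradient \<Omega> u g"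
  shows "W12_norm \<Omega> u = N (jet u g)"
  using N_eq_if_diff_zero[OF weak_grad(1)[OF assms(2,3)] assms(2) weak_grad(3)[OF assms(2,3)]]
  by (simp add: W12_norm_def L2_jet(2)[OF assms(1,2)])

lemma has_weak_gradient_diff:
  assumes "u \<in> L2 \<Omega>" "g \<in> L2 \<Omega>" "has_weak_gradient \<Omega> u g" "v \<in> L2 \<Omega>" "h \<in> L2 \<Omega>" "has_weak_gradient \<Omega> v h"
  shows "has_weak_gradient \<Omega> (u - v) (g - h)"
proof -
  have "jet (u - v) (g - h) = jet u g - jet v h" by (auto simp: jet_def fun_eq_iff)
  then show ?thesis
    using assms unfolding has_weak_gradient_iff[OF assms(1,2)] has_weak_gradient_iff[OF assms(4,5)]
      has_weak_gradient_iff[OF L2.S_diff[OF assms(1,4)] L2.S_diff[OF assms(2,5)]]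
    by (simp add: L2.ip_diff_left L2_jet(1) ibp_probe_L2)
qed

lemma W12_norm_diff_test:
  assumes "u \<in> L2 \<Omega>" "g \<in> L2 \<Omega>" "has_weak_gradient \<Omega> u g" "test_function \<Omega> \<phi>"
  shows "W12_norm \<Omega> (\<lambda>x. u x - \<phi> x) = N (jet u g - test_jet \<phi>)"
proof -
  note t = test_function_L2[OF assms(4)] grad_L2[OF assms(4)] has_weak_gradient_test_function[OF open_\<Omega> assms(4)]
  have "W12_norm \<Omega> (u - \<phi>) = N (jet (u - \<phi>) (g - grad \<phi>))"
    by (intro W12_norm_eq L2.S_diff has_weak_gradient_diff assms t)
  moreover have "jet (u - \<phi>) (g - grad \<phi>) = jet u g - test_jet \<phi>" by (auto simp: jet_def fun_eq_iff)
  ultimately show ?thesis by (simp add: fun_diff_def)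
qed

text \<open>This is the bridge between weak gradients chosen by description and jets: both spaces are
  the closure of the test functions, since the Sobolev norm of \<open>u - \<phi>\<close> is the \<open>L\<^sup>2\<close> norm of
  the difference of jets for every choice of the gradient.\<close>

lemma W12_0_iff: "u \<in> W12_0 \<Omega> \<longleftrightarrow> (\<exists>p\<in>V. val p = u)"
proof
  assume u: "u \<in> W12_0 \<Omega>"
  then obtain g where uL: "u \<in> L2 \<Omega>" and g: "g \<in> L2 \<Omega>" "has_weak_gradient \<Omega> u g"
    by (auto simp: W12_0_def W12_def)
  obtain \<phi> where \<phi>: "\<And>k::nat. test_function \<Omega> (\<phi> k)" "(\<lambda>k. W12_norm \<Omega> (\<lambda>x. u x - \<phi> k x)) \<longlonglongrightarrow> 0"
    using u by (auto simp: W12_0_def)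
  have lim: "(\<lambda>k. N (jet u g - test_jet (\<phi> k))) \<longlonglongrightarrow> 0"
    using \<phi>(2) by (simp only: W12_norm_diff_test[OF uL g \<phi>(1)])
  have "jet u g \<in> V"
    unfolding V_def
  proof (intro CollectI conjI allI impI)
    show "jet u g \<in> L2 \<Omega>" by (rule L2_jet(1)[OF uL g(1)])
    fix e :: real assume "e > 0"
    then have "\<forall>\<^sub>F k in sequentially. N (jet u g - test_jet (\<phi> k)) < e"
      by (rule order_tendstoD(2)[OF lim])
    then obtain k where "N (jet u g - test_jet (\<phi> k)) < e"
      by (auto dest: eventually_happens)
    then show "\<exists>\<phi>. test_function \<Omega> \<phi> \<and> N (jet u g - test_jet \<phi>) < e" using \<phi>(1) by blast
  qed
  then show "\<exists>p\<in>V. val p = u" by (intro bexI[of _ "jet u g"]) auto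
next
  assume "\<exists>p\<in>V. val p = u"
  then obtain p where p: "p \<in> V" "val p = u" by blast
  note L = L2_val(1)[OF V_L2[OF p(1)]] L2_gr(1)[OF V_L2[OF p(1)]]
  note wg = has_weak_gradient_V[OF p(1)]
  obtain \<phi> where \<phi>: "\<And>k. test_function \<Omega> (\<phi> k)" "\<And>k. N (p - test_jet (\<phi> k)) < 1 / real (Suc k)"
    by (rule V_approx_seq[OF p(1)]) (rule that)
  have "(\<lambda>k. W12_norm \<Omega> (\<lambda>x. u x - \<phi> k x)) \<longlonglongrightarrow> 0"
  proof (rule tendsto_sandwich[OF _ _ tendsto_const LIMSEQ_Suc[OF lim_1_over_n]])
    have eq: "W12_norm \<Omega> (\<lambda>x. u x - \<phi> k x) = N (p - test_jet (\<phi> k))" for k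
      using W12_norm_diff_test[OF L wg \<phi>(1)] by (simp add: p(2)[symmetric])
    show "\<forall>\<^sub>F k in sequentially. 0 \<le> W12_norm \<Omega> (\<lambda>x. u x - \<phi> k x)"
      unfolding eq by (intro always_eventually allI L2.nrm_nonneg L2.S_diff V_L2[OF p(1)] test_jet_L2[OF \<phi>(1)])
    show "\<forall>\<^sub>F k in sequentially. W12_norm \<Omega> (\<lambda>x. u x - \<phi> k x) \<le> 1 / real (Suc k)"
      unfolding eq using \<phi>(2) by (intro always_eventually allI less_imp_le)
  qed
  then show "u \<in> W12_0 \<Omega>"
    unfolding W12_0_def W12_def using L wg p(2) \<phi>(1) by blast
qed

lemma weak_grad_V:
  assumes "p \<in> V"
  shows "weak_grad \<Omega> (val p) \<in> L2 \<Omega>" "N (weak_grad \<Omega> (val p) - gr p) = 0"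
  using weak_grad[OF L2_gr(1)[OF V_L2[OF assms]] has_weak_gradient_V[OF assms]] by auto

lemma W12_norm_V: "p \<in> V \<Longrightarrow> W12_norm \<Omega> (val p) = N p"
  using W12_norm_eq[OF L2_val(1)[OF V_L2] L2_gr(1)[OF V_L2] has_weak_gradient_V] by simp

text \<open>A translation that moves the domain off itself makes the supports of \<open>\<phi>\<close> and its translate
  disjoint, so \<open>\<phi>(\<cdot> + z) - \<phi>\<close> has at least the norm of \<open>\<phi>\<close>, and the translation estimate
  bounds it by the gradient.\<close>

lemma Poincare: "\<exists>C>0. \<forall>p\<in>V. N (val p) \<le> C * N (gr p)"
proof -
  obtain R where R: "R > 0" "\<And>x. x \<in> \<Omega> \<Longrightarrow> norm x < R"
    using bounded_\<Omega> by (meson bounded_pos_less)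
  \<comment> \<open>Any vector of this length will do, since the domain has diameter at most \<open>2 * R\<close>.\<close>
  define z :: "real^'n" where "z = (2 * R) *\<^sub>R axis undefined 1"
  have nz: "norm z = 2 * R" using R(1) by (simp add: z_def norm_axis_1)
  have \<Omega>m: "\<Omega> \<in> sets lebesgue" using open_\<Omega> by auto
  have test: "N \<phi> \<le> 2 * R * N (grad \<phi>)" if \<phi>: "test_function \<Omega> \<phi>" for \<phi>
  proof -
    have m: "\<phi> \<in> borel_measurable borel" by (intro borel_measurable_continuous_onI test_function_continuous[OF \<phi>])
    have mg: "grad \<phi> \<in> borel_measurable borel"
      by (intro borel_measurable_continuous_onI smooth_continuous_grad test_function_smooth[OF \<phi>])
    have t2: "test_function \<Omega> (\<lambda>x. \<phi> x * \<phi> x)" by (rule test_function_mult[OF test_function_smooth[OF \<phi>] \<phi>])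
    have disj: "\<phi> (x + z) * \<phi> x = 0" for x
    proof (rule ccontr)
      assume "\<phi> (x + z) * \<phi> x \<noteq> 0"
      then have "x + z \<in> \<Omega>" "x \<in> \<Omega>" using test_function_zero_outside[OF \<phi>] by auto
      then have "norm (x + z) < R" "norm x < R" by (auto intro: R(2))
      moreover have "norm z \<le> norm (x + z) + norm x" using norm_triangle_ineq4[of "x + z" x] by simp
      ultimately show False using nz by simp
    qed
    have sq: "(\<phi> (x + z) - \<phi> x)\<^sup>2 = (\<phi> (x + z))\<^sup>2 + (\<phi> x)\<^sup>2" for x
      using disj[of x] by (simp add: power2_diff)
    have i1: "integrable lborel (\<lambda>x. (\<phi> x)\<^sup>2)"
      using test_function_integrable_lborel[OF t2] by (simp add: power2_eq_square)
    have i2: "integrable lborel (\<lambda>x. (\<phi> (x + z))\<^sup>2)"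
    proof (rule integrable_continuous_compact_support[of _ "R + norm z"])
      show "continuous_on UNIV (\<lambda>x. (\<phi> (x + z))\<^sup>2)"
        by (intro continuous_on_power continuous_on_compose2[OF test_function_continuous[OF \<phi>]] continuous_intros) auto
      fix x :: "real^'n" assume "x \<notin> cball 0 (R + norm z)"
      then have "\<not> norm (x + z) < R" using norm_triangle_ineq4[of "x + z" z] by simp
      then have "x + z \<notin> \<Omega>" using R(2) by blast
      then show "(\<phi> (x + z))\<^sup>2 = 0" using test_function_zero_outside[OF \<phi>] by simp
    qed
    have "(N \<phi>)\<^sup>2 = (LINT x|lebesgue_on \<Omega>. (\<phi> x)\<^sup>2)"
      by (simp add: L2_norm_on_def)
    also have "\<dots> = (LINT x|lborel. (\<phi> x)\<^sup>2)"
      by (rule lebesgue_on_integral_eq_lborel[OF \<Omega>m])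
         (use m test_function_zero_outside[OF \<phi>] in \<open>simp_all\<close>)
    also have "\<dots> \<le> (LINT x|lborel. (\<phi> x)\<^sup>2) + (LINT x|lborel. (\<phi> (x + z))\<^sup>2)" by simp
    also have "\<dots> = (LINT x|lborel. (\<phi> (x + z) - \<phi> x)\<^sup>2)" unfolding sq using i1 i2 by simp
    also have "\<dots> \<le> (LINT x|lborel. (grad \<phi> x \<bullet> z)\<^sup>2)" by (rule translation_estimate[OF \<phi>])
    also have "\<dots> = (LINT x|lebesgue_on \<Omega>. (grad \<phi> x \<bullet> z)\<^sup>2)"
      using mg grad_zero_outside[OF \<phi>] by (intro lebesgue_on_integral_eq_lborel[OF \<Omega>m, symmetric]) auto
    also have "\<dots> \<le> (LINT x|lebesgue_on \<Omega>. (2 * R)\<^sup>2 * (norm (grad \<phi> x))\<^sup>2)"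
    proof (rule integral_mono_AE')
      show "integrable (lebesgue_on \<Omega>) (\<lambda>x. (2 * R)\<^sup>2 * (norm (grad \<phi> x))\<^sup>2)"
        by (intro integrable_mult_right L2_integrable_sq grad_L2[OF \<phi>])
      show "AE x in lebesgue_on \<Omega>. (grad \<phi> x \<bullet> z)\<^sup>2 \<le> (2 * R)\<^sup>2 * (norm (grad \<phi> x))\<^sup>2"
      proof (rule AE_I2)
        fix x
        have "\<bar>grad \<phi> x \<bullet> z\<bar>\<^sup>2 \<le> (norm (grad \<phi> x) * norm z)\<^sup>2"
          by (intro power_mono Cauchy_Schwarz_ineq2) simp
        then show "(grad \<phi> x \<bullet> z)\<^sup>2 \<le> (2 * R)\<^sup>2 * (norm (grad \<phi> x))\<^sup>2"
          by (simp add: power_mult_distrib nz mult.commute)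
      qed
    qed auto
    also have "\<dots> = (2 * R * N (grad \<phi>))\<^sup>2"
      by (simp add: L2_norm_on_def power_mult_distrib)
    finally show ?thesis
      using R(1) L2.nrm_nonneg[OF grad_L2[OF \<phi>]] by (rule_tac power2_le_imp_le) auto
  qed
  have "N (val p) \<le> 2 * R * N (gr p)" if p: "p \<in> V" for p
  proof (rule field_le_epsilon)
    fix e :: real assume e: "e > 0"
    \<comment> \<open>The choice gives \<open>e' * (1 + 2 * R) = e\<close> in the last line of the estimate.\<close>
    define e' where "e' = e / (1 + 2 * R)"
    have e': "e' > 0" using e R(1) by (simp add: e'_def)
    obtain \<phi> where \<phi>: "test_function \<Omega> \<phi>" "N (p - test_jet \<phi>) < e'" using V_approx[OF p e'] .
    note L = V_L2[OF p] test_jet_L2[OF \<phi>(1)]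
    have v: "N (val p - \<phi>) < e'" and g: "N (gr p - grad \<phi>) < e'"
      using L2_val(2)[OF L2.S_diff[OF L]] L2_gr(2)[OF L2.S_diff[OF L]] \<phi>(2) by (simp_all add: val_diff gr_diff)
    have "N (val p) \<le> N (val p - \<phi>) + N \<phi>"
      by (intro L2.nrm_le_diff L2_val L test_function_L2[OF \<phi>(1)])
    also have "\<dots> \<le> e' + 2 * R * N (grad \<phi>)" using v test[OF \<phi>(1)] by simp
    also have "\<dots> \<le> e' + 2 * R * (e' + N (gr p))"
    proof -
      have "N (grad \<phi>) \<le> N (grad \<phi> - gr p) + N (gr p)"
        by (intro L2.nrm_le_diff L2_gr L grad_L2[OF \<phi>(1)])
      moreover have "N (grad \<phi> - gr p) = N (gr p - grad \<phi>)"
        by (intro L2.nrm_diff_commute L2_gr L grad_L2[OF \<phi>(1)])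
      ultimately have "N (grad \<phi>) \<le> e' + N (gr p)" using g by linarith
      then show ?thesis using R(1) by (intro add_left_mono mult_left_mono) auto
    qed
    also have "\<dots> = 2 * R * N (gr p) + e' * (1 + 2 * R)" by (simp add: algebra_simps)
    finally show "N (val p) \<le> 2 * R * N (gr p) + e" using R(1) by (simp add: e'_def)
  qed
  then show ?thesis using R(1) by (intro exI[of _ "2 * R"]) auto
qed

end

section \<open>The compactness theorem of Rellich\<close>

text \<open>The ball average without the factor for the volume of the ball, which keeps the identities
  free of division.\<close>

definition ball_sum :: "real \<Rightarrow> (real^'n \<Rightarrow> real) \<Rightarrow> real^'n \<Rightarrow> real"
  where "ball_sum h \<phi> x = (LINT z|lborel. indicat_real (cball 0 h) z * \<phi> (x + z))"

lemma indicator_cball_measurable: "indicat_real (cball (x::real^'n) h) \<in> borel_measurable borel"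
  by (rule borel_measurable_indicator[OF borel_closed[OF closed_cball]])

lemma ball_sum_measurable:
  fixes \<phi> :: "real^'n \<Rightarrow> real"
  assumes "continuous_on UNIV \<phi>"
  shows "ball_sum h \<phi> \<in> borel_measurable borel"
proof -
  have m: "\<phi> \<in> borel_measurable borel" using assms by (rule borel_measurable_continuous_onI)
  have "(\<lambda>w. indicat_real (cball 0 h) (snd w) * \<phi> (fst w + snd w)) \<in> borel_measurable (lborel \<Otimes>\<^sub>M lborel)"
  proof (rule borel_measurable_times)
    show "(\<lambda>w. indicat_real (cball (0::real^'n) h) (snd w)) \<in> borel_measurable (lborel \<Otimes>\<^sub>M lborel)"
      by (rule measurable_compose[OF measurable_snd]) (simp add: indicator_cball_measurable)
    have "(\<lambda>w. fst w + snd w :: real^'n) \<in> borel_measurable (lborel \<Otimes>\<^sub>M lborel)"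
      by (intro borel_measurable_add) (simp_all add: measurable_fst'' measurable_snd'')
    then show "(\<lambda>w. \<phi> (fst w + snd w)) \<in> borel_measurable (lborel \<Otimes>\<^sub>M lborel)"
      by (rule measurable_compose[OF _ m])
  qed
  then have "(\<lambda>x. LINT z|lborel. indicat_real (cball 0 h) z * \<phi> (x + z)) \<in> borel_measurable lborel"
    by (intro lborel.borel_measurable_lebesgue_integral) (simp add: case_prod_beta')
  then show ?thesis by (simp add: ball_sum_def[abs_def])
qed

lemma ball_sum_eq:
  fixes \<phi> :: "real^'n \<Rightarrow> real"
  assumes "continuous_on UNIV \<phi>"
  shows "ball_sum h \<phi> x = (LINT y|lborel. indicat_real (cball x h) y * \<phi> y)"
proof -
  have m: "\<phi> \<in> borel_measurable borel" using assms by (rule borel_measurable_continuous_onI)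
  have "(LINT y|lborel. indicat_real (cball x h) y * \<phi> y) = (LINT z|lborel. indicat_real (cball x h) (z + x) * \<phi> (z + x))"
    by (rule lborel_integral_translate[symmetric]) (rule borel_measurable_times[OF indicator_cball_measurable m])
  also have "\<dots> = ball_sum h \<phi> x"
    unfolding ball_sum_def by (intro Bochner_Integration.integral_cong) (auto simp: indicator_def dist_norm add.commute)
  finally show ?thesis by simp
qed

lemma ball_sum_correlation:
  fixes \<phi> :: "real^'n \<Rightarrow> real"
  assumes \<phi>: "test_function \<Omega> \<phi>"
  shows "integrable lborel (\<lambda>z. indicat_real (cball 0 h) z * (LINT x|lborel. \<phi> x * \<phi> (x + z)))"
    and "(LINT x|lborel. \<phi> x * ball_sum h \<phi> x)
      = (LINT z|lborel. indicat_real (cball 0 h) z * (LINT x|lborel. \<phi> x * \<phi> (x + z)))"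
proof -
  have c: "continuous_on UNIV \<phi>" by (rule test_function_continuous[OF \<phi>])
  have [measurable]: "\<phi> \<in> borel_measurable borel" using c by (rule borel_measurable_continuous_onI)
  obtain R where R: "R > 0" "\<And>x. R < norm x \<Longrightarrow> \<phi> x = 0"
    by (rule test_function_ball_support[OF \<phi>]) (rule that)
  let ?S = "cball (0::real^'n) R \<times> cball (0::real^'n) h"
  define F where "F x z = indicat_real (cball 0 h) z * (\<phi> x * \<phi> (x + z))" for x z
  have "integrable lborel (\<lambda>w. indicator ?S w *\<^sub>R (\<phi> (fst w) * \<phi> (fst w + snd w)))"
  proof (rule borel_integrable_compact)
    show "compact ?S" by (intro compact_Times compact_cball)
    show "continuous_on ?S (\<lambda>w. \<phi> (fst w) * \<phi> (fst w + snd w))"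
      by (intro continuous_on_mult continuous_on_compose2[OF c] continuous_intros) auto
  qed
  moreover have "(\<lambda>w. indicator ?S w *\<^sub>R (\<phi> (fst w) * \<phi> (fst w + snd w))) = case_prod F"
    using R(2) by (auto simp: fun_eq_iff F_def indicator_def not_le)
  ultimately have int: "integrable (lborel \<Otimes>\<^sub>M lborel) (case_prod F)"
    by (simp add: lborel_prod)
  have eq: "(LINT x|lborel. F x z) = indicat_real (cball 0 h) z * (LINT x|lborel. \<phi> x * \<phi> (x + z))" for z
    by (simp add: F_def)
  have eq2: "(LINT z|lborel. F x z) = \<phi> x * ball_sum h \<phi> x" for x
  proof -
    have "F x = (\<lambda>z. \<phi> x * (indicat_real (cball 0 h) z * \<phi> (x + z)))" by (auto simp: F_def)
    then show ?thesis by (simp add: ball_sum_def)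
  qed
  show "integrable lborel (\<lambda>z. indicat_real (cball 0 h) z * (LINT x|lborel. \<phi> x * \<phi> (x + z)))"
    using lborel_pair.integrable_snd[OF int] by (simp add: eq)
  show "(LINT x|lborel. \<phi> x * ball_sum h \<phi> x)
      = (LINT z|lborel. indicat_real (cball 0 h) z * (LINT x|lborel. \<phi> x * \<phi> (x + z)))"
    using lborel_pair.Fubini_integral[OF int] by (simp add: eq eq2)
qed

text \<open>The correlation is the square of the norm plus the pairing of \<open>\<phi>\<close> with its increment, and
  the increment is bounded by the translation estimate.\<close>

lemma correlation_lower_bound:
  fixes \<phi> :: "real^'n \<Rightarrow> real"
  assumes \<phi>: "test_function \<Omega> \<phi>" and z: "norm z \<le> h"
  shows "(LINT x|lborel. (\<phi> x)\<^sup>2) - h * L2_norm_on UNIV \<phi> * L2_norm_on UNIV (grad \<phi>)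
    \<le> (LINT x|lborel. \<phi> x * \<phi> (x + z))"
proof -
  have c: "continuous_on UNIV \<phi>" by (rule test_function_continuous[OF \<phi>])
  have m: "\<phi> \<in> borel_measurable borel" using c by (rule borel_measurable_continuous_onI)
  obtain R where R: "R > 0" "\<And>x. R < norm x \<Longrightarrow> \<phi> x = 0"
    by (rule test_function_ball_support[OF \<phi>]) (rule that)
  have cz: "continuous_on UNIV (\<lambda>x. \<phi> (x + z))"
    by (intro continuous_on_compose2[OF c] continuous_intros) auto
  have L: "\<phi> \<in> L2 UNIV" by (rule L2_UNIV_continuous_compact_support[OF c R(2)])
  have Lz: "(\<lambda>x. \<phi> (x + z)) \<in> L2 UNIV"
  proof (rule L2_UNIV_continuous_compact_support[OF cz])
    show "\<phi> (x + z) = 0" if "R + norm z < norm x" for x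
      using that norm_triangle_ineq4[of "x + z" z] by (intro R(2)) simp
  qed
  have mz: "(\<lambda>x. \<phi> (x + z)) \<in> borel_measurable borel" using cz by (rule borel_measurable_continuous_onI)
  have mg: "grad \<phi> \<in> borel_measurable borel"
    by (intro borel_measurable_continuous_onI smooth_continuous_grad test_function_smooth[OF \<phi>])
  have Ld: "(\<lambda>x. \<phi> (x + z)) - \<phi> \<in> L2 UNIV" by (rule L2.S_diff[OF Lz L])
  have toL: "L2_inner UNIV u v = (LINT x|lborel. u x * v x)"
    if "u \<in> borel_measurable borel" "v \<in> borel_measurable borel" for u v :: "real^'n \<Rightarrow> real"
    using that by (simp add: L2_inner_def lebesgue_on_UNIV_eq integral_completion)
  have nh: "0 \<le> h" using z norm_ge_zero[of z] by linarith
  have g_int: "integrable lborel (\<lambda>x. (norm (grad \<phi> x))\<^sup>2)"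
  proof -
    have "integrable lborel (\<lambda>x. \<Sum>i\<in>UNIV. partial_deriv i \<phi> x * partial_deriv i \<phi> x)"
      by (intro Bochner_Integration.integrable_sum test_function_integrable_lborel[where \<Omega> = \<Omega>] test_function_mult
          test_function_smooth[OF test_function_partial_deriv[OF \<phi>]] test_function_partial_deriv[OF \<phi>])
    then show ?thesis by (simp only: power2_norm_eq_inner inner_vec_def inner_real_def grad_nth)
  qed
  have "(L2_norm_on UNIV ((\<lambda>x. \<phi> (x + z)) - \<phi>))\<^sup>2 = (LINT x|lborel. (\<phi> (x + z) - \<phi> x)\<^sup>2)"
    using L2_norm_UNIV[of "\<lambda>x. \<phi> (x + z) - \<phi> x"] m mz by (simp add: fun_diff_def)
  also have "\<dots> \<le> (LINT x|lborel. (grad \<phi> x \<bullet> z)\<^sup>2)" by (rule translation_estimate[OF \<phi>])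
  also have "\<dots> \<le> (LINT x|lborel. h\<^sup>2 * (norm (grad \<phi> x))\<^sup>2)"
  proof (rule integral_mono_AE')
    show "integrable lborel (\<lambda>x. h\<^sup>2 * (norm (grad \<phi> x))\<^sup>2)" using g_int by simp
    show "AE x in lborel. (grad \<phi> x \<bullet> z)\<^sup>2 \<le> h\<^sup>2 * (norm (grad \<phi> x))\<^sup>2"
    proof (rule AE_I2)
      fix x
      have "\<bar>grad \<phi> x \<bullet> z\<bar> \<le> norm (grad \<phi> x) * norm z" by (rule Cauchy_Schwarz_ineq2)
      also have "\<dots> \<le> norm (grad \<phi> x) * h" using z by (intro mult_left_mono) auto
      finally have "\<bar>grad \<phi> x \<bullet> z\<bar>\<^sup>2 \<le> (norm (grad \<phi> x) * h)\<^sup>2" by (intro power_mono) auto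
      then show "(grad \<phi> x \<bullet> z)\<^sup>2 \<le> h\<^sup>2 * (norm (grad \<phi> x))\<^sup>2"
        by (simp add: power_mult_distrib mult.commute)
    qed
  qed auto
  also have "\<dots> = (h * L2_norm_on UNIV (grad \<phi>))\<^sup>2"
    using L2_norm_UNIV[OF mg] by (simp add: power_mult_distrib)
  finally have est: "L2_norm_on UNIV ((\<lambda>x. \<phi> (x + z)) - \<phi>) \<le> h * L2_norm_on UNIV (grad \<phi>)"
    by (rule power2_le_imp_le) (use nh in \<open>simp add: L2_norm_on_def\<close>)
  have "L2_inner UNIV \<phi> \<phi> - L2_inner UNIV \<phi> (\<lambda>x. \<phi> (x + z)) = - L2_inner UNIV \<phi> ((\<lambda>x. \<phi> (x + z)) - \<phi>)"
    by (simp add: L2.ip_diff_right L Lz)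
  also have "\<dots> \<le> L2_norm_on UNIV \<phi> * L2_norm_on UNIV ((\<lambda>x. \<phi> (x + z)) - \<phi>)"
    using L2.Cauchy_Schwarz[OF L Ld] by linarith
  also have "\<dots> \<le> L2_norm_on UNIV \<phi> * (h * L2_norm_on UNIV (grad \<phi>))"
    using est L2.nrm_nonneg[OF L] by (rule mult_left_mono)
  finally show ?thesis
    using toL[OF m m] toL[OF m mz] by (simp add: power2_eq_square mult_ac)
qed

context bounded_open_set
begin

lemma L2_norm_UNIV_eq:
  fixes f :: "real^'n \<Rightarrow> 'b::euclidean_space"
  assumes "continuous_on UNIV f" "\<And>x. x \<notin> \<Omega> \<Longrightarrow> f x = 0"
  shows "L2_norm_on UNIV f = N f"
proof -
  have m: "f \<in> borel_measurable borel" using assms(1) by (rule borel_measurable_continuous_onI)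
  have "(LINT x|lebesgue_on \<Omega>. (norm (f x))\<^sup>2) = (LINT x|lborel. (norm (f x))\<^sup>2)"
  proof (rule lebesgue_on_integral_eq_lborel)
    show "\<Omega> \<in> sets lebesgue" using open_\<Omega> by auto
    show "(\<lambda>x. (norm (f x))\<^sup>2) \<in> borel_measurable borel" using m by measurable
  qed (simp add: assms(2))
  also have "\<dots> = (L2_norm_on UNIV f)\<^sup>2" by (rule L2_norm_UNIV[OF m, symmetric])
  finally have "N f = sqrt ((L2_norm_on UNIV f)\<^sup>2)" by (simp add: L2_norm_on_def[of \<Omega>])
  then show ?thesis by (simp add: L2_norm_on_def[of UNIV])
qed

text \<open>Integrate \<open>correlation_lower_bound\<close> over the ball and exchange the order of integration. A
  test function with bounded gradient is thus controlled by its ball averages up to an error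
  proportional to the radius.\<close>

lemma norm_sq_le_ball_sum:
  assumes \<phi>: "test_function \<Omega> \<phi>" and h: "h > 0"
  shows "measure lborel (cball (0::real^'n) h) * ((N \<phi>)\<^sup>2 - h * N \<phi> * N (grad \<phi>)) \<le> L2_inner \<Omega> \<phi> (ball_sum h \<phi>)"
proof -
  have \<Omega>m: "\<Omega> \<in> sets lebesgue" using open_\<Omega> by auto
  note c = test_function_continuous[OF \<phi>] and cg = smooth_continuous_grad[OF test_function_smooth[OF \<phi>]]
  have m: "\<phi> \<in> borel_measurable borel" using c by (rule borel_measurable_continuous_onI)
  have N: "L2_norm_on UNIV \<phi> = N \<phi>" "L2_norm_on UNIV (grad \<phi>) = N (grad \<phi>)"
    using L2_norm_UNIV_eq[OF c test_function_zero_outside[OF \<phi>]] L2_norm_UNIV_eq[OF cg grad_zero_outside[OF \<phi>]] by auto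
  have sq: "(LINT x|lborel. (\<phi> x)\<^sup>2) = (N \<phi>)\<^sup>2"
    using L2_norm_UNIV[OF m] N by simp
  define K where "K = (N \<phi>)\<^sup>2 - h * N \<phi> * N (grad \<phi>)"
  have "measure lborel (cball (0::real^'n) h) * K = (LINT z|lborel. K * indicat_real (cball (0::real^'n) h) z)"
    by simp
  also have "\<dots> \<le> (LINT z|lborel. indicat_real (cball 0 h) z * (LINT x|lborel. \<phi> x * \<phi> (x + z)))"
  proof (rule integral_mono[OF integrable_indicator_cball ball_sum_correlation(1)[OF \<phi>]])
    fix z :: "real^'n"
    show "K * indicat_real (cball 0 h) z \<le> indicat_real (cball 0 h) z * (LINT x|lborel. \<phi> x * \<phi> (x + z))"
    proof (cases "norm z \<le> h")
      case True
      then show ?thesis using correlation_lower_bound[OF \<phi> True] by (simp add: K_def sq N)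
    qed simp
  qed
  also have "\<dots> = (LINT x|lborel. \<phi> x * ball_sum h \<phi> x)" by (rule ball_sum_correlation(2)[OF \<phi>, symmetric])
  also have "\<dots> = (LINT x|lebesgue_on \<Omega>. \<phi> x * ball_sum h \<phi> x)"
  proof (rule lebesgue_on_integral_eq_lborel[OF \<Omega>m, symmetric])
    show "(\<lambda>x. \<phi> x * ball_sum h \<phi> x) \<in> borel_measurable borel"
      using m ball_sum_measurable[OF c] by (rule borel_measurable_times)
  qed (simp add: test_function_zero_outside[OF \<phi>])
  finally show ?thesis by (simp add: K_def L2_inner_def)
qed

lemma indicator_L2: "A \<in> sets lebesgue \<Longrightarrow> indicat_real A \<in> L2 \<Omega>"
  by (rule L2_bounded[OF lmeasurable_\<Omega>, of _ 1])
     (rule measurable_restrict_space1, rule borel_measurable_indicator, simp_all add: indicator_def)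

lemma ball_sum_eq_inner:
  assumes \<phi>: "test_function \<Omega> \<phi>"
  shows "ball_sum h \<phi> x = L2_inner \<Omega> \<phi> (indicat_real (cball x h))"
proof -
  have m: "\<phi> \<in> borel_measurable borel"
    by (intro borel_measurable_continuous_onI test_function_continuous[OF \<phi>])
  have "(LINT y|lborel. indicat_real (cball x h) y * \<phi> y) = (LINT y|lebesgue_on \<Omega>. indicat_real (cball x h) y * \<phi> y)"
  proof (rule lebesgue_on_integral_eq_lborel[symmetric])
    show "\<Omega> \<in> sets lebesgue" using open_\<Omega> by auto
    show "(\<lambda>y. indicat_real (cball x h) y * \<phi> y) \<in> borel_measurable borel"
      using m by (intro borel_measurable_times borel_measurable_indicator) auto
  qed (simp add: test_function_zero_outside[OF \<phi>])
  then show ?thesis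
    by (simp add: ball_sum_eq[OF test_function_continuous[OF \<phi>]] L2_inner_def mult.commute)
qed

text \<open>For fixed radius the ball averages of a weakly null sequence tend to zero at every point
  and are uniformly bounded, hence they tend to zero in \<open>L\<^sup>2\<close>. The functions themselves
  differ from their averages by an amount that is small with the radius, uniformly in the
  sequence.\<close>

lemma Rellich_test:
  assumes \<phi>: "\<And>k. test_function \<Omega> (\<phi> k)" and B: "\<And>k. N (\<phi> k) \<le> B" "\<And>k. N (grad (\<phi> k)) \<le> B"
    and weak: "\<And>g. g \<in> L2 \<Omega> \<Longrightarrow> (\<lambda>k. L2_inner \<Omega> (\<phi> k) g) \<longlonglongrightarrow> 0"
  shows "(\<lambda>k. N (\<phi> k)) \<longlonglongrightarrow> 0"
proof -
  interpret finite_measure "lebesgue_on \<Omega>" by (rule finite_measure_\<Omega>)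
  have N0: "0 \<le> N (\<phi> k)" "0 \<le> N (grad (\<phi> k))" for k
    using L2.nrm_nonneg[OF test_function_L2[OF \<phi>]] L2.nrm_nonneg[OF grad_L2[OF \<phi>]] by auto
  have B0: "0 \<le> B" using N0(1)[of 0] B(1)[of 0] by linarith
  have ind: "indicat_real (cball x h) \<in> L2 \<Omega>" for x h by (rule indicator_L2) auto
  define D where "D = B * N (\<lambda>x. 1 :: real)"
  have one: "(\<lambda>x. 1 :: real) \<in> L2 \<Omega>" by (rule L2_bounded[OF lmeasurable_\<Omega>, of _ 1]) auto
  have bs_bound: "\<bar>ball_sum h (\<phi> k) x\<bar> \<le> D" for h k x
  proof -
    have "\<bar>ball_sum h (\<phi> k) x\<bar> \<le> N (\<phi> k) * N (indicat_real (cball x h))"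
      unfolding ball_sum_eq_inner[OF \<phi>] by (rule L2.Cauchy_Schwarz[OF test_function_L2[OF \<phi>] ind])
    also have "\<dots> \<le> B * N (\<lambda>x. 1 :: real)"
    proof (rule mult_mono[OF B(1) _ B0 L2.nrm_nonneg[OF ind]])
      show "N (indicat_real (cball x h)) \<le> N (\<lambda>x. 1 :: real)"
        using L2_dominated(2)[OF L2_measurable[OF ind] one, of 1 x h] by (simp add: indicator_def)
    qed
    finally show ?thesis by (simp add: D_def)
  qed
  have bs_meas: "ball_sum h (\<phi> k) \<in> borel_measurable (lebesgue_on \<Omega>)" for h k
    by (intro measurable_restrict_space1 measurable_completion)
       (use ball_sum_measurable[OF test_function_continuous[OF \<phi>]] in simp)
  have bs_L2: "ball_sum h (\<phi> k) \<in> L2 \<Omega>" for h k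
    by (rule L2_bounded[OF lmeasurable_\<Omega> bs_meas, of _ _ D]) (simp add: bs_bound)
  have bs_lim: "(\<lambda>k. N (ball_sum h (\<phi> k))) \<longlonglongrightarrow> 0" for h
  proof -
    have "(\<lambda>k. LINT x|lebesgue_on \<Omega>. (norm (ball_sum h (\<phi> k) x))\<^sup>2) \<longlonglongrightarrow> (LINT x|lebesgue_on \<Omega>. 0)"
    proof (rule integral_dominated_convergence[where w = "\<lambda>x. D\<^sup>2"])
      show "AE x in lebesgue_on \<Omega>. (\<lambda>k. (norm (ball_sum h (\<phi> k) x))\<^sup>2) \<longlonglongrightarrow> 0"
      proof (rule AE_I2)
        fix x
        have "(\<lambda>k. ball_sum h (\<phi> k) x) \<longlonglongrightarrow> 0"
          unfolding ball_sum_eq_inner[OF \<phi>] by (rule weak[OF ind])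
        from tendsto_power[OF tendsto_norm[OF this], of 2]
        show "(\<lambda>k. (norm (ball_sum h (\<phi> k) x))\<^sup>2) \<longlonglongrightarrow> 0" by simp
      qed
      show "AE x in lebesgue_on \<Omega>. norm ((norm (ball_sum h (\<phi> k) x))\<^sup>2) \<le> D\<^sup>2" for k
        using power_mono[OF bs_bound[of h k] abs_ge_zero, of _ 2] by (intro AE_I2) simp
      show "(\<lambda>x. (norm (ball_sum h (\<phi> k) x))\<^sup>2) \<in> borel_measurable (lebesgue_on \<Omega>)" for k
        using bs_meas[of h k] by measurable
    qed auto
    from tendsto_real_sqrt[OF this] show ?thesis by (simp add: L2_norm_on_def)
  qed
  show ?thesis
  proof (rule LIMSEQ_I)
    fix e :: real assume e: "e > 0"
    \<comment> \<open>The radius makes the error term \<open>h * B\<^sup>2\<close> at most \<open>e\<^sup>2 / 2\<close>; the summand \<open>1\<close> covers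
         \<open>B = 0\<close>.\<close>
    define h where "h = e\<^sup>2 / (2 * (B\<^sup>2 + 1))"
    have h: "h > 0" using e by (auto simp: h_def intro!: divide_pos_pos add_nonneg_pos)
    define v where "v = measure lborel (cball (0::real^'n) h)"
    have v: "v > 0" using h by (simp add: v_def content_cball_pos)
    have hB: "h * B\<^sup>2 \<le> e\<^sup>2 / 2"
    proof -
      have "h * B\<^sup>2 \<le> h * (B\<^sup>2 + 1)" using h by (intro mult_left_mono) auto
      also have "\<dots> = e\<^sup>2 / 2" using add_nonneg_pos[OF zero_le_power2[of B] zero_less_one] by (simp add: h_def field_simps)
      finally show ?thesis .
    qed
    have "(\<lambda>k. B * N (ball_sum h (\<phi> k)) / v) \<longlonglongrightarrow> B * 0 / v"
      by (intro tendsto_divide tendsto_mult tendsto_const bs_lim) (use v in simp)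
    then have "\<forall>\<^sub>F k in sequentially. B * N (ball_sum h (\<phi> k)) / v < e\<^sup>2 / 2"
      by (rule order_tendstoD(2)) (use e in simp)
    then obtain M where M: "\<And>k. k \<ge> M \<Longrightarrow> B * N (ball_sum h (\<phi> k)) / v < e\<^sup>2 / 2"
      unfolding eventually_sequentially by blast
    have "norm (N (\<phi> k) - 0) < e" if k: "k \<ge> M" for k
    proof -
      have "v * ((N (\<phi> k))\<^sup>2 - h * N (\<phi> k) * N (grad (\<phi> k))) \<le> L2_inner \<Omega> (\<phi> k) (ball_sum h (\<phi> k))"
        unfolding v_def by (rule norm_sq_le_ball_sum[OF \<phi> h])
      also have "\<dots> \<le> N (\<phi> k) * N (ball_sum h (\<phi> k))"
        using L2.Cauchy_Schwarz[OF test_function_L2[OF \<phi>[of k]] bs_L2[of h k]] by linarith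
      also have "\<dots> \<le> B * N (ball_sum h (\<phi> k))"
        by (intro mult_right_mono B L2.nrm_nonneg bs_L2)
      finally have "(N (\<phi> k))\<^sup>2 - h * N (\<phi> k) * N (grad (\<phi> k)) \<le> B * N (ball_sum h (\<phi> k)) / v"
        using v by (simp add: field_simps)
      moreover have "h * N (\<phi> k) * N (grad (\<phi> k)) \<le> h * B\<^sup>2"
        unfolding mult.assoc power2_eq_square using h B0
        by (intro mult_left_mono mult_mono B N0) auto
      ultimately have "(N (\<phi> k))\<^sup>2 < e\<^sup>2" using M[OF k] hB by linarith
      then have "N (\<phi> k) < e" using e by (rule_tac power_less_imp_less_base) auto
      then show ?thesis using N0(1)[of k] by simp
    qed
    then show "\<exists>no. \<forall>n\<ge>no. norm (N (\<phi> n) - 0) < e" by blast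
  qed
qed

text \<open>Replacing each jet by a test jet at distance less than \<open>1 / (k + 1)\<close> affects neither the
  weak limit nor the claim.\<close>

lemma Rellich:
  assumes p: "\<And>k. p k \<in> V" and B: "\<And>k. N (p k) \<le> B"
    and weak: "\<And>g. g \<in> L2 \<Omega> \<Longrightarrow> (\<lambda>k. L2_inner \<Omega> (val (p k)) g) \<longlonglongrightarrow> 0"
  shows "(\<lambda>k. N (val (p k))) \<longlonglongrightarrow> 0"
proof -
  have "\<forall>k. \<exists>\<phi>. test_function \<Omega> \<phi> \<and> N (p k - test_jet \<phi>) < 1 / real (Suc k)"
    using p unfolding V_def by simp
  then obtain \<phi> where \<phi>: "\<And>k. test_function \<Omega> (\<phi> k)" and close: "\<And>k. N (p k - test_jet (\<phi> k)) < 1 / real (Suc k)"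
    by metis
  note pL = V_L2[OF p] and tL = test_jet_L2[OF \<phi>]
  have dL: "p k - test_jet (\<phi> k) \<in> L2 \<Omega>" for k by (rule L2.S_diff[OF pL tL])
  have inv0: "(\<lambda>k. 1 / real (Suc k)) \<longlonglongrightarrow> 0" by (rule LIMSEQ_Suc[OF lim_1_over_n])
  have vd: "N (val (p k) - \<phi> k) \<le> 1 / real (Suc k)" for k
    using L2_val(2)[OF dL, of k] close[of k] by (simp add: val_diff)
  have tB: "N (test_jet (\<phi> k)) \<le> B + 1" for k
  proof -
    have "N (test_jet (\<phi> k)) \<le> N (test_jet (\<phi> k) - p k) + N (p k)" by (rule L2.nrm_le_diff[OF tL pL])
    moreover have "N (test_jet (\<phi> k) - p k) = N (p k - test_jet (\<phi> k))" by (rule L2.nrm_diff_commute[OF tL pL])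
    moreover have "1 / real (Suc k) \<le> 1" by simp
    ultimately show ?thesis using close[of k] B[of k] by linarith
  qed
  have "(\<lambda>k. N (\<phi> k)) \<longlonglongrightarrow> 0"
  proof (rule Rellich_test[OF \<phi>, where B = "B + 1"])
    show "N (\<phi> k) \<le> B + 1" "N (grad (\<phi> k)) \<le> B + 1" for k
      using L2_val(2)[OF tL, of k] L2_gr(2)[OF tL, of k] tB[of k] by simp_all
    fix g :: "real^'n \<Rightarrow> real" assume g: "g \<in> L2 \<Omega>"
    have "(\<lambda>k. L2_inner \<Omega> (val (p k) - \<phi> k) g) \<longlonglongrightarrow> 0"
    proof (rule Lim_null_comparison)
      have "norm (L2_inner \<Omega> (val (p k) - \<phi> k) g) \<le> 1 / real (Suc k) * N g" for k
      proof -
        have "\<bar>L2_inner \<Omega> (val (p k) - \<phi> k) g\<bar> \<le> N (val (p k) - \<phi> k) * N g"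
          by (rule L2.Cauchy_Schwarz[OF L2.S_diff[OF L2_val(1)[OF pL] test_function_L2[OF \<phi>]] g])
        also have "\<dots> \<le> 1 / real (Suc k) * N g" by (rule mult_right_mono[OF vd L2.nrm_nonneg[OF g]])
        finally show ?thesis by simp
      qed
      then show "\<forall>\<^sub>F k in sequentially. norm (L2_inner \<Omega> (val (p k) - \<phi> k) g) \<le> 1 / real (Suc k) * N g"
        by (intro always_eventually allI)
      show "(\<lambda>k. 1 / real (Suc k) * N g) \<longlonglongrightarrow> 0"
        using tendsto_mult[OF inv0 tendsto_const[of "N g"]] by simp
    qed
    from tendsto_diff[OF weak[OF g] this]
    show "(\<lambda>k. L2_inner \<Omega> (\<phi> k) g) \<longlonglongrightarrow> 0"
      by (simp add: L2.ip_diff_left[OF L2_val(1)[OF pL] test_function_L2[OF \<phi>] g])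
  qed
  from tendsto_add[OF inv0 this] have lim: "(\<lambda>k. 1 / real (Suc k) + N (\<phi> k)) \<longlonglongrightarrow> 0" by simp
  show ?thesis
  proof (rule tendsto_sandwich[OF _ _ tendsto_const lim])
    show "\<forall>\<^sub>F k in sequentially. 0 \<le> N (val (p k))"
      by (intro always_eventually allI L2.nrm_nonneg L2_val pL)
    have "N (val (p k)) \<le> 1 / real (Suc k) + N (\<phi> k)" for k
      using L2.nrm_le_diff[OF L2_val(1)[OF pL] test_function_L2[OF \<phi>], of k k] vd[of k] by linarith
    then show "\<forall>\<^sub>F k in sequentially. N (val (p k)) \<le> 1 / real (Suc k) + N (\<phi> k)"
      by (intro always_eventually allI)
  qed
qed

end

section \<open>Elliptic matrices and the solution operator\<close>

lemma symmetric_mat_inner: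
  assumes "symmetric_mat A" shows "(A *v x) \<bullet> y = (A *v y) \<bullet> (x :: real^'n)"
proof -
  have "(A *v x) \<bullet> y = y \<bullet> (A *v x)" by (rule inner_commute)
  also have "\<dots> = (y v* A) \<bullet> x" by (rule dot_lmul_matrix[symmetric])
  also have "y v* A = A *v y"
    using transpose_matrix_vector[of A y] assms unfolding symmetric_mat_def by metis
  finally show ?thesis .
qed

lemma symmetric_matI:
  fixes A :: "real^'n^'n"
  assumes "\<And>x y. (A *v x) \<bullet> y = (A *v y) \<bullet> x"
  shows "symmetric_mat A"
proof -
  have "A $ i $ j = A $ j $ i" for i j
    using assms[of "axis j 1" "axis i 1"] by (simp add: inner_axis matrix_vector_mul_component)
  then show ?thesis by (simp add: symmetric_mat_def transpose_def vec_eq_iff)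
qed

lemma loewner_scaled_identity:
  fixes A :: "real^'n^'n"
  shows "(c *\<^sub>R mat 1) \<preceq> A \<longleftrightarrow> (\<forall>x. c * (norm x)\<^sup>2 \<le> (A *v x) \<bullet> x)"
    and "A \<preceq> (c *\<^sub>R mat 1) \<longleftrightarrow> (\<forall>x. (A *v x) \<bullet> x \<le> c * (norm x)\<^sup>2)"
  by (simp_all add: loewner_le_def psd_mat_def matrix_vector_mult_diff_rdistrib inner_diff_left
      scaleR_matrix_vector_assoc[symmetric] power2_norm_eq_inner)

text \<open>The upper bound is expressed by the flux instead of by \<open>A \<preceq> \<mu>1 *\<^sub>R mat 1\<close>: for \<open>\<sigma> = A p\<close>
  it reads \<open>norm \<sigma>^2 \<le> \<mu>1 * (\<sigma> \<bullet> p)\<close>, which is convex in \<open>\<sigma>\<close> and linear in the product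
  \<open>\<sigma> \<bullet> p\<close>. In this form it survives weak limits of \<open>\<sigma>\<close> once the products converge.\<close>

lemma ellip_mats_iff:
  fixes A :: "real^'n^'n"
  assumes "0 < \<mu>0" "\<mu>0 \<le> \<mu>1"
  shows "A \<in> ellip_mats \<mu>0 \<mu>1 \<longleftrightarrow>
    (\<forall>x y. (A *v x) \<bullet> y = (A *v y) \<bullet> x) \<and> (\<forall>x. \<mu>0 * (norm x)\<^sup>2 \<le> (A *v x) \<bullet> x) \<and>
    (\<forall>x. (norm (A *v x))\<^sup>2 \<le> \<mu>1 * ((A *v x) \<bullet> x))"
    (is "_ \<longleftrightarrow> ?sym \<and> ?lower \<and> ?upper")
proof
  assume A: "A \<in> ellip_mats \<mu>0 \<mu>1"
  then have sym: ?sym and lower: ?lower and up: "\<And>x. (A *v x) \<bullet> x \<le> \<mu>1 * (norm x)\<^sup>2"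
    using symmetric_mat_inner by (auto simp: ellip_mats_def loewner_scaled_identity)
  have ?upper
  proof
    fix x
    define y where "y = A *v x"
    \<comment> \<open>Nonnegativity of the form at \<open>x - t * A x\<close> gives the bound, and this \<open>t\<close> is the optimal
         one.\<close>
    define t where "t = 1 / \<mu>1"
    have t: "t > 0" "t * \<mu>1 = 1" using assms by (auto simp: t_def)
    have "0 \<le> \<mu>0 * (norm (x - t *\<^sub>R y))\<^sup>2" using assms by simp
    also have "\<dots> \<le> (A *v (x - t *\<^sub>R y)) \<bullet> (x - t *\<^sub>R y)" using lower by blast
    also have "\<dots> = y \<bullet> x - 2 * t * (y \<bullet> y) + t * t * ((A *v y) \<bullet> y)"
    proof -
      have "(A *v y) \<bullet> x = y \<bullet> y" using sym y_def by metis
      then show ?thesis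
        by (simp add: matrix_vector_mult_diff_distrib matrix_vector_mult_scaleR y_def[symmetric]
            inner_diff_left inner_diff_right algebra_simps)
    qed
    also have "\<dots> \<le> y \<bullet> x - 2 * t * (y \<bullet> y) + t * t * (\<mu>1 * (y \<bullet> y))"
      using up[of y] t by (intro add_left_mono mult_left_mono) (auto simp: power2_norm_eq_inner)
    also have "\<dots> = y \<bullet> x - t * (y \<bullet> y)"
    proof -
      have "t * t * (\<mu>1 * (y \<bullet> y)) = t * (t * \<mu>1) * (y \<bullet> y)" by simp
      then show ?thesis unfolding t(2) by simp
    qed
    finally have "t * (y \<bullet> y) \<le> y \<bullet> x" by simp
    then have "\<mu>1 * (t * (y \<bullet> y)) \<le> \<mu>1 * (y \<bullet> x)" using assms by (intro mult_left_mono) auto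
    moreover have "\<mu>1 * (t * (y \<bullet> y)) = (t * \<mu>1) * (y \<bullet> y)" by simp
    ultimately have "y \<bullet> y \<le> \<mu>1 * (y \<bullet> x)" unfolding t(2) by linarith
    then show "(norm (A *v x))\<^sup>2 \<le> \<mu>1 * ((A *v x) \<bullet> x)"
      unfolding y_def power2_norm_eq_inner .
  qed
  with sym lower show "?sym \<and> ?lower \<and> ?upper" by blast
next
  assume A: "?sym \<and> ?lower \<and> ?upper"
  have "(A *v x) \<bullet> x \<le> \<mu>1 * (norm x)\<^sup>2" for x
  proof -
    have cs: "(A *v x) \<bullet> x \<le> norm (A *v x) * norm x" by (rule norm_cauchy_schwarz)
    have "norm (A *v x) * norm (A *v x) \<le> \<mu>1 * ((A *v x) \<bullet> x)"
      using A by (simp add: power2_eq_square)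
    also have "\<dots> \<le> \<mu>1 * (norm (A *v x) * norm x)" using assms by (intro mult_left_mono cs) auto
    finally have "norm (A *v x) * norm (A *v x) \<le> \<mu>1 * (norm (A *v x) * norm x)" .
    then have "norm (A *v x) \<le> \<mu>1 * norm x"
      using assms by (cases "norm (A *v x) = 0") (auto simp: mult.left_commute)
    then have "norm (A *v x) * norm x \<le> \<mu>1 * norm x * norm x" by (intro mult_right_mono) auto
    then show ?thesis using cs by (simp add: power2_eq_square)
  qed
  then show "A \<in> ellip_mats \<mu>0 \<mu>1"
    using A by (auto simp: ellip_mats_def loewner_scaled_identity intro: symmetric_matI)
qed

lemma continuous_on_matrix_vector_mult:
  fixes f :: "'a::topological_space \<Rightarrow> real^'n^'m"
  assumes "continuous_on S f" "continuous_on S g"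
  shows "continuous_on S (\<lambda>x. f x *v g x)"
  unfolding matrix_vector_mult_def using assms
  by (intro continuous_on_vec_lambda continuous_on_sum continuous_on_mult continuous_on_component) auto

definition flux :: "(real^'n \<Rightarrow> real^'n^'n) \<Rightarrow> (real^'n \<Rightarrow> real^'n) \<Rightarrow> real^'n \<Rightarrow> real^'n"
  where "flux a g x = a x *v g x"

lemma flux_add: "flux a (g + h) = flux a g + flux a h" and flux_diff: "flux a (g - h) = flux a g - flux a h"
  and flux_scale: "flux a (c *\<^sub>R g) = c *\<^sub>R flux a g"
  by (auto simp: flux_def fun_eq_iff matrix_vector_right_distrib matrix_vector_mult_diff_distrib matrix_vector_mult_scaleR)

lemma flux_measurable:
  assumes "a \<in> borel_measurable M" "g \<in> borel_measurable M"
  shows "flux a g \<in> borel_measurable M"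
proof -
  have "(\<lambda>w :: (real^'n^'n) \<times> (real^'n). fst w *v snd w) \<in> borel_measurable borel"
    by (intro borel_measurable_continuous_onI continuous_on_matrix_vector_mult continuous_intros)
  from measurable_compose[OF borel_measurable_Pair[OF assms] this]
  show ?thesis by (simp add: flux_def[abs_def])
qed

locale elliptic = bounded_open_set \<Omega> for \<Omega> :: "(real^'n) set" +
  fixes \<mu>0 \<mu>1 :: real
  assumes \<mu>: "0 < \<mu>0" "\<mu>0 \<le> \<mu>1"
begin

abbreviation "Coeff \<equiv> coeff_fields \<Omega> \<mu>0 \<mu>1"

lemma Coeff_pointwise:
  assumes "a \<in> Coeff" "x \<in> \<Omega>"
  shows "(a x *v \<xi>) \<bullet> \<eta> = (a x *v \<eta>) \<bullet> \<xi>" "\<mu>0 * (norm \<xi>)\<^sup>2 \<le> (a x *v \<xi>) \<bullet> \<xi>"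
    "(norm (a x *v \<xi>))\<^sup>2 \<le> \<mu>1 * ((a x *v \<xi>) \<bullet> \<xi>)"
  using assms ellip_mats_iff[OF \<mu>] unfolding coeff_fields_def by blast+

lemma norm_matrix_vector_le:
  assumes "a \<in> Coeff" "x \<in> \<Omega>" shows "norm (a x *v \<xi>) \<le> \<mu>1 * norm \<xi>"
proof (cases "norm (a x *v \<xi>) = 0")
  case False
  have "norm (a x *v \<xi>) * norm (a x *v \<xi>) \<le> \<mu>1 * ((a x *v \<xi>) \<bullet> \<xi>)"
    using Coeff_pointwise(3)[OF assms] by (simp add: power2_eq_square)
  also have "\<dots> \<le> \<mu>1 * (norm (a x *v \<xi>) * norm \<xi>)"
    using \<mu> by (intro mult_left_mono norm_cauchy_schwarz) auto
  finally show ?thesis using False by (simp add: mult.left_commute)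
qed (use \<mu> in simp)

lemma flux_L2:
  assumes "a \<in> Coeff" "g \<in> L2 \<Omega>" shows "flux a g \<in> L2 \<Omega>" "N (flux a g) \<le> \<mu>1 * N g"
proof -
  have m: "flux a g \<in> borel_measurable (lebesgue_on \<Omega>)"
    using assms(1) by (intro flux_measurable L2_measurable[OF assms(2)]) (simp add: coeff_fields_def)
  have "0 \<le> \<mu>1" using \<mu> by simp
  then show "flux a g \<in> L2 \<Omega>" "N (flux a g) \<le> \<mu>1 * N g"
    using L2_dominated[OF m assms(2), of \<mu>1] norm_matrix_vector_le[OF assms(1)] by (auto simp: flux_def)
qed

lemma flux_sym:
  assumes "a \<in> Coeff" "g \<in> L2 \<Omega>" "h \<in> L2 \<Omega>"
  shows "L2_inner \<Omega> (flux a g) h = L2_inner \<Omega> (flux a h) g"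
  unfolding L2_inner_def flux_def
  by (intro Bochner_Integration.integral_cong refl) (simp add: space_restrict_space Coeff_pointwise(1)[OF assms(1)])

lemma flux_coercive:
  assumes "a \<in> Coeff" "g \<in> L2 \<Omega>"
  shows "\<mu>0 * (N g)\<^sup>2 \<le> L2_inner \<Omega> (flux a g) g" "(N (flux a g))\<^sup>2 \<le> \<mu>1 * L2_inner \<Omega> (flux a g) g"
proof -
  have i: "integrable (lebesgue_on \<Omega>) (\<lambda>x. flux a g x \<bullet> g x)"
    by (rule L2_inner_integrable[OF flux_L2(1)[OF assms] assms(2)])
  have "(LINT x|lebesgue_on \<Omega>. \<mu>0 * (norm (g x))\<^sup>2) \<le> (LINT x|lebesgue_on \<Omega>. flux a g x \<bullet> g x)"
    using Coeff_pointwise(2)[OF assms(1)]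
    by (intro integral_mono integrable_mult_right L2_integrable_sq assms i) (simp add: space_restrict_space flux_def)
  then show "\<mu>0 * (N g)\<^sup>2 \<le> L2_inner \<Omega> (flux a g) g"
    by (simp add: L2_inner_def L2_norm_on_def)
  have "(LINT x|lebesgue_on \<Omega>. (norm (flux a g x))\<^sup>2) \<le> (LINT x|lebesgue_on \<Omega>. \<mu>1 * (flux a g x \<bullet> g x))"
    using Coeff_pointwise(3)[OF assms(1)]
    by (intro integral_mono integrable_mult_right L2_integrable_sq flux_L2 assms i) (simp add: space_restrict_space flux_def)
  then show "(N (flux a g))\<^sup>2 \<le> \<mu>1 * L2_inner \<Omega> (flux a g) g"
    by (simp add: L2_inner_def L2_norm_on_def)
qed

definition energy :: "(real^'n \<Rightarrow> real^'n^'n) \<Rightarrow> (real^'n \<Rightarrow> real \<times> (real^'n)) \<Rightarrow> (real^'n \<Rightarrow> real \<times> (real^'n)) \<Rightarrow> real"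
  where "energy a p q = L2_inner \<Omega> (flux a (gr p)) (gr q)"

lemma V_gr: "p \<in> V \<Longrightarrow> gr p \<in> L2 \<Omega>" and V_val: "p \<in> V \<Longrightarrow> val p \<in> L2 \<Omega>"
  using L2_gr(1) L2_val(1) V_L2 by blast+

definition dualV :: "((real^'n \<Rightarrow> real \<times> (real^'n)) \<Rightarrow> real) \<Rightarrow> bool"
  where "dualV F \<longleftrightarrow> linear_functional_on V F \<and> (\<exists>K. \<forall>p\<in>V. \<bar>F p\<bar> \<le> K * N p)"

lemma dualV_iff: "dualV F \<longleftrightarrow> semi_inner_space.bounded_functional V (L2_inner \<Omega>) F"
  using semi_inner_space.bounded_functional_def[OF semi_hilbert_space.axioms(1)[OF V_hilbert]]
  by (simp add: dualV_def nrm_L2)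

lemma dualVI:
  assumes "linear_functional_on V F" "\<And>p. p \<in> V \<Longrightarrow> \<bar>F p\<bar> \<le> K * N p" shows "dualV F"
  using assms unfolding dualV_def by blast

text \<open>By the Poincare inequality coercivity in the gradient seminorm is coercivity in the norm
  of the space.\<close>

lemma V_Lax_Milgram:
  assumes lin: "\<And>q. q \<in> V \<Longrightarrow> linear_functional_on V (\<lambda>p. b p q)"
    and sym: "\<And>p q. p \<in> V \<Longrightarrow> q \<in> V \<Longrightarrow> b p q = b q p"
    and bound: "\<And>p q. p \<in> V \<Longrightarrow> q \<in> V \<Longrightarrow> \<bar>b p q\<bar> \<le> C * N (gr p) * N (gr q)" "0 \<le> C"
    and coer: "\<And>p. p \<in> V \<Longrightarrow> c * (N (gr p))\<^sup>2 \<le> b p p" "c > 0"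
    and F: "dualV F"
  shows "\<exists>p\<in>V. \<forall>q\<in>V. b p q = F q"
proof -
  obtain D where D: "D > 0" "\<And>p. p \<in> V \<Longrightarrow> N (val p) \<le> D * N (gr p)" using Poincare by blast
  show ?thesis
  proof (rule semi_hilbert_space.lax_milgram[OF V_hilbert, where C = C and c = "c / (1 + D\<^sup>2)", unfolded nrm_L2])
    show "\<bar>b p q\<bar> \<le> C * N p * N q" if "p \<in> V" "q \<in> V" for p q
    proof -
      have "C * N (gr p) * N (gr q) \<le> C * N p * N q"
        using bound(2) that by (intro mult_mono mult_left_mono L2_gr V_L2 mult_nonneg_nonneg L2.nrm_nonneg)
      then show ?thesis using bound(1)[OF that] by linarith
    qed
    show "0 < c / (1 + D\<^sup>2)" using coer(2) by (intro divide_pos_pos add_pos_nonneg) auto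
    show "c / (1 + D\<^sup>2) * (N p)\<^sup>2 \<le> b p p" if p: "p \<in> V" for p
    proof -
      have "(N p)\<^sup>2 = (N (val p))\<^sup>2 + (N (gr p))\<^sup>2" by (rule L2_norm_val_gr[OF V_L2[OF p]])
      also have "\<dots> \<le> (D * N (gr p))\<^sup>2 + (N (gr p))\<^sup>2"
        using D(2)[OF p] L2.nrm_nonneg[OF V_val[OF p]] by (intro add_right_mono power_mono)
      also have "\<dots> = (1 + D\<^sup>2) * (N (gr p))\<^sup>2" by (simp add: power_mult_distrib algebra_simps)
      finally have "c / (1 + D\<^sup>2) * (N p)\<^sup>2 \<le> c / (1 + D\<^sup>2) * ((1 + D\<^sup>2) * (N (gr p))\<^sup>2)"
        using coer(2) by (intro mult_left_mono) (auto intro!: divide_nonneg_nonneg add_nonneg_nonneg)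
      also have "\<dots> = c * (N (gr p))\<^sup>2" using add_pos_nonneg[OF zero_less_one zero_le_power2[of D]] by simp
      finally show ?thesis using coer(1)[OF p] by linarith
    qed
    show "semi_inner_space.bounded_functional V (L2_inner \<Omega>) F" using F by (simp add: dualV_iff)
  qed (use lin sym in auto)
qed

lemma linear_functional_on_V_gr:
  "linear_functional_on (L2 \<Omega>) f \<Longrightarrow> linear_functional_on V (\<lambda>p. f (gr p))"
  using V_gr unfolding linear_functional_on_def gr_add gr_scale by blast

lemma linear_functional_on_V_val:
  "linear_functional_on (L2 \<Omega>) f \<Longrightarrow> linear_functional_on V (\<lambda>p. f (val p))"
  using V_val unfolding linear_functional_on_def val_add val_scale by blast

lemma linear_inner_right: "g \<in> L2 \<Omega> \<Longrightarrow> linear_functional_on (L2 \<Omega>) (L2_inner \<Omega> g)"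
  by (rule ssubst[of "L2_inner \<Omega> g" "\<lambda>u. L2_inner \<Omega> u g"], rule ext, rule L2.ip_commute, rule L2.ip_linear)

lemma dualV_gr: assumes g: "g \<in> L2 \<Omega>" shows "dualV (\<lambda>q. L2_inner \<Omega> g (gr q))"
proof (rule dualVI)
  show "linear_functional_on V (\<lambda>q. L2_inner \<Omega> g (gr q))"
    by (rule linear_functional_on_V_gr[OF linear_inner_right[OF g]])
  show "\<bar>L2_inner \<Omega> g (gr q)\<bar> \<le> N g * N q" if q: "q \<in> V" for q
    using L2.Cauchy_Schwarz[OF g V_gr[OF q]] mult_left_mono[OF L2_gr(2)[OF V_L2[OF q]] L2.nrm_nonneg[OF g]]
    by linarith
qed

lemma dualV_val: assumes g: "g \<in> L2 \<Omega>" shows "dualV (\<lambda>q. L2_inner \<Omega> g (val q))"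
proof (rule dualVI)
  show "linear_functional_on V (\<lambda>q. L2_inner \<Omega> g (val q))"
    by (rule linear_functional_on_V_val[OF linear_inner_right[OF g]])
  show "\<bar>L2_inner \<Omega> g (val q)\<bar> \<le> N g * N q" if q: "q \<in> V" for q
    using L2.Cauchy_Schwarz[OF g V_val[OF q]] mult_left_mono[OF L2_val(2)[OF V_L2[OF q]] L2.nrm_nonneg[OF g]]
    by linarith
qed

lemma energy_solution:
  assumes a: "a \<in> Coeff" and F: "dualV F"
  shows "\<exists>p\<in>V. \<forall>q\<in>V. energy a p q = F q"
proof (rule V_Lax_Milgram[where c = \<mu>0 and C = \<mu>1])
  show "linear_functional_on V (\<lambda>p. energy a p q)" if q: "q \<in> V" for q
  proof (rule linear_functional_onI)
    fix p p' assume "p \<in> V" "p' \<in> V"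
    then show "energy a (p + p') q = energy a p q + energy a p' q"
      by (simp add: energy_def gr_add flux_add L2.ip_add_left flux_L2[OF a] V_gr q)
  next
    fix p c assume "p \<in> V"
    then show "energy a (c *\<^sub>R p) q = c * energy a p q"
      by (simp add: energy_def gr_scale flux_scale L2.ip_scale_left flux_L2[OF a] V_gr q)
  qed
  show "energy a p q = energy a q p" if "p \<in> V" "q \<in> V" for p q
    unfolding energy_def using that by (intro flux_sym a V_gr)
  show "\<bar>energy a p q\<bar> \<le> \<mu>1 * N (gr p) * N (gr q)" if "p \<in> V" "q \<in> V" for p q
    using L2.Cauchy_Schwarz[OF flux_L2(1)[OF a V_gr[OF that(1)]] V_gr[OF that(2)]]
      mult_right_mono[OF flux_L2(2)[OF a V_gr[OF that(1)]] L2.nrm_nonneg[OF V_gr[OF that(2)]]]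
    unfolding energy_def by linarith
  show "\<mu>0 * (N (gr p))\<^sup>2 \<le> energy a p p" if "p \<in> V" for p
    unfolding energy_def by (rule flux_coercive(1)[OF a V_gr[OF that]])
qed (use \<mu> F in auto)

lemma Riesz_gradient: assumes F: "dualV F" shows "\<exists>e\<in>V. \<forall>q\<in>V. L2_inner \<Omega> (gr e) (gr q) = F q"
proof (rule V_Lax_Milgram[where c = 1 and C = 1])
  show "linear_functional_on V (\<lambda>p. L2_inner \<Omega> (gr p) (gr q))" if "q \<in> V" for q
    by (rule linear_functional_on_V_gr[OF L2.ip_linear[OF V_gr[OF that]]])
  show "\<bar>L2_inner \<Omega> (gr p) (gr q)\<bar> \<le> 1 * N (gr p) * N (gr q)" if "p \<in> V" "q \<in> V" for p q
    using L2.Cauchy_Schwarz[OF V_gr[OF that(1)] V_gr[OF that(2)]] by simp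
  show "1 * (N (gr p))\<^sup>2 \<le> L2_inner \<Omega> (gr p) (gr p)" if "p \<in> V" for p
    by (simp add: L2.nrm_sq[OF V_gr[OF that]])
qed (use F in \<open>auto simp: L2.ip_commute\<close>)

text \<open>The weak solution of \<open>div (a \<nabla>u) = div g\<close>. Every functional on the energy space is the
  pairing with some gradient \<open>g\<close>, so these right-hand sides are general, and having them in
  \<open>L\<^sup>2\<close> makes the solution operator a map between separable Hilbert spaces.\<close>

definition soln :: "(real^'n \<Rightarrow> real^'n^'n) \<Rightarrow> (real^'n \<Rightarrow> real^'n) \<Rightarrow> real^'n \<Rightarrow> real \<times> (real^'n)"
  where "soln a g = (SOME p. p \<in> V \<and> (\<forall>q\<in>V. energy a p q = L2_inner \<Omega> g (gr q)))"

lemma soln: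
  assumes "a \<in> Coeff" "g \<in> L2 \<Omega>"
  shows "soln a g \<in> V" "q \<in> V \<Longrightarrow> energy a (soln a g) q = L2_inner \<Omega> g (gr q)"
proof -
  have "\<exists>p. p \<in> V \<and> (\<forall>q\<in>V. energy a p q = L2_inner \<Omega> g (gr q))"
    using energy_solution[OF assms(1) dualV_gr[OF assms(2)]] by blast
  from someI_ex[OF this] show "soln a g \<in> V" "q \<in> V \<Longrightarrow> energy a (soln a g) q = L2_inner \<Omega> g (gr q)"
    unfolding soln_def by auto
qed

lemma gradient_bound:
  assumes a: "a \<in> Coeff" and g: "g \<in> L2 \<Omega>" and p: "p \<in> V" and eq: "energy a p p = L2_inner \<Omega> g (gr p)"
  shows "N (gr p) \<le> N g / \<mu>0"
proof (cases "N (gr p) = 0")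
  case True
  then show ?thesis using \<mu> L2.nrm_nonneg[OF g] by simp
next
  case False
  have "\<mu>0 * (N (gr p))\<^sup>2 \<le> L2_inner \<Omega> g (gr p)"
    using flux_coercive(1)[OF a V_gr[OF p]] eq by (simp add: energy_def)
  also have "\<dots> \<le> N g * N (gr p)" using L2.Cauchy_Schwarz[OF g V_gr[OF p]] by linarith
  finally have "N (gr p) * (\<mu>0 * N (gr p)) \<le> N (gr p) * N g" by (simp add: power2_eq_square mult_ac)
  moreover have "N (gr p) > 0" using False L2.nrm_nonneg[OF V_gr[OF p]] by simp
  ultimately have "\<mu>0 * N (gr p) \<le> N g" by simp
  then show ?thesis using \<mu> by (simp add: pos_le_divide_eq mult.commute)
qed

lemma soln_bound:
  assumes "a \<in> Coeff" "g \<in> L2 \<Omega>"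
  shows "N (gr (soln a g)) \<le> N g / \<mu>0" "N (flux a (gr (soln a g))) \<le> \<mu>1 / \<mu>0 * N g"
proof -
  show b: "N (gr (soln a g)) \<le> N g / \<mu>0"
    by (rule gradient_bound[OF assms soln(1)[OF assms] soln(2)[OF assms soln(1)[OF assms]]])
  have "N (flux a (gr (soln a g))) \<le> \<mu>1 * N (gr (soln a g))"
    by (rule flux_L2(2)[OF assms(1) V_gr[OF soln(1)[OF assms]]])
  also have "\<dots> \<le> \<mu>1 * (N g / \<mu>0)" using b \<mu> by (intro mult_left_mono) auto
  finally show "N (flux a (gr (soln a g))) \<le> \<mu>1 / \<mu>0 * N g" by simp
qed

lemma energy_unique:
  assumes a: "a \<in> Coeff" and p: "p \<in> V" "q \<in> V" and eq: "\<And>v. v \<in> V \<Longrightarrow> energy a p v = energy a q v"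
  shows "N (gr (p - q)) = 0"
proof -
  have d: "p - q \<in> V" using p by (rule V_diff)
  have "energy a (p - q) (p - q) = energy a p (p - q) - energy a q (p - q)"
    unfolding energy_def by (simp add: gr_diff[of p q] flux_diff L2.ip_diff_left flux_L2[OF a] V_gr p L2.S_diff)
  then have "energy a (p - q) (p - q) = L2_inner \<Omega> 0 (gr (p - q))"
    using eq[OF d] by (simp add: L2_inner_def)
  from gradient_bound[OF a L2.S_0 d this] show ?thesis
    using L2.nrm_nonneg[OF V_gr[OF d]] by (simp add: N_0)
qed

lemma soln_linear:
  assumes a: "a \<in> Coeff" and g: "g \<in> L2 \<Omega>" "h \<in> L2 \<Omega>"
  shows "N (gr (soln a (g + h)) - (gr (soln a g) + gr (soln a h))) = 0"
    and "N (gr (soln a (c *\<^sub>R g)) - c *\<^sub>R gr (soln a g)) = 0"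
proof -
  note s = soln[OF a]
  have "N (gr (soln a (g + h) - (soln a g + soln a h))) = 0"
  proof (rule energy_unique[OF a])
    show "energy a (soln a (g + h)) v = energy a (soln a g + soln a h) v" if v: "v \<in> V" for v
    proof -
      have "energy a (soln a g + soln a h) v = energy a (soln a g) v + energy a (soln a h) v"
        unfolding energy_def by (simp add: gr_add flux_add L2.ip_add_left flux_L2[OF a] V_gr s(1) g v)
      then show ?thesis using v g by (simp add: s(2) L2.S_add L2.ip_add_left V_gr)
    qed
  qed (intro s V_add L2.S_add g)+
  then show "N (gr (soln a (g + h)) - (gr (soln a g) + gr (soln a h))) = 0" by (simp add: gr_diff gr_add)
  have "N (gr (soln a (c *\<^sub>R g) - c *\<^sub>R soln a g)) = 0"
  proof (rule energy_unique[OF a])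
    show "energy a (soln a (c *\<^sub>R g)) v = energy a (c *\<^sub>R soln a g) v" if v: "v \<in> V" for v
    proof -
      have "energy a (c *\<^sub>R soln a g) v = c * energy a (soln a g) v"
        unfolding energy_def by (simp add: gr_scale flux_scale L2.ip_scale_left flux_L2[OF a] V_gr s(1) g v)
      then show ?thesis using v g by (simp add: s(2) L2.S_scale L2.ip_scale_left V_gr)
    qed
  qed (intro s V_scale L2.S_scale g)+
  then show "N (gr (soln a (c *\<^sub>R g)) - c *\<^sub>R gr (soln a g)) = 0" by (simp add: gr_diff gr_scale)
qed

text \<open>Solutions are chosen representatives, so the gradient of the solution is linear in \<open>g\<close>
  only up to null functions; a bounded functional does not see them.\<close>

lemma linear_in_data:
  assumes a: "a \<in> Coeff"
    and lin: "linear_functional_on (L2 \<Omega>) L" and bd: "\<And>u. u \<in> L2 \<Omega> \<Longrightarrow> \<bar>L u\<bar> \<le> C * N u"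
  shows "linear_functional_on (L2 \<Omega>) (\<lambda>g. L (gr (soln a g)))"
proof -
  have cong: "L u = L v" if "u \<in> L2 \<Omega>" "v \<in> L2 \<Omega>" "N (u - v) = 0" for u v
    using bd[OF L2.S_diff[OF that(1,2)]] that(3) linear_functional_onD(3)[OF lin subspace_L2 that(1,2)] by simp
  note s = V_gr[OF soln(1)[OF a]]
  show ?thesis
  proof (rule linear_functional_onI)
    fix g h :: "real^'n \<Rightarrow> real^'n" assume gh: "g \<in> L2 \<Omega>" "h \<in> L2 \<Omega>"
    have "L (gr (soln a (g + h))) = L (gr (soln a g) + gr (soln a h))"
      by (intro cong s L2.S_add gh soln_linear(1)[OF a gh])
    then show "L (gr (soln a (g + h))) = L (gr (soln a g)) + L (gr (soln a h))"
      using linear_functional_onD(1)[OF lin subspace_L2 s[OF gh(1)] s[OF gh(2)]] by simp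
  next
    fix g :: "real^'n \<Rightarrow> real^'n" and c assume g: "g \<in> L2 \<Omega>"
    have "L (gr (soln a (c *\<^sub>R g))) = L (c *\<^sub>R gr (soln a g))"
      by (intro cong s L2.S_scale g soln_linear(2)[OF a g g])
    then show "L (gr (soln a (c *\<^sub>R g))) = c * L (gr (soln a g))"
      using linear_functional_onD(2)[OF lin subspace_L2 s[OF g] s[OF g]] by simp
  qed
qed

section \<open>Weakly convergent subsequences\<close>

lemma converge_on_L2:
  fixes f :: "nat \<Rightarrow> (real^'n \<Rightarrow> 'b::euclidean_space) \<Rightarrow> real"
  assumes "\<And>k. linear_functional_on (L2 \<Omega>) (f k)" "\<And>k u. u \<in> L2 \<Omega> \<Longrightarrow> \<bar>f k u\<bar> \<le> C * N u"
    "\<And>d. d \<in> L2_probes \<Longrightarrow> convergent (\<lambda>k. f k d)" "h \<in> L2 \<Omega>"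
  shows "convergent (\<lambda>k. f k h)"
proof (rule semi_hilbert_space.functionals_converge_on_whole[OF L2_hilbert, where D = L2_probes and f = f and C = C, unfolded nrm_L2])
  show "L2_probes \<subseteq> (L2 \<Omega> :: (real^'n \<Rightarrow> 'b) set)" using L2_probes_L2(1)[OF lmeasurable_\<Omega>] by blast
  show "N w = 0" if "w \<in> L2 \<Omega>" "\<And>d. d \<in> L2_probes \<Longrightarrow> L2_inner \<Omega> w d = 0" for w :: "real^'n \<Rightarrow> 'b"
    by (rule L2_probes_separating[OF open_\<Omega> lmeasurable_\<Omega> that])
qed (use assms in auto)

text \<open>A diagonal subsequence settles the countably many pairs of an index and a probe; uniform
  boundedness extends the convergence from probes to all of \<open>L2\<close>.\<close>

lemma extraction:
  fixes f :: "nat \<Rightarrow> 't \<Rightarrow> (real^'n \<Rightarrow> 'b::euclidean_space) \<Rightarrow> real"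
  assumes T: "countable T"
    and lin: "\<And>k t. t \<in> T \<Longrightarrow> linear_functional_on (L2 \<Omega>) (f k t)"
    and bd: "\<And>k t u. t \<in> T \<Longrightarrow> u \<in> L2 \<Omega> \<Longrightarrow> \<bar>f k t u\<bar> \<le> C * N u"
  obtains r where "strict_mono (r :: nat \<Rightarrow> nat)" "\<And>t h. t \<in> T \<Longrightarrow> h \<in> L2 \<Omega> \<Longrightarrow> convergent (\<lambda>k. f (r k) t h)"
proof -
  let ?S = "T \<times> (L2_probes :: (real^'n \<Rightarrow> 'b) set)"
  have S: "countable ?S" by (intro countable_SIGMA T countable_L2_probes)
  have bound: "norm (case_prod (f k) x) \<le> \<bar>C\<bar> * sqrt (measure lebesgue \<Omega>)" if x: "x \<in> ?S" for k x
  proof -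
    obtain t d where td: "x = (t, d)" "t \<in> T" "d \<in> L2_probes" using x by blast
    note d = L2_probes_L2[OF lmeasurable_\<Omega> td(3)]
    have "\<bar>f k t d\<bar> \<le> C * N d" by (rule bd[OF td(2) d(1)])
    also have "\<dots> \<le> \<bar>C\<bar> * N d" by (intro mult_right_mono L2.nrm_nonneg d) simp
    also have "\<dots> \<le> \<bar>C\<bar> * sqrt (measure lebesgue \<Omega>)" by (intro mult_left_mono d) simp
    finally show ?thesis by (simp add: td(1))
  qed
  obtain r where r: "strict_mono (r :: nat \<Rightarrow> nat)" "\<And>x. x \<in> ?S \<Longrightarrow> \<exists>l. (\<lambda>k. case_prod (f (r k)) x) \<longlonglongrightarrow> l"
    by (rule function_convergent_subsequence[where f = "\<lambda>k. case_prod (f k)", OF S], rule bound, assumption, rule that)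
  show ?thesis
  proof (rule that[OF r(1)])
    fix t and h :: "real^'n \<Rightarrow> 'b" assume t: "t \<in> T" and h: "h \<in> L2 \<Omega>"
    show "convergent (\<lambda>k. f (r k) t h)"
    proof (rule converge_on_L2[OF lin[OF t] bd[OF t] _ h])
      show "convergent (\<lambda>k. f (r k) t d)" if "d \<in> L2_probes" for d
        using r(2)[of "(t, d)"] t that by (simp add: convergent_def)
    qed
  qed
qed

text \<open>Each functional on the energy space is the pairing with the gradient of some element, so
  convergence of gradients tested in \<open>L\<^sup>2\<close> already determines it.\<close>

lemma weak_limit_V:
  assumes p: "\<And>k. p k \<in> V" and B: "\<And>k. N (gr (p k)) \<le> B"
    and conv: "\<And>h. h \<in> L2 \<Omega> \<Longrightarrow> convergent (\<lambda>k. L2_inner \<Omega> (gr (p k)) h)"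
  shows "\<exists>w\<in>V. \<forall>F. dualV F \<longrightarrow> (\<lambda>k. F (p k)) \<longlonglongrightarrow> F w"
proof -
  have cF: "convergent (\<lambda>k. F (p k))" if F: "dualV F" for F
  proof -
    obtain e where e: "e \<in> V" "\<forall>q\<in>V. L2_inner \<Omega> (gr e) (gr q) = F q" using Riesz_gradient[OF F] by blast
    have "F (p k) = L2_inner \<Omega> (gr (p k)) (gr e)" for k
      by (rule trans[OF bspec[OF e(2) p, symmetric] L2.ip_commute])
    then show ?thesis using conv[OF V_gr[OF e(1)]] by simp
  qed
  have "\<exists>w\<in>V. \<forall>h\<in>V. L2_inner \<Omega> (gr w) (gr h) = lim (\<lambda>k. L2_inner \<Omega> (gr (p k)) (gr h))"
  proof (rule Riesz_gradient)
    have L: "(\<lambda>k. L2_inner \<Omega> (gr (p k)) (gr h)) \<longlonglongrightarrow> lim (\<lambda>k. L2_inner \<Omega> (gr (p k)) (gr h))" if "h \<in> V" for h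
      using conv[OF V_gr[OF that]] by (simp add: convergent_LIMSEQ_iff)
    show "dualV (\<lambda>h. lim (\<lambda>k. L2_inner \<Omega> (gr (p k)) (gr h)))"
    proof (rule dualVI)
      show "linear_functional_on V (\<lambda>h. lim (\<lambda>k. L2_inner \<Omega> (gr (p k)) (gr h)))"
        by (rule linear_functional_on_limit[where f = "\<lambda>k h. L2_inner \<Omega> (gr (p k)) (gr h)"])
           (use L subspace_V linear_functional_on_V_gr[OF linear_inner_right[OF V_gr[OF p]]] in auto)
      fix h assume h: "h \<in> V"
      have "\<bar>L2_inner \<Omega> (gr (p k)) (gr h)\<bar> \<le> B * N h" for k
      proof -
        have "\<bar>L2_inner \<Omega> (gr (p k)) (gr h)\<bar> \<le> N (gr (p k)) * N (gr h)"
          by (rule L2.Cauchy_Schwarz[OF V_gr[OF p] V_gr[OF h]])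
        also have "\<dots> \<le> B * N h"
          using order_trans[OF L2.nrm_nonneg[OF V_gr[OF p]] B]
          by (intro mult_mono B L2_gr V_L2[OF h] L2.nrm_nonneg V_gr[OF h])
        finally show ?thesis .
      qed
      then show "\<bar>lim (\<lambda>k. L2_inner \<Omega> (gr (p k)) (gr h))\<bar> \<le> B * N h"
        by (intro LIMSEQ_le_const2[OF tendsto_rabs[OF L[OF h]]]) blast
    qed
  qed
  then obtain w where w: "w \<in> V" "\<And>h. h \<in> V \<Longrightarrow> L2_inner \<Omega> (gr w) (gr h) = lim (\<lambda>k. L2_inner \<Omega> (gr (p k)) (gr h))"
    by blast
  have "(\<lambda>k. F (p k)) \<longlonglongrightarrow> F w" if F: "dualV F" for F
  proof -
    obtain e where e: "e \<in> V" "\<forall>q\<in>V. L2_inner \<Omega> (gr e) (gr q) = F q" using Riesz_gradient[OF F] by blast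
    have eq: "F (p k) = L2_inner \<Omega> (gr (p k)) (gr e)" for k
      by (rule trans[OF bspec[OF e(2) p, symmetric] L2.ip_commute])
    have "F w = L2_inner \<Omega> (gr w) (gr e)"
      by (rule trans[OF bspec[OF e(2) w(1), symmetric] L2.ip_commute])
    also have "\<dots> = lim (\<lambda>k. F (p k))" unfolding eq by (rule w(2)[OF e(1)])
    finally show ?thesis using cF[OF F] by (simp add: convergent_LIMSEQ_iff)
  qed
  with w(1) show ?thesis by blast
qed

lemma weak_compactness_V:
  assumes p: "\<And>k. p k \<in> V" and B: "\<And>k. N (gr (p k)) \<le> B"
  obtains r w where "strict_mono (r :: nat \<Rightarrow> nat)" "w \<in> V" "\<And>F. dualV F \<Longrightarrow> (\<lambda>k. F (p (r k))) \<longlonglongrightarrow> F w"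
proof -
  obtain r where r: "strict_mono (r :: nat \<Rightarrow> nat)"
      "\<And>t h. t \<in> {()} \<Longrightarrow> h \<in> L2 \<Omega> \<Longrightarrow> convergent (\<lambda>k. L2_inner \<Omega> (gr (p (r k))) h)"
  proof (rule extraction[of "{()}" "\<lambda>k t h. L2_inner \<Omega> (gr (p k)) h" B])
    show "\<bar>L2_inner \<Omega> (gr (p k)) u\<bar> \<le> B * N u" if "u \<in> L2 \<Omega>" for k u
      using L2.Cauchy_Schwarz[OF V_gr[OF p] that, of k] mult_right_mono[OF B L2.nrm_nonneg[OF that], of k] by linarith
  qed (use linear_inner_right[OF V_gr[OF p]] in auto)
  have "\<exists>w\<in>V. \<forall>F. dualV F \<longrightarrow> (\<lambda>k. F (p (r k))) \<longlonglongrightarrow> F w"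
    by (rule weak_limit_V[OF p B]) (use r(2) in blast)
  then show ?thesis using r(1) that by blast
qed

end

section \<open>Compensated compactness\<close>

context bounded_open_set
begin

definition times_jet :: "(real^'n \<Rightarrow> real) \<Rightarrow> (real^'n \<Rightarrow> real \<times> (real^'n)) \<Rightarrow> real^'n \<Rightarrow> real \<times> (real^'n)"
  where "times_jet \<psi> p = jet (\<lambda>x. \<psi> x * val p x) (\<lambda>x. \<psi> x *\<^sub>R gr p x + val p x *\<^sub>R grad \<psi> x)"

lemma times_jet_add: "times_jet \<psi> (p + q) = times_jet \<psi> p + times_jet \<psi> q"
  and times_jet_diff: "times_jet \<psi> (p - q) = times_jet \<psi> p - times_jet \<psi> q"
  and times_jet_scale: "times_jet \<psi> (c *\<^sub>R p) = c *\<^sub>R times_jet \<psi> p"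
  by (auto simp: times_jet_def jet_def val_def gr_def fun_eq_iff algebra_simps)

lemma times_jet_test:
  "smooth \<psi> \<Longrightarrow> smooth \<phi> \<Longrightarrow> times_jet \<psi> (test_jet \<phi>) = test_jet (\<lambda>x. \<psi> x * \<phi> x)"
  by (auto simp: times_jet_def jet_def val_def gr_def fun_eq_iff grad_mult)

lemma times_jet_bound:
  assumes \<psi>: "test_function \<Omega>' \<psi>"
  obtains C where "0 \<le> C" "\<And>p. p \<in> L2 \<Omega> \<Longrightarrow> times_jet \<psi> p \<in> L2 \<Omega> \<and> N (times_jet \<psi> p) \<le> C * N p"
proof -
  obtain B where B: "B > 0" "\<And>x. norm (\<psi> x) \<le> B" by (rule test_function_bounded[OF \<psi>]) (rule that)
  obtain B' where B': "B' > 0" "\<And>x. norm (grad \<psi> x) \<le> B'" by (rule test_function_grad_bounded[OF \<psi>]) (rule that)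
  have "times_jet \<psi> p \<in> L2 \<Omega> \<and> N (times_jet \<psi> p) \<le> (2 * B + B') * N p" if p: "p \<in> L2 \<Omega>" for p
  proof -
    note m = L2_measurable[OF L2_val(1)[OF p]] L2_measurable[OF L2_gr(1)[OF p]] test_function_measurable[OF \<psi>, of \<Omega>]
      continuous_measurable_lebesgue_on[OF smooth_continuous_grad[OF test_function_smooth[OF \<psi>]], of \<Omega>]
    have meas: "times_jet \<psi> p \<in> borel_measurable (lebesgue_on \<Omega>)"
      unfolding times_jet_def using m
      by (intro jet_measurable borel_measurable_times borel_measurable_add borel_measurable_scaleR) auto
    have "norm (times_jet \<psi> p x) \<le> (2 * B + B') * norm (p x)" for x
    proof -
      have v: "norm (val p x) \<le> norm (p x)" and g: "norm (gr p x) \<le> norm (p x)"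
        using norm_fst_le[of "fst (p x)" "snd (p x)"] norm_snd_le[of "snd (p x)" "fst (p x)"] by (simp_all add: val_def gr_def)
      have "norm (times_jet \<psi> p x) \<le> norm (\<psi> x * val p x) + norm (\<psi> x *\<^sub>R gr p x + val p x *\<^sub>R grad \<psi> x)"
        unfolding times_jet_def jet_def by (rule norm_Pair_le)
      also have "\<dots> \<le> norm (\<psi> x * val p x) + (norm (\<psi> x *\<^sub>R gr p x) + norm (val p x *\<^sub>R grad \<psi> x))"
        by (intro add_left_mono norm_triangle_ineq)
      also have "\<dots> = norm (\<psi> x) * norm (val p x) + (norm (\<psi> x) * norm (gr p x) + norm (val p x) * norm (grad \<psi> x))"
        by (simp add: abs_mult)
      also have "\<dots> \<le> B * norm (p x) + (B * norm (p x) + norm (p x) * B')"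
        using B B' v g by (intro add_mono mult_mono) auto
      also have "\<dots> = (2 * B + B') * norm (p x)" by (simp add: algebra_simps)
      finally show ?thesis .
    qed
    then show ?thesis using L2_dominated[OF meas p, of "2 * B + B'"] B(1) B'(1) by simp
  qed
  then show ?thesis using B(1) B'(1) by (intro that[of "2 * B + B'"]) auto
qed

lemma times_jet_V:
  assumes \<psi>: "test_function \<Omega> \<psi>" and p: "p \<in> V"
  shows "times_jet \<psi> p \<in> V"
proof -
  obtain C where C: "0 \<le> C" "\<And>p. p \<in> L2 \<Omega> \<Longrightarrow> times_jet \<psi> p \<in> L2 \<Omega> \<and> N (times_jet \<psi> p) \<le> C * N p"
    by (rule times_jet_bound[OF \<psi>]) (rule that)
  obtain \<phi> where \<phi>: "\<And>k. test_function \<Omega> (\<phi> k)" "\<And>k. N (p - test_jet (\<phi> k)) < 1 / real (Suc k)"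
    by (rule V_approx_seq[OF p]) (rule that)
  note pL = V_L2[OF p] and tL = test_jet_L2[OF \<phi>(1)]
  have eq: "times_jet \<psi> (test_jet (\<phi> k)) = test_jet (\<lambda>x. \<psi> x * \<phi> k x)" for k
    by (rule times_jet_test[OF test_function_smooth[OF \<psi>] test_function_smooth[OF \<phi>(1)]])
  show ?thesis
  proof (rule V_closed)
    show "times_jet \<psi> (test_jet (\<phi> k)) \<in> V" for k
      unfolding eq by (intro test_jet_V test_function_mult test_function_smooth[OF \<psi>] \<phi>)
    show "times_jet \<psi> p \<in> L2 \<Omega>" using C(2)[OF pL] by simp
    have lim: "(\<lambda>k. C * (1 / real (Suc k))) \<longlonglongrightarrow> 0"
      using tendsto_mult[OF tendsto_const[of C] LIMSEQ_Suc[OF lim_1_over_n]] by simp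
    show "(\<lambda>k. N (times_jet \<psi> (test_jet (\<phi> k)) - times_jet \<psi> p)) \<longlonglongrightarrow> 0"
    proof (rule tendsto_sandwich[OF _ _ tendsto_const lim])
      have "N (times_jet \<psi> (test_jet (\<phi> k)) - times_jet \<psi> p) \<le> C * (1 / real (Suc k))" for k
      proof -
        have "N (times_jet \<psi> (test_jet (\<phi> k)) - times_jet \<psi> p) \<le> C * N (test_jet (\<phi> k) - p)"
          using C(2)[OF L2.S_diff[OF tL pL]] by (simp add: times_jet_diff)
        also have "N (test_jet (\<phi> k) - p) = N (p - test_jet (\<phi> k))" by (rule L2.nrm_diff_commute[OF tL pL])
        also have "C * N (p - test_jet (\<phi> k)) \<le> C * (1 / real (Suc k))"
          using \<phi>(2)[of k] C(1) by (intro mult_left_mono) auto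
        finally show ?thesis .
      qed
      then show "\<forall>\<^sub>F k in sequentially. N (times_jet \<psi> (test_jet (\<phi> k)) - times_jet \<psi> p) \<le> C * (1 / real (Suc k))"
        by (intro always_eventually allI)
      show "\<forall>\<^sub>F k in sequentially. 0 \<le> N (times_jet \<psi> (test_jet (\<phi> k)) - times_jet \<psi> p)"
        using C(2) pL tL by (intro always_eventually allI L2.nrm_nonneg L2.S_diff) blast+
    qed
  qed
qed

text \<open>The part of the gradient of a product that involves the function but not its gradient, and
  therefore converges strongly where gradients converge only weakly.\<close>

definition cutoff_term :: "(real^'n \<Rightarrow> real) \<Rightarrow> (real^'n \<Rightarrow> real) \<Rightarrow> real^'n \<Rightarrow> real^'n"
  where "cutoff_term \<psi> u x = u x *\<^sub>R grad \<psi> x"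

lemma cutoff_term_diff: "cutoff_term \<psi> (u - v) = cutoff_term \<psi> u - cutoff_term \<psi> v"
  by (auto simp: cutoff_term_def fun_eq_iff algebra_simps)

lemma cutoff_term_L2:
  assumes "test_function \<Omega>' \<psi>" "u \<in> L2 \<Omega>" "0 \<le> B" "\<And>x. norm (grad \<psi> x) \<le> B"
  shows "cutoff_term \<psi> u \<in> L2 \<Omega>" "N (cutoff_term \<psi> u) \<le> B * N u"
proof -
  have m: "cutoff_term \<psi> u \<in> borel_measurable (lebesgue_on \<Omega>)"
    unfolding cutoff_term_def[abs_def]
    by (intro borel_measurable_scaleR L2_measurable[OF assms(2)] continuous_measurable_lebesgue_on
        smooth_continuous_grad test_function_smooth[OF assms(1)])
  have b: "norm (cutoff_term \<psi> u x) \<le> B * norm (u x)" for x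
    using mult_left_mono[OF assms(4)[of x], of "\<bar>u x\<bar>"] by (simp add: cutoff_term_def mult.commute)
  show "cutoff_term \<psi> u \<in> L2 \<Omega>" "N (cutoff_term \<psi> u) \<le> B * N u"
    using L2_dominated[OF m assms(2,3) b] by auto
qed

lemma weighted_integrable:
  assumes "test_function \<Omega>' \<psi>" "s \<in> L2 \<Omega>" "g \<in> L2 \<Omega>"
  shows "integrable (lebesgue_on \<Omega>) (\<lambda>x. \<psi> x * (s x \<bullet> g x))"
proof -
  obtain B where B: "B > 0" "\<And>x. norm (\<psi> x) \<le> B" by (rule test_function_bounded[OF assms(1)]) (rule that)
  have "integrable (lebesgue_on \<Omega>) (\<lambda>x. (s x \<bullet> g x) * \<psi> x)"
    by (rule integrable_times_bounded[OF L2_inner_integrable[OF assms(2,3)] test_function_measurable[OF assms(1)] B(2)])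
  then show ?thesis by (simp add: mult.commute)
qed

lemma weighted_inner_eq:
  assumes \<psi>: "test_function \<Omega> \<psi>" and s: "s \<in> L2 \<Omega>" and q: "q \<in> V"
  shows "(LINT x|lebesgue_on \<Omega>. \<psi> x * (s x \<bullet> gr q x)) = L2_inner \<Omega> s (gr (times_jet \<psi> q)) - L2_inner \<Omega> s (cutoff_term \<psi> (val q))"
proof -
  obtain B' where B': "B' > 0" "\<And>x. norm (grad \<psi> x) \<le> B'" by (rule test_function_grad_bounded[OF \<psi>]) (rule that)
  have E: "cutoff_term \<psi> (val q) \<in> L2 \<Omega>"
    by (rule cutoff_term_L2(1)[OF \<psi> L2_val(1)[OF V_L2[OF q]], of B']) (use B' in auto)
  have G: "gr (times_jet \<psi> q) \<in> L2 \<Omega>" by (rule L2_gr(1)[OF V_L2[OF times_jet_V[OF \<psi> q]]])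
  have "L2_inner \<Omega> s (gr (times_jet \<psi> q)) - L2_inner \<Omega> s (cutoff_term \<psi> (val q))
      = (LINT x|lebesgue_on \<Omega>. s x \<bullet> gr (times_jet \<psi> q) x - s x \<bullet> cutoff_term \<psi> (val q) x)"
    unfolding L2_inner_def by (rule Bochner_Integration.integral_diff[symmetric, OF L2_inner_integrable[OF s G] L2_inner_integrable[OF s E]])
  also have "(\<lambda>x. s x \<bullet> gr (times_jet \<psi> q) x - s x \<bullet> cutoff_term \<psi> (val q) x) = (\<lambda>x. \<psi> x * (s x \<bullet> gr q x))"
    by (simp add: times_jet_def cutoff_term_def fun_eq_iff inner_add_right)
  finally show ?thesis by simp
qed

lemma V_norm_le: "\<exists>D>0. \<forall>p\<in>V. N p \<le> D * N (gr p)"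
proof -
  obtain D where D: "D > 0" "\<And>p. p \<in> V \<Longrightarrow> N (val p) \<le> D * N (gr p)" using Poincare by blast
  have "N p \<le> (D + 1) * N (gr p)" if p: "p \<in> V" for p
  proof -
    have n: "0 \<le> N (val p)" "0 \<le> N (gr p)" using L2.nrm_nonneg L2_val(1) L2_gr(1) V_L2[OF p] by blast+
    have "(N p)\<^sup>2 = (N (val p))\<^sup>2 + (N (gr p))\<^sup>2" by (rule L2_norm_val_gr[OF V_L2[OF p]])
    also have "\<dots> \<le> (N (val p) + N (gr p))\<^sup>2" using n by (simp add: power2_sum)
    finally have "N p \<le> N (val p) + N (gr p)" by (rule power2_le_imp_le) (use n in simp)
    then show ?thesis using D(2)[OF p] by (simp add: algebra_simps)
  qed
  then show ?thesis using D(1) by (intro exI[of _ "D + 1"]) auto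
qed

end

text \<open>A sequence of coefficients for which all solutions and all fluxes converge weakly. \<open>U\<close> and
  \<open>Sig\<close> send the data \<open>g\<close> to the limit solution and to the limit flux; the relation between
  the two is to be found.\<close>

locale limit_data = elliptic \<Omega> \<mu>0 \<mu>1 for \<Omega> :: "(real^'n) set" and \<mu>0 \<mu>1 :: real +
  fixes as :: "nat \<Rightarrow> real^'n \<Rightarrow> real^'n^'n"
    and U :: "(real^'n \<Rightarrow> real^'n) \<Rightarrow> real^'n \<Rightarrow> real \<times> (real^'n)"
    and Sig :: "(real^'n \<Rightarrow> real^'n) \<Rightarrow> real^'n \<Rightarrow> real^'n"
  assumes as: "as k \<in> coeff_fields \<Omega> \<mu>0 \<mu>1"
    and U: "g \<in> L2 \<Omega> \<Longrightarrow> U g \<in> V"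
    and U_lim: "g \<in> L2 \<Omega> \<Longrightarrow> dualV F \<Longrightarrow> (\<lambda>k. F (soln (as k) g)) \<longlonglongrightarrow> F (U g)"
    and Sig: "g \<in> L2 \<Omega> \<Longrightarrow> Sig g \<in> L2 \<Omega>"
    and Sig_lim: "g \<in> L2 \<Omega> \<Longrightarrow> h \<in> L2 \<Omega> \<Longrightarrow>
      (\<lambda>k. L2_inner \<Omega> (flux (as k) (gr (soln (as k) g))) h) \<longlonglongrightarrow> L2_inner \<Omega> (Sig g) h"
begin

abbreviation "P k g \<equiv> gr (soln (as k) g)"
abbreviation "S k g \<equiv> flux (as k) (P k g)"

lemma P_L2: "g \<in> L2 \<Omega> \<Longrightarrow> P k g \<in> L2 \<Omega>" and S_L2: "g \<in> L2 \<Omega> \<Longrightarrow> S k g \<in> L2 \<Omega>"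
  and GU_L2: "g \<in> L2 \<Omega> \<Longrightarrow> gr (U g) \<in> L2 \<Omega>"
  by (auto intro!: V_gr soln as flux_L2 U)

lemma P_lim: assumes "g \<in> L2 \<Omega>" "h \<in> L2 \<Omega>"
  shows "(\<lambda>k. L2_inner \<Omega> (P k g) h) \<longlonglongrightarrow> L2_inner \<Omega> (gr (U g)) h"
  using U_lim[OF assms(1) dualV_gr[OF assms(2)]]
  unfolding L2.ip_commute[of \<Omega> h "gr (U g)"] L2.ip_commute[of \<Omega> h "gr (soln _ g)"] .

lemma Sig_equation: assumes g: "g \<in> L2 \<Omega>" and q: "q \<in> V"
  shows "L2_inner \<Omega> (Sig g) (gr q) = L2_inner \<Omega> g (gr q)"
proof -
  have "L2_inner \<Omega> (S k g) (gr q) = L2_inner \<Omega> g (gr q)" for k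
    using soln(2)[OF as g q] by (simp add: energy_def)
  then show ?thesis using Sig_lim[OF g V_gr[OF q]] by (simp add: LIMSEQ_const_iff)
qed

text \<open>Both factors converge only weakly. Moving the test function onto the solution rewrites
  \<open>\<psi> S \<bullet> \<nabla>u\<close> as \<open>S \<bullet> \<nabla>(\<psi> u) - S \<bullet> u \<nabla>\<psi>\<close>. In the first term the equation replaces the flux by
  the fixed \<open>g\<close>, and in the second \<open>u\<close> converges strongly by Rellich's theorem.\<close>

lemma product_limit:
  assumes g: "g \<in> L2 \<Omega>" and h: "h \<in> L2 \<Omega>" and \<psi>: "test_function \<Omega> \<psi>"
  shows "(\<lambda>k. LINT x|lebesgue_on \<Omega>. \<psi> x * (S k g x \<bullet> P k h x))
      \<longlonglongrightarrow> (LINT x|lebesgue_on \<Omega>. \<psi> x * (Sig g x \<bullet> gr (U h) x))"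
proof -
  obtain B where B: "B > 0" "\<And>x. norm (grad \<psi> x) \<le> B" by (rule test_function_grad_bounded[OF \<psi>]) (rule that)
  obtain C where C: "0 \<le> C" "\<And>p. p \<in> L2 \<Omega> \<Longrightarrow> times_jet \<psi> p \<in> L2 \<Omega> \<and> N (times_jet \<psi> p) \<le> C * N p"
    by (rule times_jet_bound[OF \<psi>]) (rule that)
  obtain D where D: "D > 0" "\<And>p. p \<in> V \<Longrightarrow> N p \<le> D * N (gr p)" using V_norm_le by blast
  let ?q = "\<lambda>k. soln (as k) h"
  have q: "?q k \<in> V" for k by (rule soln(1)[OF as h])
  note Uh = U[OF h]
  have cL: "cutoff_term \<psi> u \<in> L2 \<Omega>" "N (cutoff_term \<psi> u) \<le> B * N u" if "u \<in> L2 \<Omega>" for u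
    using cutoff_term_L2[OF \<psi> that _ B(2)] B(1) by auto
  have first: "(\<lambda>k. L2_inner \<Omega> (S k g) (gr (times_jet \<psi> (?q k)))) \<longlonglongrightarrow> L2_inner \<Omega> (Sig g) (gr (times_jet \<psi> (U h)))"
  proof -
    have eq: "L2_inner \<Omega> (S k g) (gr (times_jet \<psi> (?q k))) = L2_inner \<Omega> g (gr (times_jet \<psi> (?q k)))" for k
      using soln(2)[OF as g times_jet_V[OF \<psi> q]] by (simp add: energy_def)
    have "dualV (\<lambda>p. L2_inner \<Omega> g (gr (times_jet \<psi> p)))"
    proof (rule dualVI)
      show "linear_functional_on V (\<lambda>p. L2_inner \<Omega> g (gr (times_jet \<psi> p)))"
      proof (rule linear_functional_onI)
        fix p p' assume "p \<in> V" "p' \<in> V"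
        then show "L2_inner \<Omega> g (gr (times_jet \<psi> (p + p'))) = L2_inner \<Omega> g (gr (times_jet \<psi> p)) + L2_inner \<Omega> g (gr (times_jet \<psi> p'))"
          by (simp add: times_jet_add gr_add L2.ip_add_right V_gr times_jet_V \<psi> g)
      next
        fix p c assume "p \<in> V"
        then show "L2_inner \<Omega> g (gr (times_jet \<psi> (c *\<^sub>R p))) = c * L2_inner \<Omega> g (gr (times_jet \<psi> p))"
          by (simp add: times_jet_scale gr_scale L2.ip_scale_right V_gr times_jet_V \<psi> g)
      qed
      fix p assume p: "p \<in> V"
      have "\<bar>L2_inner \<Omega> g (gr (times_jet \<psi> p))\<bar> \<le> N g * N (gr (times_jet \<psi> p))"
        by (rule L2.Cauchy_Schwarz[OF g V_gr[OF times_jet_V[OF \<psi> p]]])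
      also have "\<dots> \<le> N g * (C * N p)"
        using C(2)[OF V_L2[OF p]] L2_gr(2)[OF V_L2[OF times_jet_V[OF \<psi> p]]]
        by (intro mult_left_mono L2.nrm_nonneg g) linarith
      finally show "\<bar>L2_inner \<Omega> g (gr (times_jet \<psi> p))\<bar> \<le> (N g * C) * N p" by simp
    qed
    from U_lim[OF h this] show ?thesis
      unfolding eq Sig_equation[OF g times_jet_V[OF \<psi> Uh]] .
  qed
  have strong: "(\<lambda>k. N (val (?q k - U h))) \<longlonglongrightarrow> 0"
  proof (rule Rellich)
    show "?q k - U h \<in> V" for k by (rule V_diff[OF q Uh])
    show "N (?q k - U h) \<le> D * (N h / \<mu>0 + N (gr (U h)))" for k
    proof -
      have "N (?q k - U h) \<le> D * N (gr (?q k - U h))" by (rule D(2)[OF V_diff[OF q Uh]])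
      also have "N (gr (?q k - U h)) \<le> N (gr (?q k)) + N (gr (U h))"
        using L2.nrm_triangle[OF V_gr[OF q] L2.S_scale[OF V_gr[OF Uh]], of k "-1"] L2.nrm_minus[OF V_gr[OF Uh]]
        by (simp add: gr_diff)
      also have "\<dots> \<le> N h / \<mu>0 + N (gr (U h))" using soln_bound(1)[OF as h] by simp
      finally show ?thesis using D(1) by simp
    qed
    fix v :: "real^'n \<Rightarrow> real" assume v: "v \<in> L2 \<Omega>"
    have "(\<lambda>k. L2_inner \<Omega> v (val (?q k)) - L2_inner \<Omega> v (val (U h))) \<longlonglongrightarrow> 0"
      using U_lim[OF h dualV_val[OF v]] by (rule LIM_zero)
    moreover have "L2_inner \<Omega> (val (?q k - U h)) v = L2_inner \<Omega> v (val (?q k)) - L2_inner \<Omega> v (val (U h))" for k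
      unfolding val_diff L2.ip_commute[of \<Omega> _ v] by (rule L2.ip_diff_right[OF V_val[OF q] V_val[OF Uh] v])
    ultimately show "(\<lambda>k. L2_inner \<Omega> (val (?q k - U h)) v) \<longlonglongrightarrow> 0" by simp
  qed
  have second: "(\<lambda>k. L2_inner \<Omega> (S k g) (cutoff_term \<psi> (val (?q k)))) \<longlonglongrightarrow> L2_inner \<Omega> (Sig g) (cutoff_term \<psi> (val (U h)))"
  proof -
    define K where "K = \<mu>1 / \<mu>0 * N g"
    have K: "N (S k g) \<le> K" for k unfolding K_def by (rule soln_bound(2)[OF as g])
    have "(\<lambda>k. L2_inner \<Omega> (S k g) (cutoff_term \<psi> (val (?q k - U h)))) \<longlonglongrightarrow> 0"
    proof (rule Lim_null_comparison)
      have "norm (L2_inner \<Omega> (S k g) (cutoff_term \<psi> (val (?q k - U h)))) \<le> (K * B) * N (val (?q k - U h))" for k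
      proof -
        note vL = V_val[OF V_diff[OF q Uh]]
        have "\<bar>L2_inner \<Omega> (S k g) (cutoff_term \<psi> (val (?q k - U h)))\<bar> \<le> N (S k g) * N (cutoff_term \<psi> (val (?q k - U h)))"
          by (rule L2.Cauchy_Schwarz[OF S_L2[OF g] cL(1)[OF vL]])
        also have "\<dots> \<le> K * (B * N (val (?q k - U h)))"
          by (intro mult_mono K cL(2) vL order_trans[OF L2.nrm_nonneg[OF S_L2[OF g]] K] L2.nrm_nonneg cL(1))
        finally show ?thesis by (simp add: mult.assoc)
      qed
      then show "\<forall>\<^sub>F k in sequentially. norm (L2_inner \<Omega> (S k g) (cutoff_term \<psi> (val (?q k - U h)))) \<le> (K * B) * N (val (?q k - U h))"
        by (intro always_eventually allI)
      show "(\<lambda>k. (K * B) * N (val (?q k - U h))) \<longlonglongrightarrow> 0"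
        using tendsto_mult[OF tendsto_const[of "K * B"] strong] by simp
    qed
    from tendsto_add[OF this Sig_lim[OF g cL(1)[OF V_val[OF Uh]]]] show ?thesis
      by (simp add: val_diff cutoff_term_diff L2.ip_diff_right[OF cL(1)[OF V_val[OF q]] cL(1)[OF V_val[OF Uh]] S_L2[OF g]])
  qed
  show ?thesis
    unfolding weighted_inner_eq[OF \<psi> S_L2[OF g] q] weighted_inner_eq[OF \<psi> Sig[OF g] Uh]
    by (rule tendsto_diff[OF first second])
qed

text \<open>For the coefficients themselves both sides agree pointwise; test and pass to the limit
  with \<open>product_limit\<close>.\<close>

lemma flux_pointwise_sym:
  assumes g: "g \<in> L2 \<Omega>" and h: "h \<in> L2 \<Omega>"
  shows "AE x in lebesgue_on \<Omega>. Sig g x \<bullet> gr (U h) x = Sig h x \<bullet> gr (U g) x"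
proof -
  have "AE x in lebesgue_on \<Omega>. Sig g x \<bullet> gr (U h) x - Sig h x \<bullet> gr (U g) x = 0"
  proof (rule AE_zero_if_test_integral_zero[OF open_\<Omega>])
    show "integrable (lebesgue_on \<Omega>) (\<lambda>x. Sig g x \<bullet> gr (U h) x - Sig h x \<bullet> gr (U g) x)"
      by (intro Bochner_Integration.integrable_diff L2_inner_integrable Sig GU_L2 g h)
    fix \<psi> :: "real^'n \<Rightarrow> real" assume \<psi>: "test_function \<Omega> \<psi>"
    have "(LINT x|lebesgue_on \<Omega>. \<psi> x * (S k g x \<bullet> P k h x)) = (LINT x|lebesgue_on \<Omega>. \<psi> x * (S k h x \<bullet> P k g x))" for k
      by (intro Bochner_Integration.integral_cong refl) (simp add: flux_def space_restrict_space Coeff_pointwise(1)[OF as])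
    then have "(LINT x|lebesgue_on \<Omega>. \<psi> x * (Sig g x \<bullet> gr (U h) x)) = (LINT x|lebesgue_on \<Omega>. \<psi> x * (Sig h x \<bullet> gr (U g) x))"
      using product_limit[OF g h \<psi>] product_limit[OF h g \<psi>] by (simp add: LIMSEQ_unique)
    then have "(LINT x|lebesgue_on \<Omega>. \<psi> x * (Sig g x \<bullet> gr (U h) x) - \<psi> x * (Sig h x \<bullet> gr (U g) x)) = 0"
      by (subst Bochner_Integration.integral_diff) (auto intro!: weighted_integrable[OF \<psi>] Sig GU_L2 g h)
    then show "(LINT x|lebesgue_on \<Omega>. (Sig g x \<bullet> gr (U h) x - Sig h x \<bullet> gr (U g) x) * \<psi> x) = 0"
      by (simp add: algebra_simps)
  qed
  then show ?thesis by eventually_elim simp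
qed

text \<open>Weak lower semicontinuity of a weighted norm, from expanding the nonnegative weighted
  square of \<open>u k - w\<close>.\<close>

lemma weighted_norm_liminf:
  assumes u: "\<And>k. u k \<in> L2 \<Omega>" and w: "w \<in> L2 \<Omega>"
    and weak: "\<And>h. h \<in> L2 \<Omega> \<Longrightarrow> (\<lambda>k. L2_inner \<Omega> (u k) h) \<longlonglongrightarrow> L2_inner \<Omega> w h"
    and \<psi>: "test_function \<Omega> \<psi>" "\<And>x. 0 \<le> \<psi> x"
    and le: "\<And>k. (LINT x|lebesgue_on \<Omega>. \<psi> x * (norm (u k x))\<^sup>2) \<le> c k" and c: "c \<longlonglongrightarrow> c0"
  shows "(LINT x|lebesgue_on \<Omega>. \<psi> x * (norm (w x))\<^sup>2) \<le> c0"
proof -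
  obtain B where B: "B > 0" "\<And>x. norm (\<psi> x) \<le> B" by (rule test_function_bounded[OF \<psi>(1)]) (rule that)
  have pw: "(\<lambda>x. \<psi> x *\<^sub>R w x) \<in> L2 \<Omega>"
  proof (rule L2_dominated(1)[OF _ w, of _ B])
    show "(\<lambda>x. \<psi> x *\<^sub>R w x) \<in> borel_measurable (lebesgue_on \<Omega>)"
      by (intro borel_measurable_scaleR test_function_measurable[OF \<psi>(1)] L2_measurable w)
    show "norm (\<psi> x *\<^sub>R w x) \<le> B * norm (w x)" for x
      using mult_right_mono[OF B(2)[of x] norm_ge_zero[of "w x"]] by simp
  qed (use B in auto)
  have iw: "integrable (lebesgue_on \<Omega>) (\<lambda>x. \<psi> x * (norm (w x))\<^sup>2)"
    using weighted_integrable[OF \<psi>(1) w w] by (simp add: power2_norm_eq_inner)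
  have iu: "integrable (lebesgue_on \<Omega>) (\<lambda>x. \<psi> x * (norm (u k x))\<^sup>2)" for k
    using weighted_integrable[OF \<psi>(1) u u] by (simp add: power2_norm_eq_inner)
  have iuw: "integrable (lebesgue_on \<Omega>) (\<lambda>x. u k x \<bullet> (\<psi> x *\<^sub>R w x))" for k
    by (rule L2_inner_integrable[OF u pw])
  have "2 * L2_inner \<Omega> (u k) (\<lambda>x. \<psi> x *\<^sub>R w x) - (LINT x|lebesgue_on \<Omega>. \<psi> x * (norm (w x))\<^sup>2) \<le> c k" for k
  proof -
    have "2 * L2_inner \<Omega> (u k) (\<lambda>x. \<psi> x *\<^sub>R w x) - (LINT x|lebesgue_on \<Omega>. \<psi> x * (norm (w x))\<^sup>2)
        = (LINT x|lebesgue_on \<Omega>. 2 * (u k x \<bullet> (\<psi> x *\<^sub>R w x)) - \<psi> x * (norm (w x))\<^sup>2)"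
      unfolding L2_inner_def using iuw iw by simp
    also have "\<dots> \<le> (LINT x|lebesgue_on \<Omega>. \<psi> x * (norm (u k x))\<^sup>2)"
    proof (rule integral_mono)
      show "2 * (u k x \<bullet> (\<psi> x *\<^sub>R w x)) - \<psi> x * (norm (w x))\<^sup>2 \<le> \<psi> x * (norm (u k x))\<^sup>2" for x
      proof -
        have "0 \<le> \<psi> x * (norm (u k x - w x))\<^sup>2" using \<psi>(2) by simp
        also have "\<dots> = \<psi> x * (norm (u k x))\<^sup>2 - 2 * (u k x \<bullet> (\<psi> x *\<^sub>R w x)) + \<psi> x * (norm (w x))\<^sup>2"
          by (simp add: power2_norm_eq_inner inner_diff_left inner_diff_right inner_commute[of "w x" "u k x"] algebra_simps)
        finally show ?thesis by simp
      qed
    qed (use iuw iw iu in auto)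
    finally show ?thesis using le[of k] by linarith
  qed
  then have "2 * L2_inner \<Omega> w (\<lambda>x. \<psi> x *\<^sub>R w x) - (LINT x|lebesgue_on \<Omega>. \<psi> x * (norm (w x))\<^sup>2) \<le> c0"
    by (intro LIMSEQ_le[OF tendsto_diff[OF tendsto_mult[OF tendsto_const weak[OF pw]] tendsto_const] c]) blast
  moreover have "L2_inner \<Omega> w (\<lambda>x. \<psi> x *\<^sub>R w x) = (LINT x|lebesgue_on \<Omega>. \<psi> x * (norm (w x))\<^sup>2)"
    by (simp add: L2_inner_def power2_norm_eq_inner)
  ultimately show ?thesis by simp
qed

text \<open>For the coefficients themselves the two bounds hold pointwise with the product on one side
  and the square of a weakly convergent field on the other. The integral of the product
  against \<open>\<psi>\<close> converges and that of the square can only drop in the limit.\<close>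

lemma flux_pointwise_bounds:
  assumes g: "g \<in> L2 \<Omega>"
  shows "AE x in lebesgue_on \<Omega>. \<mu>0 * (norm (gr (U g) x))\<^sup>2 \<le> Sig g x \<bullet> gr (U g) x"
    and "AE x in lebesgue_on \<Omega>. (norm (Sig g x))\<^sup>2 \<le> \<mu>1 * (Sig g x \<bullet> gr (U g) x)"
proof -
  have \<mu>1: "\<mu>1 > 0" using \<mu> by simp
  have c: "AE x in lebesgue_on \<Omega>. 0 \<le> m * (Sig g x \<bullet> gr (U g) x) - (norm (w x))\<^sup>2"
    if w: "w \<in> L2 \<Omega>" and u: "\<And>k. u k \<in> L2 \<Omega>"
      and weak: "\<And>h. h \<in> L2 \<Omega> \<Longrightarrow> (\<lambda>k. L2_inner \<Omega> (u k) h) \<longlonglongrightarrow> L2_inner \<Omega> w h"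
      and pw: "\<And>k x. x \<in> \<Omega> \<Longrightarrow> (norm (u k x))\<^sup>2 \<le> m * (S k g x \<bullet> P k g x)"
    for w :: "real^'n \<Rightarrow> real^'n" and u m
  proof (rule AE_nonneg_if_test_integral_nonneg[OF open_\<Omega>])
    have iw: "integrable (lebesgue_on \<Omega>) (\<lambda>x. (norm (w x))\<^sup>2)" by (rule L2_integrable_sq[OF w])
    show "integrable (lebesgue_on \<Omega>) (\<lambda>x. m * (Sig g x \<bullet> gr (U g) x) - (norm (w x))\<^sup>2)"
      by (intro Bochner_Integration.integrable_diff integrable_mult_right L2_inner_integrable Sig GU_L2 g iw)
    fix \<psi> :: "real^'n \<Rightarrow> real" assume \<psi>: "test_function \<Omega> \<psi>" "\<And>x. 0 \<le> \<psi> x"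
    have "(LINT x|lebesgue_on \<Omega>. \<psi> x * (norm (w x))\<^sup>2) \<le> m * (LINT x|lebesgue_on \<Omega>. \<psi> x * (Sig g x \<bullet> gr (U g) x))"
    proof (rule weighted_norm_liminf[OF u w weak \<psi>])
      show "(LINT x|lebesgue_on \<Omega>. \<psi> x * (norm (u k x))\<^sup>2) \<le> m * (LINT x|lebesgue_on \<Omega>. \<psi> x * (S k g x \<bullet> P k g x))" for k
      proof -
        have "(LINT x|lebesgue_on \<Omega>. \<psi> x * (norm (u k x))\<^sup>2) \<le> (LINT x|lebesgue_on \<Omega>. m * (\<psi> x * (S k g x \<bullet> P k g x)))"
        proof (rule integral_mono)
          show "integrable (lebesgue_on \<Omega>) (\<lambda>x. \<psi> x * (norm (u k x))\<^sup>2)"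
            using weighted_integrable[OF \<psi>(1) u u] by (simp add: power2_norm_eq_inner)
          show "integrable (lebesgue_on \<Omega>) (\<lambda>x. m * (\<psi> x * (S k g x \<bullet> P k g x)))"
            by (intro integrable_mult_right weighted_integrable[OF \<psi>(1)] S_L2 P_L2 g)
          show "\<psi> x * (norm (u k x))\<^sup>2 \<le> m * (\<psi> x * (S k g x \<bullet> P k g x))" if "x \<in> space (lebesgue_on \<Omega>)" for x
          proof -
            have "x \<in> \<Omega>" using that by (simp add: space_restrict_space)
            from mult_left_mono[OF pw[OF this, of k] \<psi>(2)[of x]] show ?thesis by (simp add: mult_ac)
          qed
        qed
        then show ?thesis by simp
      qed
      show "(\<lambda>k. m * (LINT x|lebesgue_on \<Omega>. \<psi> x * (S k g x \<bullet> P k g x))) \<longlonglongrightarrow> m * (LINT x|lebesgue_on \<Omega>. \<psi> x * (Sig g x \<bullet> gr (U g) x))"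
        by (intro tendsto_mult tendsto_const product_limit g \<psi>)
    qed
    moreover have "(LINT x|lebesgue_on \<Omega>. (m * (Sig g x \<bullet> gr (U g) x) - (norm (w x))\<^sup>2) * \<psi> x)
        = m * (LINT x|lebesgue_on \<Omega>. \<psi> x * (Sig g x \<bullet> gr (U g) x)) - (LINT x|lebesgue_on \<Omega>. \<psi> x * (norm (w x))\<^sup>2)"
    proof -
      have i1: "integrable (lebesgue_on \<Omega>) (\<lambda>x. m * (\<psi> x * (Sig g x \<bullet> gr (U g) x)))"
        by (intro integrable_mult_right weighted_integrable[OF \<psi>(1)] Sig GU_L2 g)
      have i2: "integrable (lebesgue_on \<Omega>) (\<lambda>x. \<psi> x * (norm (w x))\<^sup>2)"
        using weighted_integrable[OF \<psi>(1) w w] by (simp add: power2_norm_eq_inner)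
      have "(\<lambda>x. (m * (Sig g x \<bullet> gr (U g) x) - (norm (w x))\<^sup>2) * \<psi> x)
          = (\<lambda>x. m * (\<psi> x * (Sig g x \<bullet> gr (U g) x)) - \<psi> x * (norm (w x))\<^sup>2)"
        by (simp add: fun_eq_iff algebra_simps)
      then show ?thesis using Bochner_Integration.integral_diff[OF i1 i2] by simp
    qed
    ultimately show "0 \<le> (LINT x|lebesgue_on \<Omega>. (m * (Sig g x \<bullet> gr (U g) x) - (norm (w x))\<^sup>2) * \<psi> x)" by simp
  qed
  have "AE x in lebesgue_on \<Omega>. 0 \<le> (1 / \<mu>0) * (Sig g x \<bullet> gr (U g) x) - (norm (gr (U g) x))\<^sup>2"
  proof (rule c[OF GU_L2[OF g] P_L2[OF g] P_lim[OF g]])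
    show "(norm (P k g x))\<^sup>2 \<le> (1 / \<mu>0) * (S k g x \<bullet> P k g x)" if "x \<in> \<Omega>" for k x
      using Coeff_pointwise(2)[OF as[of k] that, of "P k g x"] \<mu>(1) by (simp add: flux_def pos_le_divide_eq mult.commute)
  qed
  then show "AE x in lebesgue_on \<Omega>. \<mu>0 * (norm (gr (U g) x))\<^sup>2 \<le> Sig g x \<bullet> gr (U g) x"
    by eventually_elim (use \<mu>(1) in \<open>simp add: pos_le_divide_eq mult.commute\<close>)
  have "AE x in lebesgue_on \<Omega>. 0 \<le> \<mu>1 * (Sig g x \<bullet> gr (U g) x) - (norm (Sig g x))\<^sup>2"
  proof (rule c[OF Sig[OF g] S_L2[OF g] Sig_lim[OF g]])
    show "(norm (S k g x))\<^sup>2 \<le> \<mu>1 * (S k g x \<bullet> P k g x)" if "x \<in> \<Omega>" for k x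
      using Coeff_pointwise(3)[OF as[of k] that, of "P k g x"] by (simp add: flux_def)
  qed
  then show "AE x in lebesgue_on \<Omega>. (norm (Sig g x))\<^sup>2 \<le> \<mu>1 * (Sig g x \<bullet> gr (U g) x)"
    by eventually_elim simp
qed

text \<open>The form \<open>t v w\<close>, the limit of the pairings of \<open>\<nabla>w\<close> with the solution for data \<open>\<nabla>v\<close>, is
  symmetric because the solution operators are self-adjoint. It is coercive because the data
  is dominated by the flux, whose square is at most \<open>\<mu>1\<close> times the pairing of flux and
  gradient. So the limit equation can be solved for the data.\<close>

lemma U_surjective:
  assumes q: "q \<in> V"
  shows "\<exists>g\<in>L2 \<Omega>. N (gr (U g) - gr q) = 0"
proof -
  define t where "t v w = L2_inner \<Omega> (gr (U (gr v))) (gr w)" for v w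
  have t_lim: "(\<lambda>k. L2_inner \<Omega> (P k (gr v)) (gr w)) \<longlonglongrightarrow> t v w" if "v \<in> V" "w \<in> V" for v w
    unfolding t_def by (rule P_lim[OF V_gr[OF that(1)] V_gr[OF that(2)]])
  have swap: "L2_inner \<Omega> (P k (gr v)) (gr w) = L2_inner \<Omega> (S k (gr w)) (P k (gr v))" if "v \<in> V" "w \<in> V" for v w k
    using soln(2)[OF as V_gr[OF that(2)] soln(1)[OF as V_gr[OF that(1)]]] by (simp add: energy_def L2.ip_commute)
  have sym_k: "L2_inner \<Omega> (P k (gr v)) (gr w) = L2_inner \<Omega> (P k (gr w)) (gr v)" if "v \<in> V" "w \<in> V" for v w k
    unfolding swap[OF that] swap[OF that(2,1)]
    by (rule flux_sym[OF as P_L2[OF V_gr[OF that(2)]] P_L2[OF V_gr[OF that(1)]]])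
  have \<mu>1: "\<mu>1 > 0" using \<mu> by simp
  have "\<exists>v\<in>V. \<forall>w\<in>V. t v w = L2_inner \<Omega> (gr q) (gr w)"
  proof (rule V_Lax_Milgram[where c = "1 / \<mu>1" and C = "1 / \<mu>0"])
    show "linear_functional_on V (\<lambda>v. t v w)" if w: "w \<in> V" for w
    proof (rule linear_functional_on_limit[where f = "\<lambda>k v. L2_inner \<Omega> (P k (gr v)) (gr w)"])
      show "linear_functional_on V (\<lambda>v. L2_inner \<Omega> (P k (gr v)) (gr w))" for k
      proof (rule linear_functional_on_V_gr, rule linear_in_data[OF as, where L = "\<lambda>u. L2_inner \<Omega> u (gr w)" and C = "N (gr w)"])
        show "linear_functional_on (L2 \<Omega>) (\<lambda>u. L2_inner \<Omega> u (gr w))" by (rule L2.ip_linear[OF V_gr[OF w]])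
        show "\<bar>L2_inner \<Omega> u (gr w)\<bar> \<le> N (gr w) * N u" if "u \<in> L2 \<Omega>" for u
          using L2.Cauchy_Schwarz[OF that V_gr[OF w]] by (simp add: mult.commute)
      qed
    qed (use t_lim w subspace_V in auto)
    show "t v w = t w v" if "v \<in> V" "w \<in> V" for v w
      using t_lim[OF that] t_lim[OF that(2,1)] unfolding sym_k[OF that] by (rule LIMSEQ_unique)
    show "\<bar>t v w\<bar> \<le> 1 / \<mu>0 * N (gr v) * N (gr w)" if v: "v \<in> V" and w: "w \<in> V" for v w
    proof (rule LIMSEQ_le_const2[OF tendsto_rabs[OF t_lim[OF v w]]])
      have "\<bar>L2_inner \<Omega> (P k (gr v)) (gr w)\<bar> \<le> 1 / \<mu>0 * N (gr v) * N (gr w)" for k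
      proof -
        have "\<bar>L2_inner \<Omega> (P k (gr v)) (gr w)\<bar> \<le> N (P k (gr v)) * N (gr w)"
          by (rule L2.Cauchy_Schwarz[OF P_L2[OF V_gr[OF v]] V_gr[OF w]])
        also have "\<dots> \<le> N (gr v) / \<mu>0 * N (gr w)"
          by (rule mult_right_mono[OF soln_bound(1)[OF as V_gr[OF v]] L2.nrm_nonneg[OF V_gr[OF w]]])
        finally show ?thesis by simp
      qed
      then show "\<exists>M. \<forall>k\<ge>M. \<bar>L2_inner \<Omega> (P k (gr v)) (gr w)\<bar> \<le> 1 / \<mu>0 * N (gr v) * N (gr w)" by blast
    qed
    show "1 / \<mu>1 * (N (gr v))\<^sup>2 \<le> t v v" if v: "v \<in> V" for v
    proof (rule LIMSEQ_le_const[OF t_lim[OF v v]])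
      have "1 / \<mu>1 * (N (gr v))\<^sup>2 \<le> L2_inner \<Omega> (P k (gr v)) (gr v)" for k
      proof -
        let ?s = "S k (gr v)"
        have sL: "?s \<in> L2 \<Omega>" by (rule S_L2[OF V_gr[OF v]])
        have "(N (gr v))\<^sup>2 = L2_inner \<Omega> (gr v) (gr v)" by (rule L2.nrm_sq[OF V_gr[OF v]])
        also have "\<dots> = L2_inner \<Omega> ?s (gr v)"
          using soln(2)[OF as V_gr[OF v] v] by (simp add: energy_def)
        also have "\<dots> \<le> N ?s * N (gr v)" using L2.Cauchy_Schwarz[OF sL V_gr[OF v]] by linarith
        finally have le: "N (gr v) \<le> N ?s"
          using L2.nrm_nonneg[OF V_gr[OF v]] L2.nrm_nonneg[OF sL]
          by (cases "N (gr v) = 0") (auto simp: power2_eq_square)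
        have "(N (gr v))\<^sup>2 \<le> (N ?s)\<^sup>2" by (rule power_mono[OF le L2.nrm_nonneg[OF V_gr[OF v]]])
        also have "\<dots> \<le> \<mu>1 * L2_inner \<Omega> ?s (P k (gr v))" by (rule flux_coercive(2)[OF as P_L2[OF V_gr[OF v]]])
        also have "L2_inner \<Omega> ?s (P k (gr v)) = L2_inner \<Omega> (P k (gr v)) (gr v)" by (rule swap[OF v v, symmetric])
        finally show ?thesis using \<mu>1 by (simp add: pos_divide_le_eq mult.commute)
      qed
      then show "\<exists>M. \<forall>k\<ge>M. 1 / \<mu>1 * (N (gr v))\<^sup>2 \<le> L2_inner \<Omega> (P k (gr v)) (gr v)" by blast
    qed
    show "dualV (\<lambda>w. L2_inner \<Omega> (gr q) (gr w))" by (rule dualV_gr[OF V_gr[OF q]])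
  qed (use \<mu> \<mu>1 in auto)
  then obtain v where v: "v \<in> V" "\<And>w. w \<in> V \<Longrightarrow> t v w = L2_inner \<Omega> (gr q) (gr w)" by blast
  note Uv = U[OF V_gr[OF v(1)]]
  have d: "U (gr v) - q \<in> V" by (rule V_diff[OF Uv q])
  have "(N (gr (U (gr v) - q)))\<^sup>2 = L2_inner \<Omega> (gr (U (gr v)) - gr q) (gr (U (gr v) - q))"
    using L2.nrm_sq[OF V_gr[OF d]] by (simp add: gr_diff)
  also have "\<dots> = t v (U (gr v) - q) - L2_inner \<Omega> (gr q) (gr (U (gr v) - q))"
    unfolding t_def by (rule L2.ip_diff_left[OF V_gr[OF Uv] V_gr[OF q] V_gr[OF d]])
  also have "\<dots> = 0" by (simp add: v(2)[OF d])
  finally have "N (gr (U (gr v)) - gr q) = 0" by (simp add: gr_diff)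
  then show ?thesis using V_gr[OF v(1)] by blast
qed

end

section \<open>The limit coefficient\<close>

lemma closed_ellip_mats:
  assumes "0 < \<mu>0" "\<mu>0 \<le> \<mu>1"
  shows "closed (ellip_mats \<mu>0 \<mu>1 :: (real^'n^'n) set)"
proof -
  have eq: "ellip_mats \<mu>0 \<mu>1 = {A :: real^'n^'n. (\<forall>x y. (A *v x) \<bullet> y = (A *v y) \<bullet> x) \<and>
      (\<forall>x. \<mu>0 * (norm x)\<^sup>2 \<le> (A *v x) \<bullet> x) \<and> (\<forall>x. (norm (A *v x))\<^sup>2 \<le> \<mu>1 * ((A *v x) \<bullet> x))}"
    using ellip_mats_iff[OF assms] by blast
  have c: "continuous_on UNIV (\<lambda>A :: real^'n^'n. A *v x)" for x
    by (intro continuous_on_matrix_vector_mult continuous_on_id continuous_on_const)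
  show ?thesis
    unfolding eq by (intro closed_Collect_conj closed_Collect_all closed_Collect_eq closed_Collect_le
        continuous_intros c)
qed

lemma scaled_identity_ellip:
  assumes "0 < \<mu>0" "\<mu>0 \<le> \<mu>1" shows "(\<mu>0 *\<^sub>R mat 1 :: real^'n^'n) \<in> ellip_mats \<mu>0 \<mu>1"
proof -
  have mv: "(\<mu>0 *\<^sub>R mat 1 :: real^'n^'n) *v x = \<mu>0 *\<^sub>R x" for x
    by (simp add: scaleR_matrix_vector_assoc[symmetric])
  have "\<mu>0\<^sup>2 * (norm x)\<^sup>2 \<le> \<mu>1 * (\<mu>0 * (norm x)\<^sup>2)" for x :: "real^'n"
    using assms by (simp add: power2_eq_square mult.assoc mult_right_mono mult_left_mono)
  then show ?thesis
    unfolding ellip_mats_iff[OF assms] mv using assms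
    by (simp add: power_mult_distrib power2_norm_eq_inner inner_commute)
qed

lemma borel_measurable_vec_lambda':
  fixes f :: "'j::finite \<Rightarrow> 'a \<Rightarrow> 'b::euclidean_space"
  assumes "\<And>j. f j \<in> borel_measurable M"
  shows "(\<lambda>x. \<chi> j. f j x) \<in> borel_measurable M"
proof (rule borel_measurable_euclidean_space[THEN iffD2], rule ballI)
  fix e :: "'b^'j" assume "e \<in> Basis"
  then obtain i u where e: "e = axis i u" by (auto simp: Basis_vec_def)
  show "(\<lambda>x. (\<chi> j. f j x) \<bullet> e) \<in> borel_measurable M"
    unfolding e inner_axis using borel_measurable_inner[OF assms[of i] borel_measurable_const[of u]] by simp
qed

context limit_data
begin

text \<open>Data whose limit solution has the gradient of the given test function; it exists by
  \<open>U_surjective\<close>.\<close>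

definition datum :: "(real^'n \<Rightarrow> real) \<Rightarrow> real^'n \<Rightarrow> real^'n"
  where "datum \<phi> = (SOME g. g \<in> L2 \<Omega> \<and> N (gr (U g) - grad \<phi>) = 0)"

lemma datum:
  assumes \<phi>: "test_function \<Omega> \<phi>"
  shows "datum \<phi> \<in> L2 \<Omega>" "AE x in lebesgue_on \<Omega>. gr (U (datum \<phi>)) x = grad \<phi> x"
proof -
  have "\<exists>g. g \<in> L2 \<Omega> \<and> N (gr (U g) - grad \<phi>) = 0"
    using U_surjective[OF test_jet_V[OF \<phi>]] by auto
  from someI_ex[OF this] have d: "datum \<phi> \<in> L2 \<Omega>" "N (gr (U (datum \<phi>)) - grad \<phi>) = 0"
    unfolding datum_def by auto
  then show "datum \<phi> \<in> L2 \<Omega>" by simp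
  have "AE x in lebesgue_on \<Omega>. (gr (U (datum \<phi>)) - grad \<phi>) x = 0"
    using d(2) L2_norm_zero_iff[OF L2.S_diff[OF GU_L2[OF d(1)] grad_L2[OF \<phi>]]] by blast
  then show "AE x in lebesgue_on \<Omega>. gr (U (datum \<phi>)) x = grad \<phi> x"
    by eventually_elim simp
qed

text \<open>The pair consists of slope and constant. At a point where \<open>\<psi>\<close> does not vanish the
  gradients of these functions exhaust all vectors, and they depend continuously on the
  pair, so countably many of them suffice.\<close>

definition affine_cutoff :: "(real^'n \<Rightarrow> real) \<Rightarrow> (real^'n) \<times> real \<Rightarrow> real^'n \<Rightarrow> real"
  where "affine_cutoff \<psi> s x = (fst s \<bullet> x + snd s) * \<psi> x"

definition affine_cutoff_grad :: "(real^'n \<Rightarrow> real) \<Rightarrow> real^'n \<Rightarrow> (real^'n) \<times> real \<Rightarrow> real^'n"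
  where "affine_cutoff_grad \<psi> x s = (fst s \<bullet> x + snd s) *\<^sub>R grad \<psi> x + \<psi> x *\<^sub>R fst s"

lemma affine_cutoff:
  assumes \<psi>: "test_function \<Omega> \<psi>"
  shows "test_function \<Omega> (affine_cutoff \<psi> s)" "grad (affine_cutoff \<psi> s) x = affine_cutoff_grad \<psi> x s"
proof -
  have sm: "smooth (\<lambda>x. fst s \<bullet> x + snd s)"
    unfolding inner_vec_def inner_real_def
    by (intro smooth_add smooth_const smooth_sum smooth_mult smooth_nth) auto
  show "test_function \<Omega> (affine_cutoff \<psi> s)"
    unfolding affine_cutoff_def[abs_def] by (rule test_function_mult[OF sm \<psi>])
  have "((\<lambda>x. fst s \<bullet> x + snd s) has_derivative (\<lambda>h. fst s \<bullet> h)) (at x)" for x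
    by (auto intro!: derivative_eq_intros)
  from partial_derivI[OF this] have "grad (\<lambda>x. fst s \<bullet> x + snd s) x = fst s" for x
    by (simp add: vec_eq_iff inner_axis)
  then show "grad (affine_cutoff \<psi> s) x = affine_cutoff_grad \<psi> x s"
    unfolding affine_cutoff_def[abs_def] affine_cutoff_grad_def
    by (simp add: grad_mult[OF sm test_function_smooth[OF \<psi>]])
qed

text \<open>If \<open>Sig g = A \<nabla>(U g)\<close> with symmetric \<open>A\<close>, then the fluxes belonging to \<open>x\<^sub>j \<psi>\<close> and \<open>\<psi>\<close> are
  \<open>A\<close> applied to the gradients of these functions, and \<open>\<nabla>(x\<^sub>j \<psi>) - x\<^sub>j \<nabla>\<psi> = \<psi> e\<^sub>j\<close>. The
  formula is the resulting value of the \<open>j\<close>-th row of \<open>A\<close>.\<close>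

definition local_matrix :: "(real^'n \<Rightarrow> real) \<Rightarrow> real^'n \<Rightarrow> real^'n^'n"
  where "local_matrix \<psi> x = (\<chi> j. (1 / \<psi> x) *\<^sub>R
     (Sig (datum (affine_cutoff \<psi> (axis j 1, 0))) x - (x $ j) *\<^sub>R Sig (datum \<psi>) x))"

lemma local_matrix_measurable:
  assumes "test_function \<Omega> \<psi>" shows "local_matrix \<psi> \<in> borel_measurable (lebesgue_on \<Omega>)"
proof -
  have c: "(\<lambda>x::real^'n. x $ j) \<in> borel_measurable (lebesgue_on \<Omega>)" for j
    by (intro continuous_measurable_lebesgue_on continuous_on_component continuous_on_id)
  show ?thesis
    unfolding local_matrix_def[abs_def]
    by (intro borel_measurable_vec_lambda' borel_measurable_scaleR borel_measurable_diff borel_measurable_divide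
        borel_measurable_const c L2_measurable[OF Sig[OF datum(1)]] test_function_measurable[OF assms]
        affine_cutoff assms)
qed

text \<open>Pair the flux with the gradients of \<open>x\<^sub>j \<psi>\<close> and \<open>\<psi>\<close>. By the pointwise symmetry of the
  limits, each pairing equals that of \<open>\<nabla>(U g)\<close> with the flux from which the row was built.\<close>

lemma flux_eq_local_matrix:
  assumes \<psi>: "test_function \<Omega> \<psi>" and g: "g \<in> L2 \<Omega>"
  shows "AE x in lebesgue_on \<Omega>. \<psi> x \<noteq> 0 \<longrightarrow> Sig g x = local_matrix \<psi> x *v gr (U g) x"
proof -
  have key: "AE x in lebesgue_on \<Omega>. Sig g x \<bullet> grad \<phi> x = Sig (datum \<phi>) x \<bullet> gr (U g) x" if \<phi>: "test_function \<Omega> \<phi>" for \<phi>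
    using flux_pointwise_sym[OF g datum(1)[OF \<phi>]] datum(2)[OF \<phi>] by eventually_elim simp
  have "AE x in lebesgue_on \<Omega>. \<forall>j\<in>UNIV. Sig g x \<bullet> grad (affine_cutoff \<psi> (axis j 1, 0)) x
      = Sig (datum (affine_cutoff \<psi> (axis j 1, 0))) x \<bullet> gr (U g) x"
    by (intro AE_finite_allI finite key affine_cutoff \<psi>)
  then show ?thesis using key[OF \<psi>]
  proof eventually_elim
    case (elim x)
    show ?case
    proof
      assume ne: "\<psi> x \<noteq> 0"
      have "Sig g x $ j = (local_matrix \<psi> x *v gr (U g) x) $ j" for j
      proof -
        have "Sig g x \<bullet> ((x $ j) *\<^sub>R grad \<psi> x + \<psi> x *\<^sub>R axis j 1)
            = Sig (datum (affine_cutoff \<psi> (axis j 1, 0))) x \<bullet> gr (U g) x"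
          using elim(1) by (simp add: affine_cutoff(2)[OF \<psi>] affine_cutoff_grad_def inner_axis')
        then have "\<psi> x * Sig g x $ j = Sig (datum (affine_cutoff \<psi> (axis j 1, 0))) x \<bullet> gr (U g) x
            - x $ j * (Sig (datum \<psi>) x \<bullet> gr (U g) x)"
          using elim(2) by (simp add: inner_add_right inner_axis)
        then show ?thesis using ne
          by (simp add: matrix_vector_mul_component local_matrix_def inner_diff_left field_simps)
      qed
      then show "Sig g x = local_matrix \<psi> x *v gr (U g) x" by (simp add: vec_eq_iff)
    qed
  qed
qed

text \<open>Symmetry and bounds hold almost everywhere for each single pair of affine cutoffs, hence
  off one null set for a countable dense set of pairs, and by continuity in the coefficients
  for all pairs. Each vector is a value of such a gradient.\<close>

lemma local_matrix_elliptic: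
  assumes \<psi>: "test_function \<Omega> \<psi>"
  shows "AE x in lebesgue_on \<Omega>. \<psi> x \<noteq> 0 \<longrightarrow> local_matrix \<psi> x \<in> ellip_mats \<mu>0 \<mu>1"
proof -
  obtain T :: "((real^'n) \<times> real) set" where T: "countable T" "\<And>X. open X \<Longrightarrow> X \<noteq> {} \<Longrightarrow> \<exists>d\<in>T. d \<in> X"
    by (rule countable_dense_setE) (rule that)
  have cl: "closure T = UNIV"
  proof (rule ccontr)
    assume "closure T \<noteq> UNIV"
    then have "- closure T \<noteq> {}" by blast
    from T(2)[OF open_Compl[OF closed_closure] this] obtain d where "d \<in> T" "d \<in> - closure T" by (rule bexE)
    then show False using closure_subset[of T] by blast
  qed
  let ?G = "affine_cutoff_grad \<psi>"
  let ?good = "\<lambda>x s s'. (local_matrix \<psi> x *v ?G x s) \<bullet> ?G x s' = (local_matrix \<psi> x *v ?G x s') \<bullet> ?G x s \<and>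
      \<mu>0 * (norm (?G x s))\<^sup>2 \<le> (local_matrix \<psi> x *v ?G x s) \<bullet> ?G x s \<and>
      (norm (local_matrix \<psi> x *v ?G x s))\<^sup>2 \<le> \<mu>1 * ((local_matrix \<psi> x *v ?G x s) \<bullet> ?G x s)"
  have single: "AE x in lebesgue_on \<Omega>. \<psi> x \<noteq> 0 \<longrightarrow> ?good x s s'" for s s'
  proof -
    note t = affine_cutoff(1)[OF \<psi>, of s] and t' = affine_cutoff(1)[OF \<psi>, of s']
    let ?g = "datum (affine_cutoff \<psi> s)" and ?g' = "datum (affine_cutoff \<psi> s')"
    show ?thesis
      using flux_eq_local_matrix[OF \<psi> datum(1)[OF t]] flux_eq_local_matrix[OF \<psi> datum(1)[OF t']]
        datum(2)[OF t] datum(2)[OF t'] flux_pointwise_sym[OF datum(1)[OF t] datum(1)[OF t']]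
        flux_pointwise_bounds[OF datum(1)[OF t]]
    proof eventually_elim
      case (elim x)
      show ?case
      proof
        assume "\<psi> x \<noteq> 0"
        then have e: "Sig ?g x = local_matrix \<psi> x *v ?G x s" "Sig ?g' x = local_matrix \<psi> x *v ?G x s'"
            "gr (U ?g) x = ?G x s" "gr (U ?g') x = ?G x s'"
          using elim(1-4) by (simp_all add: affine_cutoff(2)[OF \<psi>])
        show "?good x s s'" using elim(5-7) unfolding e by blast
      qed
    qed
  qed
  have "AE x in lebesgue_on \<Omega>. \<forall>s\<in>T. \<forall>s'\<in>T. \<psi> x \<noteq> 0 \<longrightarrow> ?good x s s'"
    by (intro AE_ball_countable[THEN iffD2] T(1) ballI single)
  then show ?thesis
  proof (rule eventually_mono, intro impI)
    fix x assume T': "\<forall>s\<in>T. \<forall>s'\<in>T. \<psi> x \<noteq> 0 \<longrightarrow> ?good x s s'" and ne: "\<psi> x \<noteq> 0"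
    have cont: "continuous_on UNIV (\<lambda>z. ?G x (f z))" if "continuous_on UNIV f" for f :: "((real^'n) \<times> real) \<times> ((real^'n) \<times> real) \<Rightarrow> _"
      unfolding affine_cutoff_grad_def by (intro continuous_intros that)
    have c1: "continuous_on UNIV (\<lambda>z :: ((real^'n) \<times> real) \<times> ((real^'n) \<times> real). ?G x (fst z))"
      and c2: "continuous_on UNIV (\<lambda>z :: ((real^'n) \<times> real) \<times> ((real^'n) \<times> real). ?G x (snd z))"
      by (intro cont continuous_intros)+
    define L where "L = local_matrix \<psi> x"
    define p q where "p z = ?G x (fst z)" and "q z = ?G x (snd z)" for z :: "((real^'n) \<times> real) \<times> ((real^'n) \<times> real)"
    have cp: "continuous_on UNIV p" and cq: "continuous_on UNIV q"
      using c1 c2 by (simp_all add: p_def[abs_def] q_def[abs_def])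
    have cLp: "continuous_on UNIV (\<lambda>z. L *v p z)" and cLq: "continuous_on UNIV (\<lambda>z. L *v q z)"
      by (intro continuous_on_matrix_vector_mult continuous_on_const cp cq)+
    have "closed {z. (L *v p z) \<bullet> q z = (L *v q z) \<bullet> p z}"
      by (rule closed_Collect_eq) (intro continuous_on_inner cp cq cLp cLq)+
    moreover have "closed {z. \<mu>0 * (norm (p z))\<^sup>2 \<le> (L *v p z) \<bullet> p z}"
      by (rule closed_Collect_le) (intro continuous_on_mult_left continuous_on_power continuous_on_norm continuous_on_inner cp cLp)+
    moreover have "closed {z. (norm (L *v p z))\<^sup>2 \<le> \<mu>1 * ((L *v p z) \<bullet> p z)}"
      by (rule closed_Collect_le) (intro continuous_on_mult_left continuous_on_power continuous_on_norm continuous_on_inner cp cLp)+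
    ultimately have closed_C: "closed ({z. (L *v p z) \<bullet> q z = (L *v q z) \<bullet> p z} \<inter> ({z. \<mu>0 * (norm (p z))\<^sup>2 \<le> (L *v p z) \<bullet> p z}
        \<inter> {z. (norm (L *v p z))\<^sup>2 \<le> \<mu>1 * ((L *v p z) \<bullet> p z)}))" (is "closed ?C")
      by (intro closed_Int)
    have C_iff: "z \<in> ?C \<longleftrightarrow> ?good x (fst z) (snd z)" for z
      unfolding L_def p_def q_def by blast
    have "T \<times> T \<subseteq> ?C"
    proof
      fix z assume "z \<in> T \<times> T"
      then have "fst z \<in> T" "snd z \<in> T" by auto
      then have "?good x (fst z) (snd z)" using T' ne by blast
      then show "z \<in> ?C" by (rule C_iff[THEN iffD2])
    qed
    then have sub: "closure (T \<times> T) \<subseteq> ?C" using closed_C by (rule closure_minimal)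
    have good: "?good x s s'" for s s'
    proof -
      have "(s, s') \<in> closure (T \<times> T)" by (simp add: closure_Times cl)
      from C_iff[THEN iffD1, OF subsetD[OF sub this]] show ?thesis unfolding fst_conv snd_conv .
    qed
    \<comment> \<open>The constant is chosen so that the affine factor vanishes at \<open>x\<close> and only its slope
         contributes.\<close>
    have sur: "?G x ((1 / \<psi> x) *\<^sub>R \<eta>, - (((1 / \<psi> x) *\<^sub>R \<eta>) \<bullet> x)) = \<eta>" for \<eta>
      using ne by (simp add: affine_cutoff_grad_def)
    show "local_matrix \<psi> x \<in> ellip_mats \<mu>0 \<mu>1"
      unfolding ellip_mats_iff[OF \<mu>]
    proof (intro conjI allI)
      fix \<eta> \<eta>'
      let ?s = "((1 / \<psi> x) *\<^sub>R \<eta>, - (((1 / \<psi> x) *\<^sub>R \<eta>) \<bullet> x))"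
      let ?s' = "((1 / \<psi> x) *\<^sub>R \<eta>', - (((1 / \<psi> x) *\<^sub>R \<eta>') \<bullet> x))"
      note g = good[of ?s ?s', unfolded sur]
      show "(local_matrix \<psi> x *v \<eta>) \<bullet> \<eta>' = (local_matrix \<psi> x *v \<eta>') \<bullet> \<eta>"
        "\<mu>0 * (norm \<eta>)\<^sup>2 \<le> (local_matrix \<psi> x *v \<eta>) \<bullet> \<eta>"
        "(norm (local_matrix \<psi> x *v \<eta>))\<^sup>2 \<le> \<mu>1 * ((local_matrix \<psi> x *v \<eta>) \<bullet> \<eta>)"
        using g by auto
    qed
  qed
qed

text \<open>The local matrices of a sequence of test functions without common zero are glued along the
  first test function that does not vanish at the point.\<close>

lemma limit_matrix:
  "\<exists>a\<in>coeff_fields \<Omega> \<mu>0 \<mu>1. \<forall>g\<in>L2 \<Omega>. AE x in lebesgue_on \<Omega>. Sig g x = flux a (gr (U g)) x"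
proof -
  obtain \<psi> where \<psi>: "\<And>m. test_function \<Omega> (\<psi> m)" "\<And>m x. 0 \<le> \<psi> m x" "\<And>m x. \<psi> m x \<le> 1"
      "\<And>x. (\<lambda>m. \<psi> m x) \<longlonglongrightarrow> indicat_real \<Omega> x"
    by (rule test_functions_tendsto_indicator[OF open_\<Omega>]) (rule that)
  have cover: "\<exists>m. \<psi> m x \<noteq> 0" if x: "x \<in> \<Omega>" for x
  proof (rule ccontr)
    assume "\<nexists>m. \<psi> m x \<noteq> 0"
    then have "(\<lambda>m. \<psi> m x) = (\<lambda>m. 0)" by auto
    then show False using \<psi>(4)[of x] x by (simp add: LIMSEQ_const_iff)
  qed
  define idx where "idx x = (LEAST m. \<psi> m x \<noteq> 0)" for x
  have idx: "\<psi> (idx x) x \<noteq> 0" if "x \<in> \<Omega>" for x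
    unfolding idx_def using cover[OF that] by (rule LeastI_ex)
  define a0 where "a0 x = local_matrix (\<psi> (idx x)) x" for x
  have idx_meas: "idx \<in> measurable (lebesgue_on \<Omega>) (count_space UNIV)"
    unfolding idx_def[abs_def]
  proof (rule measurable_Least)
    fix m
    have "\<psi> m -` (- {0}) \<inter> space (lebesgue_on \<Omega>) \<in> sets (lebesgue_on \<Omega>)"
      by (rule measurable_sets[OF test_function_measurable[OF \<psi>(1)]]) simp
    moreover have "\<psi> m -` (- {0}) \<inter> space (lebesgue_on \<Omega>) = {x \<in> space (lebesgue_on \<Omega>). \<psi> m x \<noteq> 0}" by blast
    ultimately have "{x \<in> space (lebesgue_on \<Omega>). \<psi> m x \<noteq> 0} \<in> sets (lebesgue_on \<Omega>)" by (simp only:)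
    then show "(\<lambda>x. \<psi> m x \<noteq> 0) \<in> measurable (lebesgue_on \<Omega>) (count_space UNIV)"
      by (rule pred_def[THEN iffD2])
  qed
  have a0_meas: "a0 \<in> borel_measurable (lebesgue_on \<Omega>)"
    unfolding a0_def[abs_def]
    by (rule measurable_compose_countable[where f = "\<lambda>m. local_matrix (\<psi> m)", OF local_matrix_measurable[OF \<psi>(1)] idx_meas])
  \<comment> \<open>Inside \<open>\<Omega>\<close> the default value, an admissible matrix, is taken only on a null set.\<close>
  define a where "a x = (if a0 x \<in> ellip_mats \<mu>0 \<mu>1 then a0 x else \<mu>0 *\<^sub>R mat 1)" for x
  have a: "a \<in> coeff_fields \<Omega> \<mu>0 \<mu>1"
  proof -
    have "a0 -` ellip_mats \<mu>0 \<mu>1 \<inter> space (lebesgue_on \<Omega>) \<in> sets (lebesgue_on \<Omega>)"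
      by (rule measurable_sets[OF a0_meas]) (rule borel_closed[OF closed_ellip_mats[OF \<mu>]])
    then have "{x \<in> space (lebesgue_on \<Omega>). a0 x \<in> ellip_mats \<mu>0 \<mu>1} \<in> sets (lebesgue_on \<Omega>)"
      by (simp add: vimage_def Int_def conj_commute)
    then have "a \<in> borel_measurable (lebesgue_on \<Omega>)"
      unfolding a_def[abs_def] by (intro measurable_If a0_meas borel_measurable_const)
    moreover have "(\<mu>0 *\<^sub>R mat 1 :: real^'n^'n) \<in> ellip_mats \<mu>0 \<mu>1" by (rule scaled_identity_ellip[OF \<mu>])
    ultimately show ?thesis by (simp add: coeff_fields_def a_def)
  qed
  have in\<Omega>: "AE x in lebesgue_on \<Omega>. x \<in> \<Omega>" by (intro AE_I2) (simp add: space_restrict_space)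
  have "AE x in lebesgue_on \<Omega>. \<forall>m. \<psi> m x \<noteq> 0 \<longrightarrow> local_matrix (\<psi> m) x \<in> ellip_mats \<mu>0 \<mu>1"
    by (intro AE_all_countable[THEN iffD2] allI local_matrix_elliptic \<psi>)
  with in\<Omega> have a_eq: "AE x in lebesgue_on \<Omega>. a x = a0 x"
    by eventually_elim (auto simp: a_def a0_def dest: idx)
  have "AE x in lebesgue_on \<Omega>. Sig g x = flux a (gr (U g)) x" if g: "g \<in> L2 \<Omega>" for g
  proof -
    have "AE x in lebesgue_on \<Omega>. \<forall>m. \<psi> m x \<noteq> 0 \<longrightarrow> Sig g x = local_matrix (\<psi> m) x *v gr (U g) x"
      by (intro AE_all_countable[THEN iffD2] allI flux_eq_local_matrix \<psi> g)
    with in\<Omega> a_eq show ?thesis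
    proof eventually_elim
      case (elim x)
      from elim(3) idx[OF elim(1)] have "Sig g x = local_matrix (\<psi> (idx x)) x *v gr (U g) x" by blast
      then show ?case by (simp add: flux_def elim(2) a0_def)
    qed
  qed
  with a show ?thesis by blast
qed

end

section \<open>Sequential compactness of H-convergence\<close>

context elliptic
begin

lemma energy_weak_grad:
  assumes a: "a \<in> Coeff" and p: "p \<in> V" and q: "q \<in> V"
  shows "(LINT x|lebesgue_on \<Omega>. (a x *v weak_grad \<Omega> (val p) x) \<bullet> weak_grad \<Omega> (val q) x) = energy a p q"
proof -
  note wp = weak_grad_V[OF p] and wq = weak_grad_V[OF q]
  have "N (flux a (weak_grad \<Omega> (val p)) - flux a (gr p)) \<le> \<mu>1 * N (weak_grad \<Omega> (val p) - gr p)"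
    using flux_L2(2)[OF a L2.S_diff[OF wp(1) V_gr[OF p]]] by (simp add: flux_diff)
  then have z: "N (flux a (weak_grad \<Omega> (val p)) - flux a (gr p)) = 0"
    using wp(2) L2.nrm_nonneg[OF L2.S_diff[OF flux_L2(1)[OF a wp(1)] flux_L2(1)[OF a V_gr[OF p]]]] by simp
  have "(LINT x|lebesgue_on \<Omega>. (a x *v weak_grad \<Omega> (val p) x) \<bullet> weak_grad \<Omega> (val q) x)
      = L2_inner \<Omega> (flux a (weak_grad \<Omega> (val p))) (weak_grad \<Omega> (val q))"
    by (simp add: L2_inner_def flux_def)
  also have "\<dots> = L2_inner \<Omega> (flux a (gr p)) (weak_grad \<Omega> (val q))"
    by (rule L2_inner_cong_AE[OF flux_L2(1)[OF a wp(1)] flux_L2(1)[OF a V_gr[OF p]] wq(1) z])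
  also have "\<dots> = L2_inner \<Omega> (weak_grad \<Omega> (val q)) (flux a (gr p))" by (rule L2.ip_commute)
  also have "\<dots> = L2_inner \<Omega> (gr q) (flux a (gr p))"
    by (rule L2_inner_cong_AE[OF wq(1) V_gr[OF q] flux_L2(1)[OF a V_gr[OF p]] wq(2)])
  also have "\<dots> = energy a p q" unfolding energy_def by (rule L2.ip_commute)
  finally show ?thesis .
qed

lemma W12_0_eq_image: "W12_0 \<Omega> = val ` V"
  by (auto simp: W12_0_iff)

lemma weak_solution_iff:
  assumes a: "a \<in> Coeff" and p: "p \<in> V"
  shows "weak_solution \<Omega> a f (val p) \<longleftrightarrow> (\<forall>q\<in>V. energy a p q = f (val q))"
  unfolding weak_solution_def W12_0_eq_image using p energy_weak_grad[OF a p] by simp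

lemma W12_dual_dualV: assumes F: "F \<in> W12_dual \<Omega>" shows "dualV (\<lambda>p. F (val p))"
proof -
  have W: "val p \<in> W12_0 \<Omega>" if "p \<in> V" for p using that W12_0_iff by blast
  obtain C where C: "\<forall>u\<in>W12_0 \<Omega>. \<bar>F u\<bar> \<le> C * W12_norm \<Omega> u" using F by (auto simp: W12_dual_def)
  show ?thesis
  proof (rule dualVI)
    show "linear_functional_on V (\<lambda>p. F (val p))"
    proof (rule linear_functional_onI)
      show "F (val (p + q)) = F (val p) + F (val q)" if "p \<in> V" "q \<in> V" for p q
      proof -
        have "val (p + q) = (\<lambda>x. val p x + val q x)" by (simp add: val_add fun_eq_iff)
        then show ?thesis using F W[OF that(1)] W[OF that(2)] by (simp add: W12_dual_def)
      qed
      show "F (val (c *\<^sub>R p)) = c * F (val p)" if "p \<in> V" for p c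
      proof -
        have "val (c *\<^sub>R p) = (\<lambda>x. c * val p x)" by (simp add: val_scale fun_eq_iff)
        then show ?thesis using F W[OF that] by (simp add: W12_dual_def)
      qed
    qed
    show "\<bar>F (val p)\<bar> \<le> C * N p" if "p \<in> V" for p
      using C W[OF that] W12_norm_V[OF that] by metis
  qed
qed

lemma convergent_subseq:
  fixes x :: "nat \<Rightarrow> real"
  assumes "convergent x" "strict_mono r" shows "convergent (\<lambda>k. x (r k))"
  using convergent_subseq_convergent[OF assms] by (simp add: o_def)

text \<open>The pairings \<open>\<langle>\<Phi>\<^sub>k g, h\<rangle>\<close> are bounded and linear in both arguments. Extraction settles \<open>g\<close>
  among the probes and all \<open>h\<close>; for fixed \<open>h\<close> convergence then extends to all \<open>g\<close>. This is
  applied to the gradients and, along the subsequence obtained, to the fluxes.\<close>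

lemma limit_data_exists:
  assumes as: "\<And>k. as k \<in> Coeff"
  shows "\<exists>r U Sig. strict_mono (r :: nat \<Rightarrow> nat) \<and> limit_data \<Omega> \<mu>0 \<mu>1 (\<lambda>k. as (r k)) U Sig"
proof -
  let ?T = "L2_probes :: (real^'n \<Rightarrow> real^'n) set"
  let ?m = "sqrt (measure lebesgue \<Omega>)"
  have \<mu>1: "\<mu>1 > 0" using \<mu> by simp
  have ext: "\<exists>r. strict_mono (r :: nat \<Rightarrow> nat) \<and> (\<forall>g\<in>L2 \<Omega>. \<forall>h\<in>L2 \<Omega>. convergent (\<lambda>k. L2_inner \<Omega> (\<Phi> (r k) g) h))"
    if \<Phi>L: "\<And>k g. g \<in> L2 \<Omega> \<Longrightarrow> \<Phi> k g \<in> L2 \<Omega>" and \<Phi>b: "\<And>k g. g \<in> L2 \<Omega> \<Longrightarrow> N (\<Phi> k g) \<le> K * N g" and K: "0 \<le> K"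
      and \<Phi>lin: "\<And>k h. h \<in> L2 \<Omega> \<Longrightarrow> linear_functional_on (L2 \<Omega>) (\<lambda>g. L2_inner \<Omega> (\<Phi> k g) h)"
    for \<Phi> :: "nat \<Rightarrow> (real^'n \<Rightarrow> real^'n) \<Rightarrow> real^'n \<Rightarrow> real^'n" and K
  proof -
    have bound: "\<bar>L2_inner \<Omega> (\<Phi> k g) h\<bar> \<le> K * N g * N h" if "g \<in> L2 \<Omega>" "h \<in> L2 \<Omega>" for k g h
      using L2.Cauchy_Schwarz[OF \<Phi>L[OF that(1), of k] that(2)] mult_right_mono[OF \<Phi>b[OF that(1), of k] L2.nrm_nonneg[OF that(2)]]
      by linarith
    obtain r where r: "strict_mono (r :: nat \<Rightarrow> nat)"
        "\<And>t h. t \<in> ?T \<Longrightarrow> h \<in> L2 \<Omega> \<Longrightarrow> convergent (\<lambda>k. L2_inner \<Omega> (\<Phi> (r k) t) h)"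
    proof (rule extraction[of ?T "\<lambda>k t h. L2_inner \<Omega> (\<Phi> k t) h" "K * ?m"])
      show "countable ?T" by (rule countable_L2_probes)
      fix k and t :: "real^'n \<Rightarrow> real^'n" assume t: "t \<in> ?T"
      note tL = L2_probes_L2[OF lmeasurable_\<Omega> t]
      show "linear_functional_on (L2 \<Omega>) (L2_inner \<Omega> (\<Phi> k t))" by (rule linear_inner_right[OF \<Phi>L[OF tL(1)]])
      fix u :: "real^'n \<Rightarrow> real^'n" assume u: "u \<in> L2 \<Omega>"
      have "K * N t * N u \<le> K * ?m * N u"
        by (intro mult_right_mono mult_left_mono tL K L2.nrm_nonneg u)
      then show "\<bar>L2_inner \<Omega> (\<Phi> k t) u\<bar> \<le> K * ?m * N u" using bound[OF tL(1) u, of k] by linarith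
    qed (rule that)
    have "convergent (\<lambda>k. L2_inner \<Omega> (\<Phi> (r k) g) h)" if g: "g \<in> L2 \<Omega>" and h: "h \<in> L2 \<Omega>" for g h
    proof (rule converge_on_L2[where f = "\<lambda>k g. L2_inner \<Omega> (\<Phi> (r k) g) h" and C = "K * N h", OF \<Phi>lin[OF h] _ r(2)[OF _ h] g])
      show "\<bar>L2_inner \<Omega> (\<Phi> (r k) u) h\<bar> \<le> K * N h * N u" if "u \<in> L2 \<Omega>" for k u
        using bound[OF that h, of "r k"] by (simp add: mult_ac)
    qed
    then show ?thesis using r(1) by blast
  qed
  have "\<exists>r. strict_mono (r :: nat \<Rightarrow> nat) \<and> (\<forall>g\<in>L2 \<Omega>. \<forall>h\<in>L2 \<Omega>. convergent (\<lambda>k. L2_inner \<Omega> (gr (soln (as (r k)) g)) h))"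
  proof (rule ext[of "\<lambda>k g. gr (soln (as k) g)" "1 / \<mu>0"])
    show "gr (soln (as k) g) \<in> L2 \<Omega>" if "g \<in> L2 \<Omega>" for k g by (rule V_gr[OF soln(1)[OF as that]])
    show "N (gr (soln (as k) g)) \<le> 1 / \<mu>0 * N g" if "g \<in> L2 \<Omega>" for k g
      using soln_bound(1)[OF as that, of k] by simp
    show "linear_functional_on (L2 \<Omega>) (\<lambda>g. L2_inner \<Omega> (gr (soln (as k) g)) h)" if h: "h \<in> L2 \<Omega>" for k h
    proof (rule linear_in_data[OF as, where L = "\<lambda>u. L2_inner \<Omega> u h" and C = "N h"])
      show "\<bar>L2_inner \<Omega> u h\<bar> \<le> N h * N u" if "u \<in> L2 \<Omega>" for u
        using L2.Cauchy_Schwarz[OF that h] by (simp add: mult.commute)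
    qed (rule L2.ip_linear[OF h])
  qed (use \<mu> in simp)
  then obtain r1 where r1: "strict_mono (r1 :: nat \<Rightarrow> nat)"
      "\<And>g h. g \<in> L2 \<Omega> \<Longrightarrow> h \<in> L2 \<Omega> \<Longrightarrow> convergent (\<lambda>k. L2_inner \<Omega> (gr (soln (as (r1 k)) g)) h)" by blast
  have "\<exists>r. strict_mono (r :: nat \<Rightarrow> nat) \<and> (\<forall>g\<in>L2 \<Omega>. \<forall>h\<in>L2 \<Omega>. convergent (\<lambda>k. L2_inner \<Omega> (flux (as (r1 (r k))) (gr (soln (as (r1 (r k))) g))) h))"
  proof (rule ext[of "\<lambda>k g. flux (as (r1 k)) (gr (soln (as (r1 k)) g))" "\<mu>1 / \<mu>0"])
    note s = V_gr[OF soln(1)[OF as]]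
    show "flux (as (r1 k)) (gr (soln (as (r1 k)) g)) \<in> L2 \<Omega>" if "g \<in> L2 \<Omega>" for k g by (rule flux_L2(1)[OF as s[OF that]])
    show "N (flux (as (r1 k)) (gr (soln (as (r1 k)) g))) \<le> \<mu>1 / \<mu>0 * N g" if "g \<in> L2 \<Omega>" for k g
      by (rule soln_bound(2)[OF as that])
    show "linear_functional_on (L2 \<Omega>) (\<lambda>g. L2_inner \<Omega> (flux (as (r1 k)) (gr (soln (as (r1 k)) g))) h)" if h: "h \<in> L2 \<Omega>" for k h
    proof (rule linear_in_data[OF as, where L = "\<lambda>u. L2_inner \<Omega> (flux (as (r1 k)) u) h" and C = "\<mu>1 * N h"])
      show "linear_functional_on (L2 \<Omega>) (\<lambda>u. L2_inner \<Omega> (flux (as (r1 k)) u) h)"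
        by (rule linear_functional_onI)
           (simp_all add: flux_add flux_scale L2.ip_add_left L2.ip_scale_left flux_L2(1)[OF as] h)
      show "\<bar>L2_inner \<Omega> (flux (as (r1 k)) u) h\<bar> \<le> \<mu>1 * N h * N u" if "u \<in> L2 \<Omega>" for u
        using L2.Cauchy_Schwarz[OF flux_L2(1)[OF as that, of "r1 k"] h]
          mult_right_mono[OF flux_L2(2)[OF as that, of "r1 k"] L2.nrm_nonneg[OF h]] by (simp add: mult_ac)
    qed
  qed (use \<mu> \<mu>1 in simp)
  then obtain r2 where r2: "strict_mono (r2 :: nat \<Rightarrow> nat)"
      "\<And>g h. g \<in> L2 \<Omega> \<Longrightarrow> h \<in> L2 \<Omega> \<Longrightarrow> convergent (\<lambda>k. L2_inner \<Omega> (flux (as (r1 (r2 k))) (gr (soln (as (r1 (r2 k))) g))) h)" by blast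
  define r where "r k = r1 (r2 k)" for k
  have r: "strict_mono r" using strict_mono_o[OF r1(1) r2(1)] by (simp add: r_def[abs_def] o_def)
  have c1: "convergent (\<lambda>k. L2_inner \<Omega> (gr (soln (as (r k)) g)) h)" if "g \<in> L2 \<Omega>" "h \<in> L2 \<Omega>" for g h
    using convergent_subseq[OF r1(2)[OF that] r2(1)] by (simp add: r_def)
  have c2: "convergent (\<lambda>k. L2_inner \<Omega> (flux (as (r k)) (gr (soln (as (r k)) g))) h)" if "g \<in> L2 \<Omega>" "h \<in> L2 \<Omega>" for g h
    using r2(2)[OF that] by (simp add: r_def)
  have "\<forall>g. g \<in> L2 \<Omega> \<longrightarrow> (\<exists>w. w \<in> V \<and> (\<forall>F. dualV F \<longrightarrow> (\<lambda>k. F (soln (as (r k)) g)) \<longlonglongrightarrow> F w))"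
    using weak_limit_V[OF soln(1)[OF as] soln_bound(1)[OF as] c1] by blast
  then obtain U where U: "\<And>g. g \<in> L2 \<Omega> \<Longrightarrow> U g \<in> V \<and> (\<forall>F. dualV F \<longrightarrow> (\<lambda>k. F (soln (as (r k)) g)) \<longlonglongrightarrow> F (U g))" by metis
  have "\<exists>w. w \<in> L2 \<Omega> \<and> (\<forall>h\<in>L2 \<Omega>. (\<lambda>k. L2_inner \<Omega> (flux (as (r k)) (gr (soln (as (r k)) g))) h) \<longlonglongrightarrow> L2_inner \<Omega> w h)" if g: "g \<in> L2 \<Omega>" for g
  proof -
    have sL: "flux (as (r k)) (gr (soln (as (r k)) g)) \<in> L2 \<Omega>" for k by (intro flux_L2 as V_gr soln g)
    obtain w where w: "w \<in> L2 \<Omega>" "\<And>h. h \<in> L2 \<Omega> \<Longrightarrow> (\<lambda>k. L2_inner \<Omega> (flux (as (r k)) (gr (soln (as (r k)) g))) h) \<longlonglongrightarrow> L2_inner \<Omega> w h"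
    proof (rule semi_hilbert_space.functional_limit[OF L2_hilbert, unfolded nrm_L2,
          where f = "\<lambda>k. L2_inner \<Omega> (flux (as (r k)) (gr (soln (as (r k)) g)))" and C = "\<mu>1 / \<mu>0 * N g"])
      show "linear_functional_on (L2 \<Omega>) (L2_inner \<Omega> (flux (as (r k)) (gr (soln (as (r k)) g))))" for k
        by (rule linear_inner_right[OF sL])
      show "\<bar>L2_inner \<Omega> (flux (as (r k)) (gr (soln (as (r k)) g))) u\<bar> \<le> \<mu>1 / \<mu>0 * N g * N u" if "u \<in> L2 \<Omega>" for k u
        using L2.Cauchy_Schwarz[OF sL that, of k] mult_right_mono[OF soln_bound(2)[OF as g, of "r k"] L2.nrm_nonneg[OF that]] by linarith
      show "convergent (\<lambda>k. L2_inner \<Omega> (flux (as (r k)) (gr (soln (as (r k)) g))) h)" if "h \<in> L2 \<Omega>" for h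
        by (rule c2[OF g that])
    qed (rule that)
    show ?thesis by (intro exI[of _ w] conjI ballI w)
  qed
  then have "\<forall>g. \<exists>w. g \<in> L2 \<Omega> \<longrightarrow> w \<in> L2 \<Omega> \<and> (\<forall>h\<in>L2 \<Omega>. (\<lambda>k. L2_inner \<Omega> (flux (as (r k)) (gr (soln (as (r k)) g))) h) \<longlonglongrightarrow> L2_inner \<Omega> w h)"
    by (intro allI) (simp only: ex_simps, rule impI)
  from choice[OF this] obtain Sig where Sig: "\<And>g. g \<in> L2 \<Omega> \<Longrightarrow> Sig g \<in> L2 \<Omega> \<and> (\<forall>h\<in>L2 \<Omega>. (\<lambda>k. L2_inner \<Omega> (flux (as (r k)) (gr (soln (as (r k)) g))) h) \<longlonglongrightarrow> L2_inner \<Omega> (Sig g) h)" by blast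
  have "limit_data \<Omega> \<mu>0 \<mu>1 (\<lambda>k. as (r k)) U Sig"
    by unfold_locales (use as U Sig in auto)
  with r show ?thesis by blast
qed

text \<open>A functional on the Sobolev space is the pairing with a gradient \<open>g\<close>, for which \<open>U g\<close>
  solves the equation with the coefficient of \<open>limit_matrix\<close>.\<close>

lemma H_compactness:
  assumes as: "\<And>k. as k \<in> Coeff"
  obtains r a where "strict_mono (r :: nat \<Rightarrow> nat)" "a \<in> Coeff" "H_converges \<Omega> (\<lambda>k. as (r k)) a"
proof -
  obtain r U Sig where r: "strict_mono (r :: nat \<Rightarrow> nat)" and lim: "limit_data \<Omega> \<mu>0 \<mu>1 (\<lambda>k. as (r k)) U Sig"
    using limit_data_exists[of as, OF as] by blast
  interpret L: limit_data \<Omega> \<mu>0 \<mu>1 "\<lambda>k. as (r k)" U Sig by (rule lim)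
  obtain a where a: "a \<in> Coeff" "\<And>g. g \<in> L2 \<Omega> \<Longrightarrow> AE x in lebesgue_on \<Omega>. Sig g x = flux a (gr (U g)) x"
    using L.limit_matrix by blast
  have "H_converges \<Omega> (\<lambda>k. as (r k)) a"
    unfolding H_converges_def
  proof
    fix f assume f: "f \<in> W12_dual \<Omega>"
    obtain e where e: "e \<in> V" "\<forall>q\<in>V. L2_inner \<Omega> (gr e) (gr q) = f (val q)"
      using Riesz_gradient[OF W12_dual_dualV[OF f]] by blast
    define g where "g = gr e"
    have g: "g \<in> L2 \<Omega>" unfolding g_def by (rule V_gr[OF e(1)])
    have eg: "L2_inner \<Omega> g (gr q) = f (val q)" if "q \<in> V" for q using e(2) that by (simp add: g_def)
    have 1: "weak_solution \<Omega> (as (r k)) f (val (soln (as (r k)) g))" for k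
      using soln[OF as g] eg by (simp add: weak_solution_iff[OF as])
    have "energy a (U g) q = f (val q)" if q: "q \<in> V" for q
    proof -
      have L: "Sig g \<in> L2 \<Omega>" "flux a (gr (U g)) \<in> L2 \<Omega>" by (intro L.Sig flux_L2 a(1) L.GU_L2 g)+
      have "N (flux a (gr (U g)) - Sig g) = 0"
        unfolding L2_norm_zero_iff[OF L2.S_diff[OF L(2,1)]] using a(2)[OF g] by eventually_elim simp
      then have "energy a (U g) q = L2_inner \<Omega> (Sig g) (gr q)"
        unfolding energy_def by (rule L2_inner_cong_AE[OF L(2,1) V_gr[OF q]])
      then show ?thesis using L.Sig_equation[OF g q] eg[OF q] by simp
    qed
    then have 2: "weak_solution \<Omega> a f (val (U g))"
      by (simp add: weak_solution_iff[OF a(1) L.U[OF g]])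
    have 3: "weakly_converges_W12_0 \<Omega> (\<lambda>k. val (soln (as (r k)) g)) (val (U g))"
      unfolding weakly_converges_W12_0_def
    proof (intro conjI allI ballI)
      show "val (soln (as (r k)) g) \<in> W12_0 \<Omega>" for k using soln(1)[OF as g] W12_0_iff by blast
      show "val (U g) \<in> W12_0 \<Omega>" using L.U[OF g] W12_0_iff by blast
      show "(\<lambda>k. G (val (soln (as (r k)) g))) \<longlonglongrightarrow> G (val (U g))" if "G \<in> W12_dual \<Omega>" for G
        by (rule L.U_lim[OF g W12_dual_dualV[OF that]])
    qed
    show "\<exists>ys y. (\<forall>k. weak_solution \<Omega> (as (r k)) f (ys k)) \<and> weak_solution \<Omega> a f y \<and> weakly_converges_W12_0 \<Omega> ys y"
      using 1 2 3 by (intro exI conjI allI)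
  qed
  with r a(1) show ?thesis by (intro that)
qed

end

section \<open>Principal eigenvalues along H-convergent sequences\<close>

context elliptic
begin

lemma energy_diff_left: "a \<in> Coeff \<Longrightarrow> p \<in> V \<Longrightarrow> q \<in> V \<Longrightarrow> v \<in> V \<Longrightarrow> energy a (p - q) v = energy a p v - energy a q v"
  and energy_scale_left: "a \<in> Coeff \<Longrightarrow> p \<in> V \<Longrightarrow> v \<in> V \<Longrightarrow> energy a (c *\<^sub>R p) v = c * energy a p v"
  by (simp_all add: energy_def gr_diff gr_scale flux_diff flux_scale
      L2.ip_diff_left L2.ip_scale_left flux_L2 V_gr)

lemma energy_sym: "a \<in> Coeff \<Longrightarrow> p \<in> V \<Longrightarrow> q \<in> V \<Longrightarrow> energy a p q = energy a q p"
  unfolding energy_def by (intro flux_sym V_gr)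

lemma energy_nonneg: assumes "a \<in> Coeff" "p \<in> V" shows "0 \<le> energy a p p"
proof -
  have "0 \<le> \<mu>0 * (N (gr p))\<^sup>2" using \<mu> by simp
  then show ?thesis
    using flux_coercive(1)[OF assms(1) V_gr[OF assms(2)]] unfolding energy_def by linarith
qed

lemma val_inner_W12_dual: assumes v: "v \<in> L2 \<Omega>" shows "(\<lambda>u. L2_inner \<Omega> v u) \<in> W12_dual \<Omega>"
  unfolding W12_dual_def W12_0_eq_image
proof (intro CollectI conjI)
  show "\<forall>u\<in>val ` V. \<forall>w\<in>val ` V. L2_inner \<Omega> v (\<lambda>x. u x + w x) = L2_inner \<Omega> v u + L2_inner \<Omega> v w"
    using L2.ip_add_right[OF V_val V_val v] by (auto simp: plus_fun_def)
  show "\<forall>u\<in>val ` V. \<forall>c. L2_inner \<Omega> v (\<lambda>x. c * u x) = c * L2_inner \<Omega> v u"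
    using L2.ip_scale_right[OF V_val v] by (auto simp: scaleR_fun_def)
  have "\<bar>L2_inner \<Omega> v (val p)\<bar> \<le> N v * W12_norm \<Omega> (val p)" if p: "p \<in> V" for p
    using L2.Cauchy_Schwarz[OF v V_val[OF p]] mult_left_mono[OF L2_val(2)[OF V_L2[OF p]] L2.nrm_nonneg[OF v]]
    by (simp add: W12_norm_V[OF p])
  then show "\<exists>C. \<forall>u\<in>val ` V. \<bar>L2_inner \<Omega> v u\<bar> \<le> C * W12_norm \<Omega> u" by blast
qed

lemma gradient_inner_W12_dual:
  assumes s: "s \<in> L2 \<Omega>"
  shows "(\<lambda>u. L2_inner \<Omega> s (weak_grad \<Omega> u)) \<in> W12_dual \<Omega>"
    and "q \<in> V \<Longrightarrow> L2_inner \<Omega> s (weak_grad \<Omega> (val q)) = L2_inner \<Omega> s (gr q)"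
proof -
  show eq: "L2_inner \<Omega> s (weak_grad \<Omega> (val q)) = L2_inner \<Omega> s (gr q)" if q: "q \<in> V" for q
    using L2_inner_cong_AE[OF weak_grad_V(1)[OF q] V_gr[OF q] s weak_grad_V(2)[OF q]]
    unfolding L2.ip_commute[of \<Omega> _ s] .
  show "(\<lambda>u. L2_inner \<Omega> s (weak_grad \<Omega> u)) \<in> W12_dual \<Omega>"
    unfolding W12_dual_def W12_0_eq_image
  proof (intro CollectI conjI ballI allI)
    fix u w assume "u \<in> val ` V" "w \<in> val ` V"
    then obtain p q where p: "p \<in> V" "u = val p" and q: "q \<in> V" "w = val q" by blast
    have "(\<lambda>x. u x + w x) = val (p + q)" by (simp add: p q val_add fun_eq_iff)
    then show "L2_inner \<Omega> s (weak_grad \<Omega> (\<lambda>x. u x + w x)) = L2_inner \<Omega> s (weak_grad \<Omega> u) + L2_inner \<Omega> s (weak_grad \<Omega> w)"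
      by (simp add: p q eq V_add gr_add L2.ip_add_right V_gr s)
  next
    fix u c assume "u \<in> val ` V"
    then obtain p where p: "p \<in> V" "u = val p" by blast
    have "(\<lambda>x. c * u x) = val (c *\<^sub>R p)" by (simp add: p val_scale fun_eq_iff)
    then show "L2_inner \<Omega> s (weak_grad \<Omega> (\<lambda>x. c * u x)) = c * L2_inner \<Omega> s (weak_grad \<Omega> u)"
      by (simp add: p eq V_scale gr_scale L2.ip_scale_right V_gr s)
  next
    have "\<bar>L2_inner \<Omega> s (weak_grad \<Omega> (val p))\<bar> \<le> N s * W12_norm \<Omega> (val p)" if p: "p \<in> V" for p
      using L2.Cauchy_Schwarz[OF s V_gr[OF p]] mult_left_mono[OF L2_gr(2)[OF V_L2[OF p]] L2.nrm_nonneg[OF s]]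
      by (simp add: W12_norm_V[OF p] eq[OF p])
    then show "\<exists>C. \<forall>u\<in>val ` V. \<bar>L2_inner \<Omega> s (weak_grad \<Omega> u)\<bar> \<le> C * W12_norm \<Omega> u" by blast
  qed
qed

lemma W12_dual_null:
  assumes G: "G \<in> W12_dual \<Omega>" and p: "p \<in> V" "q \<in> V" and z: "N (gr (p - q)) = 0"
  shows "G (val p) = G (val q)"
proof -
  obtain D where D: "D > 0" "\<And>p. p \<in> V \<Longrightarrow> N p \<le> D * N (gr p)" using V_norm_le by blast
  have d: "p - q \<in> V" by (rule V_diff[OF p])
  have "N (p - q) = 0" using D(2)[OF d] z L2.nrm_nonneg[OF V_L2[OF d]] by simp
  obtain K where K: "\<forall>p\<in>V. \<bar>G (val p)\<bar> \<le> K * N p" and lin: "linear_functional_on V (\<lambda>p. G (val p))"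
    using W12_dual_dualV[OF G] unfolding dualV_def by blast
  have "\<bar>G (val (p - q))\<bar> \<le> K * N (p - q)" using K d by blast
  then show ?thesis
    using linear_functional_onD(3)[OF lin subspace_V p] \<open>N (p - q) = 0\<close> by simp
qed

text \<open>Solve with \<open>as k\<close> for the right-hand side that \<open>p\<close> produces with \<open>a\<close>. H-convergence says
  that the solutions tend weakly to a solution for \<open>a\<close>, which can differ from \<open>p\<close> only by a
  null function.\<close>

lemma recovery_sequence:
  assumes as: "\<And>k. as k \<in> Coeff" and a: "a \<in> Coeff" and H: "H_converges \<Omega> as a" and p: "p \<in> V"
  obtains q where "\<And>k. q k \<in> V" "\<And>k v. v \<in> V \<Longrightarrow> energy (as k) (q k) v = energy a p v"
    "\<And>G. G \<in> W12_dual \<Omega> \<Longrightarrow> (\<lambda>k. G (val (q k))) \<longlonglongrightarrow> G (val p)"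
    "(\<lambda>k. energy a p (q k)) \<longlonglongrightarrow> energy a p p"
proof -
  have s: "flux a (gr p) \<in> L2 \<Omega>" by (rule flux_L2(1)[OF a V_gr[OF p]])
  define f where "f u = L2_inner \<Omega> (flux a (gr p)) (weak_grad \<Omega> u)" for u
  have f: "f \<in> W12_dual \<Omega>" "\<And>v. v \<in> V \<Longrightarrow> f (val v) = energy a p v"
    using gradient_inner_W12_dual[OF s] by (simp_all add: f_def[abs_def] energy_def)
  obtain ys y where ys: "\<And>k. weak_solution \<Omega> (as k) f (ys k)" and y: "weak_solution \<Omega> a f y"
    and w: "weakly_converges_W12_0 \<Omega> ys y"
    using H f(1) unfolding H_converges_def by blast
  have "\<forall>k. \<exists>q. q \<in> V \<and> val q = ys k"
    using w unfolding weakly_converges_W12_0_def W12_0_iff by blast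
  then obtain q where q: "\<And>k. q k \<in> V" "\<And>k. val (q k) = ys k" by metis
  obtain q0 where q0: "q0 \<in> V" "val q0 = y"
    using w unfolding weakly_converges_W12_0_def W12_0_iff by blast
  have e: "energy (as k) (q k) v = energy a p v" if "v \<in> V" for k v
    using ys[of k] weak_solution_iff[OF as[of k] q(1)[of k], of f] f(2)[OF that] that by (simp add: q(2))
  have e0: "energy a q0 v = energy a p v" if "v \<in> V" for v
    using y weak_solution_iff[OF a q0(1), of f] f(2)[OF that] that by (simp add: q0(2))
  have z: "N (gr (q0 - p)) = 0" by (rule energy_unique[OF a q0(1) p e0])
  have lim: "(\<lambda>k. G (val (q k))) \<longlonglongrightarrow> G (val p)" if G: "G \<in> W12_dual \<Omega>" for G
  proof -
    have "(\<lambda>k. G (ys k)) \<longlonglongrightarrow> G y"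
      using w G unfolding weakly_converges_W12_0_def by blast
    also have "y = val q0" by (rule q0(2)[symmetric])
    also have "G (val q0) = G (val p)" by (rule W12_dual_null[OF G q0(1) p z])
    finally show ?thesis by (simp only: q(2))
  qed
  show ?thesis
  proof (rule that[OF q(1) e lim])
    show "(\<lambda>k. energy a p (q k)) \<longlonglongrightarrow> energy a p p"
      using lim[OF f(1)] by (simp add: f(2) q(1) p)
  qed
qed

lemma eigenvalue_set:
  "{y \<in> W12_0 \<Omega>. \<not> (AE x in lebesgue_on \<Omega>. y x = 0)} = val ` {p \<in> V. N (val p) \<noteq> 0}"
  using L2_norm_zero_iff[OF V_val] by (auto simp: W12_0_eq_image)

lemma eigenvalue_eq:
  assumes "a \<in> Coeff"
  shows "principal_eigenvalue \<Omega> a = (INF p\<in>{p \<in> V. N (val p) \<noteq> 0}. energy a p p / (N (val p))\<^sup>2)"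
  unfolding principal_eigenvalue_def eigenvalue_set image_image
  using energy_weak_grad[OF assms] by (intro INF_cong) auto

lemma eigenvalue_bdd:
  assumes "a \<in> Coeff" shows "bdd_below ((\<lambda>p. energy a p p / (N (val p))\<^sup>2) ` {p \<in> V. N (val p) \<noteq> 0})"
  using energy_nonneg[OF assms] by (intro bdd_belowI2[of _ 0]) simp

lemma eigenvalue_le:
  assumes a: "a \<in> Coeff" and p: "p \<in> V"
  shows "principal_eigenvalue \<Omega> a * (N (val p))\<^sup>2 \<le> energy a p p"
proof (cases "N (val p) = 0")
  case True
  then show ?thesis using energy_nonneg[OF a p] by simp
next
  case False
  have "principal_eigenvalue \<Omega> a \<le> energy a p p / (N (val p))\<^sup>2"
    unfolding eigenvalue_eq[OF a] by (rule cINF_lower[OF eigenvalue_bdd[OF a]]) (use p False in simp)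
  then show ?thesis using False by (simp add: pos_le_divide_eq)
qed

lemma nonzero_V: assumes "\<Omega> \<noteq> {}" shows "\<exists>p\<in>V. N (val p) \<noteq> 0"
proof -
  obtain c where c: "c \<in> \<Omega>" using assms by blast
  obtain r where r: "r > 0" "cball c r \<subseteq> \<Omega>" using open_contains_cball[of \<Omega>] open_\<Omega> c by blast
  obtain b where b: "test_function \<Omega> b" "\<And>x. 0 \<le> b x" "\<And>x. b x \<noteq> 0 \<longleftrightarrow> x \<in> ball c r"
    by (rule bump_ball[OF r]) (rule that)
  have "N b \<noteq> 0"
  proof
    assume "N b = 0"
    then have "AE x in lebesgue_on \<Omega>. b x = 0" using L2_norm_zero_iff[OF test_function_L2[OF b(1)]] by blast
    then have "AE x in lebesgue. x \<in> \<Omega> \<longrightarrow> b x = 0"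
      using open_\<Omega> by (subst (asm) AE_restrict_space_iff) auto
    then have "AE x in lebesgue. x \<notin> ball c r"
    proof (rule eventually_mono)
      fix x assume "x \<in> \<Omega> \<longrightarrow> b x = 0"
      then show "x \<notin> ball c r" using b(3)[of x] r(2) ball_subset_cball[of c r] by blast
    qed
    then have "ball c r \<in> null_sets lebesgue" by (subst (asm) AE_iff_null_sets[symmetric]) auto
    then have "negligible (ball c r)" by (simp add: negligible_iff_null_sets)
    then show False using open_not_negligible[OF open_ball] r(1) by (metis ball_eq_empty not_le)
  qed
  then show ?thesis using test_jet_V[OF b(1)] by (intro bexI[of _ "test_jet b"]) simp_all
qed

lemma eigenvalue_ge:
  assumes a: "a \<in> Coeff" and ne: "\<Omega> \<noteq> {}" and c: "\<And>p. p \<in> V \<Longrightarrow> c * (N (val p))\<^sup>2 \<le> energy a p p"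
  shows "c \<le> principal_eigenvalue \<Omega> a"
  unfolding eigenvalue_eq[OF a]
proof (rule cINF_greatest)
  show "{p \<in> V. N (val p) \<noteq> 0} \<noteq> {}" using nonzero_V[OF ne] by blast
  show "c \<le> energy a p p / (N (val p))\<^sup>2" if "p \<in> {p \<in> V. N (val p) \<noteq> 0}" for p
    using c[of p] that by (simp add: pos_le_divide_eq)
qed

lemma eigenvalue_nonneg: "a \<in> Coeff \<Longrightarrow> \<Omega> \<noteq> {} \<Longrightarrow> 0 \<le> principal_eigenvalue \<Omega> a"
  by (rule eigenvalue_ge) (simp_all add: energy_nonneg)

lemma eigenvalue_near_minimiser:
  assumes a: "a \<in> Coeff" and ne: "\<Omega> \<noteq> {}" and e: "e > 0"
  shows "\<exists>p\<in>V. N (val p) = 1 \<and> energy a p p < principal_eigenvalue \<Omega> a + e"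
proof -
  let ?X = "{p \<in> V. N (val p) \<noteq> 0}"
  have "(INF p\<in>?X. energy a p p / (N (val p))\<^sup>2) < principal_eigenvalue \<Omega> a + e"
    using e by (simp add: eigenvalue_eq[OF a])
  moreover have "?X \<noteq> {}" using nonzero_V[OF ne] by blast
  ultimately obtain p where p: "p \<in> V" "N (val p) \<noteq> 0" "energy a p p / (N (val p))\<^sup>2 < principal_eigenvalue \<Omega> a + e"
    using cINF_less_iff[OF _ eigenvalue_bdd[OF a]] by blast
  define q where "q = (1 / N (val p)) *\<^sub>R p"
  have q: "q \<in> V" unfolding q_def by (rule V_scale[OF p(1)])
  have pos: "N (val p) > 0" using p(2) L2.nrm_nonneg[OF V_val[OF p(1)]] by simp
  have "N (val q) = 1" unfolding q_def val_scale using pos by (simp add: L2.nrm_scale[OF V_val[OF p(1)]])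
  moreover have "energy a q q = energy a p p / (N (val p))\<^sup>2"
  proof -
    have "energy a q q = (1 / N (val p)) * energy a p q"
      unfolding q_def by (rule energy_scale_left[OF a p(1) V_scale[OF p(1)]])
    also have "energy a p q = energy a q p" by (rule energy_sym[OF a p(1) q])
    also have "\<dots> = (1 / N (val p)) * energy a p p" unfolding q_def by (rule energy_scale_left[OF a p(1) p(1)])
    finally show ?thesis by (simp add: power2_eq_square)
  qed
  ultimately show ?thesis using q p(3) by (intro bexI[of _ q]) auto
qed

text \<open>For the recovery sequence of \<open>p\<close> the energy \<open>energy (as k) (q k) (q k)\<close> equals
  \<open>energy a p (q k)\<close> and tends to \<open>energy a p p\<close>. The square of the \<open>L\<^sup>2\<close> norm is bounded
  below by its tangent at \<open>p\<close>, which is weakly continuous, and the inequality passes to the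
  limit.\<close>

lemma eigenvalue_H_limit_ge:
  assumes as: "\<And>k. as k \<in> Coeff" and a: "a \<in> Coeff" and H: "H_converges \<Omega> as a" and ne: "\<Omega> \<noteq> {}"
    and c: "\<And>k. c \<le> principal_eigenvalue \<Omega> (as k)" "0 \<le> c"
  shows "c \<le> principal_eigenvalue \<Omega> a"
proof (rule eigenvalue_ge[OF a ne])
  fix p assume p: "p \<in> V"
  obtain q where q: "\<And>k. q k \<in> V" "\<And>k v. v \<in> V \<Longrightarrow> energy (as k) (q k) v = energy a p v"
    "\<And>G. G \<in> W12_dual \<Omega> \<Longrightarrow> (\<lambda>k. G (val (q k))) \<longlonglongrightarrow> G (val p)"
    "(\<lambda>k. energy a p (q k)) \<longlonglongrightarrow> energy a p p"
    by (rule recovery_sequence[OF as a H p]) (rule that)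
  note pv = V_val[OF p]
  have "(\<lambda>k. c * (2 * L2_inner \<Omega> (val p) (val (q k)) - (N (val p))\<^sup>2))
      \<longlonglongrightarrow> c * (2 * L2_inner \<Omega> (val p) (val p) - (N (val p))\<^sup>2)"
    by (intro tendsto_mult tendsto_diff tendsto_const q(3) val_inner_W12_dual pv)
  moreover have "c * (2 * L2_inner \<Omega> (val p) (val (q k)) - (N (val p))\<^sup>2) \<le> energy a p (q k)" for k
  proof -
    note qv = V_val[OF q(1)]
    have "0 \<le> L2_inner \<Omega> (val (q k) - val p) (val (q k) - val p)" by (intro L2.ip_nonneg L2.S_diff qv pv)
    also have "\<dots> = (N (val (q k)))\<^sup>2 - 2 * L2_inner \<Omega> (val p) (val (q k)) + (N (val p))\<^sup>2"
      by (simp add: L2.ip_diff_left L2.ip_diff_right L2.S_diff qv pv L2.nrm_sq L2.ip_commute[of \<Omega> "val (q k)" "val p"])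
    finally have "c * (2 * L2_inner \<Omega> (val p) (val (q k)) - (N (val p))\<^sup>2) \<le> c * (N (val (q k)))\<^sup>2"
      using c(2) by (intro mult_left_mono) auto
    also have "\<dots> \<le> principal_eigenvalue \<Omega> (as k) * (N (val (q k)))\<^sup>2"
      using c(1) by (intro mult_right_mono) auto
    also have "\<dots> \<le> energy (as k) (q k) (q k)" by (rule eigenvalue_le[OF as q(1)])
    finally show ?thesis by (simp add: q(2)[OF q(1)])
  qed
  ultimately have "c * (2 * L2_inner \<Omega> (val p) (val p) - (N (val p))\<^sup>2) \<le> energy a p p"
    using q(4) by (intro LIMSEQ_le) auto
  then show "c * (N (val p))\<^sup>2 \<le> energy a p p" by (simp add: L2.nrm_sq[OF pv])
qed

text \<open>Normalised near-minimisers \<open>p k\<close> have a weak limit \<open>w\<close> along a subsequence, and the strong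
  convergence in Rellich's theorem keeps its norm from dropping. With the recovery sequence
  \<open>q k\<close> of \<open>w\<close>, nonnegativity of the energy of \<open>p k - q k\<close> bounds the energy of \<open>p k\<close> from
  below by an expression that is linear in \<open>p k\<close> and therefore passes to the weak limit.\<close>

lemma eigenvalue_H_limit_le:
  assumes as: "\<And>k. as k \<in> Coeff" and a: "a \<in> Coeff" and H: "H_converges \<Omega> as a" and ne: "\<Omega> \<noteq> {}"
    and m: "(\<lambda>k. principal_eigenvalue \<Omega> (as k)) \<longlonglongrightarrow> m"
  shows "principal_eigenvalue \<Omega> a \<le> m"
proof -
  let ?l = "\<lambda>k. principal_eigenvalue \<Omega> (as k)"
  have "\<forall>k. \<exists>p. p \<in> V \<and> N (val p) = 1 \<and> energy (as k) p p < ?l k + 1 / real (Suc k)"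
    using eigenvalue_near_minimiser[OF as ne] by (metis of_nat_0_less_iff zero_less_Suc zero_less_divide_1_iff)
  then obtain p where p: "\<And>k. p k \<in> V" "\<And>k. N (val (p k)) = 1" "\<And>k. energy (as k) (p k) (p k) < ?l k + 1 / real (Suc k)"
    by metis
  obtain L where L: "\<And>k. ?l k \<le> L"
    using convergent_imp_Bseq[OF convergentI[OF m]] unfolding Bseq_def by (metis abs_le_D1 real_norm_def)
  have "N (gr (p k)) \<le> (L + 1) / \<mu>0 + 1" for k
  proof -
    have "\<mu>0 * (N (gr (p k)))\<^sup>2 \<le> energy (as k) (p k) (p k)"
      unfolding energy_def by (rule flux_coercive(1)[OF as V_gr[OF p(1)]])
    also have "\<dots> \<le> L + 1"
    proof -
      have "1 / real (Suc k) \<le> 1" by simp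
      then show ?thesis using p(3)[of k] L[of k] by linarith
    qed
    finally have "(N (gr (p k)))\<^sup>2 \<le> (L + 1) / \<mu>0" using \<mu>(1) by (simp add: pos_le_divide_eq mult.commute)
    moreover have "N (gr (p k)) \<le> 1 + (N (gr (p k)))\<^sup>2" using le_weighted_square[of 1 "N (gr (p k))"] by simp
    ultimately show ?thesis by linarith
  qed
  then obtain r w where r: "strict_mono (r :: nat \<Rightarrow> nat)" and w: "w \<in> V"
    and lim: "\<And>F. dualV F \<Longrightarrow> (\<lambda>k. F (p (r k))) \<longlonglongrightarrow> F w"
    by (rule weak_compactness_V[OF p(1)]) (rule that)
  have "(\<lambda>k. N (val (p (r k) - w))) \<longlonglongrightarrow> 0"
  proof -
    obtain D where D: "D > 0" "\<And>p. p \<in> V \<Longrightarrow> N p \<le> D * N (gr p)" using V_norm_le by blast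
    show ?thesis
    proof (rule Rellich)
      show "p (r k) - w \<in> V" for k by (rule V_diff[OF p(1) w])
      show "N (p (r k) - w) \<le> D * ((L + 1) / \<mu>0 + 1 + N (gr w))" for k
      proof -
        have "N (p (r k) - w) \<le> D * N (gr (p (r k) - w))" by (rule D(2)[OF V_diff[OF p(1) w]])
        also have "N (gr (p (r k) - w)) \<le> N (gr (p (r k))) + N (gr w)"
          using L2.nrm_triangle[OF V_gr[OF p(1)] L2.S_scale[OF V_gr[OF w]], of "r k" "-1"] L2.nrm_minus[OF V_gr[OF w]]
          by (simp add: gr_diff)
        also have "\<dots> \<le> (L + 1) / \<mu>0 + 1 + N (gr w)" using \<open>\<And>k. N (gr (p k)) \<le> (L + 1) / \<mu>0 + 1\<close> by simp
        finally show ?thesis using D(1) by simp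
      qed
      fix v :: "real^'n \<Rightarrow> real" assume v: "v \<in> L2 \<Omega>"
      have "(\<lambda>k. L2_inner \<Omega> v (val (p (r k))) - L2_inner \<Omega> v (val w)) \<longlonglongrightarrow> 0"
        using lim[OF dualV_val[OF v]] by (rule LIM_zero)
      moreover have "L2_inner \<Omega> (val (p (r k) - w)) v = L2_inner \<Omega> v (val (p (r k))) - L2_inner \<Omega> v (val w)" for k
        unfolding val_diff L2.ip_commute[of \<Omega> _ v] by (rule L2.ip_diff_right[OF V_val[OF p(1)] V_val[OF w] v])
      ultimately show "(\<lambda>k. L2_inner \<Omega> (val (p (r k) - w)) v) \<longlonglongrightarrow> 0" by simp
    qed
  qed
  then have "(\<lambda>k. N (val (p (r k)) - val w) + N (val w)) \<longlonglongrightarrow> 0 + N (val w)"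
    unfolding val_diff by (intro tendsto_add tendsto_const)
  moreover have "1 \<le> N (val (p (r k)) - val w) + N (val w)" for k
    using L2.nrm_le_diff[OF V_val[OF p(1)] V_val[OF w], of "r k"] by (simp add: p(2))
  ultimately have "1 \<le> 0 + N (val w)" by (intro LIMSEQ_le_const) auto
  then have Nw: "1 \<le> N (val w)" by simp
  obtain q where q: "\<And>k. q k \<in> V" "\<And>k v. v \<in> V \<Longrightarrow> energy (as k) (q k) v = energy a w v"
    "\<And>G. G \<in> W12_dual \<Omega> \<Longrightarrow> (\<lambda>k. G (val (q k))) \<longlonglongrightarrow> G (val w)"
    "(\<lambda>k. energy a w (q k)) \<longlonglongrightarrow> energy a w w"
    by (rule recovery_sequence[OF as a H w]) (rule that)
  have le: "2 * energy a w (p k) - energy a w (q k) \<le> ?l k + 1 / real (Suc k)" for k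
  proof -
    have d: "p k - q k \<in> V" by (rule V_diff[OF p(1) q(1)])
    have "0 \<le> energy (as k) (p k - q k) (p k - q k)" by (rule energy_nonneg[OF as d])
    also have "\<dots> = energy (as k) (p k) (p k - q k) - energy (as k) (q k) (p k - q k)"
      by (rule energy_diff_left[OF as p(1) q(1) d])
    also have "energy (as k) (p k) (p k - q k) = energy (as k) (p k) (p k) - energy (as k) (q k) (p k)"
      using energy_sym[OF as p(1) d] energy_diff_left[OF as p(1) q(1) p(1)] by simp
    also have "energy (as k) (q k) (p k - q k) = energy (as k) (q k) (p k) - energy (as k) (q k) (q k)"
      using energy_sym[OF as q(1) d] energy_diff_left[OF as p(1) q(1) q(1)] energy_sym[OF as p(1) q(1)] by simp
    finally show ?thesis using p(3)[of k] by (simp add: q(2)[OF p(1)] q(2)[OF q(1)])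
  qed
  have fw: "flux a (gr w) \<in> L2 \<Omega>" by (rule flux_L2(1)[OF a V_gr[OF w]])
  have "(\<lambda>k. 2 * energy a w (p (r k)) - energy a w (q (r k))) \<longlonglongrightarrow> 2 * energy a w w - energy a w w"
  proof (intro tendsto_diff tendsto_mult tendsto_const)
    show "(\<lambda>k. energy a w (p (r k))) \<longlonglongrightarrow> energy a w w"
      unfolding energy_def by (rule lim[OF dualV_gr[OF fw]])
    show "(\<lambda>k. energy a w (q (r k))) \<longlonglongrightarrow> energy a w w"
      using LIMSEQ_subseq_LIMSEQ[OF q(4) r] by (simp add: o_def)
  qed
  moreover have "(\<lambda>k. ?l (r k) + 1 / real (Suc (r k))) \<longlonglongrightarrow> m + 0"
    using LIMSEQ_subseq_LIMSEQ[OF tendsto_add[OF m LIMSEQ_Suc[OF lim_1_over_n]] r] by (simp add: o_def)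
  ultimately have "2 * energy a w w - energy a w w \<le> m + 0"
    using le by (intro LIMSEQ_le) auto
  then have "energy a w w \<le> m" by simp
  have "principal_eigenvalue \<Omega> a * 1 \<le> principal_eigenvalue \<Omega> a * (N (val w))\<^sup>2"
    using Nw eigenvalue_nonneg[OF a ne] by (intro mult_left_mono) auto
  also have "\<dots> \<le> energy a w w" by (rule eigenvalue_le[OF a w])
  finally show ?thesis using \<open>energy a w w \<le> m\<close> by simp
qed

end

section \<open>Two-phase coefficients\<close>

text \<open>The measure of the intersection with a centred ball is continuous in the radius, because
  its increments are bounded by those of the volume of the ball; then the intermediate value
  theorem applies.\<close>

lemma measurable_subset_with_measure:
  fixes \<Omega> :: "(real^'n) set"
  assumes \<Omega>: "open \<Omega>" "bounded \<Omega>" and t: "0 \<le> t" "t \<le> 1"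
  shows "\<exists>A. A \<subseteq> \<Omega> \<and> A \<in> sets lebesgue \<and> measure lebesgue A = t * measure lebesgue \<Omega>"
proof -
  have lm: "\<Omega> \<in> lmeasurable" using \<Omega> by (simp add: lmeasurable_open)
  obtain R where R0: "R > 0" "\<forall>x\<in>\<Omega>. norm x \<le> R" using \<Omega>(2) unfolding bounded_pos by blast
  then have R: "R > 0" "\<Omega> \<subseteq> cball 0 R" by auto
  define g where "g s = measure lebesgue (\<Omega> \<inter> cball 0 s)" for s
  define h where "h s = measure lebesgue (cball (0::real^'n) s)" for s
  have cb: "cball (0::real^'n) s \<in> lmeasurable" for s by simp
  have gl: "\<Omega> \<inter> cball 0 s \<in> lmeasurable" for s using lm cb by (rule fmeasurable.Int)
  have diff: "0 \<le> g s' - g s \<and> g s' - g s \<le> h s' - h s" if "s \<le> s'" for s s'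
  proof -
    have sub: "cball (0::real^'n) s \<subseteq> cball 0 s'" using that by auto
    have "g s' - g s = measure lebesgue ((\<Omega> \<inter> cball 0 s') - (\<Omega> \<inter> cball 0 s))"
      unfolding g_def by (rule measurable_measure_Diff[symmetric]) (use gl sub in auto)
    also have "\<dots> \<le> measure lebesgue (cball (0::real^'n) s' - cball 0 s)"
      by (rule measure_mono_fmeasurable) (use gl cb in \<open>auto intro: fmeasurable.Diff\<close>)
    also have "\<dots> = h s' - h s"
      unfolding h_def by (rule measurable_measure_Diff) (use cb sub in auto)
    finally have "g s' - g s \<le> h s' - h s" .
    moreover have "g s \<le> g s'"
      unfolding g_def by (rule measure_mono_fmeasurable) (use gl sub in auto)
    ultimately show ?thesis by simp
  qed
  have h_cont: "continuous_on {0..R} h"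
  proof -
    have "continuous_on {0..R} (\<lambda>s. unit_ball_vol (real DIM(real^'n)) * s ^ DIM(real^'n))"
      by (intro continuous_intros)
    then show ?thesis
    proof (rule continuous_on_eq)
      show "unit_ball_vol (real DIM(real^'n)) * s ^ DIM(real^'n) = h s" if "s \<in> {0..R}" for s
        using content_cball[of s "0::real^'n"] that by (simp add: h_def)
    qed
  qed
  have "continuous_on {0..R} g"
    unfolding continuous_on_iff
  proof (intro ballI allI impI)
    fix s e :: real assume s: "s \<in> {0..R}" and e: "e > 0"
    obtain d where d: "d > 0" "\<And>s'. s' \<in> {0..R} \<Longrightarrow> dist s' s < d \<Longrightarrow> dist (h s') (h s) < e"
      using h_cont s e unfolding continuous_on_iff by metis
    have "dist (g s') (g s) \<le> dist (h s') (h s)" for s'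
      using diff[of s s'] diff[of s' s] by (cases "s \<le> s'") (auto simp: dist_real_def)
    then show "\<exists>d>0. \<forall>s'\<in>{0..R}. dist s' s < d \<longrightarrow> dist (g s') (g s) < e"
      using d by (meson le_less_trans)
  qed
  moreover have "g 0 \<le> t * measure lebesgue \<Omega>"
  proof -
    have "g 0 \<le> measure lebesgue {0 :: real^'n}" unfolding g_def by (rule measure_mono_fmeasurable) (use gl[of 0] lmeasurable_compact[of "{0 :: real^'n}"] in auto)
    then show ?thesis using t(1) by (simp add: order_trans[OF _ mult_nonneg_nonneg])
  qed
  moreover have "t * measure lebesgue \<Omega> \<le> g R"
  proof -
    have "\<Omega> \<inter> cball 0 R = \<Omega>" using R(2) by blast
    then show ?thesis using t mult_right_mono[of t 1 "measure lebesgue \<Omega>"] by (simp add: g_def)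
  qed
  ultimately obtain s where "g s = t * measure lebesgue \<Omega>"
    using IVT'[of g 0 "t * measure lebesgue \<Omega>" R] R(1) by auto
  then show ?thesis using gl[of s] by (intro exI[of _ "\<Omega> \<inter> cball 0 s"]) (auto simp: g_def)
qed

lemma two_phase_nonempty:
  assumes "open \<Omega>" "bounded \<Omega>" "0 \<le> \<alpha>" "\<alpha> \<le> \<beta>" "\<beta> \<le> 1"
  shows "two_phase \<Omega> A0 A1 \<alpha> \<beta> \<noteq> {}"
proof -
  obtain A where A: "A \<subseteq> \<Omega>" "A \<in> sets lebesgue" "measure lebesgue A = \<alpha> * measure lebesgue \<Omega>"
    using measurable_subset_with_measure[OF assms(1,2), of \<alpha>] assms(3-5) by auto
  have "\<alpha> * measure lebesgue \<Omega> \<le> \<beta> * measure lebesgue \<Omega>" using assms(4) by (intro mult_right_mono) auto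
  then have "(\<lambda>x. A0 + indicat_real A x *\<^sub>R (A1 - A0)) \<in> two_phase \<Omega> A0 A1 \<alpha> \<beta>"
    unfolding two_phase_def by (intro CollectI exI[of _ A] conjI refl A(1,2)) (simp_all add: A(3))
  then show ?thesis by blast
qed

lemma two_phase_coeff_fields:
  fixes \<Omega> :: "(real^'n) set"
  assumes "A0 \<in> ellip_mats \<mu>0 \<mu>1" "A1 \<in> ellip_mats \<mu>0 \<mu>1" "a \<in> two_phase \<Omega> A0 A1 \<alpha> \<beta>"
  shows "a \<in> coeff_fields \<Omega> \<mu>0 \<mu>1"
proof -
  obtain A where A: "A \<in> sets lebesgue" "a = (\<lambda>x. A0 + indicat_real A x *\<^sub>R (A1 - A0))"
    using assms(3) unfolding two_phase_def by blast
  have "indicat_real A \<in> borel_measurable (lebesgue_on \<Omega>)"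
    by (rule measurable_restrict_space1, rule borel_measurable_indicator, rule A(1))
  then have "a \<in> borel_measurable (lebesgue_on \<Omega>)"
    unfolding A(2) by (intro borel_measurable_add borel_measurable_const borel_measurable_scaleR)
  moreover have "a x \<in> ellip_mats \<mu>0 \<mu>1" for x using assms(1,2) by (simp add: A(2) indicator_def)
  ultimately show ?thesis by (simp add: coeff_fields_def)
qed

theorem theorem4p4:
  fixes \<Omega> :: "(real^'n) set"
    and A0 A1 :: "real^'n^'n"
    and \<mu>0 \<mu>1 \<alpha> \<beta> :: real
  assumes "bounded_lipschitz_domain \<Omega>"
    and "0 < \<mu>0" and "\<mu>0 \<le> \<mu>1"
    and "A0 \<in> ellip_mats \<mu>0 \<mu>1" and "A1 \<in> ellip_mats \<mu>0 \<mu>1" and "A0 \<noteq> A1"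
    and "0 \<le> \<alpha>" and "\<alpha> \<le> \<beta>" and "\<beta> \<le> 1"
    and "(0 < \<alpha> \<and> \<beta> < 1) \<or> (\<alpha> = 0 \<and> \<beta> = 1 \<and> \<not> A0 \<preceq> A1 \<and> \<not> A1 \<preceq> A0)"
  shows "\<exists>a \<in> H_closure \<Omega> \<mu>0 \<mu>1 (two_phase \<Omega> A0 A1 \<alpha> \<beta>).
           principal_eigenvalue \<Omega> a =
             (INF b \<in> H_closure \<Omega> \<mu>0 \<mu>1 (two_phase \<Omega> A0 A1 \<alpha> \<beta>). principal_eigenvalue \<Omega> b)"
proof -
  have \<Omega>: "open \<Omega>" "bounded \<Omega>" and ne: "\<Omega> \<noteq> {}"
    using assms(1) by (auto simp: bounded_lipschitz_domain_def)
  interpret elliptic \<Omega> \<mu>0 \<mu>1 by unfold_locales (use \<Omega> assms(2,3) in auto)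
  let ?X = "two_phase \<Omega> A0 A1 \<alpha> \<beta>" and ?l = "principal_eigenvalue \<Omega>"
  have X: "a \<in> Coeff" if "a \<in> ?X" for a by (rule two_phase_coeff_fields[OF assms(4,5) that])
  have X_ne: "?X \<noteq> {}" by (rule two_phase_nonempty[OF \<Omega> assms(7-9)])
  define m where "m = (INF a\<in>?X. ?l a)"
  have bdd: "bdd_below (?l ` ?X)" using eigenvalue_nonneg[OF X ne] by (intro bdd_belowI2[of _ 0])
  have m_le: "m \<le> ?l a" if "a \<in> ?X" for a unfolding m_def by (rule cINF_lower[OF bdd that])
  have m0: "0 \<le> m" unfolding m_def using eigenvalue_nonneg[OF X ne] by (intro cINF_greatest[OF X_ne])
  have "\<exists>a\<in>?X. ?l a < m + 1 / real (Suc k)" for k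
  proof -
    have "(INF a\<in>?X. ?l a) < m + 1 / real (Suc k)" by (simp add: m_def)
    then show ?thesis using cINF_less_iff[OF X_ne bdd] by blast
  qed
  then obtain as where as: "\<And>k. as k \<in> ?X" "\<And>k. ?l (as k) < m + 1 / real (Suc k)" by metis
  have lim: "(\<lambda>k. ?l (as k)) \<longlonglongrightarrow> m"
  proof (rule tendsto_sandwich[OF _ _ tendsto_const])
    show "\<forall>\<^sub>F k in sequentially. m \<le> ?l (as k)" by (intro always_eventually allI m_le as(1))
    show "\<forall>\<^sub>F k in sequentially. ?l (as k) \<le> m + 1 / real (Suc k)" using as(2) by (intro always_eventually allI less_imp_le)
    show "(\<lambda>k. m + 1 / real (Suc k)) \<longlonglongrightarrow> m"
      using tendsto_add[OF tendsto_const[of m] LIMSEQ_Suc[OF lim_1_over_n]] by simp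
  qed
  obtain r a where r: "strict_mono (r :: nat \<Rightarrow> nat)" and a: "a \<in> Coeff" and H: "H_converges \<Omega> (\<lambda>k. as (r k)) a"
    by (rule H_compactness[OF X[OF as(1)]]) (rule that)
  have a_cl: "a \<in> H_closure \<Omega> \<mu>0 \<mu>1 ?X"
    unfolding H_closure_def by (intro CollectI conjI a exI[of _ "\<lambda>k. as (r k)"] allI as(1) H)
  have "(\<lambda>k. ?l (as (r k))) \<longlonglongrightarrow> m" using LIMSEQ_subseq_LIMSEQ[OF lim r] by (simp add: o_def)
  then have a_le: "?l a \<le> m" by (rule eigenvalue_H_limit_le[OF X[OF as(1)] a H ne])
  have ge: "m \<le> ?l b" if b: "b \<in> H_closure \<Omega> \<mu>0 \<mu>1 ?X" for b
  proof -
    obtain bs where bs: "b \<in> Coeff" "\<And>k. bs k \<in> ?X" "H_converges \<Omega> bs b"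
      using b unfolding H_closure_def by blast
    show ?thesis by (rule eigenvalue_H_limit_ge[OF X[OF bs(2)] bs(1,3) ne m_le[OF bs(2)] m0])
  qed
  have "?l a = m" using a_le ge[OF a_cl] by simp
  moreover have "(INF b \<in> H_closure \<Omega> \<mu>0 \<mu>1 ?X. ?l b) = m"
  proof (rule antisym)
    show "(INF b \<in> H_closure \<Omega> \<mu>0 \<mu>1 ?X. ?l b) \<le> m"
      using cINF_lower[OF bdd_belowI2[of _ m ?l, OF ge] a_cl] a_le by simp
    show "m \<le> (INF b \<in> H_closure \<Omega> \<mu>0 \<mu>1 ?X. ?l b)"
      using a_cl ge by (intro cINF_greatest) auto
  qed
  ultimately show ?thesis using a_cl by (intro bexI[of _ a]) auto
qed

end
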